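(* Let $W$ be an unramified discrete valuation ring of mixed characteristic $(0,p)$, let $A_0 := \widehat{W[x_1,\dots,x_d]}$ be the $p$-adic completion of a polynomial ring over $W$, and let $A_{\infty,0}$ be the $p$-adic completion of $A_0[x_1^{1/p^\infty},\dots,x_d^{1/p^\infty}, p^{1/p^\infty}]$. Fix $g \in A_0$, and let $A_{\infty,0} \to A_\infty$ be a map of integral perfectoid algebras that is almost faithfully flat modulo $p$ (with respect to $p^{1/p^\infty}$) and such that $g$ admits a compatible system of $p$-power roots $g^{1/p^k}$ in $A_\infty$. Let $X$ be the perfectoid space associated to $A_\infty$, and for $n \ge 1$ let $A_\infty\langle \frac{p^n}{g}\rangle$ be the perfectoid ring of bounded functions on the rational subset $U_n := \{x \in X : |p^n| \le |g(x)|\}$. Fix an integer $m \ge 0$. Then the natural map of pro-systems $$\{A_\infty/p^m\}_{n \ge 1} \to \Big\{A_\infty\big\langle \tfrac{p^n}{g}\big\rangle/p^m\Big\}_{n \ge 1}$$ (the source being constant in $n$) is an almost-pro-isomorphism with respect to $(pg)^{1/p^\infty}$; that is, for each $k \ge 0$, the pro-system of kernels and the pro-system of cokernels are each pro-isomorphic to a pro-system of modules killed by $(pg)^{1/p^k}$.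
   Context: "Unramified" means that $p$ is a uniformizer of $W$. Let $K := \widehat{\mathbf{Q}_p(p^{1/p^\infty})}$, a perfectoid field with ring of integers $K^\circ$. An integral perfectoid $K^\circ$-algebra is a flat, $p$-adically complete $K^\circ$-algebra $A$ such that Frobenius induces an isomorphism $A/p^{1/p} \simeq A/p$ and $A = A_*$, the latter meaning: if $f \in A[\frac1p]$ satisfies $p^{1/p^k} f \in A$ for all $k \ge 0$, then $f \in A$. The perfectoid space associated to $A_\infty$ is $X = \mathrm{Spa}(A_\infty[\frac1p], A_\infty)$, and $A_\infty\langle \frac{p^n}{g}\rangle := \mathcal{O}_X^+(U_n)$. Since $U_n \subset U_{n+1}$, restriction of functions gives transition maps $A_\infty\langle \frac{p^{n+1}}{g}\rangle \to A_\infty\langle \frac{p^n}{g}\rangle$, making these rings a projective system; the map in the statement is induced by restriction of functions from $X$ to $U_n$. A map is almost faithfully flat modulo $p$ if its reduction modulo $p$ is faithfully flat in the sense of almost mathematics with respect to the ideal $(p^{1/p^\infty})$. We put $(pg)^{1/p^k} := p^{1/p^k} g^{1/p^k}$. *)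

theory Defs
  imports "HOL-Algebra.Algebra" "HOL-Library.Multiset" "HOL-Library.Poly_Mapping"
begin

text \<open>These names would capture record fields of \<^typ>\<open>'a ring\<close>.\<close>

hide_const (open) Multiset.mult Wellorder_Constructions.zero

section \<open>Rings\<close>

definition nat_elem :: "('a, 'b) ring_scheme \<Rightarrow> nat \<Rightarrow> 'a" where
  "nat_elem R n = [n] \<cdot>\<^bsub>R\<^esub> \<one>\<^bsub>R\<^esub>"

text \<open>The map to \<open>S/J\<close> induced by \<open>h\<close> on a quotient of its source. Elements of the quotient are
  cosets; if \<open>h\<close> is compatible with the two congruences, the union below is the single coset
  of \<open>h x\<close>, for any representative \<open>x\<close>.\<close>

definition induced :: "('b, 'c) ring_scheme \<Rightarrow> 'b set \<Rightarrow> ('a \<Rightarrow> 'b) \<Rightarrow> 'a set \<Rightarrow> 'b set" where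
  "induced S J h C = (\<Union>x\<in>C. J +>\<^bsub>S\<^esub> h x)"

definition discrete_valuation_ring :: "('a, 'b) ring_scheme \<Rightarrow> bool" where
  "discrete_valuation_ring W \<longleftrightarrow>
     principal_domain W \<and> \<not> field W \<and> (\<exists>!M. maximalideal M W)"

text \<open>Mixed characteristic \<open>(0,p)\<close>: the fraction field has characteristic \<open>0\<close>, and \<open>p\<close> lies in the
  maximal ideal. Unramified: \<open>p\<close> generates the maximal ideal.\<close>

definition unramified_dvr :: "nat \<Rightarrow> ('a, 'b) ring_scheme \<Rightarrow> bool" where
  "unramified_dvr p W \<longleftrightarrow>
     discrete_valuation_ring W \<and>
     (\<forall>n>0. nat_elem W n \<noteq> \<zero>\<^bsub>W\<^esub>) \<and>
     maximalideal (PIdl\<^bsub>W\<^esub> (nat_elem W p)) W"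

subsection \<open>Polynomials and adjunction of \<open>p\<close>-power roots\<close>

text \<open>As in \<^theory>\<open>HOL-Algebra.Indexed_Polynomials\<close>, monomials in the variables \<open>I\<close> are multisets
  over \<open>I\<close>, and a polynomial is its coefficient function.\<close>

definition mpoly_ring :: "('a, 'b) ring_scheme \<Rightarrow> 'i set \<Rightarrow> ('i multiset \<Rightarrow> 'a) ring" where
  "mpoly_ring R I =
     \<lparr> carrier = {P. (\<forall>m. P m \<in> carrier R) \<and> finite {m. P m \<noteq> \<zero>\<^bsub>R\<^esub>} \<and>
                     (\<forall>m. P m \<noteq> \<zero>\<^bsub>R\<^esub> \<longrightarrow> set_mset m \<subseteq> I)},
       mult = (\<lambda>P Q m. \<Oplus>\<^bsub>R\<^esub>a\<in>{a. a \<subseteq># m}. P a \<otimes>\<^bsub>R\<^esub> Q (m - a)),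
       one = (\<lambda>m. if m = {#} then \<one>\<^bsub>R\<^esub> else \<zero>\<^bsub>R\<^esub>),
       zero = (\<lambda>m. \<zero>\<^bsub>R\<^esub>),
       add = (\<lambda>P Q m. P m \<oplus>\<^bsub>R\<^esub> Q m) \<rparr>"

definition mp_const :: "('a, 'b) ring_scheme \<Rightarrow> 'a \<Rightarrow> ('i multiset \<Rightarrow> 'a)" where
  "mp_const R a = (\<lambda>m. if m = {#} then a else \<zero>\<^bsub>R\<^esub>)"

definition mp_var :: "('a, 'b) ring_scheme \<Rightarrow> 'i \<Rightarrow> ('i multiset \<Rightarrow> 'a)" where
  "mp_var R i = (\<lambda>m. if m = {#i#} then \<one>\<^bsub>R\<^esub> else \<zero>\<^bsub>R\<^esub>)"

text \<open>\<open>R[r\<^sub>i\<^sup>1\<^sup>/\<^sup>p\<^sup>^\<^sup>\<infinity> : i \<in> I]\<close>: the universal \<open>R\<close>-algebra with a compatible system of \<open>p\<close>-power roots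
  of each \<open>r i\<close>. The variable \<open>(i, k)\<close> stands for the \<open>p\<^sup>k\<close>-th root of \<open>r i\<close>.\<close>

definition roots_ideal ::
    "('a, 'b) ring_scheme \<Rightarrow> nat \<Rightarrow> 'i set \<Rightarrow> ('i \<Rightarrow> 'a) \<Rightarrow> (('i \<times> nat) multiset \<Rightarrow> 'a) set" where
  "roots_ideal R p I r =
     (let P = mpoly_ring R (I \<times> UNIV) in
      genideal P
       ({mp_var R (i, 0) \<ominus>\<^bsub>P\<^esub> mp_const R (r i) | i. i \<in> I} \<union>
        {mp_var R (i, Suc k) [^]\<^bsub>P\<^esub> p \<ominus>\<^bsub>P\<^esub> mp_var R (i, k) | i k. i \<in> I}))"

definition adjoin_roots ::
    "('a, 'b) ring_scheme \<Rightarrow> nat \<Rightarrow> 'i set \<Rightarrow> ('i \<Rightarrow> 'a) \<Rightarrow> (('i \<times> nat) multiset \<Rightarrow> 'a) set ring" where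
  "adjoin_roots R p I r = mpoly_ring R (I \<times> UNIV) Quot roots_ideal R p I r"

definition adjoin_const ::
    "('a, 'b) ring_scheme \<Rightarrow> nat \<Rightarrow> 'i set \<Rightarrow> ('i \<Rightarrow> 'a) \<Rightarrow> 'a \<Rightarrow> (('i \<times> nat) multiset \<Rightarrow> 'a) set" where
  "adjoin_const R p I r a = roots_ideal R p I r +>\<^bsub>mpoly_ring R (I \<times> UNIV)\<^esub> mp_const R a"

definition adjoined_root ::
    "('a, 'b) ring_scheme \<Rightarrow> nat \<Rightarrow> 'i set \<Rightarrow> ('i \<Rightarrow> 'a) \<Rightarrow> 'i \<Rightarrow> nat \<Rightarrow> (('i \<times> nat) multiset \<Rightarrow> 'a) set" where
  "adjoined_root R p I r i k = roots_ideal R p I r +>\<^bsub>mpoly_ring R (I \<times> UNIV)\<^esub> mp_var R (i, k)"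

subsection \<open>Localization at one element\<close>

text \<open>The fraction \<open>a / t\<^sup>k\<close>, as an equivalence class; zero divisors are allowed.\<close>

definition fraction :: "('a, 'b) ring_scheme \<Rightarrow> 'a \<Rightarrow> 'a \<Rightarrow> nat \<Rightarrow> ('a \<times> nat) set" where
  "fraction R t a k =
     {(b, l). b \<in> carrier R \<and>
        (\<exists>j. t [^]\<^bsub>R\<^esub> (j::nat) \<otimes>\<^bsub>R\<^esub> (t [^]\<^bsub>R\<^esub> l \<otimes>\<^bsub>R\<^esub> a) = t [^]\<^bsub>R\<^esub> j \<otimes>\<^bsub>R\<^esub> (t [^]\<^bsub>R\<^esub> k \<otimes>\<^bsub>R\<^esub> b))}"

definition localization :: "('a, 'b) ring_scheme \<Rightarrow> 'a \<Rightarrow> ('a \<times> nat) set ring" where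
  "localization R t =
     \<lparr> carrier = {fraction R t a k | a k. a \<in> carrier R},
       mult = (\<lambda>C E. \<Union>(a, k)\<in>C. \<Union>(b, l)\<in>E. fraction R t (a \<otimes>\<^bsub>R\<^esub> b) (k + l)),
       one = fraction R t \<one>\<^bsub>R\<^esub> 0,
       zero = fraction R t \<zero>\<^bsub>R\<^esub> 0,
       add = (\<lambda>C E. \<Union>(a, k)\<in>C. \<Union>(b, l)\<in>E.
                fraction R t (t [^]\<^bsub>R\<^esub> l \<otimes>\<^bsub>R\<^esub> a \<oplus>\<^bsub>R\<^esub> t [^]\<^bsub>R\<^esub> k \<otimes>\<^bsub>R\<^esub> b) (k + l)) \<rparr>"

definition to_loc :: "('a, 'b) ring_scheme \<Rightarrow> 'a \<Rightarrow> 'a \<Rightarrow> ('a \<times> nat) set" where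
  "to_loc R t a = fraction R t a 0"

section \<open>Adic topologies and completion\<close>

text \<open>A triple \<open>(R, D, t)\<close> stands for the ring \<open>R\<close> with the topology for which the sets \<open>t\<^sup>N D\<close>,
  with \<open>D\<close> a subring, form a basis of neighbourhoods of \<open>0\<close>. The case \<open>D = R\<close> is the \<open>t\<close>-adic
  topology of \<open>R\<close>; if \<open>t\<close> is a unit of \<open>R\<close>, it is a Tate ring with ring of definition \<open>D\<close>
  and pseudo-uniformizer \<open>t\<close>.\<close>

definition adic_nbhd :: "('a, 'b) ring_scheme \<Rightarrow> 'a set \<Rightarrow> 'a \<Rightarrow> nat \<Rightarrow> 'a set" where
  "adic_nbhd R D t N = (\<lambda>d. t [^]\<^bsub>R\<^esub> N \<otimes>\<^bsub>R\<^esub> d) ` D"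

definition adic_open :: "('a, 'b) ring_scheme \<Rightarrow> 'a set \<Rightarrow> 'a \<Rightarrow> 'a set \<Rightarrow> bool" where
  "adic_open R D t U \<longleftrightarrow>
     U \<subseteq> carrier R \<and> (\<forall>x\<in>U. \<exists>N. \<forall>y\<in>adic_nbhd R D t N. x \<oplus>\<^bsub>R\<^esub> y \<in> U)"

definition power_bounded :: "('a, 'b) ring_scheme \<Rightarrow> 'a set \<Rightarrow> 'a \<Rightarrow> 'a set" where
  "power_bounded R D t =
     {x \<in> carrier R. \<exists>N::nat. \<forall>i::nat. t [^]\<^bsub>R\<^esub> N \<otimes>\<^bsub>R\<^esub> x [^]\<^bsub>R\<^esub> i \<in> D}"

definition cauchy_ring :: "('a, 'b) ring_scheme \<Rightarrow> 'a set \<Rightarrow> 'a \<Rightarrow> (nat \<Rightarrow> 'a) ring" where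
  "cauchy_ring R D t =
     \<lparr> carrier = {x. (\<forall>n. x n \<in> carrier R) \<and>
                     (\<forall>N. \<exists>n0. \<forall>m\<ge>n0. \<forall>n\<ge>n0. x m \<ominus>\<^bsub>R\<^esub> x n \<in> adic_nbhd R D t N)},
       mult = (\<lambda>x y n. x n \<otimes>\<^bsub>R\<^esub> y n),
       one = (\<lambda>n. \<one>\<^bsub>R\<^esub>),
       zero = (\<lambda>n. \<zero>\<^bsub>R\<^esub>),
       add = (\<lambda>x y n. x n \<oplus>\<^bsub>R\<^esub> y n) \<rparr>"

definition null_seqs :: "('a, 'b) ring_scheme \<Rightarrow> 'a set \<Rightarrow> 'a \<Rightarrow> (nat \<Rightarrow> 'a) set" where
  "null_seqs R D t =
     {x. (\<forall>n. x n \<in> carrier R) \<and> (\<forall>N. \<exists>n0. \<forall>n\<ge>n0. x n \<in> adic_nbhd R D t N)}"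

definition completion :: "('a, 'b) ring_scheme \<Rightarrow> 'a set \<Rightarrow> 'a \<Rightarrow> (nat \<Rightarrow> 'a) set ring" where
  "completion R D t = cauchy_ring R D t Quot null_seqs R D t"

definition to_completion :: "('a, 'b) ring_scheme \<Rightarrow> 'a set \<Rightarrow> 'a \<Rightarrow> 'a \<Rightarrow> (nat \<Rightarrow> 'a) set" where
  "to_completion R D t a = null_seqs R D t +>\<^bsub>cauchy_ring R D t\<^esub> (\<lambda>n. a)"

text \<open>The closure of the image of \<open>D\<close>; it defines the topology of the completion.\<close>

definition completion_subring :: "('a, 'b) ring_scheme \<Rightarrow> 'a set \<Rightarrow> 'a \<Rightarrow> (nat \<Rightarrow> 'a) set set" where
  "completion_subring R D t =
     {null_seqs R D t +>\<^bsub>cauchy_ring R D t\<^esub> x | x.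
        x \<in> carrier (cauchy_ring R D t) \<and> (\<forall>n. x n \<in> D)}"

abbreviation p_completion :: "nat \<Rightarrow> ('a, 'b) ring_scheme \<Rightarrow> (nat \<Rightarrow> 'a) set ring" where
  "p_completion p R \<equiv> completion R (carrier R) (nat_elem R p)"

abbreviation to_p_completion :: "nat \<Rightarrow> ('a, 'b) ring_scheme \<Rightarrow> 'a \<Rightarrow> (nat \<Rightarrow> 'a) set" where
  "to_p_completion p R \<equiv> to_completion R (carrier R) (nat_elem R p)"

section \<open>The perfectoid field \<open>K\<close>\<close>

type_synonym Zp = "(nat \<Rightarrow> int) set"
type_synonym Qp = "(Zp \<times> nat) set"
type_synonym Qp_roots = "((unit \<times> nat) multiset \<Rightarrow> Qp) set"
type_synonym perfd = "(nat \<Rightarrow> Qp_roots) set"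

definition Zp_ring :: "nat \<Rightarrow> Zp ring" where
  "Zp_ring p = p_completion p \<Z>"

definition Qp_field :: "nat \<Rightarrow> Qp ring" where
  "Qp_field p = localization (Zp_ring p) (nat_elem (Zp_ring p) p)"

text \<open>\<open>L = Q\<^sub>p(p\<^sup>1\<^sup>/\<^sup>p\<^sup>^\<^sup>\<infinity>)\<close>. Since every \<open>T\<^sup>q - p\<close> with \<open>q\<close> a power of \<open>p\<close> is Eisenstein, the ring
  obtained by formally adjoining the roots is already this field.\<close>

definition L_field :: "nat \<Rightarrow> Qp_roots ring" where
  "L_field p = adjoin_roots (Qp_field p) p {()} (\<lambda>_. nat_elem (Qp_field p) p)"

definition integral_closure :: "('a, 'b) ring_scheme \<Rightarrow> 'a set \<Rightarrow> 'a set" where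
  "integral_closure R Z =
     {x \<in> carrier R. \<exists>n::nat. \<exists>c. (\<forall>i<n. c i \<in> Z) \<and>
        x [^]\<^bsub>R\<^esub> n \<oplus>\<^bsub>R\<^esub> (\<Oplus>\<^bsub>R\<^esub>i\<in>{..<n}. c i \<otimes>\<^bsub>R\<^esub> x [^]\<^bsub>R\<^esub> i) = \<zero>\<^bsub>R\<^esub>}"

text \<open>The integral closure of \<open>Z\<^sub>p\<close> is the unit ball of the unique extension to \<open>L\<close> of the
  absolute value of \<open>Q\<^sub>p\<close>.\<close>

definition L_ints :: "nat \<Rightarrow> Qp_roots set" where
  "L_ints p = integral_closure (L_field p)
     ((\<lambda>z. adjoin_const (Qp_field p) p {()} (\<lambda>_. nat_elem (Qp_field p) p)
             (to_loc (Zp_ring p) (nat_elem (Zp_ring p) p) z)) ` carrier (Zp_ring p))"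

definition K_field :: "nat \<Rightarrow> perfd ring" where
  "K_field p = completion (L_field p) (L_ints p) (nat_elem (L_field p) p)"

definition K_ints :: "nat \<Rightarrow> perfd ring" where
  "K_ints p = (K_field p)
     \<lparr>carrier := power_bounded (K_field p)
        (completion_subring (L_field p) (L_ints p) (nat_elem (L_field p) p))
        (nat_elem (K_field p) p)\<rparr>"

text \<open>\<open>p\<^sup>1\<^sup>/\<^sup>p\<^sup>^\<^sup>k\<close> in \<open>K\<close>.\<close>

definition K_root :: "nat \<Rightarrow> nat \<Rightarrow> perfd" where
  "K_root p k = to_completion (L_field p) (L_ints p) (nat_elem (L_field p) p)
     (adjoined_root (Qp_field p) p {()} (\<lambda>_. nat_elem (Qp_field p) p) () k)"

section \<open>Modules, tensor products and almost flatness\<close>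

definition mod_hom ::
    "('a, 'c) ring_scheme \<Rightarrow> ('a, 'm) module \<Rightarrow> ('a, 'n) module \<Rightarrow> ('m \<Rightarrow> 'n) set" where
  "mod_hom R M N =
     {u. (\<forall>x\<in>carrier M. u x \<in> carrier N) \<and>
         (\<forall>x\<in>carrier M. \<forall>y\<in>carrier M. u (x \<oplus>\<^bsub>M\<^esub> y) = u x \<oplus>\<^bsub>N\<^esub> u y) \<and>
         (\<forall>a\<in>carrier R. \<forall>x\<in>carrier M. u (a \<odot>\<^bsub>M\<^esub> x) = a \<odot>\<^bsub>N\<^esub> u x)}"

definition alg_module :: "('a \<Rightarrow> 'b) \<Rightarrow> ('b, 'c) ring_scheme \<Rightarrow> ('a, 'b) module" where
  "alg_module f S =
     \<lparr> carrier = carrier S, mult = mult S, one = one S, zero = zero S, add = add S,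
       smult = (\<lambda>a x. f a \<otimes>\<^bsub>S\<^esub> x) \<rparr>"

text \<open>In the module records below only the additive structure and \<^const>\<open>smult\<close> carry meaning;
  the ring fields \<^const>\<open>mult\<close> and \<^const>\<open>one\<close> are dummies.\<close>

definition quot_module ::
    "('a, 'm) module \<Rightarrow> 'm set \<Rightarrow> ('a, 'm set) module" where
  "quot_module M S =
     \<lparr> carrier = a_rcosets\<^bsub>M\<^esub> S, mult = (\<lambda>_ _. S), one = S, zero = S, add = set_add M,
       smult = (\<lambda>a. induced M S (\<lambda>x. a \<odot>\<^bsub>M\<^esub> x)) \<rparr>"

text \<open>\<open>M \<otimes>\<^sub>R N\<close> is the free abelian group on \<open>M \<times> N\<close> modulo the bilinear relations.\<close>

inductive_set tensor_rel ::
    "('a, 'c) ring_scheme \<Rightarrow> ('a, 'm) module \<Rightarrow> ('a, 'n) module \<Rightarrow> ('m \<times> 'n \<Rightarrow>\<^sub>0 int) set"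
  for R M N where
    zero: "0 \<in> tensor_rel R M N"
  | diff: "z \<in> tensor_rel R M N \<Longrightarrow> w \<in> tensor_rel R M N \<Longrightarrow> z - w \<in> tensor_rel R M N"
  | addl: "x \<in> carrier M \<Longrightarrow> x' \<in> carrier M \<Longrightarrow> y \<in> carrier N \<Longrightarrow>
      frag_of (x \<oplus>\<^bsub>M\<^esub> x', y) - frag_of (x, y) - frag_of (x', y) \<in> tensor_rel R M N"
  | addr: "x \<in> carrier M \<Longrightarrow> y \<in> carrier N \<Longrightarrow> y' \<in> carrier N \<Longrightarrow>
      frag_of (x, y \<oplus>\<^bsub>N\<^esub> y') - frag_of (x, y) - frag_of (x, y') \<in> tensor_rel R M N"
  | smult: "a \<in> carrier R \<Longrightarrow> x \<in> carrier M \<Longrightarrow> y \<in> carrier N \<Longrightarrow>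
      frag_of (a \<odot>\<^bsub>M\<^esub> x, y) - frag_of (x, a \<odot>\<^bsub>N\<^esub> y) \<in> tensor_rel R M N"

definition tensor_class ::
    "('a, 'c) ring_scheme \<Rightarrow> ('a, 'm) module \<Rightarrow> ('a, 'n) module \<Rightarrow>
     ('m \<times> 'n \<Rightarrow>\<^sub>0 int) \<Rightarrow> ('m \<times> 'n \<Rightarrow>\<^sub>0 int) set" where
  "tensor_class R M N z = {z + w | w. w \<in> tensor_rel R M N}"

text \<open>The map \<open>u \<otimes> id\<close> with target \<open>M \<otimes> N\<close>.\<close>

definition tensor_map ::
    "('a, 'c) ring_scheme \<Rightarrow> ('a, 'm) module \<Rightarrow> ('a, 'n) module \<Rightarrow> ('l \<Rightarrow> 'm) \<Rightarrow>
     ('l \<times> 'n \<Rightarrow>\<^sub>0 int) set \<Rightarrow> ('m \<times> 'n \<Rightarrow>\<^sub>0 int) set" where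
  "tensor_map R M N u C =
     (\<Union>z\<in>C. tensor_class R M N (frag_extend (\<lambda>(x, y). frag_of (u x, y)) z))"

definition tensor ::
    "('a, 'c) ring_scheme \<Rightarrow> ('a, 'm) module \<Rightarrow> ('a, 'n) module \<Rightarrow>
     ('a, ('m \<times> 'n \<Rightarrow>\<^sub>0 int) set) module" where
  "tensor R M N =
     \<lparr> carrier = {tensor_class R M N z | z. Poly_Mapping.keys z \<subseteq> carrier M \<times> carrier N},
       mult = (\<lambda>_ _. tensor_rel R M N),
       one = tensor_rel R M N,
       zero = tensor_rel R M N,
       add = (\<lambda>C E. {z + w | z w. z \<in> C \<and> w \<in> E}),
       smult = (\<lambda>a. tensor_map R M N (\<lambda>x. a \<odot>\<^bsub>M\<^esub> x)) \<rparr>"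

text \<open>Almost mathematics with respect to an ideal \<open>J\<close>.\<close>

definition almost_zero :: "'a set \<Rightarrow> ('a, 'm) module \<Rightarrow> bool" where
  "almost_zero J M \<longleftrightarrow> (\<forall>a\<in>J. \<forall>x\<in>carrier M. a \<odot>\<^bsub>M\<^esub> x = \<zero>\<^bsub>M\<^esub>)"

definition ker_module :: "('a, 'm) module \<Rightarrow> ('a, 'n) module \<Rightarrow> ('m \<Rightarrow> 'n) \<Rightarrow> ('a, 'm) module" where
  "ker_module M N u = M\<lparr>carrier := a_kernel M N u\<rparr>"

text \<open>The test modules in the following definitions range over all \<open>R\<close>-modules with carrier in the
  type \<^typ>\<open>(nat \<Rightarrow> 'a) set\<close>. Every countably generated \<open>R\<close>-module is isomorphic to one of these
  (a quotient of a countable direct sum of copies of \<open>R\<close>), and (almost) flatness and faithful flatness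
  are detected on ideals and cyclic modules, so nothing is lost compared with all \<open>R\<close>-modules.\<close>

definition flat :: "('a, 'c) ring_scheme \<Rightarrow> ('a, 'b) module \<Rightarrow> bool" where
  "flat R B \<longleftrightarrow>
     (\<forall>(M :: ('a, (nat \<Rightarrow> 'a) set) module) (N :: ('a, (nat \<Rightarrow> 'a) set) module) u.
        module R M \<and> module R N \<and> u \<in> mod_hom R M N \<and> inj_on u (carrier M) \<longrightarrow>
        inj_on (tensor_map R N B u) (carrier (tensor R M B)))"

text \<open>Tensoring is right exact, so exactness of \<open>- \<otimes> B\<close> on almost modules means that it
  preserves homomorphisms with almost zero kernel.\<close>

definition almost_flat :: "('a, 'c) ring_scheme \<Rightarrow> 'a set \<Rightarrow> ('a, 'b) module \<Rightarrow> bool" where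
  "almost_flat R J B \<longleftrightarrow>
     (\<forall>(M :: ('a, (nat \<Rightarrow> 'a) set) module) (N :: ('a, (nat \<Rightarrow> 'a) set) module) u.
        module R M \<and> module R N \<and> u \<in> mod_hom R M N \<and> almost_zero J (ker_module M N u) \<longrightarrow>
        almost_zero J (ker_module (tensor R M B) (tensor R N B) (tensor_map R N B u)))"

definition almost_faithfully_flat :: "('a, 'c) ring_scheme \<Rightarrow> 'a set \<Rightarrow> ('a, 'b) module \<Rightarrow> bool" where
  "almost_faithfully_flat R J B \<longleftrightarrow>
     almost_flat R J B \<and>
     (\<forall>(M :: ('a, (nat \<Rightarrow> 'a) set) module).
        module R M \<and> almost_zero J (tensor R M B) \<longrightarrow> almost_zero J M)"

section \<open>Integral perfectoid algebras\<close>

definition p_inverted :: "nat \<Rightarrow> ('a, 'b) ring_scheme \<Rightarrow> ('a \<times> nat) set ring" where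
  "p_inverted p A = localization A (nat_elem A p)"

definition to_p_inverted :: "nat \<Rightarrow> ('a, 'b) ring_scheme \<Rightarrow> 'a \<Rightarrow> ('a \<times> nat) set" where
  "to_p_inverted p A = to_loc A (nat_elem A p)"

text \<open>The algebra structure of \<open>A\<close> is given by \<open>\<iota> : K\<degree> \<rightarrow> A\<close>. The \<^const>\<open>bij_betw\<close> clause says
  that \<open>A\<close> maps isomorphically to its \<open>p\<close>-adic completion, the last clause that \<open>A = A\<^sub>*\<close>.\<close>

definition integral_perfectoid :: "nat \<Rightarrow> 'a ring \<Rightarrow> (perfd \<Rightarrow> 'a) \<Rightarrow> bool" where
  "integral_perfectoid p A \<iota> \<longleftrightarrow>
     cring A \<and> \<iota> \<in> ring_hom (K_ints p) A \<and>
     flat (K_ints p) (alg_module \<iota> A) \<and>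
     bij_betw (to_p_completion p A) (carrier A) (carrier (p_completion p A)) \<and>
     induced A (PIdl\<^bsub>A\<^esub> (nat_elem A p)) (\<lambda>x. x [^]\<^bsub>A\<^esub> p) \<in>
       ring_iso (A Quot PIdl\<^bsub>A\<^esub> (\<iota> (K_root p 1))) (A Quot PIdl\<^bsub>A\<^esub> (nat_elem A p)) \<and>
     (\<forall>f\<in>carrier (p_inverted p A).
        (\<forall>k. to_p_inverted p A (\<iota> (K_root p k)) \<otimes>\<^bsub>p_inverted p A\<^esub> f
               \<in> to_p_inverted p A ` carrier A) \<longrightarrow>
        f \<in> to_p_inverted p A ` carrier A)"

text \<open>\<open>A\<^sub>0\<close>, and \<open>A\<^sub>\<infinity>\<^sub>,\<^sub>0\<close> obtained from it by adjoining \<open>p\<close>-power roots of the coordinates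
  \<open>x\<^sub>1, \<dots>, x\<^sub>d\<close> (indices \<open>Some i\<close>, \<open>i < d\<close>) and of \<open>p\<close> (index \<open>None\<close>).\<close>

type_synonym 'w A0 = "(nat \<Rightarrow> nat multiset \<Rightarrow> 'w) set"
type_synonym 'w A0_roots = "((nat option \<times> nat) multiset \<Rightarrow> 'w A0) set"
type_synonym 'w Ainf0 = "(nat \<Rightarrow> 'w A0_roots) set"

definition A0_ring :: "nat \<Rightarrow> nat \<Rightarrow> 'w ring \<Rightarrow> 'w A0 ring" where
  "A0_ring p d W = p_completion p (mpoly_ring W {..<d})"

definition root_index :: "nat \<Rightarrow> nat option set" where
  "root_index d = insert None (Some ` {..<d})"

definition root_base :: "nat \<Rightarrow> nat \<Rightarrow> 'w ring \<Rightarrow> nat option \<Rightarrow> 'w A0" where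
  "root_base p d W = case_option (nat_elem (A0_ring p d W) p)
     (\<lambda>i. to_p_completion p (mpoly_ring W {..<d}) (mp_var W i))"

definition A0_roots_ring :: "nat \<Rightarrow> nat \<Rightarrow> 'w ring \<Rightarrow> 'w A0_roots ring" where
  "A0_roots_ring p d W = adjoin_roots (A0_ring p d W) p (root_index d) (root_base p d W)"

definition Ainf0_ring :: "nat \<Rightarrow> nat \<Rightarrow> 'w ring \<Rightarrow> 'w Ainf0 ring" where
  "Ainf0_ring p d W = p_completion p (A0_roots_ring p d W)"

definition A0_to_Ainf0 :: "nat \<Rightarrow> nat \<Rightarrow> 'w ring \<Rightarrow> 'w A0 \<Rightarrow> 'w Ainf0" where
  "A0_to_Ainf0 p d W a = to_p_completion p (A0_roots_ring p d W)
     (adjoin_const (A0_ring p d W) p (root_index d) (root_base p d W) a)"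

definition Ainf0_p_root :: "nat \<Rightarrow> nat \<Rightarrow> 'w ring \<Rightarrow> nat \<Rightarrow> 'w Ainf0" where
  "Ainf0_p_root p d W k = to_p_completion p (A0_roots_ring p d W)
     (adjoined_root (A0_ring p d W) p (root_index d) (root_base p d W) None k)"

definition almost_ff_mod_p :: "nat \<Rightarrow> nat \<Rightarrow> 'w ring \<Rightarrow> 'a ring \<Rightarrow> ('w Ainf0 \<Rightarrow> 'a) \<Rightarrow> bool" where
  "almost_ff_mod_p p d W A \<phi> \<longleftrightarrow>
     (let R = Ainf0_ring p d W;
          I = PIdl\<^bsub>R\<^esub> (nat_elem R p);
          J = PIdl\<^bsub>A\<^esub> (nat_elem A p)
      in almost_faithfully_flat (R Quot I)
           (genideal (R Quot I) (range (\<lambda>k. I +>\<^bsub>R\<^esub> Ainf0_p_root p d W k)))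
           (alg_module (induced A J \<phi>) (A Quot J)))"

section \<open>Adic spectra and bounded functions on rational subsets\<close>

text \<open>Following Huber, an equivalence class of valuations \<open>|\<cdot>|\<close> on \<open>R\<close>, with values in an arbitrary
  totally ordered abelian group with \<open>0\<close> adjoined, is identified with the relation
  \<open>{(a, b). |a| \<le> |b|}\<close>; the relations arising in this way are those satisfying the clauses below.\<close>

definition is_valuation :: "('a, 'b) ring_scheme \<Rightarrow> 'a rel \<Rightarrow> bool" where
  "is_valuation R v \<longleftrightarrow>
     v \<subseteq> carrier R \<times> carrier R \<and>
     (\<forall>a\<in>carrier R. \<forall>b\<in>carrier R. (a, b) \<in> v \<or> (b, a) \<in> v) \<and>
     trans v \<and>
     (\<one>\<^bsub>R\<^esub>, \<zero>\<^bsub>R\<^esub>) \<notin> v \<and>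
     (\<forall>a\<in>carrier R. \<forall>b\<in>carrier R. \<forall>c\<in>carrier R.
        (a, c) \<in> v \<and> (b, c) \<in> v \<longrightarrow> (a \<oplus>\<^bsub>R\<^esub> b, c) \<in> v) \<and>
     (\<forall>a\<in>carrier R. \<forall>b\<in>carrier R. \<forall>c\<in>carrier R.
        (a, b) \<in> v \<longrightarrow> (a \<otimes>\<^bsub>R\<^esub> c, b \<otimes>\<^bsub>R\<^esub> c) \<in> v) \<and>
     (\<forall>a\<in>carrier R. \<forall>b\<in>carrier R. \<forall>c\<in>carrier R.
        (a \<otimes>\<^bsub>R\<^esub> c, b \<otimes>\<^bsub>R\<^esub> c) \<in> v \<and> (c, \<zero>\<^bsub>R\<^esub>) \<notin> v \<longrightarrow> (a, b) \<in> v)"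

text \<open>Continuity: \<open>{a. |a| < \<gamma>}\<close> is open for every \<open>\<gamma> = |b| / |c|\<close> in the value group.\<close>

definition Cont :: "('a, 'b) ring_scheme \<Rightarrow> 'a set \<Rightarrow> 'a \<Rightarrow> 'a rel set" where
  "Cont R D t =
     {v. is_valuation R v \<and>
         (\<forall>b\<in>carrier R. \<forall>c\<in>carrier R. (b, \<zero>\<^bsub>R\<^esub>) \<notin> v \<and> (c, \<zero>\<^bsub>R\<^esub>) \<notin> v \<longrightarrow>
            adic_open R D t {a \<in> carrier R. (b, a \<otimes>\<^bsub>R\<^esub> c) \<notin> v})}"

definition Spa :: "('a, 'b) ring_scheme \<Rightarrow> 'a set \<Rightarrow> 'a \<Rightarrow> 'a set \<Rightarrow> 'a rel set" where
  "Spa R D t Rplus = {v \<in> Cont R D t. \<forall>f\<in>Rplus. (f, \<one>\<^bsub>R\<^esub>) \<in> v}"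

definition pullback_valuation :: "('a, 'c) ring_scheme \<Rightarrow> ('a \<Rightarrow> 'b) \<Rightarrow> 'b rel \<Rightarrow> 'a rel" where
  "pullback_valuation R h w = {(a, b). a \<in> carrier R \<and> b \<in> carrier R \<and> (h a, h b) \<in> w}"

text \<open>Huber's \<open>R\<langle>f/s\<rangle>\<close>, for a Tate ring \<open>(R, D, t)\<close> and a unit \<open>f\<close> (so that \<open>f\<close> generates an open
  ideal, and \<open>|s(x)| \<noteq> 0\<close> wherever \<open>|f(x)| \<le> |s(x)|\<close>): the completion of \<open>R[1/s]\<close> for the topology
  with ring of definition \<open>D[f/s]\<close>.\<close>

definition rat_subring ::
    "('a, 'b) ring_scheme \<Rightarrow> 'a set \<Rightarrow> 'a \<Rightarrow> 'a \<Rightarrow> ('a \<times> nat) set set" where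
  "rat_subring R D f s = generate_ring (localization R s) (insert (fraction R s f 1) (to_loc R s ` D))"

definition rat_localization ::
    "('a, 'b) ring_scheme \<Rightarrow> 'a set \<Rightarrow> 'a \<Rightarrow> 'a \<Rightarrow> 'a \<Rightarrow> (nat \<Rightarrow> ('a \<times> nat) set) set ring" where
  "rat_localization R D t f s =
     completion (localization R s) (rat_subring R D f s) (to_loc R s t)"

definition to_rat_localization ::
    "('a, 'b) ring_scheme \<Rightarrow> 'a set \<Rightarrow> 'a \<Rightarrow> 'a \<Rightarrow> 'a \<Rightarrow> 'a \<Rightarrow> (nat \<Rightarrow> ('a \<times> nat) set) set" where
  "to_rat_localization R D t f s a =
     to_completion (localization R s) (rat_subring R D f s) (to_loc R s t) (to_loc R s a)"

text \<open>The continuous valuations of \<open>\<O>(U) = R\<langle>f/s\<rangle>\<close> whose restriction to \<open>R\<close> lies in \<open>U\<close>.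
  Restriction identifies them with the points of \<open>U\<close>: they are the unique continuous extensions
  through which \<open>|h(x)|\<close> is defined for \<open>x \<in> U\<close> and \<open>h \<in> \<O>(U)\<close>.\<close>

definition rat_points ::
    "('a, 'b) ring_scheme \<Rightarrow> 'a set \<Rightarrow> 'a \<Rightarrow> 'a \<Rightarrow> 'a \<Rightarrow> 'a rel set \<Rightarrow>
     (nat \<Rightarrow> ('a \<times> nat) set) set rel set" where
  "rat_points R D t f s U =
     {w \<in> Cont (rat_localization R D t f s)
              (completion_subring (localization R s) (rat_subring R D f s) (to_loc R s t))
              (to_rat_localization R D t f s t).
        pullback_valuation R (to_rat_localization R D t f s) w \<in> U}"

text \<open>\<open>\<O>\<^sup>+(U) = {h \<in> \<O>(U). |h(x)| \<le> 1 for all x \<in> U}\<close>.\<close>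

definition O_plus ::
    "('a, 'b) ring_scheme \<Rightarrow> 'a set \<Rightarrow> 'a \<Rightarrow> 'a \<Rightarrow> 'a \<Rightarrow> 'a rel set \<Rightarrow>
     (nat \<Rightarrow> ('a \<times> nat) set) set ring" where
  "O_plus R D t f s U = (rat_localization R D t f s)
     \<lparr>carrier := {h \<in> carrier (rat_localization R D t f s).
        \<forall>w\<in>rat_points R D t f s U. (h, \<one>\<^bsub>rat_localization R D t f s\<^esub>) \<in> w}\<rparr>"

text \<open>The space \<open>X = Spa(A[1/p], A)\<close> for an integral perfectoid algebra \<open>A\<close>; \<open>A[1/p]\<close> has the
  topology with ring of definition \<open>A\<close>.\<close>

abbreviation Tate_subring :: "nat \<Rightarrow> 'a ring \<Rightarrow> ('a \<times> nat) set set" where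
  "Tate_subring p A \<equiv> to_p_inverted p A ` carrier A"

abbreviation Tate_p :: "nat \<Rightarrow> 'a ring \<Rightarrow> ('a \<times> nat) set" where
  "Tate_p p A \<equiv> nat_elem (p_inverted p A) p"

definition perfd_space :: "nat \<Rightarrow> 'a ring \<Rightarrow> ('a \<times> nat) set rel set" where
  "perfd_space p A = Spa (p_inverted p A) (Tate_subring p A) (Tate_p p A) (Tate_subring p A)"

definition U_subset :: "nat \<Rightarrow> 'a ring \<Rightarrow> 'a \<Rightarrow> nat \<Rightarrow> ('a \<times> nat) set rel set" where
  "U_subset p A g n =
     {x \<in> perfd_space p A. (Tate_p p A [^]\<^bsub>p_inverted p A\<^esub> n, to_p_inverted p A g) \<in> x}"

type_synonym 'a bdd = "(nat \<Rightarrow> (('a \<times> nat) set \<times> nat) set) set"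

text \<open>\<open>A\<langle>p\<^sup>n/g\<rangle> = \<O>\<^sub>X\<^sup>+(U\<^sub>n)\<close>, the restriction map \<open>A = \<O>\<^sub>X\<^sup>+(X) \<rightarrow> A\<langle>p\<^sup>n/g\<rangle>\<close>, and the restriction map
  \<open>A\<langle>p\<^sup>n\<^sup>+\<^sup>1/g\<rangle> \<rightarrow> A\<langle>p\<^sup>n/g\<rangle>\<close>. The latter is the continuous extension of the identity of \<open>A[1/p][1/g]\<close>:
  as \<open>p\<^sup>n\<^sup>+\<^sup>1/g = p \<cdot> p\<^sup>n/g\<close>, Cauchy (null) sequences for the first topology are Cauchy (null) for the
  second.\<close>

definition bdd_ring :: "nat \<Rightarrow> 'a ring \<Rightarrow> 'a \<Rightarrow> nat \<Rightarrow> 'a bdd ring" where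
  "bdd_ring p A g n =
     O_plus (p_inverted p A) (Tate_subring p A) (Tate_p p A)
       (Tate_p p A [^]\<^bsub>p_inverted p A\<^esub> n) (to_p_inverted p A g) (U_subset p A g n)"

definition to_bdd :: "nat \<Rightarrow> 'a ring \<Rightarrow> 'a \<Rightarrow> nat \<Rightarrow> 'a \<Rightarrow> 'a bdd" where
  "to_bdd p A g n a =
     to_rat_localization (p_inverted p A) (Tate_subring p A) (Tate_p p A)
       (Tate_p p A [^]\<^bsub>p_inverted p A\<^esub> n) (to_p_inverted p A g) (to_p_inverted p A a)"

definition bdd_restrict :: "nat \<Rightarrow> 'a ring \<Rightarrow> 'a \<Rightarrow> nat \<Rightarrow> 'a bdd \<Rightarrow> 'a bdd" where
  "bdd_restrict p A g n =
     (let R = p_inverted p A; s = to_p_inverted p A g;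
          B = localization R s;
          D = rat_subring R (Tate_subring p A) (Tate_p p A [^]\<^bsub>R\<^esub> n) s;
          t = to_loc R s (Tate_p p A)
      in induced (cauchy_ring B D t) (null_seqs B D t) id)"

section \<open>Pro-systems\<close>

text \<open>A pro-system \<open>(M, f)\<close> of \<open>R\<close>-modules consists of modules \<open>M n\<close> and transition maps
  \<open>f n : M (n+1) \<rightarrow> M n\<close>.\<close>

definition pro_system :: "('a, 'c) ring_scheme \<Rightarrow> (nat \<Rightarrow> ('a, 'm) module) \<Rightarrow> (nat \<Rightarrow> 'm \<Rightarrow> 'm) \<Rightarrow> bool" where
  "pro_system R M f \<longleftrightarrow> (\<forall>n. module R (M n) \<and> f n \<in> mod_hom R (M (Suc n)) (M n))"

primrec transition_aux :: "(nat \<Rightarrow> 'm \<Rightarrow> 'm) \<Rightarrow> nat \<Rightarrow> nat \<Rightarrow> 'm \<Rightarrow> 'm" where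
  "transition_aux f n 0 = id"
| "transition_aux f n (Suc i) = transition_aux f n i \<circ> f (n + i)"

text \<open>The composite \<open>M j \<rightarrow> M n\<close>, for \<open>n \<le> j\<close>.\<close>

definition transition :: "(nat \<Rightarrow> 'm \<Rightarrow> 'm) \<Rightarrow> nat \<Rightarrow> nat \<Rightarrow> 'm \<Rightarrow> 'm" where
  "transition f n j = transition_aux f n (j - n)"

text \<open>Morphisms of pro-systems are elements of \<open>lim\<^sub>n colim\<^sub>j Hom(M\<^sub>j, N\<^sub>n)\<close>. Such an element is
  represented by \<open>\<alpha>\<close> and \<open>u n : M (\<alpha> n) \<rightarrow> N n\<close>; \<open>pro_eq\<close> says that two representatives define the
  same morphism.\<close>

definition pro_hom ::
    "('a, 'c) ring_scheme \<Rightarrow> (nat \<Rightarrow> ('a, 'm) module) \<Rightarrow> (nat \<Rightarrow> 'm \<Rightarrow> 'm) \<Rightarrow>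
     (nat \<Rightarrow> ('a, 'n) module) \<Rightarrow> (nat \<Rightarrow> 'n \<Rightarrow> 'n) \<Rightarrow> (nat \<Rightarrow> nat) \<Rightarrow> (nat \<Rightarrow> 'm \<Rightarrow> 'n) \<Rightarrow> bool" where
  "pro_hom R M f N g \<alpha> u \<longleftrightarrow>
     (\<forall>n. u n \<in> mod_hom R (M (\<alpha> n)) (N n)) \<and>
     (\<forall>n. \<exists>j. \<alpha> n \<le> j \<and> \<alpha> (Suc n) \<le> j \<and>
        (\<forall>x\<in>carrier (M j).
           g n (u (Suc n) (transition f (\<alpha> (Suc n)) j x)) = u n (transition f (\<alpha> n) j x)))"

definition pro_eq ::
    "(nat \<Rightarrow> ('a, 'm) module) \<Rightarrow> (nat \<Rightarrow> 'm \<Rightarrow> 'm) \<Rightarrow>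
     (nat \<Rightarrow> nat) \<Rightarrow> (nat \<Rightarrow> 'm \<Rightarrow> 'n) \<Rightarrow> (nat \<Rightarrow> nat) \<Rightarrow> (nat \<Rightarrow> 'm \<Rightarrow> 'n) \<Rightarrow> bool" where
  "pro_eq M f \<alpha> u \<beta> v \<longleftrightarrow>
     (\<forall>n. \<exists>j. \<alpha> n \<le> j \<and> \<beta> n \<le> j \<and>
        (\<forall>x\<in>carrier (M j). u n (transition f (\<alpha> n) j x) = v n (transition f (\<beta> n) j x)))"

definition pro_isomorphic ::
    "('a, 'c) ring_scheme \<Rightarrow> (nat \<Rightarrow> ('a, 'm) module) \<Rightarrow> (nat \<Rightarrow> 'm \<Rightarrow> 'm) \<Rightarrow>
     (nat \<Rightarrow> ('a, 'n) module) \<Rightarrow> (nat \<Rightarrow> 'n \<Rightarrow> 'n) \<Rightarrow> bool" where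
  "pro_isomorphic R M f N g \<longleftrightarrow>
     (\<exists>\<alpha> u \<beta> v. pro_hom R M f N g \<alpha> u \<and> pro_hom R N g M f \<beta> v \<and>
        pro_eq M f (\<lambda>n. \<alpha> (\<beta> n)) (\<lambda>n. v n \<circ> u (\<beta> n)) (\<lambda>n. n) (\<lambda>n. id) \<and>
        pro_eq N g (\<lambda>n. \<beta> (\<alpha> n)) (\<lambda>n. u n \<circ> v (\<alpha> n)) (\<lambda>n. n) (\<lambda>n. id))"

text \<open>The pro-system killed by \<open>c\<close> may be sought among those with the same type of elements and
  indexed by \<^typ>\<open>nat\<close>: if \<open>(M, f)\<close> is pro-isomorphic to any pro-system killed by \<open>c\<close>, then for
  suitable \<open>\<alpha>\<close> it is also pro-isomorphic to the system of the images of \<open>M (\<alpha> n)\<close> in \<open>M n\<close>, and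
  these are killed by \<open>c\<close>.\<close>

definition pro_killed ::
    "('a, 'c) ring_scheme \<Rightarrow> 'a \<Rightarrow> (nat \<Rightarrow> ('a, 'm) module) \<Rightarrow> (nat \<Rightarrow> 'm \<Rightarrow> 'm) \<Rightarrow> bool" where
  "pro_killed R c M f \<longleftrightarrow>
     (\<exists>(T :: nat \<Rightarrow> ('a, 'm) module) \<tau>. pro_system R T \<tau> \<and>
        (\<forall>n. \<forall>x\<in>carrier (T n). c \<odot>\<^bsub>T n\<^esub> x = \<zero>\<^bsub>T n\<^esub>) \<and>
        pro_isomorphic R M f T \<tau>)"

definition coker_module :: "('a, 'm) module \<Rightarrow> ('a, 'n) module \<Rightarrow> ('m \<Rightarrow> 'n) \<Rightarrow> ('a, 'n set) module" where
  "coker_module M N u = quot_module N (u ` carrier M)"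

text \<open>A levelwise map \<open>h\<close> of pro-systems \<open>(M, f) \<rightarrow> (N, g)\<close> which is an almost-pro-isomorphism with
  respect to the elements \<open>c k\<close>.\<close>

definition almost_pro_iso ::
    "('a, 'c) ring_scheme \<Rightarrow> (nat \<Rightarrow> 'a) \<Rightarrow> (nat \<Rightarrow> ('a, 'm) module) \<Rightarrow> (nat \<Rightarrow> 'm \<Rightarrow> 'm) \<Rightarrow>
     (nat \<Rightarrow> ('a, 'n) module) \<Rightarrow> (nat \<Rightarrow> 'n \<Rightarrow> 'n) \<Rightarrow> (nat \<Rightarrow> 'm \<Rightarrow> 'n) \<Rightarrow> bool" where
  "almost_pro_iso R c M f N g h \<longleftrightarrow>
     pro_system R M f \<and> pro_system R N g \<and>
     (\<forall>n. h n \<in> mod_hom R (M n) (N n)) \<and>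
     (\<forall>n. \<forall>x\<in>carrier (M (Suc n)). h n (f n x) = g n (h (Suc n) x)) \<and>
     (\<forall>k. pro_killed R (c k) (\<lambda>n. ker_module (M n) (N n) (h n)) f \<and>
          pro_killed R (c k) (\<lambda>n. coker_module (M n) (N n) (h n))
            (\<lambda>n. induced (N n) (h n ` carrier (M n)) (g n)))"

subsection \<open>Reduction modulo \<open>p\<^sup>m\<close>\<close>

definition p_pow_ideal :: "nat \<Rightarrow> nat \<Rightarrow> ('b, 'c) ring_scheme \<Rightarrow> 'b set" where
  "p_pow_ideal p m S = PIdl\<^bsub>S\<^esub> (nat_elem S p [^]\<^bsub>S\<^esub> m)"

text \<open>\<open>S/p\<^sup>m\<close> as a module over the source of \<open>h\<close>.\<close>

definition mod_p_pow :: "nat \<Rightarrow> nat \<Rightarrow> ('a \<Rightarrow> 'b) \<Rightarrow> ('b, 'c) ring_scheme \<Rightarrow> ('a, 'b set) module" where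
  "mod_p_pow p m h S =
     alg_module (\<lambda>a. p_pow_ideal p m S +>\<^bsub>S\<^esub> h a) (S Quot p_pow_ideal p m S)"

definition map_mod_p_pow :: "nat \<Rightarrow> nat \<Rightarrow> ('b, 'c) ring_scheme \<Rightarrow> ('a \<Rightarrow> 'b) \<Rightarrow> 'a set \<Rightarrow> 'b set" where
  "map_mod_p_pow p m S h = induced S (p_pow_ideal p m S) h"

end

theory Submission
  imports Defs
begin

text \<open>In \<open>A = A\<^sub>\<infinity>\<close>, flatness makes \<open>p\<close> a nonzerodivisor, so that the bijectivity of Frobenius
  \<open>A/p\<^sup>1\<^sup>/\<^sup>p \<rightarrow> A/p\<close> allows one to extract \<open>p\<close>-th roots modulo \<open>p\<close>. Let \<open>v\<^sub>l = (p\<^sup>n/g)\<^sup>1\<^sup>/\<^sup>p\<^sup>^\<^sup>l\<close>, and let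
  \<open>M\<^sub>n\<close> be the union of the rings \<open>A[v\<^sub>l]\<close> in \<open>A[1/p][1/g]\<close>. The core is that \<open>y\<^sup>p \<in> p M\<^sub>n\<close> implies, up to all
  \<open>(pg)\<^sup>1\<^sup>/\<^sup>p\<^sup>^\<^sup>k\<close>, that \<open>y \<in> p\<^sup>1\<^sup>/\<^sup>p M\<^sub>n\<close>: a polynomial relation at \<open>v\<^sub>l\<close> is divided formally by a linear factor, the
  coefficients of the quotient are integral over \<open>A\<close> by the valuative criterion, hence almost in \<open>A\<close>, and Frobenius
  lifts this division to one at \<open>v\<^sub>l\<^sub>+\<^sub>1\<close> with a telescoping remainder. Consequently every element that is power
  bounded for the ring of definition \<open>A[p\<^sup>n/g]\<close> lies almost in \<open>M\<^sub>n\<close>. Elements of \<open>\<O>\<^sup>+(U\<^sub>n)\<close> are power bounded,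
  because an element that is not is large at some continuous valuation, constructed by Zorn's lemma from a maximal
  pair (subring, ideal). So modulo \<open>p\<^sup>m\<close> they are almost represented by polynomials in \<open>v\<^sub>l\<close>.

  Cokernel: for \<open>j\<close> much larger than \<open>n\<close>, the low powers of \<open>(p\<^sup>j/g)\<^sup>1\<^sup>/\<^sup>p\<^sup>^\<^sup>l\<close> enter \<open>A\<close> after multiplication by a small
  power of \<open>g\<close>, and the high ones are divisible by \<open>p\<^sup>m\<close> in \<open>M\<^sub>n\<close>. Kernel: if \<open>a \<in> A\<close> is divisible by \<open>p\<^sup>m\<close> in
  \<open>\<O>\<^sup>+(U\<^sub>n)\<close>, then \<open>a/p\<^sup>m\<close> lies almost in \<open>M\<^sub>n\<close>, and for large \<open>n\<close> a small power of \<open>g\<close> makes it integral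
  over \<open>A\<close>.\<close>

section \<open>Linear combinations\<close>

text \<open>Both A and g may involve zero divisors, so all constructions take place in A[1/p][1/g]
  itself: valuations come from pairs (subring, ideal) and may have a nonzero support. The map from A
  to this localization kills only g-torsion, and because A is reduced such torsion is killed by
  every g^(1/p^k); replacing A by its image is therefore harmless for almost statements. Each almost
  statement costs a factor \<delta> k = (pg)^(1/p^k), the p-th power of \<delta> (k+1). As p >= 2,
  two losses at level k+1 fit into one at level k, and as p^2 >= 3, three losses at level k+2 do.
  Hence the shifts k+1, k+2 and k+3 below. The thresholds m p^(k+1) for the cokernel and m p^(k+3)
  for the kernel come from one count: p^m consists of m p^l factors p^(1/p^l), while g^(1/p^j)
  consists of only p^(l-j) factors g^(1/p^l), so each of these has to account for m p^j factors
  p^(1/p^l).\<close>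

primrec lsum :: "('a, 'b) ring_scheme \<Rightarrow> (nat \<Rightarrow> 'a) \<Rightarrow> (nat \<Rightarrow> 'a) \<Rightarrow> nat \<Rightarrow> 'a" where
  "lsum R a m 0 = \<zero>\<^bsub>R\<^esub>"
| "lsum R a m (Suc n) = lsum R a m n \<oplus>\<^bsub>R\<^esub> a n \<otimes>\<^bsub>R\<^esub> m n"

text \<open>For a subring K this is K[x]; for an ideal I of a subring B it is the ideal I B[x] of
  B[x]. Coefficient sequences are total and the length is separate, so two elements can be brought
  to a common length by padding with 0.\<close>

definition pset :: "('a, 'b) ring_scheme \<Rightarrow> 'a set \<Rightarrow> 'a \<Rightarrow> 'a set" where
  "pset R K x = {lsum R a (\<lambda>i. x [^]\<^bsub>R\<^esub> i) n | a n. \<forall>i. a i \<in> K}"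

text \<open>Submodules of R over a bare set B of scalars. Stability under negation is not demanded;
  for a subring B it is multiplication by -1.\<close>

definition submod :: "('a, 'b) ring_scheme \<Rightarrow> 'a set \<Rightarrow> 'a set \<Rightarrow> bool" where
  "submod R B K \<longleftrightarrow> K \<subseteq> carrier R \<and> \<zero>\<^bsub>R\<^esub> \<in> K \<and> (\<forall>x\<in>K. \<forall>y\<in>K. x \<oplus>\<^bsub>R\<^esub> y \<in> K) \<and>
     (\<forall>b\<in>B. \<forall>x\<in>K. b \<otimes>\<^bsub>R\<^esub> x \<in> K)"

lemma submodD:
  assumes "submod R B K"
  shows "K \<subseteq> carrier R" "x \<in> K \<Longrightarrow> x \<in> carrier R" "\<zero>\<^bsub>R\<^esub> \<in> K"
    "x \<in> K \<Longrightarrow> y \<in> K \<Longrightarrow> x \<oplus>\<^bsub>R\<^esub> y \<in> K" "b \<in> B \<Longrightarrow> x \<in> K \<Longrightarrow> b \<otimes>\<^bsub>R\<^esub> x \<in> K"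
  using assms by (auto simp: submod_def)

lemma psetI: "(\<And>i. a i \<in> K) \<Longrightarrow> lsum R a (\<lambda>i. x [^]\<^bsub>R\<^esub> i) n \<in> pset R K x"
  unfolding pset_def by blast

lemma psetE:
  assumes "y \<in> pset R K x"
  obtains a n where "\<And>i. a i \<in> K" "y = lsum R a (\<lambda>i. x [^]\<^bsub>R\<^esub> (i::nat)) n"
  using assms unfolding pset_def by blast

context cring
begin

lemma lsum_closed [simp, intro]:
  "(\<And>i. a i \<in> carrier R) \<Longrightarrow> (\<And>i. m i \<in> carrier R) \<Longrightarrow> lsum R a m n \<in> carrier R"
  by (induction n) auto

lemma lsum_cong:
  "(\<And>i. i < n \<Longrightarrow> a i \<otimes> m i = a' i \<otimes> m' i) \<Longrightarrow> lsum R a m n = lsum R a' m' n"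
  by (induction n) auto

lemma lsum_add:
  assumes "\<And>i. a i \<in> carrier R" "\<And>i. a' i \<in> carrier R" "\<And>i. m i \<in> carrier R"
  shows "lsum R a m n \<oplus> lsum R a' m n = lsum R (\<lambda>i. a i \<oplus> a' i) m n"
proof (induction n)
  case (Suc n)
  have "lsum R a m (Suc n) \<oplus> lsum R a' m (Suc n)
      = (lsum R a m n \<oplus> lsum R a' m n) \<oplus> (a n \<otimes> m n \<oplus> a' n \<otimes> m n)"
    using assms by (simp add: a_ac)
  then show ?case using Suc assms by (simp add: l_distr)
qed simp

lemma lsum_smult:
  assumes "\<And>i. a i \<in> carrier R" "\<And>i. m i \<in> carrier R" "s \<in> carrier R"
  shows "s \<otimes> lsum R a m n = lsum R (\<lambda>i. s \<otimes> a i) m n"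
  using assms by (induction n) (auto simp: r_distr m_assoc)

lemma lsum_smult_right:
  assumes "\<And>i. a i \<in> carrier R" "\<And>i. m i \<in> carrier R" "s \<in> carrier R"
  shows "s \<otimes> lsum R a m n = lsum R a (\<lambda>i. s \<otimes> m i) n"
  using assms by (induction n) (auto simp: r_distr m_lcomm)

lemma lsum_zero:
  assumes "\<And>i. i < n \<Longrightarrow> a i = \<zero>" "\<And>i. m i \<in> carrier R"
  shows "lsum R a m n = \<zero>"
  using assms by (induction n) auto

lemma lsum_pad:
  assumes "\<And>i. a i \<in> carrier R" "\<And>i. m i \<in> carrier R" "n \<le> N"
  shows "lsum R (\<lambda>i. if i < n then a i else \<zero>) m N = lsum R a m n"
proof -
  have "lsum R (\<lambda>i. if i < n then a i else \<zero>) m (n + k) = lsum R a m n" for k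
  proof (induction k)
    case 0
    show ?case by (simp, rule lsum_cong) simp
  next
    case (Suc k)
    then show ?case using assms by simp
  qed
  from this[of "N - n"] assms(3) show ?thesis by simp
qed

lemma lsum_head:
  assumes "\<And>i. a i \<in> carrier R" "\<And>i. m i \<in> carrier R"
  shows "lsum R a m (Suc n) = a 0 \<otimes> m 0 \<oplus> lsum R (\<lambda>i. a (Suc i)) (\<lambda>i. m (Suc i)) n"
proof (induction n)
  case (Suc n)
  have "lsum R a m (Suc (Suc n)) = (a 0 \<otimes> m 0 \<oplus> lsum R (\<lambda>i. a (Suc i)) (\<lambda>i. m (Suc i)) n) \<oplus> a (Suc n) \<otimes> m (Suc n)"
    using Suc by simp
  then show ?case using assms by (simp add: a_assoc)
qed (use assms in simp)

lemma lsum_in_submod: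
  assumes "submod R B K" "\<And>i. a i \<in> B" "\<And>i. m i \<in> K"
  shows "lsum R a m n \<in> K"
  by (induction n) (use assms in \<open>auto intro: submodD\<close>)

lemma submod_pset:
  assumes "submod R B K" "B \<subseteq> carrier R" "x \<in> carrier R"
  shows "submod R B (pset R K x)"
  unfolding submod_def
proof (intro conjI ballI)
  note K = submodD[OF assms(1)]
  have xp: "\<And>i::nat. x [^] i \<in> carrier R" using assms by simp
  show "pset R K x \<subseteq> carrier R"
    using K(2) xp by (auto elim!: psetE)
  show "\<zero> \<in> pset R K x"
    using psetI[of "\<lambda>_. \<zero>" K R x 0] K(3) by simp
  fix y z assume "y \<in> pset R K x" "z \<in> pset R K x"
  then obtain a n b l where a: "\<And>i. a i \<in> K" and b: "\<And>i. b i \<in> K" and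
    y: "y = lsum R a (\<lambda>i. x [^] i) n" and z: "z = lsum R b (\<lambda>i. x [^] i) l" by (auto elim!: psetE)
  define a' where "a' = (\<lambda>i. if i < n then a i else \<zero>)"
  define b' where "b' = (\<lambda>i. if i < l then b i else \<zero>)"
  have y': "y = lsum R a' (\<lambda>i. x [^] i) (max n l)" "z = lsum R b' (\<lambda>i. x [^] i) (max n l)"
    unfolding y z a'_def b'_def using lsum_pad[of a] lsum_pad[of b] a b K(2) xp by simp_all
  have "y \<oplus> z = lsum R (\<lambda>i. a' i \<oplus> b' i) (\<lambda>i. x [^] i) (max n l)"
    unfolding y' by (rule lsum_add) (use a b K xp in \<open>auto simp: a'_def b'_def\<close>)
  also have "\<dots> \<in> pset R K x"
    by (rule psetI) (use a b K in \<open>auto simp: a'_def b'_def\<close>)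
  finally show "y \<oplus> z \<in> pset R K x" .
next
  note K = submodD[OF assms(1)]
  fix s y assume s: "s \<in> B" and "y \<in> pset R K x"
  then obtain a n where a: "\<And>i. a i \<in> K" and y: "y = lsum R a (\<lambda>i. x [^] i) n" by (auto elim!: psetE)
  have "s \<otimes> y = lsum R (\<lambda>i. s \<otimes> a i) (\<lambda>i. x [^] i) n"
    unfolding y by (rule lsum_smult) (use a K s assms in auto)
  also have "\<dots> \<in> pset R K x" by (rule psetI) (use a K s in auto)
  finally show "s \<otimes> y \<in> pset R K x" .
qed

lemma pset_mult_gen:
  assumes "submod R B K" "x \<in> carrier R" "y \<in> pset R K x"
  shows "x \<otimes> y \<in> pset R K x"
proof -
  note K = submodD[OF assms(1)]
  obtain a n where a: "\<And>i. a i \<in> K" and y: "y = lsum R a (\<lambda>i. x [^] i) n"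
    using assms(3) by (auto elim!: psetE)
  define b where "b = case_nat \<zero> a"
  have b: "b i \<in> K" for i using a K(3) by (cases i) (auto simp: b_def)
  have "lsum R b (\<lambda>i. x [^] i) (Suc n) = lsum R a (\<lambda>i. x [^] Suc i) n"
    by (subst lsum_head) (use a b K assms in \<open>auto simp: b_def\<close>)
  also have "\<dots> = x \<otimes> y"
    unfolding y by (subst lsum_smult_right) (use a K assms in \<open>auto simp: m_comm\<close>)
  finally show ?thesis using psetI[of b K R x "Suc n"] b by simp
qed

text \<open>With K = B this is closure of B[x] under products; with K an ideal it makes I B[x] an
  ideal of B[x], as the pair argument of \<open>contains_one\<close> requires.\<close>

lemma pset_mult:
  assumes "submod R B K" "B \<subseteq> carrier R" "x \<in> carrier R" "y \<in> pset R B x" "z \<in> pset R K x"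
  shows "y \<otimes> z \<in> pset R K x"
proof -
  note P = submodD[OF submod_pset[OF assms(1-3)]]
  obtain a n where a: "\<And>i. a i \<in> B" and y: "y = lsum R a (\<lambda>i. x [^] i) n"
    using assms(4) by (auto elim!: psetE)
  have ac: "\<And>i. a i \<in> carrier R" using a assms by auto
  have xz: "x [^] (i::nat) \<otimes> z \<in> pset R K x" for i
  proof (induction i)
    case (Suc i)
    have "x [^] Suc i \<otimes> z = x \<otimes> (x [^] i \<otimes> z)"
      using assms P(2)[OF assms(5)] by (simp add: m_ac)
    then show ?case using pset_mult_gen[OF assms(1,3) Suc] by simp
  qed (use assms P in auto)
  have "y \<otimes> z = z \<otimes> y" using m_comm y ac assms P by simp
  also have "\<dots> = lsum R a (\<lambda>i. z \<otimes> x [^] i) n"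
    unfolding y by (rule lsum_smult_right) (use ac assms P in auto)
  also have "\<dots> = lsum R a (\<lambda>i. x [^] i \<otimes> z) n"
    by (rule lsum_cong) (use ac assms P in \<open>simp add: m_comm\<close>)
  also have "\<dots> \<in> pset R K x"
    by (rule lsum_in_submod[OF submod_pset[OF assms(1-3)] a xz])
  finally show ?thesis .
qed

lemma pset_incl:
  assumes "K \<subseteq> carrier R" "x \<in> carrier R" "y \<in> K"
  shows "y \<in> pset R K x"
  using psetI[of "\<lambda>_. y" K R x 1] assms by auto

lemma subring_submod: "subring B R \<Longrightarrow> submod R B B"
  unfolding submod_def by (auto dest: subringE)

lemma gen_in_pset:
  assumes "subring B R" "x \<in> carrier R"
  shows "x \<in> pset R B x"
  using pset_mult_gen[OF subring_submod[OF assms(1)] assms(2) pset_incl, of \<one>] assms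
  by (simp add: subringE(1,3))

lemma subring_pset:
  assumes "subring B R" "x \<in> carrier R"
  shows "subring (pset R B x) R"
proof (rule subringI)
  have m: "submod R B B" and BC: "B \<subseteq> carrier R" using assms by (auto simp: subring_submod subringE)
  note P = submodD[OF submod_pset[OF m BC assms(2)]]
  show "pset R B x \<subseteq> carrier R" using P by auto
  show "\<one> \<in> pset R B x" using pset_incl[OF BC assms(2)] subringE(3)[OF assms(1)] by auto
  show "h \<otimes> k \<in> pset R B x" if "h \<in> pset R B x" "k \<in> pset R B x" for h k
    using pset_mult[OF m BC assms(2) that] .
  show "h \<oplus> k \<in> pset R B x" if "h \<in> pset R B x" "k \<in> pset R B x" for h k
    using P that by auto
  show "\<ominus> h \<in> pset R B x" if "h \<in> pset R B x" for h
  proof -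
    have "\<ominus> h = (\<ominus> \<one>) \<otimes> h" using P(2)[OF that] by (simp add: l_minus)
    moreover have "\<ominus> \<one> \<in> B" using assms(1) by (simp add: subringE)
    ultimately show ?thesis using P(5) that by simp
  qed
qed

text \<open>Elimination of one generator at a time replaces the determinant. The factor s congruent
  to 1 modulo I, instead of 1 itself, is what the induction produces: every elimination multiplies
  the remaining relations by another such factor.\<close>

lemma nakayama:
  assumes "subring B R" "submod R B I" "I \<subseteq> B" "\<And>k. m k \<in> carrier R" "s \<in> B" "\<one> \<ominus> s \<in> I"
    "\<And>k. k < n \<Longrightarrow> \<exists>a. (\<forall>i. a i \<in> I) \<and> s \<otimes> m k = lsum R a m n"
  shows "\<exists>s'\<in>B. \<one> \<ominus> s' \<in> I \<and> (\<forall>k<n. s' \<otimes> m k = \<zero>)"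
  using assms(5-7)
proof (induction n arbitrary: s)
  case 0
  then show ?case using assms by auto
next
  case (Suc n)
  note I = submodD[OF assms(2)] and B = subringE[OF assms(1)]
  have Bc: "\<And>x. x \<in> B \<Longrightarrow> x \<in> carrier R" using B(1) by auto
  have In: "x \<in> I \<Longrightarrow> \<ominus> x \<in> I" for x
  proof -
    assume x: "x \<in> I"
    have "\<ominus> x = (\<ominus> \<one>) \<otimes> x" using x I by (simp add: l_minus)
    then show ?thesis using I(5)[of "\<ominus> \<one>"] x B by auto
  qed
  obtain A where A: "\<And>i. A i \<in> I" "s \<otimes> m n = lsum R A m (Suc n)" using Suc.prems(3)[of n] by auto
  \<comment> \<open>Moving the last term of the relation for \<open>m n\<close> to the left
    expresses t times \<open>m n\<close> by the earlier generators, and t is still congruent to 1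
    modulo I.\<close>
  define t where "t = s \<ominus> A n"
  have sc: "s \<in> carrier R" and Ac: "\<And>i. A i \<in> carrier R" using Suc.prems A I Bc by auto
  have tB: "t \<in> B" unfolding t_def a_minus_def using Suc.prems B(5,7) subsetD[OF assms(3) A(1)] by blast
  have tc: "t \<in> carrier R" using tB Bc by auto
  have "\<one> \<ominus> t = (\<one> \<ominus> s) \<oplus> A n" unfolding t_def using sc Ac[of n]
    by (simp add: a_minus_def minus_add a_assoc)
  then have t1: "\<one> \<ominus> t \<in> I" using I Suc.prems A by simp
  have tm: "t \<otimes> m n = lsum R A m n"
  proof -
    have "t \<otimes> m n = s \<otimes> m n \<ominus> A n \<otimes> m n" unfolding t_def using sc Ac[of n] assms(4)[of n] by algebra
    also have "\<dots> = lsum R A m n \<oplus> A n \<otimes> m n \<ominus> A n \<otimes> m n" using A by simp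
    also have "\<dots> = lsum R A m n" using Ac assms(4) by (simp add: a_minus_def a_assoc r_neg)
    finally show ?thesis .
  qed
  \<comment> \<open>The extra factor t turns the occurrence of \<open>m n\<close> in the other
    relations into a combination of the earlier generators.\<close>
  define u where "u = s \<otimes> t"
  have uB: "u \<in> B" unfolding u_def using B Suc.prems tB by auto
  have "\<one> \<ominus> u = (\<one> \<ominus> s) \<oplus> s \<otimes> (\<one> \<ominus> t)"
    unfolding u_def using sc tc by (simp add: a_minus_def r_distr r_minus a_assoc[symmetric])
       (simp add: a_assoc l_neg)
  then have u1: "\<one> \<ominus> u \<in> I" using I t1 Suc.prems by simp
  have "\<exists>a. (\<forall>i. a i \<in> I) \<and> u \<otimes> m k = lsum R a m n" if "k < n" for k
  proof -
    obtain a where a: "\<And>i. a i \<in> I" "s \<otimes> m k = lsum R a m (Suc n)" using Suc.prems(3)[of k] \<open>k < n\<close> by auto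
    have ac: "\<And>i. a i \<in> carrier R" using a I by auto
    have "u \<otimes> m k = t \<otimes> (s \<otimes> m k)" unfolding u_def using sc tc assms(4) by (simp add: m_ac)
    also have "\<dots> = t \<otimes> lsum R a m n \<oplus> a n \<otimes> (t \<otimes> m n)"
      using a ac tc assms(4) by (simp add: r_distr m_lcomm)
    also have "\<dots> = lsum R (\<lambda>i. t \<otimes> a i) m n \<oplus> lsum R (\<lambda>i. a n \<otimes> A i) m n"
      unfolding tm using ac tc Ac assms(4) by (simp add: lsum_smult)
    also have "\<dots> = lsum R (\<lambda>i. t \<otimes> a i \<oplus> a n \<otimes> A i) m n"
      by (rule lsum_add) (use ac tc Ac assms(4) in auto)
    finally show ?thesis
      using a(1) A(1) tB I(4,5) subsetD[OF assms(3) a(1)[of n]]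
      by (intro exI[of _ "\<lambda>i. t \<otimes> a i \<oplus> a n \<otimes> A i"]) auto
  qed
  from Suc.IH[OF uB u1 this] obtain r where r: "r \<in> B" "\<one> \<ominus> r \<in> I" "\<And>k. k < n \<Longrightarrow> r \<otimes> m k = \<zero>" by auto
  have rc: "r \<in> carrier R" using r Bc by auto
  show ?case
  proof (intro bexI[of _ "r \<otimes> t"] conjI allI impI)
    show "r \<otimes> t \<in> B" using B r tB by auto
    have "\<one> \<ominus> r \<otimes> t = (\<one> \<ominus> r) \<oplus> r \<otimes> (\<one> \<ominus> t)"
      using rc tc by (simp add: a_minus_def r_distr r_minus a_assoc[symmetric])
         (simp add: a_assoc l_neg)
    then show "\<one> \<ominus> r \<otimes> t \<in> I" using I t1 r by simp
    fix k assume k: "k < Suc n"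
    show "r \<otimes> t \<otimes> m k = \<zero>"
    proof (cases "k = n")
      case True
      have "r \<otimes> t \<otimes> m k = r \<otimes> lsum R A m n" using True tm rc tc assms(4) by (simp add: m_assoc)
      also have "\<dots> = lsum R A (\<lambda>i. r \<otimes> m i) n" using Ac rc assms(4) by (simp add: lsum_smult_right)
      also have "\<dots> = lsum R (\<lambda>_. \<zero>) (\<lambda>i. r \<otimes> m i) n"
        by (rule lsum_cong) (use r Ac in simp)
      also have "\<dots> = \<zero>" using rc assms(4) by (simp add: lsum_zero)
      finally show ?thesis .
    next
      case False
      then have "r \<otimes> m k = \<zero>" using k r by simp
      moreover have "r \<otimes> t \<otimes> m k = t \<otimes> (r \<otimes> m k)" using rc tc assms(4) by (simp add: m_ac)
      ultimately show ?thesis using tc by simp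
    qed
  qed
qed

end

section \<open>Valuations\<close>

lemma valuationD:
  assumes "is_valuation R v"
  shows "(a, b) \<in> v \<Longrightarrow> a \<in> carrier R" "(a, b) \<in> v \<Longrightarrow> b \<in> carrier R"
    "a \<in> carrier R \<Longrightarrow> b \<in> carrier R \<Longrightarrow> (a, b) \<notin> v \<Longrightarrow> (b, a) \<in> v"
    "(a, b) \<in> v \<Longrightarrow> (b, c) \<in> v \<Longrightarrow> (a, c) \<in> v"
    "(\<one>\<^bsub>R\<^esub>, \<zero>\<^bsub>R\<^esub>) \<notin> v"
    "(a, c) \<in> v \<Longrightarrow> (b, c) \<in> v \<Longrightarrow> (a \<oplus>\<^bsub>R\<^esub> b, c) \<in> v"
    "(a, b) \<in> v \<Longrightarrow> c \<in> carrier R \<Longrightarrow> (a \<otimes>\<^bsub>R\<^esub> c, b \<otimes>\<^bsub>R\<^esub> c) \<in> v"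
    "(a \<otimes>\<^bsub>R\<^esub> c, b \<otimes>\<^bsub>R\<^esub> c) \<in> v \<Longrightarrow> (c, \<zero>\<^bsub>R\<^esub>) \<notin> v \<Longrightarrow> a \<in> carrier R \<Longrightarrow> b \<in> carrier R \<Longrightarrow> c \<in> carrier R
       \<Longrightarrow> (a, b) \<in> v"
proof -
  note v = assms[unfolded is_valuation_def]
  have c: "x \<in> carrier R" "y \<in> carrier R" if "(x, y) \<in> v" for x y
    using conjunct1[OF v] that by auto
  show "(a, b) \<in> v \<Longrightarrow> a \<in> carrier R" "(a, b) \<in> v \<Longrightarrow> b \<in> carrier R" by (fact c)+
  show "a \<in> carrier R \<Longrightarrow> b \<in> carrier R \<Longrightarrow> (a, b) \<notin> v \<Longrightarrow> (b, a) \<in> v"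
    using conjunct1[OF conjunct2[OF v]] by blast
  note v2 = conjunct2[OF conjunct2[OF v]]
  show "(a, b) \<in> v \<Longrightarrow> (b, c) \<in> v \<Longrightarrow> (a, c) \<in> v" by (rule transD[OF conjunct1[OF v2]])
  note v3 = conjunct2[OF v2]
  show "(\<one>\<^bsub>R\<^esub>, \<zero>\<^bsub>R\<^esub>) \<notin> v" by (rule conjunct1[OF v3])
  note v4 = conjunct2[OF v3]
  show "(a, c) \<in> v \<Longrightarrow> (b, c) \<in> v \<Longrightarrow> (a \<oplus>\<^bsub>R\<^esub> b, c) \<in> v" using conjunct1[OF v4] c by simp
  note v5 = conjunct2[OF v4]
  show "(a, b) \<in> v \<Longrightarrow> c \<in> carrier R \<Longrightarrow> (a \<otimes>\<^bsub>R\<^esub> c, b \<otimes>\<^bsub>R\<^esub> c) \<in> v"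
    using conjunct1[OF v5] c by simp
  show "(a \<otimes>\<^bsub>R\<^esub> c, b \<otimes>\<^bsub>R\<^esub> c) \<in> v \<Longrightarrow> (c, \<zero>\<^bsub>R\<^esub>) \<notin> v \<Longrightarrow> a \<in> carrier R \<Longrightarrow> b \<in> carrier R \<Longrightarrow> c \<in> carrier R
       \<Longrightarrow> (a, b) \<in> v" using conjunct2[OF v5] by blast
qed

lemma valuation_refl: "is_valuation R v \<Longrightarrow> a \<in> carrier R \<Longrightarrow> (a, a) \<in> v"
  using valuationD(3)[of R v a a] by blast

context cring
begin

text \<open>That |-1| is at most 1 follows from totality: if not, then |1| <= |-1|, and multiplying
  this by -1 gives |-1| <= 1 after all.\<close>

lemma valuation_uminus:
  assumes v: "is_valuation R v" and ab: "(a, b) \<in> v"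
  shows "(\<ominus> a, b) \<in> v"
proof -
  note V = valuationD[OF v]
  have c: "a \<in> carrier R" "b \<in> carrier R" using V(1,2) ab by auto
  have "(\<ominus> \<one>, \<one>) \<in> v"
  proof (rule ccontr)
    assume n: "(\<ominus> \<one>, \<one>) \<notin> v"
    then have "(\<one>, \<ominus> \<one>) \<in> v" using V(3) by auto
    from V(7)[OF this, of "\<ominus> \<one>"] have "(\<ominus> \<one>, \<one>) \<in> v" by (simp add: l_minus)
    with n show False ..
  qed
  from V(7)[OF this c(1)] have "(\<ominus> a, a) \<in> v" using c by (simp add: l_minus)
  then show ?thesis using V(4) ab by blast
qed

lemma valuation_minus:
  assumes v: "is_valuation R v" and "(a, c) \<in> v" "(b, c) \<in> v"
  shows "(a \<ominus> b, c) \<in> v"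
  unfolding a_minus_def using valuationD(6)[OF v assms(2) valuation_uminus[OF v assms(3)]] .

lemma valuation_mult:
  assumes v: "is_valuation R v" and "(a, b) \<in> v" "(c, d) \<in> v"
  shows "(a \<otimes> c, b \<otimes> d) \<in> v"
proof -
  note V = valuationD[OF v]
  have cc: "a \<in> carrier R" "b \<in> carrier R" "c \<in> carrier R" "d \<in> carrier R" using V(1,2) assms by blast+
  have 1: "(a \<otimes> c, b \<otimes> c) \<in> v" using V(7)[OF assms(2) cc(3)] .
  have "(b \<otimes> c, b \<otimes> d) \<in> v" using V(7)[OF assms(3) cc(2)] cc by (simp add: m_comm)
  with 1 show ?thesis using V(4) by blast
qed

lemma valuation_mult_one:
  assumes "is_valuation R v" and "(a, \<one>) \<in> v" "(c, \<one>) \<in> v"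
  shows "(a \<otimes> c, \<one>) \<in> v"
  using valuation_mult[OF assms] by simp

lemma valuation_zero:
  assumes v: "is_valuation R v" and "b \<in> carrier R"
  shows "(\<zero>, b) \<in> v"
proof -
  note V = valuationD[OF v]
  have "(\<zero>, \<one>) \<in> v" using V(3)[of \<one> \<zero>] V(5) by auto
  from V(7)[OF this assms(2)] show ?thesis using assms(2) by simp
qed

lemma valuation_pow:
  assumes v: "is_valuation R v" and "(a, b) \<in> v"
  shows "(a [^] (n::nat), b [^] n) \<in> v"
proof (induction n)
  case 0
  then show ?case using valuation_refl[OF v] by simp
next
  case (Suc n)
  then show ?case using valuation_mult[OF v Suc assms(2)] by simp
qed

lemma valuation_lsum:
  assumes v: "is_valuation R v" and "b \<in> carrier R" "\<And>i. i < n \<Longrightarrow> (a i \<otimes> m i, b) \<in> v"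
  shows "(lsum R a m n, b) \<in> v"
  using assms(3) by (induction n) (auto intro: valuation_zero[OF v assms(2)] valuationD(6)[OF v])

lemma valuation_unit:
  assumes v: "is_valuation R v" and "a \<in> carrier R" "b \<in> carrier R" "a \<otimes> b = \<one>"
  shows "(a, \<zero>) \<notin> v"
proof
  assume "(a, \<zero>) \<in> v"
  from valuationD(7)[OF v this assms(3)] assms have "(\<one>, \<zero>) \<in> v" by simp
  then show False using valuationD(5)[OF v] by blast
qed

lemma valuation_pullback:
  assumes S: "cring S" and h: "h \<in> ring_hom R S" and v: "is_valuation S v"
  shows "is_valuation R (pullback_valuation R h v)"
proof -
  interpret S: cring S by fact
  note V = valuationD[OF v]
  have z: "h \<zero> = \<zero>\<^bsub>S\<^esub>"
    using ring_hom_zero[OF h ring_axioms S.ring_axioms] .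
  note H = ring_hom_closed[OF h] ring_hom_mult[OF h] ring_hom_add[OF h] ring_hom_one[OF h] z
  have X: "(a, b) \<in> pullback_valuation R h v \<longleftrightarrow> a \<in> carrier R \<and> b \<in> carrier R \<and> (h a, h b) \<in> v" for a b
    by (simp add: pullback_valuation_def)
  show ?thesis
    unfolding is_valuation_def trans_def X
  proof (intro conjI ballI allI impI; (elim conjE)?)
    show "pullback_valuation R h v \<subseteq> carrier R \<times> carrier R" by (auto simp: pullback_valuation_def)
  next
    show "\<not> (\<one> \<in> carrier R \<and> \<zero> \<in> carrier R \<and> (h \<one>, h \<zero>) \<in> v)" using V(5) H by simp
  next
    fix a b c assume "a \<in> carrier R" "b \<in> carrier R" "c \<in> carrier R" "(h (a \<otimes> c), h (b \<otimes> c)) \<in> v"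
      "\<not> (c \<in> carrier R \<and> \<zero> \<in> carrier R \<and> (h c, h \<zero>) \<in> v)"
    then show "(h a, h b) \<in> v" using V(8)[of "h a" "h c" "h b"] H by simp
  next
    fix a b assume "a \<in> carrier R" "b \<in> carrier R"
    then show "(a \<in> carrier R \<and> b \<in> carrier R \<and> (h a, h b) \<in> v) \<or> (b \<in> carrier R \<and> a \<in> carrier R \<and> (h b, h a) \<in> v)"
      using V(3) H(1) by blast
  next
    fix a b c assume "(h a, h b) \<in> v" "(h b, h c) \<in> v"
    then show "(h a, h c) \<in> v" by (rule V(4))
  next
    fix a b c assume "a \<in> carrier R" "b \<in> carrier R" "c \<in> carrier R" "(h a, h c) \<in> v" "(h b, h c) \<in> v"
    then show "(h (a \<oplus> b), h c) \<in> v" using V(6) H(3) by simp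
  next
    fix a b c assume "a \<in> carrier R" "b \<in> carrier R" "c \<in> carrier R" "(h a, h b) \<in> v"
    then show "(h (a \<otimes> c), h (b \<otimes> c)) \<in> v" using V(7) H by simp
  qed (simp_all)
qed

end

subsection \<open>Manis pairs\<close>

text \<open>Following Manis, a valuation on a ring is obtained from a pair (subring, proper ideal of it)
  that is maximal under inclusion; no passage to a field is needed. A pair \<open>(B, I)\<close> is coded as the
  disjoint sum \<open>B <+> I\<close>, which turns the order into set inclusion.\<close>

definition (in cring) adm :: "'a set \<Rightarrow> 'a \<Rightarrow> ('a + 'a) set \<Rightarrow> bool" where
  "adm B0 z Q \<longleftrightarrow> subring {b. Inl b \<in> Q} R \<and> B0 \<subseteq> {b. Inl b \<in> Q} \<and> submod R {b. Inl b \<in> Q} {i. Inr i \<in> Q} \<and>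
     {i. Inr i \<in> Q} \<subseteq> {b. Inl b \<in> Q} \<and> z \<in> {i. Inr i \<in> Q} \<and> \<one> \<notin> {i. Inr i \<in> Q}"

context cring
begin

lemma adm_Plus: "adm B0 z (B <+> I) \<longleftrightarrow>
    subring B R \<and> B0 \<subseteq> B \<and> submod R B I \<and> I \<subseteq> B \<and> z \<in> I \<and> \<one> \<notin> I"
  unfolding adm_def by (simp add: Plus_def image_iff)

lemma adm_chain:
  assumes "C \<noteq> {}" "subset.chain {Q. adm B0 z Q} C"
  shows "adm B0 z (\<Union>C)"
proof -
  have A: "adm B0 z Q" if "Q \<in> C" for Q using assms(2) that unfolding subset.chain_def by auto
  have two: "\<exists>Q\<in>C. a \<in> Q \<and> b \<in> Q" if "a \<in> \<Union>C" "b \<in> \<Union>C" for a b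
    using assms(2) that unfolding subset.chain_def by blast
  have s: "subring {b. Inl b \<in> Q} R" "submod R {b. Inl b \<in> Q} {i. Inr i \<in> Q}" if "Q \<in> C" for Q
    using A[OF that] by (auto simp: adm_def)
  note sub = subringE[OF s(1)] and mo = submodD[OF s(2)]
  obtain Q0 where Q0: "Q0 \<in> C" using assms(1) by auto
  show ?thesis
    unfolding adm_def
  proof (intro conjI)
    show "subring {b. Inl b \<in> \<Union>C} R"
    proof (rule subringI)
      show "{b. Inl b \<in> \<Union>C} \<subseteq> carrier R" using sub(1) by auto
      show "\<one> \<in> {b. Inl b \<in> \<Union>C}" using sub(3)[OF Q0] Q0 by auto
      show "\<ominus> h \<in> {b. Inl b \<in> \<Union>C}" if "h \<in> {b. Inl b \<in> \<Union>C}" for h using that sub(5) by auto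
      fix h k assume "h \<in> {b. Inl b \<in> \<Union>C}" "k \<in> {b. Inl b \<in> \<Union>C}"
      then obtain Q where "Q \<in> C" "Inl h \<in> Q" "Inl k \<in> Q" using two[of "Inl h" "Inl k"] by blast
      then show "h \<otimes> k \<in> {b. Inl b \<in> \<Union>C}" "h \<oplus> k \<in> {b. Inl b \<in> \<Union>C}"
        using sub(6,7)[of Q h k] by blast+
    qed
    show "submod R {b. Inl b \<in> \<Union>C} {i. Inr i \<in> \<Union>C}"
      unfolding submod_def
    proof (intro conjI ballI)
      show "{i. Inr i \<in> \<Union>C} \<subseteq> carrier R" using mo(1) by auto
      show "\<zero> \<in> {i. Inr i \<in> \<Union>C}" using mo(3)[OF Q0] Q0 by auto
      show "x \<oplus> y \<in> {i. Inr i \<in> \<Union>C}" if xy: "x \<in> {i. Inr i \<in> \<Union>C}" "y \<in> {i. Inr i \<in> \<Union>C}" for x y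
      proof -
        obtain Q where "Q \<in> C" "Inr x \<in> Q" "Inr y \<in> Q" using two[of "Inr x" "Inr y"] xy by blast
        then show ?thesis using mo(4)[of Q x y] by blast
      qed
      show "b \<otimes> x \<in> {i. Inr i \<in> \<Union>C}" if bx: "b \<in> {b. Inl b \<in> \<Union>C}" "x \<in> {i. Inr i \<in> \<Union>C}" for b x
      proof -
        obtain Q where "Q \<in> C" "Inl b \<in> Q" "Inr x \<in> Q" using two[of "Inl b" "Inr x"] bx by blast
        then show ?thesis using mo(5)[of Q b x] by blast
      qed
    qed
    show "B0 \<subseteq> {b. Inl b \<in> \<Union>C}" "{i. Inr i \<in> \<Union>C} \<subseteq> {b. Inl b \<in> \<Union>C}"
      "z \<in> {i. Inr i \<in> \<Union>C}" "\<one> \<notin> {i. Inr i \<in> \<Union>C}"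
      using A Q0 unfolding adm_def by blast+
  qed
qed

text \<open>The last hypothesis says that z is not invertible in B0, so the ideal z B0 is proper and
  Zorn's lemma can start from (B0, z B0). Maximality can then be stated among all pairs, since a
  pair above (B, I) automatically contains B0 and z.\<close>

lemma maximal_pair_exists:
  assumes "subring B0 R" "z \<in> B0" "\<And>b. b \<in> B0 \<Longrightarrow> z \<otimes> b \<noteq> \<one>"
  obtains B I where "subring B R" "B0 \<subseteq> B" "submod R B I" "I \<subseteq> B" "z \<in> I" "\<one> \<notin> I"
    "\<And>B' I'. subring B' R \<Longrightarrow> submod R B' I' \<Longrightarrow> I' \<subseteq> B' \<Longrightarrow> \<one> \<notin> I' \<Longrightarrow> B \<subseteq> B' \<Longrightarrow> I \<subseteq> I' \<Longrightarrow> B' = B \<and> I' = I"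
proof -
  note B0 = subringE[OF assms(1)]
  have zc: "z \<in> carrier R" using assms B0 by auto
  define I0 where "I0 = (\<lambda>b. z \<otimes> b) ` B0"
  have "submod R B0 I0"
    unfolding submod_def I0_def
  proof (intro conjI ballI)
    show "(\<otimes>) z ` B0 \<subseteq> carrier R" using B0(1) zc by auto
    show "\<zero> \<in> (\<otimes>) z ` B0" using B0(2) zc by force
    show "x \<oplus> y \<in> (\<otimes>) z ` B0" if xy: "x \<in> (\<otimes>) z ` B0" "y \<in> (\<otimes>) z ` B0" for x y
    proof -
      obtain b b' where "b \<in> B0" "b' \<in> B0" "x = z \<otimes> b" "y = z \<otimes> b'" using xy by auto
      then have "x \<oplus> y = z \<otimes> (b \<oplus> b')" "b \<oplus> b' \<in> B0" using zc B0 by (auto simp: r_distr subset_iff)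
      then show ?thesis by blast
    qed
    show "b \<otimes> x \<in> (\<otimes>) z ` B0" if bx: "b \<in> B0" "x \<in> (\<otimes>) z ` B0" for b x
    proof -
      obtain b' where b': "b' \<in> B0" "x = z \<otimes> b'" using bx by auto
      have "b \<in> carrier R" "b' \<in> carrier R" using b' bx B0(1) by auto
      then have "b \<otimes> x = z \<otimes> (b \<otimes> b')" "b \<otimes> b' \<in> B0" using b' bx zc B0 by (auto simp: m_lcomm)
      then show ?thesis by blast
    qed
  qed
  moreover have "I0 \<subseteq> B0" unfolding I0_def using assms B0 by auto
  moreover have "z \<in> I0" unfolding I0_def using zc B0(3) by force
  moreover have "\<one> \<notin> I0" unfolding I0_def using assms(3) by (metis imageE)
  ultimately have "adm B0 z (B0 <+> I0)" using assms by (simp add: adm_Plus)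
  then have "{Q. adm B0 z Q} \<noteq> {}" by auto
  then have "\<exists>M\<in>{Q. adm B0 z Q}. \<forall>Q\<in>{Q. adm B0 z Q}. M \<subseteq> Q \<longrightarrow> Q = M"
    by (rule subset_Zorn_nonempty) (simp add: adm_chain)
  then obtain M where M: "adm B0 z M" "\<And>Q. adm B0 z Q \<Longrightarrow> M \<subseteq> Q \<Longrightarrow> Q = M" by auto
  define B I where "B = {b. Inl b \<in> M}" and "I = {i. Inr i \<in> M}"
  show thesis
  proof (rule that)
    show BI: "subring B R" "B0 \<subseteq> B" "submod R B I" "I \<subseteq> B" "z \<in> I" "\<one> \<notin> I"
      using M(1) unfolding adm_def B_def I_def by auto
    fix B' I' assume *: "subring B' R" "submod R B' I'" "I' \<subseteq> B'" "\<one> \<notin> I'" "B \<subseteq> B'" "I \<subseteq> I'"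
    have "adm B0 z (B' <+> I')" unfolding adm_Plus using * BI by auto
    moreover have "M \<subseteq> B' <+> I'"
    proof
      fix x assume "x \<in> M" then show "x \<in> B' <+> I'"
        using * by (cases x) (auto simp: B_def I_def)
    qed
    ultimately have "B' <+> I' = M" using M(2) by blast
    then show "B' = B \<and> I' = I" unfolding B_def I_def by auto
  qed
qed

end

text \<open>The Manis property of maximal pairs, via minimal relations \<open>s = i\<^sub>0 + i\<^sub>1 x + \<dots> + i\<^sub>n x\<^sup>n\<close> with
  \<open>s \<in> B - I\<close> and all \<open>i\<^sub>k \<in> I\<close>: the product \<open>i\<^sub>n x\<close> is integral over \<open>B\<close>.\<close>

locale maximal_pair = cring +
  fixes B I
  assumes sub: "subring B R" and mo: "submod R B I" and IB: "I \<subseteq> B" and one: "\<one> \<notin> I"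
    and maxi: "\<And>B' I'. subring B' R \<Longrightarrow> submod R B' I' \<Longrightarrow> I' \<subseteq> B' \<Longrightarrow> \<one> \<notin> I' \<Longrightarrow> B \<subseteq> B' \<Longrightarrow> I \<subseteq> I' \<Longrightarrow> B' = B \<and> I' = I"
begin

lemmas B = subringE[OF sub]
lemmas I = submodD[OF mo]

lemma Bc: "x \<in> B \<Longrightarrow> x \<in> carrier R" using B(1) by auto

lemma I_r: "x \<in> I \<Longrightarrow> b \<in> B \<Longrightarrow> x \<otimes> b \<in> I"
  using I(5)[of b x] I(2)[of x] Bc[of b] by (simp add: m_comm)

text \<open>The pair (B, I + sB) is strictly larger than (B, I), so its ideal cannot be proper. In
  other words I is a maximal ideal of B.\<close>

lemma inverse_mod_I:
  assumes "s \<in> B" "s \<notin> I"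
  obtains i b where "i \<in> I" "b \<in> B" "\<one> = i \<oplus> s \<otimes> b"
proof -
  define I' where "I' = {i \<oplus> s \<otimes> b | i b. i \<in> I \<and> b \<in> B}"
  have sc: "s \<in> carrier R" using assms Bc by auto
  have "submod R B I'"
    unfolding submod_def
  proof (intro conjI ballI)
    show "I' \<subseteq> carrier R" unfolding I'_def using I Bc sc by auto
    show "\<zero> \<in> I'" unfolding I'_def using I(3) B(2) sc by force
    show "x \<oplus> y \<in> I'" if xy: "x \<in> I'" "y \<in> I'" for x y
    proof -
      obtain i b j c where *: "i \<in> I" "b \<in> B" "x = i \<oplus> s \<otimes> b" "j \<in> I" "c \<in> B" "y = j \<oplus> s \<otimes> c"
        using xy unfolding I'_def by auto
      have "x \<oplus> y = (i \<oplus> j) \<oplus> s \<otimes> (b \<oplus> c)" unfolding * using * I Bc sc by (simp add: r_distr a_ac)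
      then show ?thesis unfolding I'_def using I(4)[OF *(1,4)] B(7)[OF *(2,5)] by blast
    qed
    show "a \<otimes> x \<in> I'" if ax: "a \<in> B" "x \<in> I'" for a x
    proof -
      obtain i b where *: "i \<in> I" "b \<in> B" "x = i \<oplus> s \<otimes> b"
        using ax unfolding I'_def by auto
      have "a \<otimes> x = (a \<otimes> i) \<oplus> s \<otimes> (a \<otimes> b)" unfolding * using * I Bc sc ax by (simp add: r_distr m_ac)
      then show ?thesis unfolding I'_def using I(5)[OF ax(1) *(1)] B(6)[OF ax(1) *(2)] by blast
    qed
  qed
  moreover have "I' \<subseteq> B" unfolding I'_def using IB B assms by auto
  moreover have "I \<subseteq> I'" unfolding I'_def using B(2) sc I(2) by force
  moreover have "s \<in> I'" unfolding I'_def using I(3) B(3) sc by force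
  ultimately have "\<one> \<in> I'" using maxi[of B I'] sub assms by auto
  then show thesis unfolding I'_def using that by auto
qed

lemma prime:
  assumes "s \<in> B" "s' \<in> B" "s \<notin> I" "s' \<notin> I"
  shows "s \<otimes> s' \<notin> I"
proof
  assume ss: "s \<otimes> s' \<in> I"
  obtain i b where *: "i \<in> I" "b \<in> B" "\<one> = i \<oplus> s \<otimes> b" using inverse_mod_I assms by metis
  have c: "s' \<in> carrier R" "s \<in> carrier R" "b \<in> carrier R" "i \<in> carrier R" using assms * Bc I by auto
  have "s' = (i \<oplus> s \<otimes> b) \<otimes> s'" using c by (simp add: *(3)[symmetric])
  also have "\<dots> = s' \<otimes> i \<oplus> b \<otimes> (s \<otimes> s')" using c by algebra
  also have "\<dots> \<in> I" using I * assms ss by auto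
  finally show False using assms by simp
qed

text \<open>Otherwise (B[x], I B[x]) would be a strictly larger pair.\<close>

lemma contains_one:
  assumes "x \<in> carrier R" "x \<notin> B"
  shows "\<one> \<in> pset R I x"
proof (rule ccontr)
  assume n: "\<one> \<notin> pset R I x"
  have BC: "B \<subseteq> carrier R" using B by auto
  have "submod R (pset R B x) (pset R I x)"
    unfolding submod_def using submodD[OF submod_pset[OF mo BC assms(1)]]
      pset_mult[OF mo BC assms(1)] by blast
  moreover have "pset R I x \<subseteq> pset R B x" using IB unfolding pset_def by blast
  moreover have "B \<subseteq> pset R B x" "I \<subseteq> pset R I x" using pset_incl[OF _ assms(1)] BC I(1) by blast+
  ultimately have "pset R B x = B" using maxi[OF subring_pset[OF sub assms(1)]] n by blast
  then show False using gen_in_pset[OF sub assms(1)] assms by simp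
qed

text \<open>If y were outside B, the ideal I B[y] would contain 1 and be all of B[y]. Since B[y] is
  generated as a module by y^0, ..., y^(r-1), Nakayama yields an element congruent to 1 modulo I
  that kills y^0 = 1; it is 0, so 1 would lie in I.\<close>

lemma integrally_closed:
  assumes "y \<in> carrier R" "y [^] (r::nat) = lsum R c (\<lambda>i. y [^] i) r" "\<And>i. c i \<in> B"
  shows "y \<in> B"
proof (rule ccontr)
  assume "y \<notin> B"
  then have o: "\<one> \<in> pset R I y" using contains_one assms by auto
  have BC: "B \<subseteq> carrier R" using B by auto
  have yp: "\<And>i::nat. y [^] i \<in> carrier R" using assms by simp
  have cc: "\<And>i. c i \<in> carrier R" using assms BC by auto
  \<comment> \<open>The monic equation rewrites every power of y in terms of the first r ones, with
    coefficients in B.\<close>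
  have red1: "\<exists>b. (\<forall>i. b i \<in> B) \<and> y [^] n = lsum R b (\<lambda>i. y [^] i) r" for n :: nat
  proof (induction n)
    case 0
    show ?case
    proof (cases r)
      case 0
      have "\<one> = \<zero>" using assms(2) 0 by simp
      then show ?thesis using one I by auto
    next
      case (Suc r')
      have "lsum R (\<lambda>i. if i < 1 then \<one> else \<zero>) (\<lambda>i. y [^] i) r = lsum R (\<lambda>i. \<one>) (\<lambda>i. y [^] i) 1"
        by (rule lsum_pad) (use Suc yp in auto)
      then show ?thesis by (intro exI[of _ "\<lambda>i. if i < 1 then \<one> else \<zero>"]) (use B in auto)
    qed
  next
    case (Suc n)
    then obtain b where b: "\<And>i. b i \<in> B" "y [^] n = lsum R b (\<lambda>i. y [^] i) r" by auto
    have bc: "\<And>i. b i \<in> carrier R" using b BC by auto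
    define b' where "b' = case_nat \<zero> b"
    have b'B: "b' i \<in> B" for i using b B by (cases i) (auto simp: b'_def)
    have b'c: "\<And>i. b' i \<in> carrier R" using b'B BC by auto
    have "y [^] Suc n = y \<otimes> lsum R b (\<lambda>i. y [^] i) r" using b(2) bc yp assms(1) by (simp add: m_comm)
    also have "\<dots> = lsum R b (\<lambda>i. y [^] Suc i) r"
      using bc yp assms by (subst lsum_smult_right) (auto simp: m_comm)
    also have "\<dots> = lsum R b' (\<lambda>i. y [^] i) (Suc r)"
      by (subst lsum_head) (use b'c yp bc assms(1) in \<open>auto simp: b'_def\<close>)
    also have "\<dots> = lsum R b' (\<lambda>i. y [^] i) r \<oplus> b' r \<otimes> lsum R c (\<lambda>i. y [^] i) r" using assms(2) by simp
    also have "\<dots> = lsum R (\<lambda>i. b' i \<oplus> b' r \<otimes> c i) (\<lambda>i. y [^] i) r"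
      using b'c cc yp by (simp add: lsum_smult lsum_add)
    finally show ?case using b'B B assms by (intro exI[of _ "\<lambda>i. b' i \<oplus> b' r \<otimes> c i"]) auto
  qed
  have red2: "\<exists>b. (\<forall>i. b i \<in> I) \<and> lsum R a (\<lambda>i. y [^] i) n = lsum R b (\<lambda>i. y [^] i) r"
    if a: "\<And>i. a i \<in> I" for a n
  proof (induction n)
    case 0
    then show ?case using I by (intro exI[of _ "\<lambda>_. \<zero>"]) (simp add: lsum_zero yp)
  next
    case (Suc n)
    then obtain b where b: "\<And>i. b i \<in> I" "lsum R a (\<lambda>i. y [^] i) n = lsum R b (\<lambda>i. y [^] i) r" by auto
    obtain d where d: "\<And>i. d i \<in> B" "y [^] n = lsum R d (\<lambda>i. y [^] i) r" using red1 by metis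
    have "lsum R a (\<lambda>i. y [^] i) (Suc n) = lsum R b (\<lambda>i. y [^] i) r \<oplus> a n \<otimes> lsum R d (\<lambda>i. y [^] i) r"
      using b d by simp
    also have "\<dots> = lsum R (\<lambda>i. b i \<oplus> a n \<otimes> d i) (\<lambda>i. y [^] i) r"
      using I(2)[OF b(1)] I(2)[OF a] Bc[OF d(1)] yp by (simp add: lsum_smult lsum_add)
    finally show ?case using b I I_r[OF a d(1)] by (intro exI[of _ "\<lambda>i. b i \<oplus> a n \<otimes> d i"]) auto
  qed
  \<comment> \<open>Every power of y lies in B[y] = I B[y] and is then reduced to length r. The
    factor \<one> is the initial s of \<open>nakayama\<close>.\<close>
  have "\<exists>a. (\<forall>i. a i \<in> I) \<and> \<one> \<otimes> y [^] k = lsum R a (\<lambda>i. y [^] i) r" for k :: nat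
  proof -
    obtain d n where d: "\<And>i. d i \<in> B" "y [^] k = lsum R d (\<lambda>i. y [^] i) n" using red1 by metis
    have "y [^] k \<in> pset R B y" unfolding d(2) by (rule psetI) (rule d)
    from pset_mult[OF mo BC assms(1) this o] have "y [^] k \<in> pset R I y" using yp by simp
    then obtain a l where "\<And>i. a i \<in> I" "y [^] k = lsum R a (\<lambda>i. y [^] i) l" by (auto elim!: psetE)
    then show ?thesis unfolding l_one[OF yp] using red2[of a l] by simp
  qed
  from nakayama[OF sub mo IB yp B(3) _ this]
  obtain s' where s': "s' \<in> B" "\<one> \<ominus> s' \<in> I" "\<And>k. k < r \<Longrightarrow> s' \<otimes> y [^] k = \<zero>"
    using I(3) by (auto simp: a_minus_def r_neg)
  have "r \<noteq> 0" using assms(2) one I by (cases r) auto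
  then have "s' = \<zero>" using s'(3)[of 0] Bc[OF s'(1)] by simp
  then show False using s'(2) one by (simp add: a_minus_def)
qed

text \<open>The witness is the top coefficient of a shortest relation with value in B - I: its
  product with x is in B by integral closedness, and outside I because otherwise the relation could
  be shortened.\<close>

lemma manis:
  assumes x: "x \<in> carrier R" "x \<notin> B"
  obtains y where "y \<in> I" "x \<otimes> y \<in> B" "x \<otimes> y \<notin> I"
proof -
  define Q where "Q n \<longleftrightarrow> (\<exists>a. (\<forall>i. a i \<in> I) \<and> lsum R a (\<lambda>i. x [^] i) n \<in> B \<and> lsum R a (\<lambda>i. x [^] i) n \<notin> I)" for n
  obtain a0 n0 where "\<And>i. a0 i \<in> I" "\<one> = lsum R a0 (\<lambda>i. x [^] (i::nat)) n0"
    using contains_one[OF x] by (auto elim!: psetE)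
  then have "Q n0" unfolding Q_def using one B(3) by (intro exI[of _ a0]) auto
  then have "\<exists>n. Q n" by blast
  define n where "n = (LEAST n. Q n)"
  have Qn: "Q n" unfolding n_def using \<open>\<exists>n. Q n\<close> LeastI_ex by metis
  have least: "\<not> Q k" if "k < n" for k using not_less_Least that unfolding n_def by blast
  have xp: "\<And>i::nat. x [^] i \<in> carrier R" using x by simp
  obtain a where a: "\<And>i. a i \<in> I" and s: "lsum R a (\<lambda>i. x [^] i) n \<in> B" "lsum R a (\<lambda>i. x [^] i) n \<notin> I"
    using Qn unfolding Q_def by auto
  have ac: "\<And>i. a i \<in> carrier R" using a I by auto
  have aB: "\<And>i. a i \<in> B" using a IB by auto
  \<comment> \<open>A relation of length 0 has value 0 and one of length 1 has its value in I, so a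
    shortest relation has at least two terms.\<close>
  have "n \<noteq> 0" using s I by (cases n) auto
  moreover have "n \<noteq> 1" using s a xp ac by auto
  ultimately obtain r where r: "n = Suc (Suc r)" by (metis One_nat_def old.nat.exhaust)
  define i where "i = a (Suc r)"
  define y where "y = i \<otimes> x"
  define S where "S = lsum R a (\<lambda>i. x [^] i) n"
  have ic: "i \<in> carrier R" "i \<in> I" "i \<in> B" and yc: "y \<in> carrier R" using ac a aB x unfolding i_def y_def by auto
  have Sc: "S \<in> carrier R" "S \<in> B" using s Bc unfolding S_def by auto
  have pw: "i [^] (k::nat) \<in> B" for k by (induction k) (use B ic in auto)
  have pwc: "i [^] (k::nat) \<in> carrier R" for k using ic by simp
  \<comment> \<open>With i the coefficient of x^(r+1), multiplication by i^r turns the relation into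
    a monic equation of degree r+1 for y = i x.\<close>
  have "S = lsum R a (\<lambda>i. x [^] i) (Suc r) \<oplus> i \<otimes> x [^] Suc r" unfolding S_def r i_def by simp
  then have "i [^] r \<otimes> S = i [^] r \<otimes> lsum R a (\<lambda>i. x [^] i) (Suc r) \<oplus> i [^] r \<otimes> (i \<otimes> x [^] Suc r)"
    using ic ac xp x by (simp add: r_distr del: lsum.simps)
  also have "i [^] r \<otimes> (i \<otimes> x [^] Suc r) = y [^] Suc r"
    unfolding y_def using ic x by (simp add: nat_pow_distrib m_ac)
  also have "i [^] r \<otimes> lsum R a (\<lambda>i. x [^] i) (Suc r) = lsum R (\<lambda>k. i [^] r \<otimes> a k) (\<lambda>i. x [^] i) (Suc r)"
    using pwc ac xp by (rule_tac lsum_smult) auto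
  also have "\<dots> = lsum R (\<lambda>k. i [^] (r - k) \<otimes> a k) (\<lambda>i. y [^] i) (Suc r)"
  proof (rule lsum_cong)
    fix k assume "k < Suc r"
    then have "i [^] r = i [^] (r - k) \<otimes> i [^] k" using ic by (simp add: nat_pow_mult)
    moreover have "y [^] k = i [^] k \<otimes> x [^] k" unfolding y_def using ic x by (simp add: nat_pow_distrib)
    ultimately show "i [^] r \<otimes> a k \<otimes> x [^] k = i [^] (r - k) \<otimes> a k \<otimes> y [^] k"
      using pwc ac xp by (simp add: m_ac)
  qed
  finally have eq: "i [^] r \<otimes> S = lsum R (\<lambda>k. i [^] (r - k) \<otimes> a k) (\<lambda>i. y [^] i) (Suc r) \<oplus> y [^] Suc r" .
  \<comment> \<open>The coefficients of that equation solved for y^(r+1); the value S enters only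
    the constant one.\<close>
  define c where "c k = (if k < 1 then i [^] r \<otimes> S else \<zero>) \<oplus> \<ominus> \<one> \<otimes> (i [^] (r - k) \<otimes> a k)" for k :: nat
  have cB: "c k \<in> B" for k unfolding c_def using B pw Sc aB by auto
  let ?L = "lsum R (\<lambda>k. i [^] (r - k) \<otimes> a k) (\<lambda>i. y [^] i) (Suc r)"
  have Lc: "?L \<in> carrier R" by (rule lsum_closed) (use pwc ac yc in auto)
  have yp: "\<And>i::nat. y [^] i \<in> carrier R" using yc by simp
  have "lsum R c (\<lambda>i. y [^] i) (Suc r) =
      lsum R (\<lambda>k. if k < 1 then i [^] r \<otimes> S else \<zero>) (\<lambda>i. y [^] i) (Suc r) \<oplus>
      lsum R (\<lambda>k. \<ominus> \<one> \<otimes> (i [^] (r - k) \<otimes> a k)) (\<lambda>i. y [^] i) (Suc r)"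
    unfolding c_def by (rule lsum_add[symmetric]) (use pwc ac Sc yp in auto)
  also have "lsum R (\<lambda>k. if k < 1 then i [^] r \<otimes> S else \<zero>) (\<lambda>i. y [^] i) (Suc r)
      = lsum R (\<lambda>k. i [^] r \<otimes> S) (\<lambda>i. y [^] i) 1"
    by (rule lsum_pad) (use pwc Sc yp in auto)
  also have "\<dots> = i [^] r \<otimes> S" using pwc Sc by simp
  also have "lsum R (\<lambda>k. \<ominus> \<one> \<otimes> (i [^] (r - k) \<otimes> a k)) (\<lambda>i. y [^] i) (Suc r) = \<ominus> \<one> \<otimes> ?L"
    by (rule lsum_smult[symmetric]) (use pwc ac yp in auto)
  also have "i [^] r \<otimes> S \<oplus> \<ominus> \<one> \<otimes> ?L = y [^] Suc r"
    unfolding eq using Lc yp[of "Suc r"]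
    by (simp add: l_minus a_comm[of ?L] a_assoc r_neg del: lsum.simps nat_pow_Suc)
  finally have "lsum R c (\<lambda>i. y [^] i) (Suc r) = y [^] Suc r" .
  from integrally_closed[OF yc this[symmetric] cB] have "y \<in> B" .
  have "y \<notin> I"
  proof
    assume yI: "y \<in> I"
    \<comment> \<open>Since i x^(r+1) = y x^r, the top term can be merged into the preceding one if
      y is in I. The value S stays and the relation becomes shorter.\<close>
    define a' where "a' = a(r := a r \<oplus> y)"
    have "lsum R a' (\<lambda>i. x [^] i) (Suc r) = lsum R a (\<lambda>i. x [^] i) r \<oplus> (a r \<oplus> y) \<otimes> x [^] r"
      unfolding a'_def by (simp, subst lsum_cong[of r _ _ a "\<lambda>i. x [^] i"]) auto
    also have "\<dots> = S" unfolding S_def r y_def i_def using ac xp x by (simp add: r_distr m_ac a_ac)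
    finally have "Q (Suc r)" unfolding Q_def using a yI I s S_def
      by (intro exI[of _ a']) (auto simp: a'_def)
    then show False using least r by simp
  qed
  then show thesis using that[of i] \<open>y \<in> B\<close> ic x unfolding y_def by (simp add: m_comm)
qed

text \<open>An element of R outside I can be multiplied into B without entering I, by
  \<open>manis\<close>; in B the claim is primality of I.\<close>

lemma prime':
  assumes "x \<in> carrier R" "y \<in> carrier R" "x \<notin> I" "y \<notin> I"
  shows "x \<otimes> y \<notin> I"
proof
  assume xy: "x \<otimes> y \<in> I"
  have ex: "\<exists>x'\<in>B. x \<otimes> x' \<in> B \<and> x \<otimes> x' \<notin> I" if "x \<in> carrier R" "x \<notin> I" for x
  proof (cases "x \<in> B")
    case True
    then show ?thesis using that B(3) by force
  next
    case False
    then show ?thesis using manis[OF that(1) False] IB by blast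
  qed
  obtain x' y' where *: "x' \<in> B" "x \<otimes> x' \<in> B" "x \<otimes> x' \<notin> I" "y' \<in> B" "y \<otimes> y' \<in> B" "y \<otimes> y' \<notin> I"
    using ex[OF assms(1,3)] ex[OF assms(2,4)] by blast
  have "(x \<otimes> x') \<otimes> (y \<otimes> y') = (x \<otimes> y) \<otimes> (x' \<otimes> y')" using * assms Bc by (simp add: m_ac)
  also have "\<dots> \<in> I" using I_r[OF xy] * B by auto
  finally show False using prime * by blast
qed

text \<open>|a| <= |b| means that the set of z with b z in I is contained in the set of z with a z
  in I. This gives the Manis valuation as a relation, without constructing a value group.\<close>

definition manis_val :: "'a rel" where
  "manis_val = {(a, b). a \<in> carrier R \<and> b \<in> carrier R \<and> (\<forall>z\<in>carrier R. b \<otimes> z \<in> I \<longrightarrow> a \<otimes> z \<in> I)}"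

lemma manis_valuation: "is_valuation R manis_val"
  unfolding is_valuation_def
proof (intro conjI ballI impI; (elim conjE)?)
  show "manis_val \<subseteq> carrier R \<times> carrier R" by (auto simp: manis_val_def)
  show "trans manis_val" by (auto simp: trans_def manis_val_def)
  have "\<zero> \<otimes> \<one> \<in> I" "\<one> \<otimes> \<one> \<notin> I" using I one by auto
  then show "(\<one>, \<zero>) \<notin> manis_val" unfolding manis_val_def by blast
next
  fix a b assume c: "a \<in> carrier R" "b \<in> carrier R"
  show "(a, b) \<in> manis_val \<or> (b, a) \<in> manis_val"
  proof (rule ccontr)
    assume "\<not> ?thesis"
    then obtain z z' where z: "z \<in> carrier R" "b \<otimes> z \<in> I" "a \<otimes> z \<notin> I" "z' \<in> carrier R" "a \<otimes> z' \<in> I" "b \<otimes> z' \<notin> I"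
      unfolding manis_val_def using c by auto
    have "(a \<otimes> z) \<otimes> (b \<otimes> z') = (a \<otimes> z') \<otimes> (b \<otimes> z)" using z c by (simp add: m_ac)
    also have "\<dots> \<in> I" using I_r z IB by auto
    finally show False using prime' z c by (meson m_closed)
  qed
next
  fix a b c assume "a \<in> carrier R" "b \<in> carrier R" "c \<in> carrier R" "(a, c) \<in> manis_val" "(b, c) \<in> manis_val"
  then show "(a \<oplus> b, c) \<in> manis_val" using I(4) by (auto simp: manis_val_def l_distr)
next
  fix a b c assume "a \<in> carrier R" "b \<in> carrier R" "c \<in> carrier R" "(a, b) \<in> manis_val"
  then show "(a \<otimes> c, b \<otimes> c) \<in> manis_val" by (auto simp: manis_val_def m_assoc)
next
  fix a b c assume c: "a \<in> carrier R" "b \<in> carrier R" "c \<in> carrier R" and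
    m: "(a \<otimes> c, b \<otimes> c) \<in> manis_val" and n: "(c, \<zero>) \<notin> manis_val"
  obtain z0 where z0: "z0 \<in> carrier R" "c \<otimes> z0 \<notin> I" using n c I unfolding manis_val_def by auto
  \<comment> \<open>A multiple of c in B - I can be cancelled: being in B it carries I into I, and
    by \<open>prime'\<close> it carries no other element into I.\<close>
  have "\<exists>z1\<in>carrier R. c \<otimes> z1 \<in> B \<and> c \<otimes> z1 \<notin> I"
  proof (cases "c \<otimes> z0 \<in> B")
    case True
    then show ?thesis using z0 by auto
  next
    case False
    then obtain y where "y \<in> I" "c \<otimes> z0 \<otimes> y \<in> B" "c \<otimes> z0 \<otimes> y \<notin> I"
      using manis[OF _ False] c z0 by auto
    then show ?thesis using c z0 I by (intro bexI[of _ "z0 \<otimes> y"]) (auto simp: m_assoc)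
  qed
  then obtain z1 where z1: "z1 \<in> carrier R" "c \<otimes> z1 \<in> B" "c \<otimes> z1 \<notin> I" by auto
  have "a \<otimes> z \<in> I" if z: "z \<in> carrier R" "b \<otimes> z \<in> I" for z
  proof (rule ccontr)
    assume n: "a \<otimes> z \<notin> I"
    have "b \<otimes> c \<otimes> (z1 \<otimes> z) = b \<otimes> z \<otimes> (c \<otimes> z1)" using c z1 z by (simp add: m_ac)
    also have "\<dots> \<in> I" using I_r z z1 by auto
    finally have "a \<otimes> c \<otimes> (z1 \<otimes> z) \<in> I" using m z1 z unfolding manis_val_def by auto
    also have "a \<otimes> c \<otimes> (z1 \<otimes> z) = a \<otimes> z \<otimes> (c \<otimes> z1)" using c z1 z by (simp add: m_ac)
    finally show False using prime' n z1 c z by (meson m_closed)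
  qed
  then show "(a, b) \<in> manis_val" using c by (auto simp: manis_val_def)
qed

lemma manis_le_one: "f \<in> B \<Longrightarrow> (f, \<one>) \<in> manis_val"
  unfolding manis_val_def using I(5) Bc by auto

lemma manis_less_one:
  assumes "z \<in> I" "h \<in> carrier R" "h \<otimes> z = \<one>"
  shows "(h, \<one>) \<notin> manis_val"
proof
  assume "(h, \<one>) \<in> manis_val"
  moreover have "\<one> \<otimes> z \<in> I" "h \<otimes> z \<notin> I" using assms one I by auto
  ultimately show False using assms(1) I(2) unfolding manis_val_def by blast
qed

end

text \<open>The statement about h is |z| < 1 in the form in which it gets applied: z will be the
  inverse of an element that is to become large.\<close>

lemma (in cring) valuation_exists:
  assumes "subring B0 R" "z \<in> B0" "\<And>b. b \<in> B0 \<Longrightarrow> z \<otimes> b \<noteq> \<one>"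
  obtains v where "is_valuation R v" "\<And>f. f \<in> B0 \<Longrightarrow> (f, \<one>) \<in> v"
    "\<And>h. h \<in> carrier R \<Longrightarrow> h \<otimes> z = \<one> \<Longrightarrow> (h, \<one>) \<notin> v"
proof -
  obtain B I where *: "subring B R" "B0 \<subseteq> B" "submod R B I" "I \<subseteq> B" "z \<in> I" "\<one> \<notin> I"
    "\<And>B' I'. subring B' R \<Longrightarrow> submod R B' I' \<Longrightarrow> I' \<subseteq> B' \<Longrightarrow> \<one> \<notin> I' \<Longrightarrow> B \<subseteq> B' \<Longrightarrow> I \<subseteq> I' \<Longrightarrow> B' = B \<and> I' = I"
    using maximal_pair_exists[OF assms] by blast
  interpret maximal_pair R B I
    by (rule maximal_pair.intro[OF cring_axioms maximal_pair_axioms.intro[OF *(1,3,4,6,7)]])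
  show thesis using that[OF manis_valuation] manis_le_one manis_less_one *(2,5) by blast
qed

section \<open>Localization\<close>

locale loc_elt = cring +
  fixes t
  assumes t [simp, intro]: "t \<in> carrier R"
begin

definition feq :: "'a \<Rightarrow> nat \<Rightarrow> 'a \<Rightarrow> nat \<Rightarrow> bool" where
  "feq a k b l \<longleftrightarrow> (\<exists>j::nat. t [^] j \<otimes> (t [^] l \<otimes> a) = t [^] j \<otimes> (t [^] k \<otimes> b))"

lemma feqI: "t [^] (j::nat) \<otimes> (t [^] l \<otimes> a) = t [^] j \<otimes> (t [^] k \<otimes> b) \<Longrightarrow> feq a k b l"
  unfolding feq_def by blast

lemma feqI0: "a \<in> carrier R \<Longrightarrow> b \<in> carrier R \<Longrightarrow> t [^] l \<otimes> a = t [^] k \<otimes> b \<Longrightarrow> feq a k b l"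
  by (rule feqI[of 0]) simp

lemma feqE:
  assumes "feq a k b l"
  obtains j :: nat where "t [^] j \<otimes> (t [^] l \<otimes> a) = t [^] j \<otimes> (t [^] k \<otimes> b)"
  using assms unfolding feq_def by blast

lemma feq_refl: "feq a k a k" by (rule feqI) simp

lemma feq_sym: "feq a k b l \<Longrightarrow> feq b l a k" unfolding feq_def by metis

lemma feq_trans:
  assumes "feq a k b l" "feq b l c q" and c: "a \<in> carrier R" "b \<in> carrier R" "c \<in> carrier R"
  shows "feq a k c q"
proof -
  obtain i j :: nat where j: "t [^] j \<otimes> (t [^] l \<otimes> a) = t [^] j \<otimes> (t [^] k \<otimes> b)"
    and i: "t [^] i \<otimes> (t [^] q \<otimes> b) = t [^] i \<otimes> (t [^] l \<otimes> c)" using assms by (elim feqE)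
  \<comment> \<open>The exponent l clears the denominator of b, through which the two equations are
    composed.\<close>
  have "t [^] (i + j + l) \<otimes> (t [^] q \<otimes> a) = t [^] i \<otimes> t [^] q \<otimes> (t [^] j \<otimes> (t [^] l \<otimes> a))"
    using c by (simp add: nat_pow_mult[symmetric] m_ac)
  also have "\<dots> = t [^] j \<otimes> t [^] k \<otimes> (t [^] i \<otimes> (t [^] q \<otimes> b))" unfolding j using c by (simp add: m_ac)
  also have "\<dots> = t [^] (i + j + l) \<otimes> (t [^] k \<otimes> c)" unfolding i
    using c by (simp add: nat_pow_mult[symmetric] m_ac)
  finally show ?thesis by (rule feqI)
qed

lemma mem_fraction: "(b, l) \<in> fraction R t a k \<longleftrightarrow> b \<in> carrier R \<and> feq a k b l"
  by (simp add: fraction_def feq_def)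

lemma fraction_eq:
  assumes "a \<in> carrier R" "b \<in> carrier R"
  shows "fraction R t a k = fraction R t b l \<longleftrightarrow> feq a k b l"
proof
  assume "fraction R t a k = fraction R t b l"
  moreover have "(b, l) \<in> fraction R t b l" using assms by (simp add: mem_fraction feq_refl)
  ultimately have "(b, l) \<in> fraction R t a k" by simp
  then show "feq a k b l" by (simp add: mem_fraction)
next
  assume f: "feq a k b l"
  show "fraction R t a k = fraction R t b l"
  proof (rule Set.set_eqI)
    fix x :: "'a \<times> nat"
    obtain c q where x: "x = (c, q)" by (cases x)
    show "x \<in> fraction R t a k \<longleftrightarrow> x \<in> fraction R t b l"
      unfolding x mem_fraction using feq_trans[OF feq_sym[OF f]] feq_trans[OF f] assms by blast
  qed
qed

abbreviation "L \<equiv> localization R t"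

lemma loc_carrierE:
  assumes "x \<in> carrier L"
  obtains a k where "a \<in> carrier R" "x = fraction R t a k"
  using assms unfolding localization_def by auto

lemma fraction_closed [simp, intro]: "a \<in> carrier R \<Longrightarrow> fraction R t a k \<in> carrier L"
  unfolding localization_def by auto

lemma loc_one: "\<one>\<^bsub>L\<^esub> = fraction R t \<one> 0" and loc_zero: "\<zero>\<^bsub>L\<^esub> = fraction R t \<zero> 0"
  by (simp_all add: localization_def)

text \<open>The operations of \<open>localization\<close> are unions over all representatives. If F
  depends only on the two fractions, every set in the union is the same one.\<close>

lemma UN_fraction:
  assumes "a \<in> carrier R" "b \<in> carrier R"
    "\<And>a' k' b' l'. a' \<in> carrier R \<Longrightarrow> b' \<in> carrier R \<Longrightarrow> feq a k a' k' \<Longrightarrow> feq b l b' l' \<Longrightarrow> F a' k' b' l' = F a k b l"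
  shows "(\<Union>(a, k)\<in>fraction R t a k. \<Union>(b, l)\<in>fraction R t b l. F a k b l) = F a k b l"
proof (rule Set.set_eqI)
  fix x
  have 1: "(a, k) \<in> fraction R t a k" "(b, l) \<in> fraction R t b l"
    using assms by (auto simp: mem_fraction feq_refl)
  show "x \<in> (\<Union>(a, k)\<in>fraction R t a k. \<Union>(b, l)\<in>fraction R t b l. F a k b l) \<longleftrightarrow> x \<in> F a k b l"
  proof
    assume "x \<in> F a k b l"
    then show "x \<in> (\<Union>(a, k)\<in>fraction R t a k. \<Union>(b, l)\<in>fraction R t b l. F a k b l)"
      using 1 by (auto intro!: bexI[OF _ 1(1)] bexI[OF _ 1(2)])
  next
    assume "x \<in> (\<Union>(a, k)\<in>fraction R t a k. \<Union>(b, l)\<in>fraction R t b l. F a k b l)"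
    then obtain a' k' b' l' where "(a', k') \<in> fraction R t a k" "(b', l') \<in> fraction R t b l" "x \<in> F a' k' b' l'"
      by auto
    then show "x \<in> F a k b l" using assms(3)[of a' b' k' l'] by (simp add: mem_fraction)
  qed
qed

lemma loc_mult:
  assumes a: "a \<in> carrier R" and b: "b \<in> carrier R"
  shows "fraction R t a k \<otimes>\<^bsub>L\<^esub> fraction R t b l = fraction R t (a \<otimes> b) (k + l)"
proof -
  have "fraction R t (a' \<otimes> b') (k' + l') = fraction R t (a \<otimes> b) (k + l)"
    if c: "a' \<in> carrier R" "b' \<in> carrier R" and f: "feq a k a' k'" "feq b l b' l'" for a' k' b' l'
  proof -
    obtain i j :: nat where j: "t [^] j \<otimes> (t [^] k' \<otimes> a) = t [^] j \<otimes> (t [^] k \<otimes> a')"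
      and i: "t [^] i \<otimes> (t [^] l' \<otimes> b) = t [^] i \<otimes> (t [^] l \<otimes> b')" using f by (elim feqE)
    have "t [^] (j + i) \<otimes> (t [^] (k' + l') \<otimes> (a \<otimes> b)) = (t [^] j \<otimes> (t [^] k' \<otimes> a)) \<otimes> (t [^] i \<otimes> (t [^] l' \<otimes> b))"
      using a b by (simp add: nat_pow_mult[symmetric] m_ac)
    also have "\<dots> = t [^] (j + i) \<otimes> (t [^] (k + l) \<otimes> (a' \<otimes> b'))" unfolding i j
      using c by (simp add: nat_pow_mult[symmetric] m_ac)
    finally have "feq (a \<otimes> b) (k + l) (a' \<otimes> b') (k' + l')" by (rule feqI)
    then show ?thesis using fraction_eq a b c feq_sym by simp
  qed
  then show ?thesis using UN_fraction[OF a b, of k l "\<lambda>a k b l. fraction R t (a \<otimes> b) (k + l)"]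
    by (simp add: localization_def)
qed

lemma loc_add:
  assumes a: "a \<in> carrier R" and b: "b \<in> carrier R"
  shows "fraction R t a k \<oplus>\<^bsub>L\<^esub> fraction R t b l = fraction R t (t [^] l \<otimes> a \<oplus> t [^] k \<otimes> b) (k + l)"
proof -
  have "fraction R t (t [^] l' \<otimes> a' \<oplus> t [^] k' \<otimes> b') (k' + l') = fraction R t (t [^] l \<otimes> a \<oplus> t [^] k \<otimes> b) (k + l)"
    if c: "a' \<in> carrier R" "b' \<in> carrier R" and f: "feq a k a' k'" "feq b l b' l'" for a' k' b' l'
  proof -
    obtain i j :: nat where j: "t [^] j \<otimes> (t [^] k' \<otimes> a) = t [^] j \<otimes> (t [^] k \<otimes> a')"
      and i: "t [^] i \<otimes> (t [^] l' \<otimes> b) = t [^] i \<otimes> (t [^] l \<otimes> b')" using f by (elim feqE)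
    have "t [^] (j + i) \<otimes> (t [^] (k' + l') \<otimes> (t [^] l \<otimes> a \<oplus> t [^] k \<otimes> b))
        = t [^] i \<otimes> t [^] l' \<otimes> t [^] l \<otimes> (t [^] j \<otimes> (t [^] k' \<otimes> a)) \<oplus> t [^] j \<otimes> t [^] k' \<otimes> t [^] k \<otimes> (t [^] i \<otimes> (t [^] l' \<otimes> b))"
      using a b by (simp add: nat_pow_mult[symmetric] m_ac r_distr)
    also have "\<dots> = t [^] (j + i) \<otimes> (t [^] (k + l) \<otimes> (t [^] l' \<otimes> a' \<oplus> t [^] k' \<otimes> b'))" unfolding i j
      using c by (simp add: nat_pow_mult[symmetric] m_ac r_distr)
    finally have "feq (t [^] l \<otimes> a \<oplus> t [^] k \<otimes> b) (k + l) (t [^] l' \<otimes> a' \<oplus> t [^] k' \<otimes> b') (k' + l')" by (rule feqI)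
    then show ?thesis using fraction_eq a b c feq_sym by simp
  qed
  then show ?thesis
    using UN_fraction[OF a b, of k l "\<lambda>a k b l. fraction R t (t [^] l \<otimes> a \<oplus> t [^] k \<otimes> b) (k + l)"]
    by (simp add: localization_def)
qed

lemma loc_cring: "cring L"
proof (rule cringI)
  show "abelian_group L"
  proof (rule abelian_groupI)
    show "x \<oplus>\<^bsub>L\<^esub> y \<in> carrier L" if "x \<in> carrier L" "y \<in> carrier L" for x y
      using that by (auto elim!: loc_carrierE simp: loc_add)
    show "\<zero>\<^bsub>L\<^esub> \<in> carrier L" by (simp add: loc_zero)
    show "x \<oplus>\<^bsub>L\<^esub> y \<oplus>\<^bsub>L\<^esub> z = x \<oplus>\<^bsub>L\<^esub> (y \<oplus>\<^bsub>L\<^esub> z)"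
      if "x \<in> carrier L" "y \<in> carrier L" "z \<in> carrier L" for x y z
    proof -
      obtain a k b l c q where *: "a \<in> carrier R" "x = fraction R t a k" "b \<in> carrier R" "y = fraction R t b l"
        "c \<in> carrier R" "z = fraction R t c q" using \<open>x \<in> _\<close> \<open>y \<in> _\<close> \<open>z \<in> _\<close> by (elim loc_carrierE)
      show ?thesis unfolding * using *(1,3,5)
        by (simp add: loc_add nat_pow_mult[symmetric] r_distr m_ac a_ac add.assoc)
    qed
    show "x \<oplus>\<^bsub>L\<^esub> y = y \<oplus>\<^bsub>L\<^esub> x" if "x \<in> carrier L" "y \<in> carrier L" for x y
    proof -
      obtain a k b l where *: "a \<in> carrier R" "x = fraction R t a k" "b \<in> carrier R" "y = fraction R t b l"
        using \<open>x \<in> _\<close> \<open>y \<in> _\<close> by (elim loc_carrierE)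
      show ?thesis unfolding * using *(1,3) by (simp add: loc_add add.commute a_comm)
    qed
    show "\<zero>\<^bsub>L\<^esub> \<oplus>\<^bsub>L\<^esub> x = x" if "x \<in> carrier L" for x
      using that by (auto elim!: loc_carrierE simp: loc_add loc_zero)
    show "\<exists>y\<in>carrier L. y \<oplus>\<^bsub>L\<^esub> x = \<zero>\<^bsub>L\<^esub>" if "x \<in> carrier L" for x
    proof -
      obtain a k where *: "a \<in> carrier R" "x = fraction R t a k" using \<open>x \<in> _\<close> by (elim loc_carrierE)
      have "fraction R t (\<ominus> a) k \<oplus>\<^bsub>L\<^esub> x = fraction R t \<zero> (k + k)"
        unfolding * using *(1) by (simp add: loc_add r_minus l_neg)
      also have "\<dots> = \<zero>\<^bsub>L\<^esub>" unfolding loc_zero by (subst fraction_eq) (auto intro: feqI0)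
      finally show ?thesis using *(1) by (intro bexI[of _ "fraction R t (\<ominus> a) k"]) auto
    qed
  qed
  show "Group.comm_monoid L"
  proof (rule comm_monoidI)
    show "x \<otimes>\<^bsub>L\<^esub> y \<in> carrier L" if "x \<in> carrier L" "y \<in> carrier L" for x y
      using that by (auto elim!: loc_carrierE simp: loc_mult)
    show "\<one>\<^bsub>L\<^esub> \<in> carrier L" by (simp add: loc_one)
    show "x \<otimes>\<^bsub>L\<^esub> y \<otimes>\<^bsub>L\<^esub> z = x \<otimes>\<^bsub>L\<^esub> (y \<otimes>\<^bsub>L\<^esub> z)"
      if "x \<in> carrier L" "y \<in> carrier L" "z \<in> carrier L" for x y z
      using that by (auto elim!: loc_carrierE simp: loc_mult m_assoc add.assoc)
    show "x \<otimes>\<^bsub>L\<^esub> y = y \<otimes>\<^bsub>L\<^esub> x" if "x \<in> carrier L" "y \<in> carrier L" for x y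
      using that by (auto elim!: loc_carrierE simp: loc_mult m_comm add.commute)
    show "\<one>\<^bsub>L\<^esub> \<otimes>\<^bsub>L\<^esub> x = x" if "x \<in> carrier L" for x
      using that by (auto elim!: loc_carrierE simp: loc_mult loc_one)
  qed
  show "(x \<oplus>\<^bsub>L\<^esub> y) \<otimes>\<^bsub>L\<^esub> z = x \<otimes>\<^bsub>L\<^esub> z \<oplus>\<^bsub>L\<^esub> y \<otimes>\<^bsub>L\<^esub> z"
    if "x \<in> carrier L" "y \<in> carrier L" "z \<in> carrier L" for x y z
  proof -
    obtain a k b l c q where *: "a \<in> carrier R" "x = fraction R t a k" "b \<in> carrier R" "y = fraction R t b l"
      "c \<in> carrier R" "z = fraction R t c q" using \<open>x \<in> _\<close> \<open>y \<in> _\<close> \<open>z \<in> _\<close> by (elim loc_carrierE)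
    show ?thesis unfolding * using *(1,3,5)
      by (simp add: loc_mult loc_add fraction_eq)
         (rule feqI0, simp_all add: nat_pow_mult[symmetric] r_distr l_distr m_ac a_ac)
  qed
qed

lemma to_loc_hom: "to_loc R t \<in> ring_hom R L"
  by (rule ring_hom_memI) (auto simp: to_loc_def loc_mult loc_add loc_one)

lemma to_loc_eq:
  assumes "a \<in> carrier R" "b \<in> carrier R"
  shows "to_loc R t a = to_loc R t b \<longleftrightarrow> (\<exists>j::nat. t [^] j \<otimes> a = t [^] j \<otimes> b)"
  using assms by (simp add: to_loc_def fraction_eq feq_def)

lemma to_loc_pow:
  assumes "a \<in> carrier R"
  shows "to_loc R t a [^]\<^bsub>L\<^esub> (n::nat) = to_loc R t (a [^] n)"
proof -
  interpret L: cring L by (rule loc_cring)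
  show ?thesis
    by (induction n) (use assms ring_hom_mult[OF to_loc_hom] ring_hom_one[OF to_loc_hom] in auto)
qed

lemma fraction_cancel:
  assumes "a \<in> carrier R"
  shows "fraction R t a k \<otimes>\<^bsub>L\<^esub> to_loc R t t [^]\<^bsub>L\<^esub> k = to_loc R t a"
  using assms unfolding to_loc_pow[OF t]
  by (simp add: to_loc_def loc_mult fraction_eq) (rule feqI0, simp_all add: m_comm)

lemma inverse_t:
  "fraction R t \<one> 1 \<otimes>\<^bsub>L\<^esub> to_loc R t t = \<one>\<^bsub>L\<^esub>"
proof -
  interpret L: cring L by (rule loc_cring)
  have "to_loc R t t \<in> carrier L" by (simp add: to_loc_def)
  then have "to_loc R t t [^]\<^bsub>L\<^esub> (1::nat) = to_loc R t t" by (rule L.nat_pow_eone)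
  then show ?thesis using fraction_cancel[of \<one> 1] by (simp add: to_loc_def loc_one del: One_nat_def)
qed

lemma to_loc_closed [simp, intro]: "a \<in> carrier R \<Longrightarrow> to_loc R t a \<in> carrier L"
  by (simp add: to_loc_def)

end

lemma (in cring) loc_eltI: "t \<in> carrier R \<Longrightarrow> loc_elt R t"
  by unfold_locales auto

lemma (in cring) nat_elem_closed [simp, intro]: "nat_elem R n \<in> carrier R"
  unfolding nat_elem_def by simp

lemma (in cring) nat_elem_hom:
  assumes "cring S" "h \<in> ring_hom R S"
  shows "h (nat_elem R n) = nat_elem S n"
proof -
  interpret S: cring S by fact
  have "h ([n] \<cdot> \<one>) = [n] \<cdot>\<^bsub>S\<^esub> \<one>\<^bsub>S\<^esub>"
  proof (induction n)
    case 0
    then show ?case using ring_hom_zero[OF assms(2) ring_axioms S.ring_axioms] by simp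
  next
    case (Suc n)
    then show ?case using ring_hom_add[OF assms(2)] ring_hom_one[OF assms(2)] by simp
  qed
  then show ?thesis by (simp add: nat_elem_def)
qed

section \<open>Quotients\<close>

lemma (in ideal) coset_eq:
  "a \<in> carrier R \<Longrightarrow> b \<in> carrier R \<Longrightarrow> I +> a = I +> b \<longleftrightarrow> a \<ominus> b \<in> I"
  using quotient_eq_iff_same_a_r_cos[OF ideal_axioms] by simp

lemma (in ring) coset_closed:
  "I \<subseteq> carrier R \<Longrightarrow> x \<in> carrier R \<Longrightarrow> I +> x \<in> carrier (R Quot I)"
  using a_rcosetsI by (simp add: FactRing_def)

lemma (in ring) quot_elemE:
  assumes "C \<in> carrier (R Quot I)"
  obtains x where "x \<in> carrier R" "C = I +> x"
  using assms unfolding FactRing_def A_RCOSETS_def' by auto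

lemma induced_coset:
  assumes R: "cring R" and S: "cring S" and h: "h \<in> ring_hom R S" and I: "ideal I R" and J: "ideal J S"
    and IJ: "\<And>x. x \<in> I \<Longrightarrow> h x \<in> J" and x: "x \<in> carrier R"
  shows "induced S J h (I +>\<^bsub>R\<^esub> x) = J +>\<^bsub>S\<^esub> h x"
proof -
  interpret R: cring R by fact
  interpret S: cring S by fact
  interpret I: ideal I R by fact
  interpret J: ideal J S by fact
  have sub: "abelian_subgroup I R" by (rule abelian_subgroupI3) unfold_locales
  have "J +>\<^bsub>S\<^esub> h y = J +>\<^bsub>S\<^esub> h x" if y: "y \<in> I +>\<^bsub>R\<^esub> x" for y
  proof -
    obtain i where i: "i \<in> I" "y = i \<oplus>\<^bsub>R\<^esub> x" using y unfolding a_r_coset_def' by auto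
    have c: "i \<in> carrier R" using i I.Icarr by auto
    have "h y \<ominus>\<^bsub>S\<^esub> h x = h i"
      using ring_hom_add[OF h c x] ring_hom_closed[OF h c] ring_hom_closed[OF h x] i
      by (simp add: a_minus_def S.a_assoc S.r_neg)
    moreover have "h y \<in> carrier S" "h x \<in> carrier S" using i c x ring_hom_closed[OF h] by auto
    ultimately show ?thesis using J.coset_eq IJ i by simp
  qed
  moreover have "x \<in> I +>\<^bsub>R\<^esub> x" using abelian_subgroup.a_rcos_self[OF sub x] .
  ultimately show ?thesis unfolding induced_def by blast
qed

lemma induced_hom:
  assumes R: "cring R" and S: "cring S" and h: "h \<in> ring_hom R S" and I: "ideal I R" and J: "ideal J S"
    and IJ: "\<And>x. x \<in> I \<Longrightarrow> h x \<in> J"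
  shows "induced S J h \<in> ring_hom (R Quot I) (S Quot J)"
proof -
  interpret R: cring R by fact
  interpret S: cring S by fact
  interpret I: ideal I R by fact
  interpret J: ideal J S by fact
  have ind: "induced S J h (I +>\<^bsub>R\<^esub> x) = J +>\<^bsub>S\<^esub> h x" if "x \<in> carrier R" for x
    using induced_coset[OF R S h I J _ that] IJ by simp
  note hc = ring_hom_closed[OF h]
  show ?thesis
  proof (rule ring_hom_memI)
    fix C assume C: "C \<in> carrier (R Quot I)"
    then obtain x where x: "x \<in> carrier R" "C = I +>\<^bsub>R\<^esub> x" by (rule R.quot_elemE)
    show "induced S J h C \<in> carrier (S Quot J)"
      unfolding x ind[OF x(1)] by (rule S.coset_closed) (use hc x J.a_subset in auto)
    fix C' assume "C' \<in> carrier (R Quot I)"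
    then obtain y where y: "y \<in> carrier R" "C' = I +>\<^bsub>R\<^esub> y" by (rule R.quot_elemE)
    show "induced S J h (C \<otimes>\<^bsub>R Quot I\<^esub> C') = induced S J h C \<otimes>\<^bsub>S Quot J\<^esub> induced S J h C'"
      unfolding x y ring_hom_mult[OF I.rcos_ring_hom x(1) y(1), symmetric]
      using x y hc by (simp add: ind ring_hom_mult[OF h] ring_hom_mult[OF J.rcos_ring_hom])
    show "induced S J h (C \<oplus>\<^bsub>R Quot I\<^esub> C') = induced S J h C \<oplus>\<^bsub>S Quot J\<^esub> induced S J h C'"
      unfolding x y ring_hom_add[OF I.rcos_ring_hom x(1) y(1), symmetric]
      using x y hc by (simp add: ind ring_hom_add[OF h] ring_hom_add[OF J.rcos_ring_hom])
  next
    show "induced S J h \<one>\<^bsub>R Quot I\<^esub> = \<one>\<^bsub>S Quot J\<^esub>"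
      unfolding ring_hom_one[OF I.rcos_ring_hom, symmetric]
      by (simp add: ind ring_hom_one[OF h] ring_hom_one[OF J.rcos_ring_hom])
  qed
qed

section \<open>Completion\<close>

locale subring_elt = cring +
  fixes D t
  assumes D: "subring D R" and tD: "t \<in> D"
begin

lemmas DE = subringE[OF D]

lemma Dc: "x \<in> D \<Longrightarrow> x \<in> carrier R" using DE(1) by auto

lemma t: "t \<in> carrier R" using tD Dc by auto

lemma tp [simp]: "t [^] (n::nat) \<in> carrier R" using t by simp

lemma tpD: "t [^] (n::nat) \<in> D" by (induction n) (use DE tD in auto)

lemma t_up:
  assumes "t [^] K \<otimes> y \<in> D" "K \<le> L" "y \<in> carrier R"
  shows "t [^] (L::nat) \<otimes> y \<in> D"
proof -
  have "t [^] L = t [^] (L - K) \<otimes> t [^] K" using assms t by (simp add: nat_pow_mult)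
  then have "t [^] L \<otimes> y = t [^] (L - K) \<otimes> (t [^] K \<otimes> y)" using assms by (simp add: m_assoc)
  then show ?thesis using DE(6)[OF tpD assms(1)] by simp
qed

lemma bounded_submod: "submod R D {y \<in> carrier R. t [^] (K::nat) \<otimes> y \<in> D}"
  unfolding submod_def using DE Dc by (auto simp: r_distr m_lcomm)

end

locale adic = subring_elt +
  assumes absorb: "x \<in> carrier R \<Longrightarrow> \<exists>N::nat. t [^] N \<otimes> x \<in> D"
begin

abbreviation nb where "nb \<equiv> adic_nbhd R D t"

lemma nbE: assumes "x \<in> nb N" obtains d where "d \<in> D" "x = t [^] N \<otimes> d"
  using assms unfolding adic_nbhd_def by auto

lemma nbI: "d \<in> D \<Longrightarrow> t [^] N \<otimes> d \<in> nb N"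
  unfolding adic_nbhd_def by auto

lemma nb_carrier: "x \<in> nb N \<Longrightarrow> x \<in> carrier R"
  using Dc by (auto elim!: nbE)

lemma nb_0: "nb 0 = D" unfolding adic_nbhd_def using Dc by force

lemma nb_D: "x \<in> nb N \<Longrightarrow> x \<in> D" using DE tpD by (auto elim!: nbE)

lemma nb_add: "x \<in> nb N \<Longrightarrow> y \<in> nb N \<Longrightarrow> x \<oplus> y \<in> nb N"
proof (elim nbE)
  fix d e assume "d \<in> D" "e \<in> D" "x = t [^] N \<otimes> d" "y = t [^] N \<otimes> e"
  then show ?thesis using nbI[of "d \<oplus> e" N] DE(7) Dc by (simp add: r_distr)
qed

lemma nb_uminus: "x \<in> nb N \<Longrightarrow> \<ominus> x \<in> nb N"
proof (elim nbE)
  fix d assume "d \<in> D" "x = t [^] N \<otimes> d"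
  then show ?thesis using nbI[of "\<ominus> d" N] DE(5) Dc by (simp add: r_minus)
qed

lemma nb_minus: "x \<in> nb N \<Longrightarrow> y \<in> nb N \<Longrightarrow> x \<ominus> y \<in> nb N"
  unfolding a_minus_def using nb_add nb_uminus by blast

lemma nb_zero: "\<zero> \<in> nb N" using nbI[OF DE(2), of N] by simp

lemma nb_mult:
  assumes "t [^] (K::nat) \<otimes> y \<in> D" "x \<in> nb (N + K)" "y \<in> carrier R"
  shows "y \<otimes> x \<in> nb N"
proof -
  obtain d where d: "d \<in> D" "x = t [^] (N + K) \<otimes> d" using assms by (auto elim: nbE)
  have "y \<otimes> x = t [^] N \<otimes> (t [^] K \<otimes> y \<otimes> d)"
    unfolding d using assms d Dc by (simp add: nat_pow_mult[symmetric] t m_ac)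
  then show ?thesis using nbI[OF DE(6)[OF assms(1) d(1)]] by simp
qed

abbreviation "Cc \<equiv> cauchy_ring R D t"
abbreviation "Nn \<equiv> null_seqs R D t"
abbreviation "Rh \<equiv> completion R D t"
abbreviation "Dh \<equiv> completion_subring R D t"
abbreviation "th \<equiv> to_completion R D t t"

lemma cauchyD:
  assumes "x \<in> carrier Cc"
  shows "x n \<in> carrier R" "\<exists>n0. \<forall>m\<ge>n0. \<forall>n\<ge>n0. x m \<ominus> x n \<in> nb N"
  using assms by (auto simp: cauchy_ring_def)

lemma cauchyI:
  assumes "\<And>n. x n \<in> carrier R" "\<And>N. \<exists>n0. \<forall>m\<ge>n0. \<forall>n\<ge>n0. x m \<ominus> x n \<in> nb N"
  shows "x \<in> carrier Cc"
  using assms by (auto simp: cauchy_ring_def)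

text \<open>From some index on, the terms differ from a fixed one by elements of D; the finitely
  many others are absorbed one after the other, with the maximum of the exponents.\<close>

lemma cauchy_bounded:
  assumes "x \<in> carrier Cc"
  obtains K :: nat where "\<And>n. t [^] K \<otimes> x n \<in> D"
proof -
  obtain n0 where n0: "\<And>m. m \<ge> n0 \<Longrightarrow> x m \<ominus> x n0 \<in> D" using cauchyD(2)[OF assms, of 0] nb_0 by blast
  have "\<exists>K::nat. \<forall>m\<le>l. t [^] K \<otimes> x m \<in> D" for l
  proof (induction l)
    case 0
    then show ?case using absorb[OF cauchyD(1)[OF assms]] by auto
  next
    case (Suc l)
    then obtain K :: nat where K: "\<And>m. m \<le> l \<Longrightarrow> t [^] K \<otimes> x m \<in> D" by auto
    obtain K' :: nat where K': "t [^] K' \<otimes> x (Suc l) \<in> D" using absorb[OF cauchyD(1)[OF assms]] by auto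
    have "t [^] (max K K') \<otimes> x m \<in> D" if "m \<le> Suc l" for m
      using that t_up[OF K, of m "max K K'"] t_up[OF K', of "max K K'"] cauchyD(1)[OF assms] by (cases "m = Suc l") auto
    then show ?case by blast
  qed
  then obtain K :: nat where K: "\<And>m. m \<le> n0 \<Longrightarrow> t [^] K \<otimes> x m \<in> D" by blast
  have "t [^] K \<otimes> x n \<in> D" for n
  proof (cases "n \<le> n0")
    case False
    have c: "x n \<in> carrier R" "x n0 \<in> carrier R" using cauchyD[OF assms] by auto
    have "x n = (x n \<ominus> x n0) \<oplus> x n0" using c by (simp add: a_minus_def a_assoc l_neg)
    then have "t [^] K \<otimes> x n = t [^] K \<otimes> (x n \<ominus> x n0) \<oplus> t [^] K \<otimes> x n0"
      using c by (metis minus_closed r_distr tp)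
    then show ?thesis using False DE(6)[OF tpD n0] DE(7) K by simp
  qed (use K in auto)
  then show thesis by (rule that)
qed

lemma Cc_ops: "\<one>\<^bsub>Cc\<^esub> = (\<lambda>_. \<one>)" "\<zero>\<^bsub>Cc\<^esub> = (\<lambda>_. \<zero>)" "x \<otimes>\<^bsub>Cc\<^esub> y = (\<lambda>n. x n \<otimes> y n)" "x \<oplus>\<^bsub>Cc\<^esub> y = (\<lambda>n. x n \<oplus> y n)"
  by (simp_all add: cauchy_ring_def)

lemma const_cauchy [simp, intro]: "a \<in> carrier R \<Longrightarrow> (\<lambda>_. a) \<in> carrier Cc"
  by (rule cauchyI) (auto simp: a_minus_def r_neg nb_zero)

lemma cauchy_add: "x \<in> carrier Cc \<Longrightarrow> y \<in> carrier Cc \<Longrightarrow> (\<lambda>n. x n \<oplus> y n) \<in> carrier Cc"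
proof (rule cauchyI)
  assume x: "x \<in> carrier Cc" and y: "y \<in> carrier Cc"
  note c = cauchyD(1)[OF x] cauchyD(1)[OF y]
  show "x n \<oplus> y n \<in> carrier R" for n using c by simp
  fix N
  obtain n1 where n1: "\<And>m n. m \<ge> n1 \<Longrightarrow> n \<ge> n1 \<Longrightarrow> x m \<ominus> x n \<in> nb N" using cauchyD(2)[OF x, of N] by blast
  obtain n2 where n2: "\<And>m n. m \<ge> n2 \<Longrightarrow> n \<ge> n2 \<Longrightarrow> y m \<ominus> y n \<in> nb N" using cauchyD(2)[OF y, of N] by blast
  show "\<exists>n0. \<forall>m\<ge>n0. \<forall>n\<ge>n0. (x m \<oplus> y m) \<ominus> (x n \<oplus> y n) \<in> nb N"
  proof (intro exI[of _ "max n1 n2"] allI impI)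
    fix m n assume "max n1 n2 \<le> m" "max n1 n2 \<le> n"
    then have "(x m \<ominus> x n) \<oplus> (y m \<ominus> y n) \<in> nb N" using n1 n2 nb_add by simp
    also have "(x m \<ominus> x n) \<oplus> (y m \<ominus> y n) = (x m \<oplus> y m) \<ominus> (x n \<oplus> y n)"
      using c by (simp add: a_minus_def minus_add a_ac)
    finally show "(x m \<oplus> y m) \<ominus> (x n \<oplus> y n) \<in> nb N" .
  qed
qed

lemma cauchy_mult: "x \<in> carrier Cc \<Longrightarrow> y \<in> carrier Cc \<Longrightarrow> (\<lambda>n. x n \<otimes> y n) \<in> carrier Cc"
proof (rule cauchyI)
  assume x: "x \<in> carrier Cc" and y: "y \<in> carrier Cc"
  note c = cauchyD(1)[OF x] cauchyD(1)[OF y]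
  show "x n \<otimes> y n \<in> carrier R" for n using c by simp
  fix N
  obtain K L :: nat where K: "\<And>n. t [^] K \<otimes> x n \<in> D" and L: "\<And>n. t [^] L \<otimes> y n \<in> D"
    using cauchy_bounded x y by metis
  \<comment> \<open>Multiplication by terms of y loses at most L powers of t, so x must be Cauchy to
    precision N + L, and symmetrically for y.\<close>
  obtain n1 where n1: "\<And>m n. m \<ge> n1 \<Longrightarrow> n \<ge> n1 \<Longrightarrow> x m \<ominus> x n \<in> nb (N + L)" using cauchyD(2)[OF x, of "N + L"] by blast
  obtain n2 where n2: "\<And>m n. m \<ge> n2 \<Longrightarrow> n \<ge> n2 \<Longrightarrow> y m \<ominus> y n \<in> nb (N + K)" using cauchyD(2)[OF y, of "N + K"] by blast
  show "\<exists>n0. \<forall>m\<ge>n0. \<forall>n\<ge>n0. (x m \<otimes> y m) \<ominus> (x n \<otimes> y n) \<in> nb N"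
  proof (intro exI[of _ "max n1 n2"] allI impI)
    fix m n assume mn: "max n1 n2 \<le> m" "max n1 n2 \<le> n"
    have "y m \<otimes> (x m \<ominus> x n) \<in> nb N" by (rule nb_mult[OF L]) (use mn n1 c in auto)
    moreover have "x n \<otimes> (y m \<ominus> y n) \<in> nb N" by (rule nb_mult[OF K]) (use mn n2 c in auto)
    ultimately have "y m \<otimes> (x m \<ominus> x n) \<oplus> x n \<otimes> (y m \<ominus> y n) \<in> nb N" by (rule nb_add)
    also have "y m \<otimes> (x m \<ominus> x n) \<oplus> x n \<otimes> (y m \<ominus> y n) = (x m \<otimes> y m) \<ominus> (x n \<otimes> y n)"
      using c(1)[of m] c(1)[of n] c(2)[of m] c(2)[of n] by algebra
    finally show "(x m \<otimes> y m) \<ominus> (x n \<otimes> y n) \<in> nb N" .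
  qed
qed

lemma cauchy_uminus: "x \<in> carrier Cc \<Longrightarrow> (\<lambda>n. \<ominus> x n) \<in> carrier Cc"
  using cauchy_mult[OF const_cauchy, of "\<ominus> \<one>" x] cauchyD(1)[of x] by (simp add: l_minus)

lemma Cc_cring: "cring Cc"
proof (rule cringI)
  show "abelian_group Cc"
  proof (rule abelian_groupI)
    show "\<exists>y\<in>carrier Cc. y \<oplus>\<^bsub>Cc\<^esub> x = \<zero>\<^bsub>Cc\<^esub>" if "x \<in> carrier Cc" for x
      using that cauchyD(1)[OF that] by (intro bexI[of _ "\<lambda>n. \<ominus> x n"] cauchy_uminus) (auto simp: Cc_ops l_neg)
  qed (auto simp: Cc_ops cauchy_add cauchyD(1) a_ac)
  show "Group.comm_monoid Cc"
    by (rule comm_monoidI) (auto simp: Cc_ops cauchy_mult cauchyD(1) m_ac)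
qed (auto simp: Cc_ops cauchyD(1) l_distr)

lemma Cc_uminus:
  assumes "x \<in> carrier Cc"
  shows "\<ominus>\<^bsub>Cc\<^esub> x = (\<lambda>n. \<ominus> x n)"
proof -
  interpret C: cring Cc by (rule Cc_cring)
  have "(\<lambda>n. \<ominus> x n) \<oplus>\<^bsub>Cc\<^esub> x = \<zero>\<^bsub>Cc\<^esub>" using cauchyD(1)[OF assms] by (simp add: Cc_ops l_neg)
  then show ?thesis using C.minus_equality[OF _ assms cauchy_uminus[OF assms]] by simp
qed

lemma Cc_minus: "x \<in> carrier Cc \<Longrightarrow> y \<in> carrier Cc \<Longrightarrow> x \<ominus>\<^bsub>Cc\<^esub> y = (\<lambda>n. x n \<ominus> y n)"
  by (simp add: a_minus_def Cc_uminus Cc_ops)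

lemma null_cauchy:
  assumes "x \<in> Nn"
  shows "x \<in> carrier Cc"
proof (rule cauchyI)
  show "x n \<in> carrier R" for n using assms by (simp add: null_seqs_def)
  fix N
  have "\<exists>n0. \<forall>n\<ge>n0. x n \<in> nb N" using assms by (simp add: null_seqs_def)
  then show "\<exists>n0. \<forall>m\<ge>n0. \<forall>n\<ge>n0. x m \<ominus> x n \<in> nb N" using nb_minus by blast
qed

lemma null_ideal: "ideal Nn Cc"
proof (rule idealI)
  interpret C: cring Cc by (rule Cc_cring)
  show "ring Cc" by (rule C.ring_axioms)
  have mult: "x \<otimes>\<^bsub>Cc\<^esub> a \<in> Nn" if a: "a \<in> Nn" and x: "x \<in> carrier Cc" for a x
  proof -
    obtain K :: nat where K: "\<And>n. t [^] K \<otimes> x n \<in> D" using cauchy_bounded[OF x] by blast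
    have "\<exists>n0. \<forall>n\<ge>n0. x n \<otimes> a n \<in> nb N" for N
    proof -
      obtain n0 where "\<And>n. n \<ge> n0 \<Longrightarrow> a n \<in> nb (N + K)" using a unfolding null_seqs_def by blast
      then show ?thesis using nb_mult[OF K] cauchyD(1)[OF x] by blast
    qed
    then show ?thesis using cauchyD(1)[OF x] cauchyD(1)[OF null_cauchy[OF a]] by (simp add: null_seqs_def Cc_ops)
  qed
  show "x \<otimes>\<^bsub>Cc\<^esub> a \<in> Nn" "a \<otimes>\<^bsub>Cc\<^esub> x \<in> Nn" if "a \<in> Nn" "x \<in> carrier Cc" for a x
    using mult[OF that] C.m_comm[OF that(2) null_cauchy[OF that(1)]] by auto
  show "subgroup Nn (add_monoid Cc)"
  proof (rule group.subgroupI)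
    show "Group.group (add_monoid Cc)" by (rule C.a_group)
    show "Nn \<subseteq> carrier (add_monoid Cc)" using null_cauchy by auto
    have "\<zero>\<^bsub>Cc\<^esub> \<in> Nn" by (simp add: null_seqs_def Cc_ops nb_zero)
    then show "Nn \<noteq> {}" by auto
    show "inv\<^bsub>add_monoid Cc\<^esub> a \<in> Nn" if "a \<in> Nn" for a
    proof -
      have "\<ominus>\<^bsub>Cc\<^esub> a = (\<ominus>\<^bsub>Cc\<^esub> \<one>\<^bsub>Cc\<^esub>) \<otimes>\<^bsub>Cc\<^esub> a" using null_cauchy[OF that] by (simp add: C.l_minus)
      then have "\<ominus>\<^bsub>Cc\<^esub> a \<in> Nn" using mult[OF that, of "\<ominus>\<^bsub>Cc\<^esub> \<one>\<^bsub>Cc\<^esub>"] by simp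
      then show ?thesis unfolding a_inv_def .
    qed
    show "a \<otimes>\<^bsub>add_monoid Cc\<^esub> b \<in> Nn" if ab: "a \<in> Nn" "b \<in> Nn" for a b
    proof -
      have "\<exists>n0. \<forall>n\<ge>n0. a n \<oplus> b n \<in> nb N" for N
      proof -
        obtain n1 n2 where "\<And>n. n \<ge> n1 \<Longrightarrow> a n \<in> nb N" "\<And>n. n \<ge> n2 \<Longrightarrow> b n \<in> nb N"
          using ab unfolding null_seqs_def by blast
        then show ?thesis using nb_add by (intro exI[of _ "max n1 n2"]) auto
      qed
      then show ?thesis using cauchyD(1)[OF null_cauchy] ab by (simp add: null_seqs_def Cc_ops)
    qed
  qed
qed

lemma Rh_cring: "cring Rh"
  unfolding completion_def by (rule ideal.quotient_is_cring[OF null_ideal Cc_cring])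

lemma coset_hom: "(\<lambda>x. Nn +>\<^bsub>Cc\<^esub> x) \<in> ring_hom Cc Rh"
  unfolding completion_def by (rule ideal.rcos_ring_hom[OF null_ideal])

lemma const_hom: "(\<lambda>a _. a) \<in> ring_hom R Cc"
  by (rule ring_hom_memI) (auto simp: Cc_ops)

lemma to_completion_hom: "to_completion R D t \<in> ring_hom R Rh"
  using ring_hom_trans[OF const_hom coset_hom] by (simp add: to_completion_def[abs_def] comp_def)

lemma Rh_elemE:
  assumes "y \<in> carrier Rh"
  obtains z where "z \<in> carrier Cc" "y = Nn +>\<^bsub>Cc\<^esub> z"
proof -
  interpret C: cring Cc by (rule Cc_cring)
  show thesis using C.quot_elemE assms that unfolding completion_def by blast
qed

lemma coset_eq':
  assumes "x \<in> carrier Cc" "y \<in> carrier Cc"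
  shows "Nn +>\<^bsub>Cc\<^esub> x = Nn +>\<^bsub>Cc\<^esub> y \<longleftrightarrow> (\<lambda>n. x n \<ominus> y n) \<in> Nn"
  using ideal.coset_eq[OF null_ideal assms] Cc_minus[OF assms] by simp

lemma Dh_iff:
  "y \<in> Dh \<longleftrightarrow> (\<exists>z\<in>carrier Cc. (\<forall>n. z n \<in> D) \<and> y = Nn +>\<^bsub>Cc\<^esub> z)"
  unfolding completion_subring_def by auto

lemma Dh_subring: "subring Dh Rh"
proof -
  interpret C: cring Cc by (rule Cc_cring)
  interpret Q: cring Rh by (rule Rh_cring)
  interpret h: ring_hom_ring Cc Rh "\<lambda>x. Nn +>\<^bsub>Cc\<^esub> x"
    by (rule ring_hom_ringI2[OF C.ring_axioms Q.ring_axioms coset_hom])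
  have "subring {z \<in> carrier Cc. \<forall>n. z n \<in> D} Cc"
    by (rule C.subringI) (use DE in \<open>auto simp: Cc_ops Cc_uminus cauchy_add cauchy_mult cauchy_uminus Dc\<close>)
  from h.img_is_subring[OF this] show ?thesis
    by (rule back_subst[of "\<lambda>x. subring x Rh"]) (unfold completion_subring_def, blast)
qed

text \<open>D is open: an element of R that is a limit of elements of D differs from one of them by
  an element of \<open>nb 0\<close>, which is D. This lets membership in the completed ring of
  definition be tested before completion.\<close>

lemma to_completion_D:
  assumes "x \<in> carrier R"
  shows "to_completion R D t x \<in> Dh \<longleftrightarrow> x \<in> D"
proof
  assume "x \<in> D"
  then show "to_completion R D t x \<in> Dh" unfolding Dh_iff to_completion_def
    using assms by (intro bexI[of _ "\<lambda>_. x"]) auto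
next
  assume "to_completion R D t x \<in> Dh"
  then obtain z where z: "z \<in> carrier Cc" "\<And>n. z n \<in> D" "Nn +>\<^bsub>Cc\<^esub> (\<lambda>_. x) = Nn +>\<^bsub>Cc\<^esub> z"
    unfolding Dh_iff to_completion_def by blast
  then have "(\<lambda>n. x \<ominus> z n) \<in> Nn" using coset_eq' assms by simp
  then obtain n where "x \<ominus> z n \<in> D" unfolding null_seqs_def using nb_0 by blast
  then have "(x \<ominus> z n) \<oplus> z n \<in> D" using DE(7) z by simp
  then show "x \<in> D" using assms Dc[OF z(2)] by (simp add: a_minus_def a_assoc l_neg)
qed

lemma to_completion_pow:
  assumes "x \<in> carrier R"
  shows "to_completion R D t (x [^] (n::nat)) = to_completion R D t x [^]\<^bsub>Rh\<^esub> n"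
proof -
  interpret Q: cring Rh by (rule Rh_cring)
  show ?thesis by (induction n)
     (use assms ring_hom_mult[OF to_completion_hom] ring_hom_one[OF to_completion_hom] in auto)
qed

lemma Rh_adic: "adic Rh Dh th"
proof -
  interpret Q: cring Rh by (rule Rh_cring)
  show ?thesis
  proof (intro adic.intro subring_elt.intro subring_elt_axioms.intro adic_axioms.intro Rh_cring)
    show "subring Dh Rh" by (rule Dh_subring)
    show "th \<in> Dh" using to_completion_D[OF t] tD by simp
    fix y assume "y \<in> carrier Rh"
    then obtain z where z: "z \<in> carrier Cc" "y = Nn +>\<^bsub>Cc\<^esub> z" by (rule Rh_elemE)
    obtain K :: nat where K: "\<And>n. t [^] K \<otimes> z n \<in> D" using cauchy_bounded[OF z(1)] by blast
    have "th [^]\<^bsub>Rh\<^esub> K \<otimes>\<^bsub>Rh\<^esub> y = Nn +>\<^bsub>Cc\<^esub> (\<lambda>n. t [^] K \<otimes> z n)"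
      unfolding z to_completion_pow[OF t, symmetric] unfolding to_completion_def
      using ring_hom_mult[OF coset_hom, of "\<lambda>_. t [^] K" z] z by (simp add: Cc_ops)
    moreover have "(\<lambda>n. t [^] K \<otimes> z n) \<in> carrier Cc" using cauchy_mult[OF const_cauchy z(1), of "t [^] K"] by simp
    ultimately have "th [^]\<^bsub>Rh\<^esub> K \<otimes>\<^bsub>Rh\<^esub> y \<in> Dh" unfolding Dh_iff
      using K by (intro bexI[of _ "\<lambda>n. t [^] K \<otimes> z n"]) auto
    then show "\<exists>N::nat. th [^]\<^bsub>Rh\<^esub> N \<otimes>\<^bsub>Rh\<^esub> y \<in> Dh" by blast
  qed
qed

text \<open>A term far out in a representing sequence serves as x. As t is a unit, the remaining
  differences can be divided by t^m, and the quotients still form a Cauchy sequence.\<close>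

lemma completion_approx:
  assumes u: "s \<in> carrier R" "s \<otimes> t = \<one>" and y: "y \<in> carrier Rh"
  obtains x \<delta> where "x \<in> carrier R" "\<delta> \<in> Dh" "y = to_completion R D t x \<oplus>\<^bsub>Rh\<^esub> th [^]\<^bsub>Rh\<^esub> (m::nat) \<otimes>\<^bsub>Rh\<^esub> \<delta>"
proof -
  have st: "s [^] n \<otimes> t [^] n = \<one>" for n :: nat
    using u t by (simp add: nat_pow_distrib[symmetric])
  obtain z where z: "z \<in> carrier Cc" "y = Nn +>\<^bsub>Cc\<^esub> z" using y by (rule Rh_elemE)
  note zc = cauchyD(1)[OF z(1)]
  obtain n0 where n0: "\<And>i j. i \<ge> n0 \<Longrightarrow> j \<ge> n0 \<Longrightarrow> z i \<ominus> z j \<in> nb m" using cauchyD(2)[OF z(1), of m] by blast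
  \<comment> \<open>The index is clamped at n0 because \<open>Dh\<close> asks all terms of a
    sequence to lie in D, not only those far out.\<close>
  define d where "d i = s [^] m \<otimes> (z (max i n0) \<ominus> z n0)" for i
  have td: "t [^] m \<otimes> d i = z (max i n0) \<ominus> z n0" for i
  proof -
    have "t [^] m \<otimes> d i = (s [^] m \<otimes> t [^] m) \<otimes> (z (max i n0) \<ominus> z n0)"
      unfolding d_def using u zc by (simp add: m_ac)
    then show ?thesis using zc st by simp
  qed
  have cancel: "x = e" if "t [^] m \<otimes> x = t [^] m \<otimes> e" "x \<in> carrier R" "e \<in> carrier R" for x e
  proof -
    have "s [^] m \<otimes> t [^] m \<otimes> x = s [^] m \<otimes> t [^] m \<otimes> e" using that u by (simp add: m_assoc)
    then show ?thesis using st that by simp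
  qed
  have dc: "d i \<in> carrier R" for i unfolding d_def using u zc by simp
  have dD: "d i \<in> D" for i
  proof -
    have "z (max i n0) \<ominus> z n0 \<in> nb m" using n0 by simp
    then obtain e where e: "e \<in> D" "z (max i n0) \<ominus> z n0 = t [^] m \<otimes> e" by (rule nbE)
    then show ?thesis using cancel[of "d i" e] dc Dc td by simp
  qed
  have dC: "d \<in> carrier Cc"
  proof (rule cauchyI[OF dc])
    fix N
    obtain n1 where n1: "\<And>i j. i \<ge> n1 \<Longrightarrow> j \<ge> n1 \<Longrightarrow> z i \<ominus> z j \<in> nb (m + N)" using cauchyD(2)[OF z(1), of "m + N"] by blast
    show "\<exists>n0. \<forall>i\<ge>n0. \<forall>j\<ge>n0. d i \<ominus> d j \<in> nb N"
    proof (intro exI[of _ n1] allI impI)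
      fix i j assume ij: "n1 \<le> i" "n1 \<le> j"
      have "z (max i n0) \<ominus> z (max j n0) \<in> nb (m + N)" using n1 ij by (simp add: le_max_iff_disj)
      then obtain e where e: "e \<in> D" "z (max i n0) \<ominus> z (max j n0) = t [^] (m + N) \<otimes> e"
        by (rule nbE)
      have "t [^] m \<otimes> (d i \<ominus> d j) = t [^] m \<otimes> d i \<ominus> t [^] m \<otimes> d j" using dc[of i] dc[of j] tp[of m] by algebra
      also have "\<dots> = z (max i n0) \<ominus> z (max j n0)" unfolding td
        using zc[of "max i n0"] zc[of "max j n0"] zc[of n0] by algebra
      also have "\<dots> = t [^] m \<otimes> (t [^] N \<otimes> e)" using e Dc t by (simp add: nat_pow_mult[symmetric] m_assoc)
      finally have "d i \<ominus> d j = t [^] N \<otimes> e" using cancel dc e Dc by simp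
      then show "d i \<ominus> d j \<in> nb N" using nbI e by simp
    qed
  qed
  show thesis
  proof (rule that)
    show "z n0 \<in> carrier R" by (rule zc)
    show "Nn +>\<^bsub>Cc\<^esub> d \<in> Dh" unfolding Dh_iff using dC dD by blast
    have "to_completion R D t (z n0) \<oplus>\<^bsub>Rh\<^esub> th [^]\<^bsub>Rh\<^esub> m \<otimes>\<^bsub>Rh\<^esub> (Nn +>\<^bsub>Cc\<^esub> d) = Nn +>\<^bsub>Cc\<^esub> (\<lambda>n. z n0 \<oplus> t [^] m \<otimes> d n)"
      unfolding to_completion_pow[OF t, symmetric] unfolding to_completion_def
      using ring_hom_mult[OF coset_hom, of "\<lambda>_. t [^] m" d] ring_hom_add[OF coset_hom, of "\<lambda>_. z n0" "\<lambda>n. t [^] m \<otimes> d n"]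
        dC zc cauchy_mult[OF const_cauchy dC, of "t [^] m"] by (simp add: Cc_ops)
    also have "\<dots> = Nn +>\<^bsub>Cc\<^esub> z"
    proof (subst coset_eq')
      show "(\<lambda>n. z n0 \<oplus> t [^] m \<otimes> d n) \<in> carrier Cc"
        using cauchy_add[OF const_cauchy cauchy_mult[OF const_cauchy dC], of "z n0" "t [^] m"] zc by simp
      have "z n0 \<oplus> t [^] m \<otimes> d n \<ominus> z n = \<zero>" if "n \<ge> n0" for n
        unfolding td using that zc[of n] zc[of n0] by (simp add: max_absorb1) algebra
      moreover have "z n0 \<oplus> t [^] m \<otimes> d n \<ominus> z n \<in> carrier R" for n using zc dc by simp
      ultimately show "(\<lambda>n. z n0 \<oplus> t [^] m \<otimes> d n \<ominus> z n) \<in> Nn" unfolding null_seqs_def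
        using nb_zero by auto metis
    qed (rule z)
    finally show "y = to_completion R D t (z n0) \<oplus>\<^bsub>Rh\<^esub> th [^]\<^bsub>Rh\<^esub> m \<otimes>\<^bsub>Rh\<^esub> (Nn +>\<^bsub>Cc\<^esub> d)" using z by simp
  qed
qed

end

lemma completion_map:
  assumes a1: "adic R D t" and a2: "adic R D' t" and DD: "D \<subseteq> D'"
  defines "f \<equiv> induced (cauchy_ring R D' t) (null_seqs R D' t) id"
  shows "f \<in> ring_hom (completion R D t) (completion R D' t)"
    and "x \<in> carrier R \<Longrightarrow> f (to_completion R D t x) = to_completion R D' t x"
    and "y \<in> completion_subring R D t \<Longrightarrow> f y \<in> completion_subring R D' t"
proof -
  interpret A: adic R D t by fact
  interpret B: adic R D' t by fact
  have nb: "adic_nbhd R D t N \<subseteq> adic_nbhd R D' t N" for N unfolding adic_nbhd_def using DD by auto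
  have c: "x \<in> carrier B.Cc" if "x \<in> carrier A.Cc" for x
    by (rule B.cauchyI) (use A.cauchyD[OF that] nb in blast)+
  have n: "x \<in> B.Nn" if "x \<in> A.Nn" for x
    using that nb unfolding null_seqs_def by auto blast
  have h: "id \<in> ring_hom A.Cc B.Cc" by (rule ring_hom_memI) (auto simp: c A.Cc_ops B.Cc_ops)
  show "f \<in> ring_hom (completion R D t) (completion R D' t)"
    unfolding f_def completion_def
    by (rule induced_hom[OF A.Cc_cring B.Cc_cring h A.null_ideal B.null_ideal]) (simp add: n)
  have ind: "f (A.Nn +>\<^bsub>A.Cc\<^esub> z) = B.Nn +>\<^bsub>B.Cc\<^esub> z" if "z \<in> carrier A.Cc" for z
    unfolding f_def using induced_coset[OF A.Cc_cring B.Cc_cring h A.null_ideal B.null_ideal _ that] n by simp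
  show "x \<in> carrier R \<Longrightarrow> f (to_completion R D t x) = to_completion R D' t x"
    unfolding to_completion_def by (simp add: ind)
  show "y \<in> completion_subring R D t \<Longrightarrow> f y \<in> completion_subring R D' t"
    unfolding A.Dh_iff B.Dh_iff using ind c DD by blast
qed

lemma (in cring) adic_whole: "t \<in> carrier R \<Longrightarrow> adic R (carrier R) t"
  by unfold_locales (auto intro!: carrier_is_subring)

section \<open>Polynomials and adjunction of roots\<close>

lemma finite_submsets: "finite {a. a \<subseteq># m}"
proof (induction m)
  case (add x m)
  have "a \<in> {a. a \<subseteq># m} \<union> add_mset x ` {a. a \<subseteq># m}" if a: "a \<subseteq># add_mset x m" for a
  proof (cases "x \<in># a")
    case True
    then obtain b where b: "a = add_mset x b" by (metis mset_add)
    then show ?thesis using a by auto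
  next
    case False
    then have "a \<subseteq># m" using a by (metis diff_single_trivial add_mset_remove_trivial mset_subset_eq_add_mset_cancel
          subset_eq_diff_conv union_mset_add_mset_right add.right_neutral)
    then show ?thesis by simp
  qed
  then have "{a. a \<subseteq># add_mset x m} \<subseteq> {a. a \<subseteq># m} \<union> add_mset x ` {a. a \<subseteq># m}" by auto
  then show ?case using add finite_subset by fastforce
qed simp

lemma (in abelian_monoid) finsum_Sigma:
  assumes "finite A" "\<And>x. x \<in> A \<Longrightarrow> finite (B x)" "\<And>x y. x \<in> A \<Longrightarrow> y \<in> B x \<Longrightarrow> f x y \<in> carrier G"
  shows "(\<Oplus>x\<in>A. \<Oplus>y\<in>B x. f x y) = (\<Oplus>z\<in>Sigma A B. f (fst z) (snd z))"
  using assms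
proof (induction A rule: finite_induct)
  case (insert x A)
  have S: "Sigma (insert x A) B = Pair x ` B x \<union> Sigma A B" by auto
  have "(\<Oplus>z\<in>Sigma (insert x A) B. f (fst z) (snd z)) =
      (\<Oplus>z\<in>Pair x ` B x. f (fst z) (snd z)) \<oplus> (\<Oplus>z\<in>Sigma A B. f (fst z) (snd z))"
    unfolding S by (rule finsum_Un_disjoint) (use insert in auto)
  also have "(\<Oplus>z\<in>Pair x ` B x. f (fst z) (snd z)) = (\<Oplus>y\<in>B x. f x y)"
    by (subst finsum_reindex) (use insert.prems in \<open>auto simp: inj_on_def\<close>)
  also have "(\<Oplus>z\<in>Sigma A B. f (fst z) (snd z)) = (\<Oplus>x\<in>A. \<Oplus>y\<in>B x. f x y)"
    using insert by simp
  finally show ?case using insert by (subst finsum_insert) auto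
qed simp

locale mpoly = cring R for R (structure) +
  fixes I :: "'i set"
begin

abbreviation "P \<equiv> mpoly_ring R I"

lemma mem_P: "p \<in> carrier P \<longleftrightarrow> (\<forall>m. p m \<in> carrier R) \<and> finite {m. p m \<noteq> \<zero>} \<and> (\<forall>m. p m \<noteq> \<zero> \<longrightarrow> set_mset m \<subseteq> I)"
  by (simp add: mpoly_ring_def)

lemma P_ops: "\<one>\<^bsub>P\<^esub> = (\<lambda>m. if m = {#} then \<one> else \<zero>)" "\<zero>\<^bsub>P\<^esub> = (\<lambda>_. \<zero>)" "p \<oplus>\<^bsub>P\<^esub> q = (\<lambda>m. p m \<oplus> q m)"
    "p \<otimes>\<^bsub>P\<^esub> q = (\<lambda>m. \<Oplus>a\<in>{a. a \<subseteq># m}. p a \<otimes> q (m - a))"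
  by (simp_all add: mpoly_ring_def)

lemma P_add: "p \<in> carrier P \<Longrightarrow> q \<in> carrier P \<Longrightarrow> p \<oplus>\<^bsub>P\<^esub> q \<in> carrier P"
proof -
  assume p: "p \<in> carrier P" and q: "q \<in> carrier P"
  have "{m. p m \<oplus> q m \<noteq> \<zero>} \<subseteq> {m. p m \<noteq> \<zero>} \<union> {m. q m \<noteq> \<zero>}" by auto
  then have "finite {m. p m \<oplus> q m \<noteq> \<zero>}" using p q unfolding mem_P by (meson finite_UnI finite_subset)
  moreover have "set_mset m \<subseteq> I" if "p m \<oplus> q m \<noteq> \<zero>" for m
  proof -
    have "p m \<noteq> \<zero> \<or> q m \<noteq> \<zero>" using that by auto
    then show ?thesis using p q unfolding mem_P by blast
  qed
  ultimately show ?thesis using p q by (simp add: mem_P P_ops)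
qed

lemma P_mult: "p \<in> carrier P \<Longrightarrow> q \<in> carrier P \<Longrightarrow> p \<otimes>\<^bsub>P\<^esub> q \<in> carrier P"
proof -
  assume p: "p \<in> carrier P" and q: "q \<in> carrier P"
  have ex: "\<exists>a. a \<subseteq># m \<and> p a \<noteq> \<zero> \<and> q (m - a) \<noteq> \<zero>" if nz: "(p \<otimes>\<^bsub>P\<^esub> q) m \<noteq> \<zero>" for m
  proof (rule ccontr)
    assume n: "\<not> ?thesis"
    have "p a \<otimes> q (m - a) = \<zero>" if "a \<subseteq># m" for a
    proof (cases "p a = \<zero>")
      case False
      then have "q (m - a) = \<zero>" using n that by blast
      then show ?thesis using p by (simp add: mem_P)
    qed (use q in \<open>simp add: mem_P\<close>)
    then have "(p \<otimes>\<^bsub>P\<^esub> q) m = \<zero>" unfolding P_ops by (intro add.finprod_one_eqI) simp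
    with nz show False ..
  qed
  have "{m. (p \<otimes>\<^bsub>P\<^esub> q) m \<noteq> \<zero>} \<subseteq> (\<lambda>(a, b). a + b) ` ({m. p m \<noteq> \<zero>} \<times> {m. q m \<noteq> \<zero>})"
  proof
    fix m assume "m \<in> {m. (p \<otimes>\<^bsub>P\<^esub> q) m \<noteq> \<zero>}"
    then obtain a where "a \<subseteq># m" "p a \<noteq> \<zero>" "q (m - a) \<noteq> \<zero>" using ex by blast
    then show "m \<in> (\<lambda>(a, b). a + b) ` ({m. p m \<noteq> \<zero>} \<times> {m. q m \<noteq> \<zero>})"
      by (intro image_eqI[of _ _ "(a, m - a)"]) auto
  qed
  then have "finite {m. (p \<otimes>\<^bsub>P\<^esub> q) m \<noteq> \<zero>}" using p q unfolding mem_P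
    by (meson finite_SigmaI finite_imageI finite_subset)
  moreover have "set_mset m \<subseteq> I" if "(p \<otimes>\<^bsub>P\<^esub> q) m \<noteq> \<zero>" for m
  proof -
    obtain a where a: "a \<subseteq># m" "p a \<noteq> \<zero>" "q (m - a) \<noteq> \<zero>" using ex \<open>(p \<otimes>\<^bsub>P\<^esub> q) m \<noteq> \<zero>\<close> by blast
    have "set_mset (a + (m - a)) \<subseteq> I" unfolding set_mset_union using p q a unfolding mem_P by (intro Un_least) blast+
    then show ?thesis using a by simp
  qed
  moreover have "(p \<otimes>\<^bsub>P\<^esub> q) m \<in> carrier R" for m
    unfolding P_ops by (rule finsum_closed) (use p q in \<open>auto simp: mem_P\<close>)
  ultimately show ?thesis by (simp add: mem_P)
qed

lemma P_assoc:
  assumes "p \<in> carrier P" "q \<in> carrier P" "r \<in> carrier P"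
  shows "p \<otimes>\<^bsub>P\<^esub> q \<otimes>\<^bsub>P\<^esub> r = p \<otimes>\<^bsub>P\<^esub> (q \<otimes>\<^bsub>P\<^esub> r)"
proof (rule ext)
  fix m
  have c: "p a \<in> carrier R" "q a \<in> carrier R" "r a \<in> carrier R" for a using assms by (auto simp: mem_P)
  have "(p \<otimes>\<^bsub>P\<^esub> q \<otimes>\<^bsub>P\<^esub> r) m = (\<Oplus>d\<in>{d. d \<subseteq># m}. \<Oplus>a\<in>{a. a \<subseteq># d}. p a \<otimes> q (d - a) \<otimes> r (m - d))"
    unfolding P_ops by (intro finsum_cong' refl) (use c in \<open>auto simp: finsum_ldistr finite_submsets\<close>)
  also have "\<dots> = (\<Oplus>z\<in>Sigma {d. d \<subseteq># m} (\<lambda>d. {a. a \<subseteq># d}). p (snd z) \<otimes> q (fst z - snd z) \<otimes> r (m - fst z))"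
    by (rule finsum_Sigma) (use c in \<open>auto simp: finite_submsets\<close>)
  \<comment> \<open>Chains a \<subseteq># d \<subseteq># m are the same as decompositions of m into
    a, b = d - a and the rest.\<close>
  also have "Sigma {d. d \<subseteq># m} (\<lambda>d. {a. a \<subseteq># d}) =
      (\<lambda>(a, b). (a + b, a)) ` Sigma {a. a \<subseteq># m} (\<lambda>a. {b. b \<subseteq># m - a})" (is "_ = ?h ` ?S")
  proof (rule equalityI)
    show "Sigma {d. d \<subseteq># m} (\<lambda>d. {a. a \<subseteq># d}) \<subseteq> ?h ` ?S"
    proof (clarsimp)
      fix d a assume d: "d \<subseteq># m" "a \<subseteq># d"
      then have "(d, a) = ?h (a, d - a)" by simp
      moreover have "(a, d - a) \<in> ?S" using d
        by (simp add: subset_eq_diff_conv subset_mset.order_trans[of a d m])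
      ultimately show "(d, a) \<in> ?h ` ?S" by (rule image_eqI)
    qed
    show "?h ` ?S \<subseteq> Sigma {d. d \<subseteq># m} (\<lambda>d. {a. a \<subseteq># d})"
      by (auto simp: subset_mset.le_diff_conv2 add.commute)
  qed
  also have "(\<Oplus>z\<in>?h ` ?S. p (snd z) \<otimes> q (fst z - snd z) \<otimes> r (m - fst z))
      = (\<Oplus>z\<in>?S. p (fst z) \<otimes> q (snd z) \<otimes> r (m - (fst z + snd z)))"
    by (subst finsum_reindex) (use c in \<open>auto simp: inj_on_def case_prod_beta\<close>)
  also have "\<dots> = (\<Oplus>a\<in>{a. a \<subseteq># m}. \<Oplus>b\<in>{b. b \<subseteq># m - a}. p a \<otimes> q b \<otimes> r (m - (a + b)))"
    by (rule finsum_Sigma[symmetric]) (use c in \<open>auto simp: finite_submsets\<close>)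
  also have "\<dots> = (p \<otimes>\<^bsub>P\<^esub> (q \<otimes>\<^bsub>P\<^esub> r)) m"
    unfolding P_ops by (intro finsum_cong' refl)
      (use c in \<open>auto simp: finsum_rdistr finite_submsets m_assoc\<close>)
  finally show "(p \<otimes>\<^bsub>P\<^esub> q \<otimes>\<^bsub>P\<^esub> r) m = (p \<otimes>\<^bsub>P\<^esub> (q \<otimes>\<^bsub>P\<^esub> r)) m" .
qed

lemma P_comm:
  assumes "p \<in> carrier P" "q \<in> carrier P"
  shows "p \<otimes>\<^bsub>P\<^esub> q = q \<otimes>\<^bsub>P\<^esub> p"
proof (rule ext)
  fix m :: "'i multiset"
  have c: "p a \<in> carrier R" "q a \<in> carrier R" for a using assms by (auto simp: mem_P)
  have dd: "m - (m - a) = a" if "a \<subseteq># m" for a using that by (simp add: subset_mset.diff_diff_right)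
  have im: "{a. a \<subseteq># m} = (\<lambda>a. m - a) ` {a. a \<subseteq># m}"
  proof (rule equalityI)
    show "{a. a \<subseteq># m} \<subseteq> (\<lambda>a. m - a) ` {a. a \<subseteq># m}"
    proof
      fix a assume "a \<in> {a. a \<subseteq># m}"
      then show "a \<in> (\<lambda>a. m - a) ` {a. a \<subseteq># m}"
        by (intro image_eqI[of _ _ "m - a"]) (auto simp: subset_mset.diff_diff_right)
    qed
  qed auto
  have "(p \<otimes>\<^bsub>P\<^esub> q) m = (\<Oplus>a\<in>(\<lambda>a. m - a) ` {a. a \<subseteq># m}. p a \<otimes> q (m - a))"
    unfolding P_ops using im by simp
  also have "\<dots> = (\<Oplus>a\<in>{a. a \<subseteq># m}. p (m - a) \<otimes> q (m - (m - a)))"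
    by (rule finsum_reindex) (use c dd in \<open>auto intro!: inj_onI, metis\<close>)
  also have "\<dots> = (\<Oplus>a\<in>{a. a \<subseteq># m}. q a \<otimes> p (m - a))"
    by (rule finsum_cong') (use c in \<open>auto simp: m_comm subset_mset.diff_diff_right\<close>)
  finally show "(p \<otimes>\<^bsub>P\<^esub> q) m = (q \<otimes>\<^bsub>P\<^esub> p) m" unfolding P_ops .
qed

definition mono :: "'a \<Rightarrow> 'i multiset \<Rightarrow> 'i multiset \<Rightarrow> 'a" where
  "mono a m = (\<lambda>m'. if m' = m then a else \<zero>)"

lemma mono_closed:
  assumes "a \<in> carrier R" "set_mset m \<subseteq> I"
  shows "mono a m \<in> carrier P"
proof -
  have "{m'. mono a m m' \<noteq> \<zero>} \<subseteq> {m}" by (auto simp: mono_def)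
  then have "finite {m'. mono a m m' \<noteq> \<zero>}" by (rule finite_subset) simp
  then show ?thesis using assms by (auto simp: mem_P mono_def)
qed

lemma mono_mult:
  assumes a: "a \<in> carrier R" and q: "q \<in> carrier P"
  shows "(mono a m' \<otimes>\<^bsub>P\<^esub> q) m = (if m' \<subseteq># m then a \<otimes> q (m - m') else \<zero>)"
proof -
  have c: "q b \<in> carrier R" for b using q by (simp add: mem_P)
  have "(mono a m' \<otimes>\<^bsub>P\<^esub> q) m = (\<Oplus>b\<in>{b. b \<subseteq># m}. if m' = b then a \<otimes> q (m - b) else \<zero>)"
    unfolding P_ops by (rule finsum_cong') (use c a in \<open>auto simp: mono_def\<close>)
  also have "\<dots> = (if m' \<subseteq># m then a \<otimes> q (m - m') else \<zero>)"
  proof (cases "m' \<subseteq># m")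
    case True
    then show ?thesis using finsum_singleton[of m' "{b. b \<subseteq># m}" "\<lambda>b. a \<otimes> q (m - b)"] c a
      by (auto simp: finite_submsets)
  next
    case False
    then show ?thesis by (auto intro!: add.finprod_one_eqI)
  qed
  finally show ?thesis .
qed

lemma P_cring: "cring P"
proof (rule cringI)
  have one: "\<one>\<^bsub>P\<^esub> = mono \<one> {#}" by (simp add: P_ops mono_def)
  show "abelian_group P"
  proof (rule abelian_groupI)
    show "\<exists>y\<in>carrier P. y \<oplus>\<^bsub>P\<^esub> x = \<zero>\<^bsub>P\<^esub>" if x: "x \<in> carrier P" for x
    proof (rule bexI)
      have "{m. \<ominus> x m \<noteq> \<zero>} = {m. x m \<noteq> \<zero>}" using x by (auto simp: mem_P)
      then show "(\<lambda>m. \<ominus> x m) \<in> carrier P" using x by (auto simp: mem_P)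
      show "(\<lambda>m. \<ominus> x m) \<oplus>\<^bsub>P\<^esub> x = \<zero>\<^bsub>P\<^esub>" using x by (simp add: P_ops mem_P l_neg)
    qed
    show "\<zero>\<^bsub>P\<^esub> \<in> carrier P" by (simp add: mem_P P_ops)
  qed (simp_all add: P_add, simp_all add: P_ops mem_P a_ac)
  show "Group.comm_monoid P"
  proof (rule comm_monoidI)
    show "\<one>\<^bsub>P\<^esub> \<otimes>\<^bsub>P\<^esub> x = x" if "x \<in> carrier P" for x
      by (rule ext) (use that in \<open>simp add: one mono_mult mem_P\<close>)
    show "\<one>\<^bsub>P\<^esub> \<in> carrier P" unfolding one by (rule mono_closed) auto
  qed (simp_all add: P_mult P_assoc, simp add: P_comm)
  show "(x \<oplus>\<^bsub>P\<^esub> y) \<otimes>\<^bsub>P\<^esub> z = x \<otimes>\<^bsub>P\<^esub> z \<oplus>\<^bsub>P\<^esub> y \<otimes>\<^bsub>P\<^esub> z"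
    if "x \<in> carrier P" "y \<in> carrier P" "z \<in> carrier P" for x y z
  proof (rule ext)
    fix m
    have c: "x a \<in> carrier R" "y a \<in> carrier R" "z a \<in> carrier R" for a using that by (auto simp: mem_P)
    show "((x \<oplus>\<^bsub>P\<^esub> y) \<otimes>\<^bsub>P\<^esub> z) m = (x \<otimes>\<^bsub>P\<^esub> z \<oplus>\<^bsub>P\<^esub> y \<otimes>\<^bsub>P\<^esub> z) m"
      unfolding P_ops by (subst finsum_addf[symmetric]) (use c in \<open>auto simp: l_distr intro!: finsum_cong'\<close>)
  qed
qed

lemma const_mono: "mp_const R a = mono a {#}" by (simp add: mp_const_def mono_def)

lemma var_mono: "mp_var R i = mono \<one> {#i#}" by (simp add: mp_var_def mono_def)

lemma const_hom: "mp_const R \<in> ring_hom R P"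
proof (rule ring_hom_memI)
  fix a assume a: "a \<in> carrier R"
  show "mp_const R a \<in> carrier P" unfolding const_mono using a by (simp add: mono_closed)
  fix b assume b: "b \<in> carrier R"
  show "mp_const R (a \<otimes> b) = mp_const R a \<otimes>\<^bsub>P\<^esub> mp_const R b"
    by (rule ext) (use a b in \<open>simp add: const_mono mono_mult mono_closed, simp add: mono_def\<close>)
  show "mp_const R (a \<oplus> b) = mp_const R a \<oplus>\<^bsub>P\<^esub> mp_const R b"
    by (auto simp: mp_const_def P_ops)
next
  show "mp_const R \<one> = \<one>\<^bsub>P\<^esub>" by (simp add: mp_const_def P_ops)
qed

lemma var_closed: "i \<in> I \<Longrightarrow> mp_var R i \<in> carrier P"
  unfolding var_mono by (rule mono_closed) auto

lemma mono_add_mset: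
  assumes "a \<in> carrier R" "i \<in> I" "set_mset m \<subseteq> I"
  shows "mono a (add_mset i m) = mp_var R i \<otimes>\<^bsub>P\<^esub> mono a m"
proof (rule ext)
  fix m'
  have "(mp_var R i \<otimes>\<^bsub>P\<^esub> mono a m) m' = (if {#i#} \<subseteq># m' then \<one> \<otimes> mono a m (m' - {#i#}) else \<zero>)"
    unfolding var_mono by (rule mono_mult) (use assms in \<open>auto simp: mono_closed\<close>)
  also have "\<dots> = mono a (add_mset i m) m'"
    using assms by (auto simp: mono_def insert_DiffM)
  finally show "mono a (add_mset i m) m' = (mp_var R i \<otimes>\<^bsub>P\<^esub> mono a m) m'" by simp
qed

text \<open>Induction on a finite set containing the support, splitting off one monomial at a
  time.\<close>

lemma P_generated:
  assumes S: "subring S P" and c: "\<And>a. a \<in> carrier R \<Longrightarrow> mp_const R a \<in> S" and v: "\<And>i. i \<in> I \<Longrightarrow> mp_var R i \<in> S"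
    and p: "p \<in> carrier P"
  shows "p \<in> S"
proof -
  note SE = subringE[OF S]
  have mono: "mono a m \<in> S" if "a \<in> carrier R" "set_mset m \<subseteq> I" for a m
    using that(2) by (induction m) (use that(1) c v SE in \<open>auto simp: mono_add_mset const_mono[symmetric]\<close>)
  have "\<forall>p\<in>carrier P. {m. p m \<noteq> \<zero>} \<subseteq> F \<longrightarrow> p \<in> S" if "finite F" for F
    using that
  proof (induction F rule: finite_induct)
    case empty
    then have "p = \<zero>\<^bsub>P\<^esub>" if "{m. p m \<noteq> \<zero>} \<subseteq> {}" for p using that by (auto simp: P_ops)
    then show ?case using SE(2) by blast
  next
    case (insert x F)
    show ?case
    proof (intro ballI impI)
      fix p assume p: "p \<in> carrier P" "{m. p m \<noteq> \<zero>} \<subseteq> insert x F"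
      define q where "q = p(x := \<zero>)"
      have "{m. q m \<noteq> \<zero>} \<subseteq> {m. p m \<noteq> \<zero>}" by (auto simp: q_def)
      then have "finite {m. q m \<noteq> \<zero>}" using p finite_subset unfolding mem_P by blast
      then have "q \<in> carrier P" using p by (auto simp: mem_P q_def)
      moreover have "{m. q m \<noteq> \<zero>} \<subseteq> F" using p by (auto simp: q_def)
      ultimately have q: "q \<in> S" using insert.IH by blast
      have p_eq: "p = q \<oplus>\<^bsub>P\<^esub> mono (p x) x" using p by (auto simp: P_ops q_def mono_def mem_P)
      show "p \<in> S"
      proof (cases "p x = \<zero>")
        case True
        then have "p = q" by (auto simp: q_def)
        then show ?thesis using q by simp
      next
        case False
        then have "mono (p x) x \<in> S" using p mono by (auto simp: mem_P)
        then show ?thesis using p_eq SE(7) q by metis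
      qed
    qed
  qed
  then show ?thesis using p by (auto simp: mem_P)
qed

end

section \<open>Formal adjunction of compatible p-power roots\<close>

locale adjoin = cring R for R (structure) +
  fixes p :: nat and I :: "'i set" and r :: "'i \<Rightarrow> 'a"
  assumes r: "\<And>i. i \<in> I \<Longrightarrow> r i \<in> carrier R"
begin

sublocale mp: mpoly R "I \<times> (UNIV :: nat set)" by unfold_locales

abbreviation "J \<equiv> roots_ideal R p I r"
abbreviation "E \<equiv> adjoin_roots R p I r"

lemma gens:
  "{mp_var R (i, 0) \<ominus>\<^bsub>mp.P\<^esub> mp_const R (r i) | i. i \<in> I} \<union>
        {mp_var R (i, Suc k) [^]\<^bsub>mp.P\<^esub> p \<ominus>\<^bsub>mp.P\<^esub> mp_var R (i, k) | i k. i \<in> I} \<subseteq> carrier mp.P" (is "?G \<subseteq> _")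
proof -
  interpret P: cring mp.P by (rule mp.P_cring)
  show ?thesis using mp.var_closed ring_hom_closed[OF mp.const_hom] r by (auto intro!: P.minus_closed P.nat_pow_closed)
qed

lemma J_ideal: "ideal J mp.P"
proof -
  interpret P: cring mp.P by (rule mp.P_cring)
  show ?thesis unfolding roots_ideal_def Let_def by (rule P.genideal_ideal[OF gens])
qed

lemma J_mem:
  "i \<in> I \<Longrightarrow> mp_var R (i, 0) \<ominus>\<^bsub>mp.P\<^esub> mp_const R (r i) \<in> J"
  "i \<in> I \<Longrightarrow> mp_var R (i, Suc k) [^]\<^bsub>mp.P\<^esub> p \<ominus>\<^bsub>mp.P\<^esub> mp_var R (i, k) \<in> J"
proof -
  interpret P: cring mp.P by (rule mp.P_cring)
  note s = P.genideal_self[OF gens]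
  show "i \<in> I \<Longrightarrow> mp_var R (i, 0) \<ominus>\<^bsub>mp.P\<^esub> mp_const R (r i) \<in> J"
    unfolding roots_ideal_def Let_def by (rule subsetD[OF s]) blast
  show "i \<in> I \<Longrightarrow> mp_var R (i, Suc k) [^]\<^bsub>mp.P\<^esub> p \<ominus>\<^bsub>mp.P\<^esub> mp_var R (i, k) \<in> J"
    unfolding roots_ideal_def Let_def by (rule subsetD[OF s]) blast
qed

lemma E_cring: "cring E"
  unfolding adjoin_roots_def by (rule ideal.quotient_is_cring[OF J_ideal mp.P_cring])

lemma E_coset_hom: "(\<lambda>x. J +>\<^bsub>mp.P\<^esub> x) \<in> ring_hom mp.P E"
  unfolding adjoin_roots_def by (rule ideal.rcos_ring_hom[OF J_ideal])

lemma const_hom: "adjoin_const R p I r \<in> ring_hom R E"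
  using ring_hom_trans[OF mp.const_hom E_coset_hom] by (simp add: adjoin_const_def[abs_def] comp_def)

lemma root_closed: "i \<in> I \<Longrightarrow> adjoined_root R p I r i k \<in> carrier E"
  unfolding adjoined_root_def by (rule ring_hom_closed[OF E_coset_hom]) (simp add: mp.var_closed)

lemma coset_pow:
  assumes "x \<in> carrier mp.P"
  shows "(J +>\<^bsub>mp.P\<^esub> x) [^]\<^bsub>E\<^esub> (n::nat) = J +>\<^bsub>mp.P\<^esub> (x [^]\<^bsub>mp.P\<^esub> n)"
proof -
  interpret P: cring mp.P by (rule mp.P_cring)
  interpret E: cring E by (rule E_cring)
  show ?thesis by (induction n)
     (use assms ring_hom_mult[OF E_coset_hom] ring_hom_one[OF E_coset_hom] in auto)
qed

lemma root_0: "i \<in> I \<Longrightarrow> adjoined_root R p I r i 0 = adjoin_const R p I r (r i)"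
  unfolding adjoined_root_def adjoin_const_def
  using ideal.coset_eq[OF J_ideal, of "mp_var R (i, 0)" "mp_const R (r i)"] J_mem(1) mp.var_closed
    ring_hom_closed[OF mp.const_hom] r by simp

lemma root_Suc: "i \<in> I \<Longrightarrow> adjoined_root R p I r i (Suc k) [^]\<^bsub>E\<^esub> p = adjoined_root R p I r i k"
proof -
  assume i: "i \<in> I"
  interpret P: cring mp.P by (rule mp.P_cring)
  have v: "mp_var R (i, k) \<in> carrier mp.P" for k using mp.var_closed i by simp
  show ?thesis
    unfolding adjoined_root_def coset_pow[OF v] ideal.coset_eq[OF J_ideal P.nat_pow_closed[OF v] v]
    by (rule J_mem(2)[OF i])
qed

text \<open>Reduces membership in a subring to constants and roots; in this way denominators are
  bounded for all elements of the field generated by the p-power roots of p.\<close>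

lemma E_generated:
  assumes S: "subring S E" and c: "\<And>a. a \<in> carrier R \<Longrightarrow> adjoin_const R p I r a \<in> S"
    and v: "\<And>i k. i \<in> I \<Longrightarrow> adjoined_root R p I r i k \<in> S" and x: "x \<in> carrier E"
  shows "x \<in> S"
proof -
  interpret P: cring mp.P by (rule mp.P_cring)
  interpret E: cring E by (rule E_cring)
  interpret h: ring_hom_ring mp.P E "\<lambda>x. J +>\<^bsub>mp.P\<^esub> x"
    by (rule ring_hom_ringI2[OF P.ring_axioms E.ring_axioms E_coset_hom])
  note SE = subringE[OF S]
  obtain q where q: "q \<in> carrier mp.P" "x = J +>\<^bsub>mp.P\<^esub> q" using P.quot_elemE x unfolding adjoin_roots_def by blast
  have "subring {q \<in> carrier mp.P. J +>\<^bsub>mp.P\<^esub> q \<in> S} mp.P"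
    by (rule P.subringI) (use SE in auto)
  from mp.P_generated[OF this _ _ q(1)] have "q \<in> {q \<in> carrier mp.P. J +>\<^bsub>mp.P\<^esub> q \<in> S}"
    using c v ring_hom_closed[OF mp.const_hom] mp.var_closed
    unfolding adjoin_const_def adjoined_root_def by auto
  then show ?thesis using q by simp
qed

end

section \<open>Integral closure and power-bounded elements\<close>

context cring
begin

lemma lsum_mem:
  assumes "submod R B K" "\<And>i. i < n \<Longrightarrow> a i \<in> B" "\<And>i. i < n \<Longrightarrow> m i \<in> K"
  shows "lsum R a m n \<in> K"
  using assms(2,3) by (induction n) (auto intro: submodD[OF assms(1)])

lemma finsum_lsum:
  assumes "\<And>i. i < n \<Longrightarrow> a i \<in> carrier R" "\<And>i. m i \<in> carrier R"
  shows "(\<Oplus>i\<in>{..<n}. a i \<otimes> m i) = lsum R a m n"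
  using assms(1)
proof (induction n)
  case (Suc n)
  have "(\<Oplus>i\<in>{..<Suc n}. a i \<otimes> m i) = a n \<otimes> m n \<oplus> (\<Oplus>i\<in>{..<n}. a i \<otimes> m i)"
    unfolding lessThan_Suc by (rule finsum_insert) (use Suc assms in auto)
  moreover have "lsum R a m n \<in> carrier R"
    using Suc.prems assms(2) by (intro lsum_mem[of "carrier R" "carrier R" n a m]) (auto simp: submod_def)
  ultimately show ?case using Suc assms by (simp add: a_comm)
qed simp

text \<open>Polynomials in x of degree below n over D. Integrality becomes the statement that x^n
  lies in this span, a form without signs into which further equations can be substituted.\<close>

definition lspan :: "'a set \<Rightarrow> 'a \<Rightarrow> nat \<Rightarrow> 'a set" where
  "lspan D x n = {lsum R c (\<lambda>i. x [^] i) n | c. \<forall>i. c i \<in> D}"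

lemma lspan_submod:
  assumes "subring D R" "x \<in> carrier R"
  shows "submod R D (lspan D x n)"
  unfolding submod_def
proof (intro conjI ballI)
  note DE = subringE[OF assms(1)]
  have c: "c i \<in> carrier R" if "\<And>i. c i \<in> D" for c :: "nat \<Rightarrow> 'a" and i using that DE(1) by auto
  have xp: "\<And>i::nat. x [^] i \<in> carrier R" using assms by simp
  show "lspan D x n \<subseteq> carrier R" unfolding lspan_def using c xp by auto
  have "lsum R (\<lambda>_. \<zero>) (\<lambda>i. x [^] i) n = \<zero>" using xp by (simp add: lsum_zero)
  then show "\<zero> \<in> lspan D x n" unfolding lspan_def using DE(2) by (intro CollectI exI[of _ "\<lambda>_. \<zero>"]) simp
  show "y \<oplus> z \<in> lspan D x n" if yz: "y \<in> lspan D x n" "z \<in> lspan D x n" for y z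
  proof -
    obtain a b where ab: "\<And>i. a i \<in> D" "y = lsum R a (\<lambda>i. x [^] i) n" "\<And>i. b i \<in> D" "z = lsum R b (\<lambda>i. x [^] i) n"
      using yz unfolding lspan_def by auto
    have "y \<oplus> z = lsum R (\<lambda>i. a i \<oplus> b i) (\<lambda>i. x [^] i) n"
      unfolding ab by (rule lsum_add) (use ab c xp in auto)
    then show ?thesis unfolding lspan_def using ab DE(7) by blast
  qed
  show "b \<otimes> y \<in> lspan D x n" if by': "b \<in> D" "y \<in> lspan D x n" for b y
  proof -
    obtain a where a: "\<And>i. a i \<in> D" "y = lsum R a (\<lambda>i. x [^] i) n" using by' unfolding lspan_def by auto
    have "b \<otimes> y = lsum R (\<lambda>i. b \<otimes> a i) (\<lambda>i. x [^] i) n"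
      unfolding a by (rule lsum_smult) (use a c by' DE xp in auto)
    then show ?thesis unfolding lspan_def using a DE(6) by' by blast
  qed
qed

lemma lspan_pow:
  assumes "subring D R" "x \<in> carrier R" "k < n"
  shows "x [^] k \<in> lspan D x n"
proof -
  note DE = subringE[OF assms(1)]
  have xp: "\<And>i::nat. x [^] i \<in> carrier R" using assms by simp
  have "lsum R (\<lambda>i. if i = k then \<one> else \<zero>) (\<lambda>i. x [^] i) m = (if k < m then x [^] k else \<zero>)" for m
    by (induction m) (use xp in \<open>auto simp: less_Suc_eq\<close>)
  then show ?thesis unfolding lspan_def using assms DE(2,3)
    by (intro CollectI exI[of _ "\<lambda>i. if i = k then \<one> else \<zero>"]) auto
qed

lemma integral_iff:
  assumes D: "subring D R" and x: "x \<in> carrier R"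
  shows "x \<in> integral_closure R D \<longleftrightarrow> (\<exists>n::nat. x [^] n \<in> lspan D x n)"
proof
  note DE = subringE[OF D]
  have xp: "\<And>i::nat. x [^] i \<in> carrier R" using x by simp
  assume "x \<in> integral_closure R D"
  then obtain n :: nat and c where c: "\<And>i. i < n \<Longrightarrow> c i \<in> D" and
    e: "x [^] n \<oplus> (\<Oplus>i\<in>{..<n}. c i \<otimes> x [^] i) = \<zero>" unfolding integral_closure_def by blast
  have "(\<Oplus>i\<in>{..<n}. c i \<otimes> x [^] i) = lsum R c (\<lambda>i. x [^] i) n"
    by (rule finsum_lsum) (use c DE(1) xp in auto)
  moreover have "lsum R c (\<lambda>i. x [^] i) n \<in> lspan D x n"
    by (rule lsum_mem[OF lspan_submod[OF D x]]) (use c lspan_pow[OF D x] in auto)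
  ultimately have L: "(\<Oplus>i\<in>{..<n}. c i \<otimes> x [^] i) \<in> lspan D x n" (is "?L \<in> _") by simp
  have Lc: "?L \<in> carrier R" using submodD(2)[OF lspan_submod[OF D x] L] .
  have "x [^] n = \<ominus> ?L" using e minus_equality xp Lc by (metis a_comm minus_minus)
  also have "\<dots> = \<ominus> \<one> \<otimes> ?L" using Lc by (simp add: l_minus)
  also have "\<dots> \<in> lspan D x n" using submodD(5)[OF lspan_submod[OF D x] _ L] DE(3,5) by simp
  finally show "\<exists>n::nat. x [^] n \<in> lspan D x n" by blast
next
  note DE = subringE[OF D]
  have xp: "\<And>i::nat. x [^] i \<in> carrier R" using x by simp
  assume "\<exists>n::nat. x [^] n \<in> lspan D x n"
  then obtain n :: nat and c where c: "\<And>i. c i \<in> D" "x [^] n = lsum R c (\<lambda>i. x [^] i) n" unfolding lspan_def by auto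
  have cc: "\<And>i. c i \<in> carrier R" using c DE(1) by auto
  have mc: "\<And>i. \<ominus> \<one> \<otimes> c i \<in> D" using c DE by auto
  have "(\<Oplus>i\<in>{..<n}. (\<ominus> \<one> \<otimes> c i) \<otimes> x [^] i) = lsum R (\<lambda>i. \<ominus> \<one> \<otimes> c i) (\<lambda>i. x [^] i) n"
    by (rule finsum_lsum) (use cc xp in auto)
  also have "\<dots> = \<ominus> \<one> \<otimes> x [^] n" unfolding c(2) by (rule lsum_smult[symmetric]) (use cc xp in auto)
  finally have "x [^] n \<oplus> (\<Oplus>i\<in>{..<n}. (\<ominus> \<one> \<otimes> c i) \<otimes> x [^] i) = \<zero>"
    using xp by (simp add: l_minus r_neg)
  then show "x \<in> integral_closure R D" unfolding integral_closure_def using x mc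
    by (intro CollectI conjI exI[of _ n] exI[of _ "\<lambda>i. \<ominus> \<one> \<otimes> c i"]) auto
qed

text \<open>If |x| > 1, the lower powers of x are at most |x|^(n-1), so the equation would give
  |x|^n <= |x|^(n-1), and cancelling contradicts |x| > 1.\<close>

lemma lspan_valuation:
  assumes v: "is_valuation R v" and D: "\<And>f. f \<in> D \<Longrightarrow> (f, \<one>) \<in> v" and DR: "subring D R"
    and x: "x \<in> carrier R" "x [^] (n::nat) \<in> lspan D x n"
  shows "(x, \<one>) \<in> v"
proof (rule ccontr)
  assume gt: "(x, \<one>) \<notin> v"
  note V = valuationD[OF v]
  have xp: "\<And>i::nat. x [^] i \<in> carrier R" using x by simp
  have ge: "(\<one>, x) \<in> v" using gt V(3) x by blast
  obtain c where c: "\<And>i. c i \<in> D" "x [^] n = lsum R c (\<lambda>i. x [^] i) n" using x unfolding lspan_def by auto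
  have cc: "\<And>i. c i \<in> carrier R" using c subringE(1)[OF DR] by auto
  have nz: "(x [^] k, \<zero>) \<notin> v" for k :: nat
  proof
    assume "(x [^] k, \<zero>) \<in> v"
    then have "(\<one> [^] k, \<zero>) \<in> v" using valuation_pow[OF v ge] V(4) by blast
    then show False using V(5) by simp
  qed
  have mono: "(x [^] i, x [^] (i + d)) \<in> v" for i d :: nat
  proof (induction d)
    case 0
    then show ?case using valuation_refl[OF v] xp by simp
  next
    case (Suc d)
    have "(x [^] (i + d) \<otimes> \<one>, x [^] (i + d) \<otimes> x) \<in> v"
      using valuation_mult[OF v valuation_refl[OF v] ge] xp by blast
    then show ?case using Suc V(4) xp by auto
  qed
  show False
  proof (cases n)
    case 0
    then show False using c(2) nz[of 0] valuation_refl[OF v, of \<zero>] by simp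
  next
    case (Suc k)
    have "(c i \<otimes> x [^] i, x [^] k) \<in> v" if "i < n" for i
    proof -
      have "(c i \<otimes> x [^] i, \<one> \<otimes> x [^] k) \<in> v"
        by (rule valuation_mult[OF v D[OF c(1)]]) (use mono[of i "k - i"] that Suc in auto)
      then show ?thesis using xp by simp
    qed
    then have "(x [^] n, x [^] k) \<in> v" unfolding c(2) using valuation_lsum[OF v xp] by blast
    then have "(x \<otimes> x [^] k, \<one> \<otimes> x [^] k) \<in> v" using Suc xp x by (simp add: m_comm)
    then show False using V(8) nz xp x gt by blast
  qed
qed

lemma integral_valuation:
  assumes "is_valuation R v" "\<And>f. f \<in> D \<Longrightarrow> (f, \<one>) \<in> v" "subring D R" "x \<in> integral_closure R D"
  shows "(x, \<one>) \<in> v"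
proof -
  have x: "x \<in> carrier R" using assms(4) unfolding integral_closure_def by blast
  show ?thesis using integral_iff[OF assms(3) x] assms(4) lspan_valuation[OF assms(1-3) x] by blast
qed

lemma hom_lsum:
  assumes S: "cring S" and h: "h \<in> ring_hom R S" and "\<And>i. a i \<in> carrier R" "\<And>i. m i \<in> carrier R"
  shows "h (lsum R a m n) = lsum S (\<lambda>i. h (a i)) (\<lambda>i. h (m i)) n"
proof -
  interpret S: cring S by fact
  show ?thesis
  proof (induction n)
    case 0
    show ?case using ring_hom_zero[OF h ring_axioms S.ring_axioms] by simp
  next
    case (Suc n)
    then show ?case using assms ring_hom_add[OF h] ring_hom_mult[OF h] lsum_closed[of a m n] by simp
  qed
qed

text \<open>The valuative criterion of integrality: if 1/x were invertible in D[1/x], clearing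
  denominators would give an integral equation for x. So 1/x is not a unit there,
  \<open>valuation_exists\<close> makes it small and x large, and the valuation is pulled back to
  R.\<close>

lemma non_integral_valuation:
  assumes D: "subring D R" and x: "x \<in> carrier R" "x \<notin> integral_closure R D"
  obtains v where "is_valuation R v" "\<And>f. f \<in> D \<Longrightarrow> (f, \<one>) \<in> v" "(x, \<one>) \<notin> v"
proof -
  interpret loc_elt R x by (rule loc_eltI[OF x(1)])
  interpret L: cring L by (rule loc_cring)
  note DE = subringE[OF D]
  let ?l = "to_loc R x"
  define X' where "X' = ?l x"
  define z where "z = fraction R x \<one> 1"
  have Xc: "X' \<in> carrier L" and zc: "z \<in> carrier L" and Xz: "X' \<otimes>\<^bsub>L\<^esub> z = \<one>\<^bsub>L\<^esub>"
    using x inverse_t fraction_closed[of \<one> 1] L.m_comm unfolding X'_def z_def by auto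
  have Xp: "\<And>i::nat. X' [^]\<^bsub>L\<^esub> i \<in> carrier L" and zp: "\<And>i::nat. z [^]\<^bsub>L\<^esub> i \<in> carrier L" using Xc zc by auto
  interpret h: ring_hom_ring R L ?l
    by (rule ring_hom_ringI2[OF ring_axioms L.ring_axioms to_loc_hom])
  have DL: "subring (?l ` D) L" by (rule h.img_is_subring[OF D])
  define B0 where "B0 = pset L (?l ` D) z"
  have B0: "subring B0 L" unfolding B0_def by (rule L.subring_pset[OF DL zc])
  have z0: "z \<in> B0" unfolding B0_def by (rule L.gen_in_pset[OF DL zc])
  have "z \<otimes>\<^bsub>L\<^esub> b \<noteq> \<one>\<^bsub>L\<^esub>" if b: "b \<in> B0" for b
  proof
    assume one: "z \<otimes>\<^bsub>L\<^esub> b = \<one>\<^bsub>L\<^esub>"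
    obtain a n where a: "\<And>i. a i \<in> ?l ` D" "b = lsum L a (\<lambda>i. z [^]\<^bsub>L\<^esub> i) n"
      using b unfolding B0_def by (auto elim!: psetE)
    have "\<forall>i. \<exists>d. d \<in> D \<and> a i = ?l d" using a(1) by blast
    then obtain d where d: "\<And>i. d i \<in> D" "\<And>i. a i = ?l (d i)" by metis
    have dc: "\<And>i. d i \<in> carrier R" using d DE(1) by auto
    have ac: "\<And>i. a i \<in> carrier L" using d dc by auto
    have bc: "b \<in> carrier L" unfolding a using ac zp by auto
    have red: "X' [^]\<^bsub>L\<^esub> (k + l) \<otimes>\<^bsub>L\<^esub> z [^]\<^bsub>L\<^esub> l = X' [^]\<^bsub>L\<^esub> k" for k l :: nat
    proof -
      have "X' [^]\<^bsub>L\<^esub> (k + l) \<otimes>\<^bsub>L\<^esub> z [^]\<^bsub>L\<^esub> l = X' [^]\<^bsub>L\<^esub> k \<otimes>\<^bsub>L\<^esub> (X' \<otimes>\<^bsub>L\<^esub> z) [^]\<^bsub>L\<^esub> l"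
        using Xc zc by (simp add: L.nat_pow_mult[symmetric] L.nat_pow_distrib L.m_assoc)
      then show ?thesis using Xz Xp by simp
    qed
    \<comment> \<open>Here b is a polynomial of length n in z = 1/x. Multiplying 1 = z b by x^n
      leaves only the powers x^(n-1-i) with i < n.\<close>
    have "X' [^]\<^bsub>L\<^esub> n = X' [^]\<^bsub>L\<^esub> n \<otimes>\<^bsub>L\<^esub> z \<otimes>\<^bsub>L\<^esub> b" using one Xp zc bc by (simp add: L.m_assoc)
    also have "\<dots> = lsum L a (\<lambda>i. X' [^]\<^bsub>L\<^esub> n \<otimes>\<^bsub>L\<^esub> z \<otimes>\<^bsub>L\<^esub> z [^]\<^bsub>L\<^esub> i) n"
      unfolding a(2) by (rule L.lsum_smult_right) (use ac zp Xp zc in auto)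
    also have "\<dots> = lsum L (\<lambda>i. ?l (d i)) (\<lambda>i. ?l (x [^] (n - 1 - i))) n"
    proof (rule L.lsum_cong)
      fix i assume i: "i < n"
      have "X' [^]\<^bsub>L\<^esub> n \<otimes>\<^bsub>L\<^esub> z \<otimes>\<^bsub>L\<^esub> z [^]\<^bsub>L\<^esub> i = X' [^]\<^bsub>L\<^esub> (n - 1 - i + Suc i) \<otimes>\<^bsub>L\<^esub> z [^]\<^bsub>L\<^esub> Suc i"
        using i Xp zp zc by (simp add: L.m_ac)
      also have "\<dots> = ?l (x [^] (n - 1 - i))" unfolding red unfolding X'_def by (rule to_loc_pow[OF x(1)])
      finally show "a i \<otimes>\<^bsub>L\<^esub> (X' [^]\<^bsub>L\<^esub> n \<otimes>\<^bsub>L\<^esub> z \<otimes>\<^bsub>L\<^esub> z [^]\<^bsub>L\<^esub> i) = ?l (d i) \<otimes>\<^bsub>L\<^esub> ?l (x [^] (n - 1 - i))"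
        using d by simp
    qed
    also have "\<dots> = ?l (lsum R d (\<lambda>i. x [^] (n - 1 - i)) n)"
      by (rule hom_lsum[OF loc_cring to_loc_hom, symmetric]) (use dc x in auto)
    finally have "?l (x [^] n) = ?l (lsum R d (\<lambda>i. x [^] (n - 1 - i)) n)"
      unfolding X'_def to_loc_pow[OF x(1)] .
    \<comment> \<open>Equality in the localization becomes equality in R after multiplication by
      some x^j. This merely raises the degree of the monic equation.\<close>
    then obtain j :: nat where j: "x [^] j \<otimes> x [^] n = x [^] j \<otimes> lsum R d (\<lambda>i. x [^] (n - 1 - i)) n"
      using to_loc_eq[of "x [^] n" "lsum R d (\<lambda>i. x [^] (n - 1 - i)) n"] dc x by auto
    have "x [^] (j + n) = lsum R d (\<lambda>i. x [^] j \<otimes> x [^] (n - 1 - i)) n"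
      using j x dc by (subst lsum_smult_right[symmetric]) (auto simp: nat_pow_mult[symmetric])
    also have "\<dots> \<in> lspan D x (j + n)"
      by (rule lsum_mem[OF lspan_submod[OF D x(1)]])
        (use d x lspan_pow[OF D x(1)] in \<open>auto simp: nat_pow_mult\<close>)
    finally show False using integral_iff[OF D x(1)] x(2) by blast
  qed
  from L.valuation_exists[OF B0 z0 this] obtain v where v: "is_valuation L v"
    "\<And>f. f \<in> B0 \<Longrightarrow> (f, \<one>\<^bsub>L\<^esub>) \<in> v" "\<And>h. h \<in> carrier L \<Longrightarrow> h \<otimes>\<^bsub>L\<^esub> z = \<one>\<^bsub>L\<^esub> \<Longrightarrow> (h, \<one>\<^bsub>L\<^esub>) \<notin> v" by blast
  show thesis
  proof (rule that)
    show "is_valuation R (pullback_valuation R ?l v)" by (rule valuation_pullback[OF loc_cring to_loc_hom v(1)])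
    show "(x, \<one>) \<notin> pullback_valuation R ?l v"
      using v(3)[OF Xc Xz] by (simp add: pullback_valuation_def X'_def)
    fix f assume f: "f \<in> D"
    have "?l f \<in> B0" unfolding B0_def by (rule L.pset_incl[OF subringE(1)[OF DL] zc]) (use f in auto)
    then show "(f, \<one>) \<in> pullback_valuation R ?l v" using v(2) f DE(1) by (auto simp: pullback_valuation_def)
  qed
qed

lemma integral_closure_valuations:
  assumes D: "subring D R" and x: "x \<in> carrier R"
    and "\<And>v. is_valuation R v \<Longrightarrow> (\<And>f. f \<in> D \<Longrightarrow> (f, \<one>) \<in> v) \<Longrightarrow> (x, \<one>) \<in> v"
  shows "x \<in> integral_closure R D"
  using non_integral_valuation[OF D x] assms(3) by blast

lemma integral_closure_carrier: "x \<in> integral_closure R D \<Longrightarrow> x \<in> carrier R"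
  unfolding integral_closure_def by blast

lemma integral_closure_incl:
  assumes "subring D R" "x \<in> D"
  shows "x \<in> integral_closure R D"
  by (rule integral_closure_valuations[OF assms(1)]) (use subringE(1)[OF assms(1)] assms(2) in auto)

text \<open>Closure under the ring operations is immediate from the description by valuations.\<close>

lemma integral_closure_subring:
  assumes D: "subring D R"
  shows "subring (integral_closure R D) R"
proof (rule subringI)
  show "integral_closure R D \<subseteq> carrier R" using integral_closure_carrier by auto
  show "\<one> \<in> integral_closure R D" using integral_closure_incl[OF D subringE(3)[OF D]] .
  show "\<ominus> h \<in> integral_closure R D" if h: "h \<in> integral_closure R D" for h
    by (rule integral_closure_valuations[OF D])
      (use integral_valuation[OF _ _ D h] integral_closure_carrier[OF h] valuation_uminus in auto)
  fix h k assume h: "h \<in> integral_closure R D" and k: "k \<in> integral_closure R D"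
  show "h \<otimes> k \<in> integral_closure R D"
    by (rule integral_closure_valuations[OF D])
      (use integral_valuation[OF _ _ D h] integral_valuation[OF _ _ D k]
        integral_closure_carrier[OF h] integral_closure_carrier[OF k] valuation_mult_one in auto)
  show "h \<oplus> k \<in> integral_closure R D"
  proof (rule integral_closure_valuations[OF D])
    show "h \<oplus> k \<in> carrier R" using integral_closure_carrier h k by simp
    fix v assume v: "is_valuation R v" "\<And>f. f \<in> D \<Longrightarrow> (f, \<one>) \<in> v"
    show "(h \<oplus> k, \<one>) \<in> v"
      by (rule valuationD(6)[OF v(1) integral_valuation[OF v D h] integral_valuation[OF v D k]])
  qed
qed

lemma integral_closure_root:
  assumes D: "subring D R" and x: "x \<in> carrier R" "x [^] (n::nat) \<in> D" "n > 0"
  shows "x \<in> integral_closure R D"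
proof -
  note S = lspan_submod[OF D x(1), of n]
  have "x [^] n = x [^] n \<otimes> x [^] (0::nat)" using x by simp
  also have "\<dots> \<in> lspan D x n" by (rule submodD(5)[OF S x(2)]) (rule lspan_pow[OF D x(1,3)])
  finally show ?thesis using integral_iff[OF D x(1)] by blast
qed

end

text \<open>The integral equation has coefficients in D, so reducing a high power of x to powers
  below n introduces no new denominator.\<close>

lemma (in subring_elt) integral_bounded:
  assumes "x \<in> integral_closure R D" and K0: "t [^] (K0::nat) \<otimes> x \<in> D"
  obtains K :: nat where "\<And>i::nat. t [^] K \<otimes> x [^] i \<in> D"
proof -
  have x: "x \<in> carrier R" using assms(1) by (rule integral_closure_carrier)
  have xp: "\<And>i::nat. x [^] i \<in> carrier R" using x by simp
  obtain n :: nat where n: "x [^] n \<in> lspan D x n" using integral_iff[OF D x] assms by blast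
  obtain c where c: "\<And>i. c i \<in> D" "x [^] n = lsum R c (\<lambda>i. x [^] i) n" using n unfolding lspan_def by auto
  have cc: "\<And>i. c i \<in> carrier R" using c Dc by auto
  have pw: "t [^] (K0 * i) \<otimes> x [^] i \<in> D" for i :: nat
  proof -
    have "(t [^] K0 \<otimes> x) [^] i \<in> D" by (induction i) (use DE K0 in auto)
    then show ?thesis using x t by (simp add: nat_pow_distrib nat_pow_pow)
  qed
  \<comment> \<open>The powers x^i with i < n have denominators at most t^(K0 i).\<close>
  define K where "K = K0 * n"
  have K: "t [^] K \<otimes> x [^] i \<in> D" if "i < n" for i
    by (rule t_up[OF pw]) (use that xp in \<open>auto simp: K_def\<close>)
  have "t [^] K \<otimes> x [^] i \<in> D" for i :: nat
  proof (induction i rule: less_induct)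
    case (less i)
    show ?case
    proof (cases "i < n")
      case False
      have "x [^] i = x [^] (i - n) \<otimes> x [^] n" using False x by (simp add: nat_pow_mult)
      also have "\<dots> = lsum R c (\<lambda>j. x [^] (i - n) \<otimes> x [^] j) n"
        unfolding c(2) by (rule lsum_smult_right) (use cc xp in auto)
      also have "\<dots> \<in> {y \<in> carrier R. t [^] K \<otimes> y \<in> D}"
        by (rule lsum_mem[OF bounded_submod]) (use c less x False in \<open>auto simp: nat_pow_mult\<close>)
      finally show ?thesis by simp
    qed (use K in simp)
  qed
  then show thesis by (rule that)
qed

section \<open>Power-bounded elements and continuous valuations\<close>

context adic
begin

lemma power_boundedE:
  assumes "x \<in> power_bounded R D t"
  obtains N :: nat where "x \<in> carrier R" "\<And>i::nat. t [^] N \<otimes> x [^] i \<in> D"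
  using assms unfolding power_bounded_def by blast

lemma power_bounded_subringI:
  assumes S: "subring S R" and N: "\<And>z. z \<in> S \<Longrightarrow> t [^] (N::nat) \<otimes> z \<in> D" and x: "x \<in> S"
  shows "x \<in> power_bounded R D t"
proof -
  note SE = subringE[OF S]
  have "x [^] i \<in> S" for i :: nat by (induction i) (use SE x in auto)
  then show ?thesis unfolding power_bounded_def using N SE(1) x by blast
qed

lemma power_bounded_incl: "x \<in> D \<Longrightarrow> x \<in> power_bounded R D t"
  by (rule power_bounded_subringI[OF D, of 0]) (auto simp: Dc)

text \<open>Both elements lie in the common subring D[x][y], whose denominators are bounded by
  t^(N+M). Closure of the power-bounded elements under ring operations follows without estimating
  powers of a sum.\<close>

lemma power_bounded_join:
  assumes "x \<in> power_bounded R D t" "y \<in> power_bounded R D t"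
  obtains S N where "subring S R" "\<And>z. z \<in> S \<Longrightarrow> t [^] (N::nat) \<otimes> z \<in> D" "x \<in> S" "y \<in> S"
proof -
  obtain N :: nat where x: "x \<in> carrier R" "\<And>i::nat. t [^] N \<otimes> x [^] i \<in> D"
    using power_boundedE[OF assms(1)] by blast
  obtain M :: nat where y: "y \<in> carrier R" "\<And>i::nat. t [^] M \<otimes> y [^] i \<in> D"
    using power_boundedE[OF assms(2)] by blast
  have D1: "subring (pset R D x) R" by (rule subring_pset[OF D x(1)])
  have D2: "subring (pset R (pset R D x) y) R" by (rule subring_pset[OF D1 y(1)])
  have b1: "t [^] N \<otimes> z \<in> D" if z: "z \<in> pset R D x" for z
  proof -
    obtain a n where a: "\<And>i. a i \<in> D" "z = lsum R a (\<lambda>i. x [^] i) n" using z by (auto elim!: psetE)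
    have "z \<in> {y \<in> carrier R. t [^] N \<otimes> y \<in> D}"
      unfolding a by (rule lsum_mem[OF bounded_submod]) (use a x in auto)
    then show ?thesis by simp
  qed
  have P1c: "\<And>z. z \<in> pset R D x \<Longrightarrow> z \<in> carrier R" using subringE(1)[OF D1] by auto
  have b2: "t [^] (N + M) \<otimes> z \<in> D" if z: "z \<in> pset R (pset R D x) y" for z
  proof -
    obtain a n where a: "\<And>i. a i \<in> pset R D x" "z = lsum R a (\<lambda>i. y [^] i) n" using z by (auto elim!: psetE)
    have "t [^] (N + M) \<otimes> z = lsum R (\<lambda>i. t [^] N \<otimes> a i) (\<lambda>i. t [^] M \<otimes> y [^] i) n"
    proof -
      have "t [^] (N + M) \<otimes> z = t [^] N \<otimes> (t [^] M \<otimes> z)"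
        using P1c a y t by (simp add: nat_pow_mult[symmetric] m_assoc)
      also have "\<dots> = t [^] N \<otimes> lsum R a (\<lambda>i. t [^] M \<otimes> y [^] i) n"
        unfolding a by (subst lsum_smult_right) (use P1c a y in auto)
      also have "\<dots> = lsum R (\<lambda>i. t [^] N \<otimes> a i) (\<lambda>i. t [^] M \<otimes> y [^] i) n"
        by (rule lsum_smult) (use P1c a y in auto)
      finally show ?thesis .
    qed
    also have "\<dots> \<in> D" by (rule lsum_mem[OF subring_submod[OF D]]) (use b1 a y in auto)
    finally show ?thesis .
  qed
  have "x \<in> pset R (pset R D x) y" by (rule pset_incl[OF subringE(1)[OF D1] y(1) gen_in_pset[OF D x(1)]])
  then show thesis using that[OF D2 b2] gen_in_pset[OF D1 y(1)] by blast
qed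

lemma power_bounded_subring: "subring (power_bounded R D t) R"
proof (rule subringI)
  show "power_bounded R D t \<subseteq> carrier R" unfolding power_bounded_def by auto
  show "\<one> \<in> power_bounded R D t" by (rule power_bounded_incl) (rule DE(3))
  fix h k assume h: "h \<in> power_bounded R D t"
  show "\<ominus> h \<in> power_bounded R D t"
    using power_bounded_join[OF h h] power_bounded_subringI subringE(5) by metis
  assume k: "k \<in> power_bounded R D t"
  obtain S N where S: "subring S R" "\<And>z. z \<in> S \<Longrightarrow> t [^] (N::nat) \<otimes> z \<in> D" "h \<in> S" "k \<in> S"
    using power_bounded_join[OF h k] by blast
  show "h \<otimes> k \<in> power_bounded R D t" "h \<oplus> k \<in> power_bounded R D t"
    using power_bounded_subringI[OF S(1,2)] subringE(6,7)[OF S(1) S(3,4)] by blast+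
qed

text \<open>Identifying the elements smaller than all powers of \<open>t\<close> with \<open>0\<close> makes a valuation continuous.\<close>

lemma truncate_valuation:
  assumes u: "s \<in> carrier R" "s \<otimes> t = \<one>" and v: "is_valuation R v" and D1: "\<And>f. f \<in> D \<Longrightarrow> (f, \<one>) \<in> v"
    and t1: "(\<one>, t) \<notin> v"
  obtains w where "w \<in> Cont R D t" "v \<subseteq> w" "\<And>h. (h, \<one>) \<in> w \<Longrightarrow> (h, \<one>) \<in> v"
proof -
  note V = valuationD[OF v]
  \<comment> \<open>These elements become the support of w. As |t| < 1, the element 1 is not among
    them.\<close>
  define z where "z a \<longleftrightarrow> (\<forall>N::nat. (a, t [^] N) \<in> v)" for a
  define w where "w = {(a, b). a \<in> carrier R \<and> b \<in> carrier R \<and> ((a, b) \<in> v \<or> z a)}"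
  have tnz: "(t [^] (N::nat), \<zero>) \<notin> v" for N
    by (rule valuation_unit[OF v, of _ "s [^] N"])
      (use u t in \<open>auto simp: nat_pow_distrib[symmetric] m_comm\<close>)
  have cancel: "(a, b) \<in> v" if "(a \<otimes> t [^] N, b \<otimes> t [^] N) \<in> v" "a \<in> carrier R" "b \<in> carrier R" for a b and N :: nat
    using V(8)[OF that(1) tnz] that by simp
  have zmono: "z a" if "(a, b) \<in> v" "z b" for a b using that V(4) unfolding z_def by blast
  have z1: "\<not> z \<one>"
  proof
    assume "z \<one>"
    then have "(\<one>, t [^] (1::nat)) \<in> v" unfolding z_def by blast
    then show False using t1 t by simp
  qed
  have z0: "z \<zero>" unfolding z_def using valuation_zero[OF v] by simp
  have zmult: "z (a \<otimes> c)" if "z a" "a \<in> carrier R" "c \<in> carrier R" for a c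
    unfolding z_def
  proof
    fix N
    obtain K :: nat where K: "t [^] K \<otimes> c \<in> D" using absorb \<open>c \<in> _\<close> by blast
    have "(a, t [^] (N + K)) \<in> v" using \<open>z a\<close> unfolding z_def by blast
    from valuation_mult[OF v this D1[OF K]] have "((a \<otimes> c) \<otimes> t [^] K, t [^] N \<otimes> t [^] K) \<in> v"
      using that t by (simp add: nat_pow_mult m_ac add.commute)
    then show "(a \<otimes> c, t [^] N) \<in> v" by (rule cancel) (use that in auto)
  qed
  have zcancel: "z a" if "z (a \<otimes> c)" "\<not> z c" "a \<in> carrier R" "c \<in> carrier R" for a c
    unfolding z_def
  proof
    fix N
    obtain M :: nat where "(c, t [^] M) \<notin> v" using \<open>\<not> z c\<close> unfolding z_def by blast
    then have "(t [^] M, c) \<in> v" using V(3) that by simp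
    from valuation_mult[OF v valuation_refl[OF v that(3)] this] have 1: "(a \<otimes> t [^] M, a \<otimes> c) \<in> v" .
    have "(a \<otimes> c, t [^] (N + M)) \<in> v" using \<open>z (a \<otimes> c)\<close> unfolding z_def by blast
    then have "(a \<otimes> c, t [^] N \<otimes> t [^] M) \<in> v" using t by (simp add: nat_pow_mult)
    then have "(a \<otimes> t [^] M, t [^] N \<otimes> t [^] M) \<in> v" using 1 V(4) by blast
    then show "(a, t [^] N) \<in> v" by (rule cancel) (use that in auto)
  qed
  have znle: "(a, c) \<in> v" if "z a" "\<not> z c" "c \<in> carrier R" for a c
  proof -
    obtain M :: nat where "(c, t [^] M) \<notin> v" using \<open>\<not> z c\<close> unfolding z_def by blast
    then have "(t [^] M, c) \<in> v" using V(3) that by simp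
    then show ?thesis using \<open>z a\<close> V(4) unfolding z_def by blast
  qed
  have zadd: "z (a \<oplus> b)" if "z a" "z b" for a b using that V(6) unfolding z_def by blast
  have val: "is_valuation R w"
    unfolding is_valuation_def
  proof (intro conjI ballI impI; (elim conjE)?)
    show "w \<subseteq> carrier R \<times> carrier R" by (auto simp: w_def)
    show "trans w" unfolding trans_def w_def using zmono V(4) by blast
    show "(\<one>, \<zero>) \<notin> w" using z1 V(5) by (simp add: w_def)
  next
    fix a b assume "a \<in> carrier R" "b \<in> carrier R"
    then show "(a, b) \<in> w \<or> (b, a) \<in> w" using V(3) unfolding w_def by blast
  next
    fix a b c assume c: "a \<in> carrier R" "b \<in> carrier R" "c \<in> carrier R" and ac: "(a, c) \<in> w" and bc: "(b, c) \<in> w"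
    show "(a \<oplus> b, c) \<in> w"
    proof (cases "z c")
      case True
      then have "z a" "z b" using ac bc zmono unfolding w_def by blast+
      then show ?thesis using zadd c unfolding w_def by auto
    next
      case False
      then have "(a, c) \<in> v" "(b, c) \<in> v" using ac bc znle c unfolding w_def by blast+
      then show ?thesis using V(6) c unfolding w_def by auto
    qed
  next
    fix a b c assume "a \<in> carrier R" "b \<in> carrier R" "c \<in> carrier R" "(a, b) \<in> w"
    then show "(a \<otimes> c, b \<otimes> c) \<in> w" using V(7) zmult unfolding w_def by auto
  next
    fix a b c assume c: "a \<in> carrier R" "b \<in> carrier R" "c \<in> carrier R" and
      m: "(a \<otimes> c, b \<otimes> c) \<in> w" and n: "(c, \<zero>) \<notin> w"
    have nz: "\<not> z c" "(c, \<zero>) \<notin> v" using n c unfolding w_def by auto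
    show "(a, b) \<in> w"
    proof (cases "z (a \<otimes> c)")
      case True
      then show ?thesis using zcancel nz c unfolding w_def by auto
    next
      case False
      then have "(a \<otimes> c, b \<otimes> c) \<in> v" using m unfolding w_def by auto
      then show ?thesis using V(8) nz c unfolding w_def by auto
    qed
  qed
  have "adic_open R D t {a \<in> carrier R. (b, a \<otimes> c) \<notin> w}"
    if b: "b \<in> carrier R" "(b, \<zero>) \<notin> w" and c: "c \<in> carrier R" for b c
  proof -
    have nb: "\<not> z b" using b unfolding w_def by auto
    \<comment> \<open>M is chosen with |t^M| < |b| and K bounds c, so any y in t^(M+K) D satisfies
      |y c| <= |t^M| < |b| and cannot change the truth of |x c| < |b|.\<close>
    obtain M :: nat where M: "(b, t [^] M) \<notin> v" using nb unfolding z_def by blast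
    obtain K :: nat where K: "t [^] K \<otimes> c \<in> D" using absorb c by blast
    have "(b, (x \<oplus> y) \<otimes> c) \<notin> w" if x: "x \<in> carrier R" "(b, x \<otimes> c) \<notin> w" and y: "y \<in> nb (M + K)" for x y
    proof
      assume "(b, (x \<oplus> y) \<otimes> c) \<in> w"
      then have le: "(b, (x \<oplus> y) \<otimes> c) \<in> v" using nb unfolding w_def by auto
      have yc: "y \<in> carrier R" using y nb_carrier by blast
      obtain d where d: "d \<in> D" "y = t [^] (M + K) \<otimes> d" using y by (rule nbE)
      have "y \<otimes> c = t [^] M \<otimes> (d \<otimes> (t [^] K \<otimes> c))"
        unfolding d using d Dc c t by (simp add: nat_pow_mult[symmetric] m_ac)
      moreover have "(t [^] M \<otimes> (d \<otimes> (t [^] K \<otimes> c)), t [^] M \<otimes> \<one>) \<in> v"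
        by (rule valuation_mult[OF v valuation_refl[OF v]]) (use D1 DE(6) d K in auto)
      ultimately have y1: "(y \<otimes> c, t [^] M) \<in> v" by simp
      have dist: "(x \<oplus> y) \<otimes> c = x \<otimes> c \<oplus> y \<otimes> c" using x yc c by (simp add: l_distr)
      have xyc: "x \<otimes> c \<in> carrier R" "y \<otimes> c \<in> carrier R" using x yc c by auto
      show False
      proof (cases "(x \<otimes> c, y \<otimes> c) \<in> v")
        case True
        then have "((x \<oplus> y) \<otimes> c, y \<otimes> c) \<in> v" unfolding dist using V(6) valuation_refl[OF v] xyc by blast
        then have "(b, t [^] M) \<in> v" using le y1 V(4) by blast
        then show False using M by blast
      next
        case False
        then have "(y \<otimes> c, x \<otimes> c) \<in> v" using V(3) xyc by blast
        then have "((x \<oplus> y) \<otimes> c, x \<otimes> c) \<in> v" unfolding dist using V(6) valuation_refl[OF v] xyc by blast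
        then have "(b, x \<otimes> c) \<in> v" using le V(4) by blast
        then show False using x b xyc unfolding w_def by auto
      qed
    qed
    then show ?thesis unfolding adic_open_def using nb_carrier by blast
  qed
  then have "w \<in> Cont R D t" unfolding Cont_def using val by blast
  moreover have "v \<subseteq> w" unfolding w_def using V(1,2) by auto
  moreover have "(h, \<one>) \<in> v" if "(h, \<one>) \<in> w" for h using that znle z1 unfolding w_def by auto
  ultimately show thesis by (rule that)
qed

text \<open>Integral elements are power bounded, so h is not integral over D and some valuation
  bounded by 1 on D has |h| > 1. Then |t| < 1 is automatic: for |t| >= 1 one would get |h| <= |t^N
  h| <= 1 as soon as t^N h lies in D. So \<open>truncate_valuation\<close> applies and keeps |h| >
  1.\<close>

lemma unbounded_valuation:
  assumes u: "s \<in> carrier R" "s \<otimes> t = \<one>" and h: "h \<in> carrier R" "h \<notin> power_bounded R D t"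
  obtains w where "w \<in> Cont R D t" "\<And>f. f \<in> D \<Longrightarrow> (f, \<one>) \<in> w" "(h, \<one>) \<notin> w"
proof -
  have "h \<notin> integral_closure R D"
  proof
    assume hi: "h \<in> integral_closure R D"
    obtain K0 :: nat where "t [^] K0 \<otimes> h \<in> D" using absorb h by blast
    from integral_bounded[OF hi this] obtain K :: nat where "\<And>i::nat. t [^] K \<otimes> h [^] i \<in> D" by blast
    then show False using h unfolding power_bounded_def by blast
  qed
  from non_integral_valuation[OF D h(1) this] obtain v where
    v: "is_valuation R v" "\<And>f. f \<in> D \<Longrightarrow> (f, \<one>) \<in> v" "(h, \<one>) \<notin> v" by blast
  note V = valuationD[OF v(1)]
  have "(\<one>, t) \<notin> v"
  proof
    assume o: "(\<one>, t) \<in> v"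
    obtain N :: nat where N: "t [^] N \<otimes> h \<in> D" using absorb h by blast
    have "(\<one> [^] N, t [^] N) \<in> v" by (rule valuation_pow[OF v(1) o])
    from valuation_mult[OF v(1) this valuation_refl[OF v(1) h(1)]] have "(h, t [^] N \<otimes> h) \<in> v" using h by simp
    then show False using V(4) v N by blast
  qed
  from truncate_valuation[OF u v(1,2) this] obtain w where "w \<in> Cont R D t" "v \<subseteq> w"
    "\<And>h. (h, \<one>) \<in> w \<Longrightarrow> (h, \<one>) \<in> v" by blast
  then show thesis using that[of w] v by blast
qed

end

section \<open>The ring of integers of \<open>K\<close>\<close>

lemma (in cring) subring_nat_elem:
  assumes "subring H R"
  shows "nat_elem R n \<in> H"
proof -
  have "[n] \<cdot> \<one> \<in> H" by (induction n) (use subringE[OF assms] in auto)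
  then show ?thesis by (simp add: nat_elem_def)
qed

lemma (in cring) subring_cring: "subring H R \<Longrightarrow> cring (R\<lparr>carrier := H\<rparr>)"
  using subcring_iff[OF subringE(1)] subcringI' by blast

lemma (in cring) power_tower:
  assumes "\<And>k. x k \<in> carrier R" "\<And>k. x (Suc k) [^] (p::nat) = x k"
  shows "x (k + l) [^] (p ^ l) = x k"
proof (induction l)
  case 0
  show ?case using assms(1) by simp
next
  case (Suc l)
  have "x (k + Suc l) [^] (p ^ Suc l) = (x (Suc (k + l)) [^] p) [^] (p ^ l)"
    using assms(1) by (simp add: nat_pow_pow)
  then show ?case using Suc assms(2) by simp
qed

lemma Zp_cring: "cring (Zp_ring p)"
proof -
  have "adic \<Z> (carrier \<Z>) (nat_elem \<Z> p)"
    by (rule cring.adic_whole[OF int_is_cring cring.nat_elem_closed[OF int_is_cring]])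
  then show ?thesis unfolding Zp_ring_def by (rule adic.Rh_cring)
qed

locale K_setup =
  fixes p :: nat
  assumes p0: "p > 0"
begin

abbreviation "ZZ \<equiv> Zp_ring p"
abbreviation "pz \<equiv> nat_elem ZZ p"
abbreviation "QQ \<equiv> Qp_field p"
abbreviation "pq \<equiv> nat_elem QQ p"
abbreviation "LL \<equiv> L_field p"
abbreviation "pl \<equiv> nat_elem LL p"
abbreviation "OL \<equiv> L_ints p"
abbreviation "KK \<equiv> K_field p"
abbreviation "pk \<equiv> nat_elem KK p"

sublocale ZZ: cring ZZ by (rule Zp_cring)

sublocale ZQ: loc_elt ZZ pz by unfold_locales simp

lemma QQ_eq: "QQ = localization ZZ pz" by (simp add: Qp_field_def)

sublocale QQ: cring QQ unfolding QQ_eq by (rule ZQ.loc_cring)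

sublocale QL: adjoin QQ p "{()}" "\<lambda>_. pq" by unfold_locales simp

lemma LL_eq: "LL = adjoin_roots QQ p {()} (\<lambda>_. pq)" by (simp add: L_field_def)

sublocale LL: cring LL unfolding LL_eq by (rule QL.E_cring)

definition "ZtoL = (\<lambda>z. adjoin_const QQ p {()} (\<lambda>_. pq) (to_loc ZZ pz z))"

lemma QL_hom: "adjoin_const QQ p {()} (\<lambda>_. pq) \<in> ring_hom QQ LL"
  unfolding LL_eq by (rule QL.const_hom)

lemma ZQ_hom: "to_loc ZZ pz \<in> ring_hom ZZ QQ"
  unfolding QQ_eq by (rule ZQ.to_loc_hom)

lemma ZL_hom: "ZtoL \<in> ring_hom ZZ LL"
  using ring_hom_trans[OF ZQ_hom QL_hom] by (simp add: ZtoL_def comp_def)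

lemma ZL_subring: "subring (ZtoL ` carrier ZZ) LL"
proof -
  interpret h: ring_hom_ring ZZ LL ZtoL
    by (rule ring_hom_ringI2[OF ZZ.ring_axioms LL.ring_axioms ZL_hom])
  show ?thesis by (rule h.img_is_subring[OF ZZ.carrier_is_subring])
qed

lemma OL_eq: "OL = integral_closure LL (ZtoL ` carrier ZZ)"
  by (simp add: L_ints_def ZtoL_def)

lemma OL_subring: "subring OL LL"
  unfolding OL_eq by (rule LL.integral_closure_subring[OF ZL_subring])

definition "rt k = adjoined_root QQ p {()} (\<lambda>_. pq) () k"

lemma rt_closed: "rt k \<in> carrier LL"
  unfolding rt_def LL_eq by (rule QL.root_closed) simp

lemma rt_Suc: "rt (Suc k) [^]\<^bsub>LL\<^esub> p = rt k"
  unfolding rt_def LL_eq by (rule QL.root_Suc) simp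

lemma rt_0: "rt 0 = pl"
proof -
  have "rt 0 = adjoin_const QQ p {()} (\<lambda>_. pq) pq" unfolding rt_def by (rule QL.root_0) simp
  then show ?thesis using QQ.nat_elem_hom[OF LL.cring_axioms QL_hom] by simp
qed

lemma OL_root: "rt k \<in> OL"
proof -
  have "rt (0 + k) [^]\<^bsub>LL\<^esub> (p ^ k) = rt 0" by (rule LL.power_tower[of rt p, OF rt_closed rt_Suc])
  then have "rt k [^]\<^bsub>LL\<^esub> (p ^ k) \<in> ZtoL ` carrier ZZ"
    using LL.subring_nat_elem[OF ZL_subring] rt_0 by simp
  then show ?thesis unfolding OL_eq
    by (rule LL.integral_closure_root[OF ZL_subring rt_closed]) (use p0 in simp)
qed

text \<open>The ring of integers of L becomes L after inverting p. The elements with bounded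
  denominator form a subring that contains Q_p, whose elements are fractions z/p^k, and the roots of
  p, which are integral.\<close>

lemma OL_absorb:
  assumes "x \<in> carrier LL"
  shows "\<exists>N::nat. pl [^]\<^bsub>LL\<^esub> N \<otimes>\<^bsub>LL\<^esub> x \<in> OL"
proof -
  note OE = subringE[OF OL_subring]
  have Oc: "\<And>y. y \<in> OL \<Longrightarrow> y \<in> carrier LL" using OE(1) by auto
  have pO: "pl \<in> OL" by (rule LL.subring_nat_elem[OF OL_subring])
  have pp: "pl [^]\<^bsub>LL\<^esub> (n::nat) \<in> OL" for n by (induction n) (use OE pO in auto)
  define S where "S = {x \<in> carrier LL. \<exists>N::nat. pl [^]\<^bsub>LL\<^esub> N \<otimes>\<^bsub>LL\<^esub> x \<in> OL}"
  have OS: "x \<in> S" if "x \<in> OL" for x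
    unfolding S_def using that Oc by (intro CollectI conjI exI[of _ 0]) auto
  have S: "subring S LL"
  proof (rule LL.subringI)
    show "S \<subseteq> carrier LL" by (auto simp: S_def)
    show "\<one>\<^bsub>LL\<^esub> \<in> S" using OS OE(3) by simp
    fix h assume h: "h \<in> S"
    then obtain N :: nat where N: "h \<in> carrier LL" "pl [^]\<^bsub>LL\<^esub> N \<otimes>\<^bsub>LL\<^esub> h \<in> OL" unfolding S_def by blast
    have "pl [^]\<^bsub>LL\<^esub> N \<otimes>\<^bsub>LL\<^esub> (\<ominus>\<^bsub>LL\<^esub> h) \<in> OL" using OE(5)[OF N(2)] N(1) by (simp add: LL.r_minus)
    then show "\<ominus>\<^bsub>LL\<^esub> h \<in> S" unfolding S_def using N by blast
    fix k assume k: "k \<in> S"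
    then obtain M :: nat where M: "k \<in> carrier LL" "pl [^]\<^bsub>LL\<^esub> M \<otimes>\<^bsub>LL\<^esub> k \<in> OL" unfolding S_def by blast
    have "pl [^]\<^bsub>LL\<^esub> (N + M) \<otimes>\<^bsub>LL\<^esub> (h \<otimes>\<^bsub>LL\<^esub> k) = (pl [^]\<^bsub>LL\<^esub> N \<otimes>\<^bsub>LL\<^esub> h) \<otimes>\<^bsub>LL\<^esub> (pl [^]\<^bsub>LL\<^esub> M \<otimes>\<^bsub>LL\<^esub> k)"
      using N M by (simp add: LL.nat_pow_mult[symmetric] LL.m_ac)
    then show "h \<otimes>\<^bsub>LL\<^esub> k \<in> S" unfolding S_def using N M OE(6)
      by (intro CollectI conjI exI[of _ "N + M"]) auto
    have "pl [^]\<^bsub>LL\<^esub> (N + M) \<otimes>\<^bsub>LL\<^esub> (h \<oplus>\<^bsub>LL\<^esub> k) = pl [^]\<^bsub>LL\<^esub> M \<otimes>\<^bsub>LL\<^esub> (pl [^]\<^bsub>LL\<^esub> N \<otimes>\<^bsub>LL\<^esub> h) \<oplus>\<^bsub>LL\<^esub> pl [^]\<^bsub>LL\<^esub> N \<otimes>\<^bsub>LL\<^esub> (pl [^]\<^bsub>LL\<^esub> M \<otimes>\<^bsub>LL\<^esub> k)"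
      using N M by (simp add: LL.nat_pow_mult[symmetric] LL.m_ac LL.r_distr LL.l_distr)
    then show "h \<oplus>\<^bsub>LL\<^esub> k \<in> S" unfolding S_def using N M OE(6,7) pp
      by (intro CollectI conjI exI[of _ "N + M"]) auto
  qed
  have "adjoin_const QQ p {()} (\<lambda>_. pq) a \<in> S" if a: "a \<in> carrier QQ" for a
  proof -
    obtain z k where z: "z \<in> carrier ZZ" "a = fraction ZZ pz z k"
      using a unfolding QQ_eq by (rule ZQ.loc_carrierE)
    have tz: "to_loc ZZ pz pz = pq" using ZZ.nat_elem_hom[OF QQ.cring_axioms ZQ_hom] by simp
    have "a \<otimes>\<^bsub>QQ\<^esub> pq [^]\<^bsub>QQ\<^esub> k = to_loc ZZ pz z"
      using ZQ.fraction_cancel[OF z(1), of k] unfolding z(2) QQ_eq[symmetric] tz .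
    then have "adjoin_const QQ p {()} (\<lambda>_. pq) (a \<otimes>\<^bsub>QQ\<^esub> pq [^]\<^bsub>QQ\<^esub> k) = ZtoL z" by (simp add: ZtoL_def)
    moreover have "adjoin_const QQ p {()} (\<lambda>_. pq) (pq [^]\<^bsub>QQ\<^esub> k) = pl [^]\<^bsub>LL\<^esub> k"
    proof (induction k)
      case 0
      show ?case using ring_hom_one[OF QL_hom] by simp
    next
      case (Suc k)
      then show ?case using ring_hom_mult[OF QL_hom] QQ.nat_elem_hom[OF LL.cring_axioms QL_hom] by simp
    qed
    ultimately have "adjoin_const QQ p {()} (\<lambda>_. pq) a \<otimes>\<^bsub>LL\<^esub> pl [^]\<^bsub>LL\<^esub> k = ZtoL z"
      using ring_hom_mult[OF QL_hom a, of "pq [^]\<^bsub>QQ\<^esub> k"] by simp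
    moreover have "ZtoL z \<in> OL" unfolding OL_eq
      by (rule LL.integral_closure_incl[OF ZL_subring]) (use z in simp)
    moreover have ac: "adjoin_const QQ p {()} (\<lambda>_. pq) a \<in> carrier LL" using ring_hom_closed[OF QL_hom a] .
    ultimately have "pl [^]\<^bsub>LL\<^esub> k \<otimes>\<^bsub>LL\<^esub> adjoin_const QQ p {()} (\<lambda>_. pq) a \<in> OL" using LL.m_comm by simp
    then show ?thesis unfolding S_def using ac by blast
  qed
  moreover have "adjoined_root QQ p {()} (\<lambda>_. pq) i k \<in> S" for i k
    using OS[OF OL_root] unfolding rt_def by (cases i) simp
  ultimately have "x \<in> S"
    using QL.E_generated[of S x] S assms unfolding LL_eq by blast
  then show ?thesis unfolding S_def by blast
qed

sublocale LA: adic LL OL pl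
proof (intro adic.intro subring_elt.intro subring_elt_axioms.intro adic_axioms.intro LL.cring_axioms OL_subring OL_absorb)
  show "pl \<in> OL" by (rule LL.subring_nat_elem[OF OL_subring])
qed

lemma KK_eq: "KK = completion LL OL pl" by (simp add: K_field_def)

sublocale KK: cring KK unfolding KK_eq by (rule LA.Rh_cring)

definition "OK = completion_subring LL OL pl"

lemma LK_hom: "to_completion LL OL pl \<in> ring_hom LL KK"
  unfolding KK_eq by (rule LA.to_completion_hom)

lemma pk_eq: "to_completion LL OL pl pl = pk"
  using LL.nat_elem_hom[OF KK.cring_axioms LK_hom] .

sublocale KA: adic KK OK pk
  using LA.Rh_adic unfolding KK_eq[symmetric] OK_def[symmetric] pk_eq .

lemma K_ints_eq: "K_ints p = KK\<lparr>carrier := power_bounded KK OK pk\<rparr>"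
  by (simp add: K_ints_def OK_def)

lemma K_ints_cring: "cring (K_ints p)"
  unfolding K_ints_eq by (rule KK.subring_cring[OF KA.power_bounded_subring])

lemma K_root_eq: "K_root p k = to_completion LL OL pl (rt k)"
  by (simp add: K_root_def rt_def)

lemma K_root_closed: "K_root p k \<in> carrier (K_ints p)"
proof -
  have "K_root p k \<in> OK" unfolding K_root_eq OK_def using LA.to_completion_D[OF rt_closed] OL_root by simp
  then show ?thesis unfolding K_ints_eq using KA.power_bounded_incl by simp
qed

lemma K_root_Suc: "K_root p (Suc k) [^]\<^bsub>K_ints p\<^esub> p = K_root p k"
proof -
  have "K_root p (Suc k) [^]\<^bsub>KK\<^esub> p = K_root p k"
    unfolding K_root_eq KK_eq using LA.to_completion_pow[OF rt_closed, of "Suc k" p] rt_Suc by simp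
  then show ?thesis unfolding K_ints_eq
    using KK.nat_pow_consistent[of "K_root p (Suc k)" p "power_bounded KK OK pk"] by simp
qed

lemma nat_elem_K_ints: "nat_elem (K_ints p) n = nat_elem KK n"
  unfolding nat_elem_def K_ints_eq add_pow_def by simp (simp add: nat_pow_def)

lemma K_root_0: "K_root p 0 = nat_elem (K_ints p) p"
  unfolding K_root_eq rt_0 pk_eq nat_elem_K_ints ..

text \<open>p is invertible in K, already in Q_p. The lemma feeds \<open>flat_regular\<close>, which
  carries regularity of p over to flat algebras.\<close>

lemma K_ints_regular:
  assumes "x \<in> carrier (K_ints p)" "nat_elem (K_ints p) p \<otimes>\<^bsub>K_ints p\<^esub> x = \<zero>\<^bsub>K_ints p\<^esub>"
  shows "x = \<zero>\<^bsub>K_ints p\<^esub>"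
proof -
  have x: "x \<in> carrier KK" "pk \<otimes>\<^bsub>KK\<^esub> x = \<zero>\<^bsub>KK\<^esub>"
    using assms unfolding nat_elem_K_ints unfolding K_ints_eq power_bounded_def by auto
  define s where "s = to_completion LL OL pl (adjoin_const QQ p {()} (\<lambda>_. pq) (fraction ZZ pz \<one>\<^bsub>ZZ\<^esub> 1))"
  have f: "fraction ZZ pz \<one>\<^bsub>ZZ\<^esub> 1 \<in> carrier QQ" unfolding QQ_eq by simp
  have tz: "to_loc ZZ pz pz = pq" using ZZ.nat_elem_hom[OF QQ.cring_axioms ZQ_hom] by simp
  have 1: "fraction ZZ pz \<one>\<^bsub>ZZ\<^esub> 1 \<otimes>\<^bsub>QQ\<^esub> pq = \<one>\<^bsub>QQ\<^esub>"
    using ZQ.inverse_t unfolding QQ_eq[symmetric] tz .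
  have h: "to_completion LL OL pl \<circ> adjoin_const QQ p {()} (\<lambda>_. pq) \<in> ring_hom QQ KK"
    by (rule ring_hom_trans[OF QL_hom LK_hom])
  have s: "s \<in> carrier KK" "s \<otimes>\<^bsub>KK\<^esub> pk = \<one>\<^bsub>KK\<^esub>"
    using ring_hom_closed[OF h f] ring_hom_mult[OF h f, of pq] ring_hom_one[OF h] 1 QQ.nat_elem_hom[OF KK.cring_axioms h]
    unfolding s_def comp_def by auto
  have "x = (s \<otimes>\<^bsub>KK\<^esub> pk) \<otimes>\<^bsub>KK\<^esub> x" using s x by simp
  also have "\<dots> = s \<otimes>\<^bsub>KK\<^esub> (pk \<otimes>\<^bsub>KK\<^esub> x)" by (rule KK.m_assoc) (use s x in auto)
  also have "\<dots> = \<zero>\<^bsub>KK\<^esub>" using s x by simp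
  finally show ?thesis unfolding K_ints_eq by simp
qed

end

section \<open>Flat algebras\<close>

definition const_fun_set :: "'a \<Rightarrow> (nat \<Rightarrow> 'a) set" where "const_fun_set x = {\<lambda>_. x}"

definition unconst :: "(nat \<Rightarrow> 'a) set \<Rightarrow> 'a" where "unconst C = the_elem C 0"

lemma unconst [simp]: "unconst (const_fun_set x) = x"
  by (simp add: unconst_def const_fun_set_def)

text \<open>\<open>flat\<close> quantifies over test modules whose carriers consist of sets of
  sequences. R is placed there as the singletons of constant sequences; the fields
  \<open>mult\<close> and \<open>one\<close> carry no meaning.\<close>

definition self_module :: "('a, 'b) ring_scheme \<Rightarrow> ('a, (nat \<Rightarrow> 'a) set) module" where
  "self_module R = \<lparr> carrier = const_fun_set ` carrier R, mult = (\<lambda>_ _. undefined), one = undefined,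
     zero = const_fun_set \<zero>\<^bsub>R\<^esub>, add = (\<lambda>C E. const_fun_set (unconst C \<oplus>\<^bsub>R\<^esub> unconst E)),
     smult = (\<lambda>a C. const_fun_set (a \<otimes>\<^bsub>R\<^esub> unconst C)) \<rparr>"

lemma (in cring) self_module_module: "module R (self_module R)"
proof (rule moduleI)
  show "cring R" by (rule cring_axioms)
  show "abelian_group (self_module R)"
  proof (rule abelian_groupI)
    show "\<exists>y\<in>carrier (self_module R). y \<oplus>\<^bsub>self_module R\<^esub> x = \<zero>\<^bsub>self_module R\<^esub>"
      if "x \<in> carrier (self_module R)" for x
      using that by (auto simp: self_module_def l_neg intro!: bexI[of _ "\<ominus> unconst x"])
  qed (auto simp: self_module_def a_ac)
qed (auto simp: self_module_def l_distr r_distr m_assoc)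

lemma tensor_rel_minus: "z \<in> tensor_rel R M N \<Longrightarrow> - z \<in> tensor_rel R M N"
  using tensor_rel.diff[OF tensor_rel.zero, of z R M N] by simp

lemma tensor_rel_add: "z \<in> tensor_rel R M N \<Longrightarrow> w \<in> tensor_rel R M N \<Longrightarrow> z + w \<in> tensor_rel R M N"
  using tensor_rel.diff[OF _ tensor_rel_minus, of z R M N w] by simp

lemma tensor_class_eq: "z - w \<in> tensor_rel R M N \<Longrightarrow> tensor_class R M N z = tensor_class R M N w"
proof -
  have sub: "tensor_class R M N z \<subseteq> tensor_class R M N w" if zw: "z - w \<in> tensor_rel R M N" for z w
  proof
    fix x assume "x \<in> tensor_class R M N z"
    then obtain r where r: "x = z + r" "r \<in> tensor_rel R M N" unfolding tensor_class_def by auto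
    have "x = w + ((z - w) + r)" using r by simp
    then show "x \<in> tensor_class R M N w" unfolding tensor_class_def using tensor_rel_add[OF zw r(2)] by blast
  qed
  assume "z - w \<in> tensor_rel R M N"
  then show ?thesis using sub[of z w] sub[of w z] tensor_rel_minus[of "z - w"] by auto
qed

lemma tensor_class_self: "z \<in> tensor_class R M N z"
  unfolding tensor_class_def using tensor_rel.zero by (intro CollectI exI[of _ 0]) auto

lemma frag_extend_tensor_rel:
  assumes "u \<in> mod_hom R M M'" "z \<in> tensor_rel R M N"
  shows "frag_extend (\<lambda>(x, y). frag_of (u x, y)) z \<in> tensor_rel R M' N"
  using assms(2)
proof (induction rule: tensor_rel.induct)
  case zero
  show ?case by (simp add: tensor_rel.zero)
next
  case (diff z w)
  then show ?case by (simp add: frag_extend_diff tensor_rel.diff)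
next
  case (addl x x' y)
  then show ?case using assms(1) tensor_rel.addl[of "u x" M' "u x'" y N R]
    by (simp add: frag_extend_diff mod_hom_def)
next
  case (addr x y y')
  then show ?case using assms(1) tensor_rel.addr[of "u x" M' y N y' R]
    by (simp add: frag_extend_diff mod_hom_def)
next
  case (smult a x y)
  then show ?case using assms(1) tensor_rel.smult[of a R "u x" M' y N]
    by (simp add: frag_extend_diff mod_hom_def)
qed

lemma tensor_map_class:
  assumes "u \<in> mod_hom R M M'"
  shows "tensor_map R M' N u (tensor_class R M N z)
    = tensor_class R M' N (frag_extend (\<lambda>(x, y). frag_of (u x, y)) z)"
proof -
  have "tensor_class R M' N (frag_extend (\<lambda>(x, y). frag_of (u x, y)) w)
      = tensor_class R M' N (frag_extend (\<lambda>(x, y). frag_of (u x, y)) z)" if w: "w \<in> tensor_class R M N z" for w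
  proof -
    obtain r where r: "w = z + r" "r \<in> tensor_rel R M N" using w unfolding tensor_class_def by auto
    show ?thesis by (rule tensor_class_eq) (use frag_extend_tensor_rel[OF assms r(2)] r in \<open>simp add: frag_extend_add\<close>)
  qed
  then show ?thesis unfolding tensor_map_def using tensor_class_self by blast
qed

text \<open>Multiplication by c on R is injective, so it stays injective after tensoring with A. It
  sends 1 \<otimes> a to c \<otimes> a = 1 \<otimes> ca = 0, hence 1 \<otimes> a = 0, and evaluation
  of tensors in A gives a = 0.\<close>

lemma flat_regular:
  fixes R :: "'a ring"
  assumes R: "cring R" and A: "cring A" and i: "i \<in> ring_hom R A" and fl: "flat R (alg_module i A)"
    and c: "c \<in> carrier R" and reg: "\<And>x. x \<in> carrier R \<Longrightarrow> c \<otimes>\<^bsub>R\<^esub> x = \<zero>\<^bsub>R\<^esub> \<Longrightarrow> x = \<zero>\<^bsub>R\<^esub>"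
    and a: "a \<in> carrier A" "i c \<otimes>\<^bsub>A\<^esub> a = \<zero>\<^bsub>A\<^esub>"
  shows "a = \<zero>\<^bsub>A\<^esub>"
proof -
  interpret R: cring R by fact
  interpret A: cring A by fact
  note H = ring_hom_closed[OF i] ring_hom_mult[OF i] ring_hom_add[OF i] ring_hom_one[OF i]
  define M where "M = self_module R"
  define N where "N = alg_module i A"
  define u where "u = (\<lambda>C. const_fun_set (c \<otimes>\<^bsub>R\<^esub> unconst C))"
  have M: "module R M" unfolding M_def by (rule R.self_module_module)
  have u: "u \<in> mod_hom R M M"
    unfolding mod_hom_def u_def M_def self_module_def using c by (auto simp: R.r_distr R.m_lcomm)
  have "inj_on u (carrier M)"
  proof (rule inj_onI)
    fix C E assume "C \<in> carrier M" "E \<in> carrier M" and e: "u C = u E"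
    then obtain x y where xy: "x \<in> carrier R" "y \<in> carrier R" "C = const_fun_set x" "E = const_fun_set y"
      unfolding M_def self_module_def by auto
    have "c \<otimes>\<^bsub>R\<^esub> x = c \<otimes>\<^bsub>R\<^esub> y" using e xy unfolding u_def by (metis unconst)
    then have "c \<otimes>\<^bsub>R\<^esub> (x \<ominus>\<^bsub>R\<^esub> y) = \<zero>\<^bsub>R\<^esub>" using xy c by (simp add: a_minus_def R.r_distr R.r_minus R.r_neg)
    then have "x \<ominus>\<^bsub>R\<^esub> y = \<zero>\<^bsub>R\<^esub>" using reg xy by simp
    then show "C = E" using xy by simp
  qed
  then have inj: "inj_on (tensor_map R M N u) (carrier (tensor R M N))"
    using fl M u unfolding flat_def N_def by blast
  have Nc: "carrier N = carrier A" "\<zero>\<^bsub>N\<^esub> = \<zero>\<^bsub>A\<^esub>" "\<And>x y. x \<oplus>\<^bsub>N\<^esub> y = x \<oplus>\<^bsub>A\<^esub> y" "\<And>r x. r \<odot>\<^bsub>N\<^esub> x = i r \<otimes>\<^bsub>A\<^esub> x"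
    by (simp_all add: N_def alg_module_def)
  define e where "e = const_fun_set \<one>\<^bsub>R\<^esub>"
  have e: "e \<in> carrier M" by (simp add: e_def M_def self_module_def)
  have ce: "c \<odot>\<^bsub>M\<^esub> e = u e" by (simp add: M_def self_module_def u_def)
  have uec: "u e \<in> carrier M" using u e unfolding mod_hom_def by auto
  have ez: "frag_of (e, \<zero>\<^bsub>A\<^esub>) \<in> tensor_rel R M N"
    using tensor_rel_minus[OF tensor_rel.addr[of e M "\<zero>\<^bsub>A\<^esub>" N "\<zero>\<^bsub>A\<^esub>" R]] e Nc by simp
  have "frag_of (u e, a) - frag_of (e, \<zero>\<^bsub>A\<^esub>) \<in> tensor_rel R M N"
    using tensor_rel.smult[OF c e, of a N] a Nc ce by simp
  then have "frag_of (u e, a) \<in> tensor_rel R M N" using tensor_rel_add[OF _ ez] by fastforce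
  then have "tensor_class R M N (frag_of (u e, a)) = tensor_class R M N 0" by (intro tensor_class_eq) simp
  then have "tensor_map R M N u (tensor_class R M N (frag_of (e, a))) = tensor_map R M N u (tensor_class R M N 0)"
    unfolding tensor_map_class[OF u] by simp
  moreover have tc: "tensor_class R M N z \<in> carrier (tensor R M N)" if "Poly_Mapping.keys z \<subseteq> carrier M \<times> carrier N" for z
    unfolding tensor_def using that by auto
  have "tensor_class R M N (frag_of (e, a)) \<in> carrier (tensor R M N)" by (rule tc) (use e a Nc in simp)
  moreover have "tensor_class R M N 0 \<in> carrier (tensor R M N)" by (rule tc) simp
  ultimately have "tensor_class R M N (frag_of (e, a)) = tensor_class R M N 0" using inj_onD[OF inj] by blast
  then have rel: "frag_of (e, a) \<in> tensor_rel R M N"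
    using tensor_class_self[of "frag_of (e, a)" R M N] by (auto simp: tensor_class_def)
  define S where "S = carrier M \<times> carrier N"
  \<comment> \<open>The evaluation of r \<otimes> y as i(r) y, on generators of the free abelian
    group. \<open>key\<close> checks that its extension h vanishes on all tensor relations.\<close>
  define f where "f = (\<lambda>(C, y). i (unconst C) \<otimes>\<^bsub>A\<^esub> y)"
  have "f ` S \<subseteq> carrier (add_monoid A)"
    unfolding f_def S_def M_def self_module_def using Nc H by auto
  from comm_group.free_Abelian_group_universal[OF A.a_comm_group this]
  obtain h where h: "h \<in> hom (free_Abelian_group S) (add_monoid A)" "\<And>x. x \<in> S \<Longrightarrow> h (frag_of x) = f x" by blast
  interpret h: group_hom "free_Abelian_group S" "add_monoid A" h
    using h(1) A.a_group by (simp add: group_hom_def group_hom_axioms_def)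
  have hdiff: "h (z - w) = h z \<ominus>\<^bsub>A\<^esub> h w" and hc: "h z \<in> carrier A"
    if "Poly_Mapping.keys z \<subseteq> S" "Poly_Mapping.keys w \<subseteq> S" for z w
  proof -
    have zw: "z \<in> carrier (free_Abelian_group S)" "w \<in> carrier (free_Abelian_group S)" using that by (auto simp: free_Abelian_group_def)
    have d: "z - w \<in> carrier (free_Abelian_group S)"
      using that keys_diff[of z w] by (auto simp: free_Abelian_group_def)
    show hz: "h z \<in> carrier A" using h.hom_closed[OF zw(1)] by simp
    have hw: "h w \<in> carrier A" using h.hom_closed[OF zw(2)] by simp
    have hd: "h (z - w) \<in> carrier A" using h.hom_closed[OF d] by simp
    have "h ((z - w) + w) = h (z - w) \<oplus>\<^bsub>A\<^esub> h w" using h.hom_mult[OF d zw(2)] by (simp add: free_Abelian_group_def)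
    then have "h z = h (z - w) \<oplus>\<^bsub>A\<^esub> h w" by simp
    then show "h (z - w) = h z \<ominus>\<^bsub>A\<^esub> h w" using hd hw by (simp add: a_minus_def A.a_assoc A.r_neg)
  qed
  have key: "Poly_Mapping.keys z \<subseteq> S \<and> h z = \<zero>\<^bsub>A\<^esub>" if "z \<in> tensor_rel R M N" for z
    using that
  proof (induction rule: tensor_rel.induct)
    case zero
    then show ?case using hdiff[of 0 0] hc[of 0 0] by (simp add: a_minus_def A.r_neg)
  next
    case (diff z w)
    then show ?case using hdiff[of z w] keys_diff[of z w] by (auto simp: a_minus_def)
  next
    case (addl x x' y)
    have m: "(x \<oplus>\<^bsub>M\<^esub> x', y) \<in> S" "(x, y) \<in> S" "(x', y) \<in> S"
      using addl by (auto simp: S_def M_def self_module_def)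
    have k: "Poly_Mapping.keys (frag_of (x \<oplus>\<^bsub>M\<^esub> x', y) - frag_of (x, y)) \<subseteq> S"
      using m keys_diff[of "frag_of (x \<oplus>\<^bsub>M\<^esub> x', y)" "frag_of (x, y)"] by auto
    have "h (frag_of (x \<oplus>\<^bsub>M\<^esub> x', y) - frag_of (x, y) - frag_of (x', y)) = f (x \<oplus>\<^bsub>M\<^esub> x', y) \<ominus>\<^bsub>A\<^esub> f (x, y) \<ominus>\<^bsub>A\<^esub> f (x', y)"
      using hdiff[of "frag_of (x \<oplus>\<^bsub>M\<^esub> x', y)" "frag_of (x, y)"] hdiff[OF k, of "frag_of (x', y)"] h(2) m by simp
    also have "\<dots> = \<zero>\<^bsub>A\<^esub>"
    proof -
      obtain r r' where r: "r \<in> carrier R" "r' \<in> carrier R" "x = const_fun_set r" "x' = const_fun_set r'"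
        using addl unfolding M_def self_module_def by auto
      have c: "i r \<in> carrier A" "i r' \<in> carrier A" "y \<in> carrier A" using H r addl Nc by auto
      have "f (x \<oplus>\<^bsub>M\<^esub> x', y) = (i r \<oplus>\<^bsub>A\<^esub> i r') \<otimes>\<^bsub>A\<^esub> y" using r H by (simp add: f_def M_def self_module_def)
      moreover have "f (x, y) = i r \<otimes>\<^bsub>A\<^esub> y" "f (x', y) = i r' \<otimes>\<^bsub>A\<^esub> y" using r by (simp_all add: f_def)
      ultimately show ?thesis using c by (simp only:) algebra
    qed
    finally show ?case using k m keys_diff[of "frag_of (x \<oplus>\<^bsub>M\<^esub> x', y) - frag_of (x, y)" "frag_of (x', y)"] by auto
  next
    case (addr x y y')
    have m: "(x, y \<oplus>\<^bsub>N\<^esub> y') \<in> S" "(x, y) \<in> S" "(x, y') \<in> S"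
      using addr Nc by (auto simp: S_def)
    have k: "Poly_Mapping.keys (frag_of (x, y \<oplus>\<^bsub>N\<^esub> y') - frag_of (x, y)) \<subseteq> S"
      using m keys_diff[of "frag_of (x, y \<oplus>\<^bsub>N\<^esub> y')" "frag_of (x, y)"] by auto
    have "h (frag_of (x, y \<oplus>\<^bsub>N\<^esub> y') - frag_of (x, y) - frag_of (x, y')) = f (x, y \<oplus>\<^bsub>N\<^esub> y') \<ominus>\<^bsub>A\<^esub> f (x, y) \<ominus>\<^bsub>A\<^esub> f (x, y')"
      using hdiff[of "frag_of (x, y \<oplus>\<^bsub>N\<^esub> y')" "frag_of (x, y)"] hdiff[OF k, of "frag_of (x, y')"] h(2) m by simp
    also have "\<dots> = \<zero>\<^bsub>A\<^esub>"
    proof -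
      obtain r where r: "r \<in> carrier R" "x = const_fun_set r"
        using addr unfolding M_def self_module_def by auto
      have c: "i r \<in> carrier A" "y' \<in> carrier A" "y \<in> carrier A" using H r addr Nc by auto
      have "f (x, y \<oplus>\<^bsub>N\<^esub> y') = i r \<otimes>\<^bsub>A\<^esub> (y \<oplus>\<^bsub>A\<^esub> y')" "f (x, y) = i r \<otimes>\<^bsub>A\<^esub> y" "f (x, y') = i r \<otimes>\<^bsub>A\<^esub> y'"
        using r Nc by (simp_all add: f_def)
      then show ?thesis using c by (simp only:) algebra
    qed
    finally show ?case using k m keys_diff[of "frag_of (x, y \<oplus>\<^bsub>N\<^esub> y') - frag_of (x, y)" "frag_of (x, y')"] by auto
  next
    case (smult r x y)
    have m: "(r \<odot>\<^bsub>M\<^esub> x, y) \<in> S" "(x, r \<odot>\<^bsub>N\<^esub> y) \<in> S"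
      using smult Nc H by (auto simp: S_def M_def self_module_def)
    have "h (frag_of (r \<odot>\<^bsub>M\<^esub> x, y) - frag_of (x, r \<odot>\<^bsub>N\<^esub> y)) = f (r \<odot>\<^bsub>M\<^esub> x, y) \<ominus>\<^bsub>A\<^esub> f (x, r \<odot>\<^bsub>N\<^esub> y)"
      using hdiff[of "frag_of (r \<odot>\<^bsub>M\<^esub> x, y)" "frag_of (x, r \<odot>\<^bsub>N\<^esub> y)"] h(2) m by simp
    also have "\<dots> = \<zero>\<^bsub>A\<^esub>"
    proof -
      obtain q where q: "q \<in> carrier R" "x = const_fun_set q"
        using smult unfolding M_def self_module_def by auto
      have c: "i r \<in> carrier A" "i q \<in> carrier A" "y \<in> carrier A" using H q smult Nc by auto
      have "f (r \<odot>\<^bsub>M\<^esub> x, y) = (i r \<otimes>\<^bsub>A\<^esub> i q) \<otimes>\<^bsub>A\<^esub> y" "f (x, r \<odot>\<^bsub>N\<^esub> y) = i q \<otimes>\<^bsub>A\<^esub> (i r \<otimes>\<^bsub>A\<^esub> y)"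
        using q H smult Nc by (simp_all add: f_def M_def self_module_def)
      then show ?thesis using c by (simp add: A.m_ac a_minus_def A.r_neg)
    qed
    finally show ?case using m keys_diff[of "frag_of (r \<odot>\<^bsub>M\<^esub> x, y)" "frag_of (x, r \<odot>\<^bsub>N\<^esub> y)"] by auto
  qed
  have "f (e, a) = \<zero>\<^bsub>A\<^esub>" using key[OF rel] h(2)[of "(e, a)"] e a Nc by (simp add: S_def)
  then show ?thesis using a H by (simp add: f_def e_def)
qed

section \<open>Congruences modulo \<open>p\<close>\<close>

context cring
begin

lemma nat_elem_0: "nat_elem R 0 = \<zero>" and nat_elem_1: "nat_elem R (Suc 0) = \<one>"
  by (simp_all add: nat_elem_def)

lemma nat_elem_add: "nat_elem R (i + j) = nat_elem R i \<oplus> nat_elem R j"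
  by (induction i) (auto simp: nat_elem_def a_ac)

lemma nat_elem_mult: "nat_elem R (i * j) = nat_elem R i \<otimes> nat_elem R j"
proof (induction i)
  case (Suc i)
  have "nat_elem R (Suc i) = \<one> \<oplus> nat_elem R i" using nat_elem_add[of "Suc 0" i] by (simp add: nat_elem_1)
  then show ?case using Suc by (simp add: nat_elem_add l_distr)
qed (simp add: nat_elem_0)

lemma lsum_extend:
  assumes "\<And>i. n \<le> i \<Longrightarrow> i < N \<Longrightarrow> a i = \<zero>" "n \<le> N" "\<And>i. a i \<in> carrier R" "\<And>i. m i \<in> carrier R"
  shows "lsum R a m N = lsum R a m n"
  using assms(2,1)
proof (induction N rule: dec_induct)
  case (step N)
  then show ?case using assms(3,4) by simp
qed simp

lemma binomial:
  assumes a: "a \<in> carrier R" and b: "b \<in> carrier R"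
  shows "(a \<oplus> b) [^] n = lsum R (\<lambda>k. nat_elem R (n choose k)) (\<lambda>k. a [^] k \<otimes> b [^] (n - k)) (Suc n)"
proof (induction n)
  case 0
  then show ?case using a b by (simp add: nat_elem_1)
next
  case (Suc n)
  let ?C = "\<lambda>n k. nat_elem R (n choose k)"
  let ?f = "\<lambda>n k. a [^] k \<otimes> b [^] (n - k)"
  have fc: "?f m k \<in> carrier R" for m k :: nat using a b by simp
  have ab: "a \<oplus> b \<in> carrier R" using a b by simp
  have Lc: "lsum R (?C n) (?f m) l \<in> carrier R" for m l using fc by (intro lsum_closed) auto
  have "lsum R (?C (Suc n)) (?f (Suc n)) (Suc (Suc n)) = ?C (Suc n) 0 \<otimes> ?f (Suc n) 0 \<oplus>
      lsum R (\<lambda>k. ?C (Suc n) (Suc k)) (\<lambda>k. ?f (Suc n) (Suc k)) (Suc n)"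
    by (rule lsum_head) (use a b in auto)
  also have "(\<lambda>k. ?C (Suc n) (Suc k)) = (\<lambda>k. ?C n k \<oplus> ?C n (Suc k))"
    by (simp add: nat_elem_add)
  also have "lsum R (\<lambda>k. ?C n k \<oplus> ?C n (Suc k)) (\<lambda>k. ?f (Suc n) (Suc k)) (Suc n) =
     lsum R (\<lambda>k. ?C n k) (\<lambda>k. ?f (Suc n) (Suc k)) (Suc n) \<oplus> lsum R (\<lambda>k. ?C n (Suc k)) (\<lambda>k. ?f (Suc n) (Suc k)) (Suc n)"
    by (rule lsum_add[symmetric]) (use a b in auto)
  also have "lsum R (\<lambda>k. ?C n k) (\<lambda>k. ?f (Suc n) (Suc k)) (Suc n) = lsum R (?C n) (\<lambda>k. a \<otimes> ?f n k) (Suc n)"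
    by (rule lsum_cong) (use a b in \<open>simp add: m_ac\<close>)
  also have "\<dots> = a \<otimes> (a \<oplus> b) [^] n"
    unfolding Suc by (rule lsum_smult_right[symmetric]) (use a fc in auto)
  also have "?C (Suc n) 0 \<otimes> ?f (Suc n) 0 \<oplus> (a \<otimes> (a \<oplus> b) [^] n \<oplus> lsum R (\<lambda>k. ?C n (Suc k)) (\<lambda>k. ?f (Suc n) (Suc k)) (Suc n))
      = a \<otimes> (a \<oplus> b) [^] n \<oplus> (?C n 0 \<otimes> ?f (Suc n) 0 \<oplus> lsum R (\<lambda>k. ?C n (Suc k)) (\<lambda>k. ?f (Suc n) (Suc k)) (Suc n))"
  proof -
    have "lsum R (\<lambda>k. ?C n (Suc k)) (\<lambda>k. ?f (Suc n) (Suc k)) (Suc n) \<in> carrier R"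
      by (rule lsum_closed) (use a b in auto)
    then show ?thesis unfolding binomial_n_0
      by (intro a_lcomm) (use a b ab in auto)
  qed
  also have "?C n 0 \<otimes> ?f (Suc n) 0 \<oplus> lsum R (\<lambda>k. ?C n (Suc k)) (\<lambda>k. ?f (Suc n) (Suc k)) (Suc n)
      = lsum R (?C n) (?f (Suc n)) (Suc (Suc n))"
    by (rule lsum_head[symmetric]) (use a b in auto)
  also have "\<dots> = lsum R (?C n) (?f (Suc n)) (Suc n)"
    using a b Lc[of "Suc n" "Suc n"] by (subst lsum.simps(2)) (simp add: nat_elem_0 binomial_eq_0 del: lsum.simps)
  also have "\<dots> = lsum R (?C n) (\<lambda>k. b \<otimes> ?f n k) (Suc n)"
  proof (rule lsum_cong)
    fix k assume "k < Suc n"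
    then have "Suc n - k = Suc (n - k)" by simp
    then show "?C n k \<otimes> ?f (Suc n) k = ?C n k \<otimes> (b \<otimes> ?f n k)" using a b by (simp add: m_ac)
  qed
  also have "\<dots> = b \<otimes> (a \<oplus> b) [^] n"
    unfolding Suc by (rule lsum_smult_right[symmetric]) (use b fc in auto)
  also have "a \<otimes> (a \<oplus> b) [^] n \<oplus> b \<otimes> (a \<oplus> b) [^] n = (a \<oplus> b) [^] Suc n"
  proof -
    have "(a \<oplus> b) [^] n \<in> carrier R" using ab by simp
    then show ?thesis using a b by (simp add: m_comm[of "(a \<oplus> b) [^] n"] l_distr)
  qed
  finally show ?case by simp
qed

text \<open>p divides the binomial coefficients strictly between the ends. The quotients
  \<open>r k\<close> are formed in the natural numbers, so the remainder w lies in S even though p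
  may be a unit of R.\<close>

lemma freshman:
  assumes S: "subring S R" and p: "Factorial_Ring.prime (p::nat)" and ab: "a \<in> S" "b \<in> S"
  shows "\<exists>w\<in>S. (a \<oplus> b) [^] p = a [^] p \<oplus> b [^] p \<oplus> nat_elem R p \<otimes> w"
proof -
  note SE = subringE[OF S]
  have c: "a \<in> carrier R" "b \<in> carrier R" using ab SE(1) by auto
  have pS: "x [^] (k::nat) \<in> S" if "x \<in> S" for x k by (induction k) (use SE that in auto)
  obtain q where q: "p = Suc q" using p prime_gt_0_nat by (metis Suc_pred)
  let ?f = "\<lambda>k. a [^] k \<otimes> b [^] (p - k)"
  have fc: "?f k \<in> carrier R" for k :: nat using c by simp
  define r where "r k = (p choose Suc k) div p" for k
  have r: "p choose Suc k = p * r k" if "k < q" for k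
  proof -
    have "p dvd (p choose Suc k)" by (rule dvd_choose_prime) (use that q p in auto)
    then show ?thesis by (simp add: r_def)
  qed
  define w where "w = lsum R (\<lambda>k. nat_elem R (r k)) (\<lambda>k. ?f (Suc k)) q"
  have wS: "w \<in> S" unfolding w_def
    by (rule lsum_mem[OF subring_submod[OF S]]) (use subring_nat_elem[OF S] SE pS ab in auto)
  have wc: "w \<in> carrier R" using wS SE(1) by auto
  have "(a \<oplus> b) [^] p = lsum R (\<lambda>k. nat_elem R (p choose k)) ?f (Suc q) \<oplus> nat_elem R (p choose p) \<otimes> ?f p"
    unfolding binomial[OF c] by (simp add: q)
  also have "lsum R (\<lambda>k. nat_elem R (p choose k)) ?f (Suc q) = nat_elem R (p choose 0) \<otimes> ?f 0 \<oplus>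
      lsum R (\<lambda>k. nat_elem R (p choose Suc k)) (\<lambda>k. ?f (Suc k)) q"
    by (rule lsum_head) (use c in auto)
  also have "lsum R (\<lambda>k. nat_elem R (p choose Suc k)) (\<lambda>k. ?f (Suc k)) q =
      lsum R (\<lambda>k. nat_elem R p \<otimes> nat_elem R (r k)) (\<lambda>k. ?f (Suc k)) q"
    by (rule lsum_cong) (simp only: r nat_elem_mult)
  also have "\<dots> = nat_elem R p \<otimes> w"
    unfolding w_def by (rule lsum_smult[symmetric]) (use c in auto)
  finally have "(a \<oplus> b) [^] p = a [^] p \<oplus> b [^] p \<oplus> nat_elem R p \<otimes> w"
    using c wc by (simp add: nat_elem_1 a_ac)
  then show ?thesis using wS by blast
qed

text \<open>Padding with zeros between the multiples of p lets a polynomial in x^p be compared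
  coefficientwise with polynomials in x.\<close>

lemma lsum_sparse:
  assumes "\<And>i. Y i \<in> carrier R" "x \<in> carrier R" "p > 0"
  shows "lsum R (\<lambda>m. if p dvd m then Y (m div p) else \<zero>) (\<lambda>m. x [^] m) (p * d) = lsum R Y (\<lambda>i. (x [^] p) [^] i) d"
proof (induction d)
  case (Suc d)
  let ?Z = "\<lambda>m. if p dvd m then Y (m div p) else \<zero>"
  have "lsum R ?Z (\<lambda>m. x [^] m) (p * Suc d) = lsum R ?Z (\<lambda>m. x [^] m) (Suc (p * d))"
  proof (rule lsum_extend)
    fix i assume i: "Suc (p * d) \<le> i" "i < p * Suc d"
    have "\<not> p dvd i"
    proof
      assume "p dvd i"
      then obtain e where "i = p * e" by (rule dvdE)
      then have "p * d < p * e" "p * e < p * Suc d" using i by (simp_all only: Suc_le_eq)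
      then have "d < e" "e < Suc d" using assms(3) by (simp_all only: mult_less_cancel1)
      then show False by simp
    qed
    then show "?Z i = \<zero>" by simp
  qed (use assms in auto)
  then show ?case using Suc assms by (simp add: nat_pow_pow)
qed simp

text \<open>F consists of the coefficients of (bV - c) H(V). At V = x the factor bx - c vanishes, so
  a truncated evaluation leaves only the boundary term.\<close>

lemma telescope:
  assumes "b \<in> carrier R" "c \<in> carrier R" "x \<in> carrier R" "b \<otimes> x = c" "\<And>i. H i \<in> carrier R"
    "F 0 = \<ominus> (c \<otimes> H 0)" "\<And>i. F (Suc i) = b \<otimes> H i \<ominus> c \<otimes> H (Suc i)"
  shows "lsum R F (\<lambda>i. x [^] i) (Suc m) = \<ominus> (c \<otimes> H m \<otimes> x [^] m)"
proof (induction m)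
  case 0
  then show ?case using assms by simp
next
  case (Suc m)
  have xc: "x [^] m \<in> carrier R" using assms by simp
  have Fc: "F i \<in> carrier R" for i using assms by (cases i) auto
  have "lsum R F (\<lambda>i. x [^] i) (Suc (Suc m)) = \<ominus> (c \<otimes> H m \<otimes> x [^] m) \<oplus> F (Suc m) \<otimes> x [^] Suc m"
    using Suc by simp
  also have "F (Suc m) \<otimes> x [^] Suc m = (b \<otimes> x) \<otimes> H m \<otimes> x [^] m \<ominus> c \<otimes> H (Suc m) \<otimes> x [^] Suc m"
    unfolding assms(7) using assms(1,2,3,5) xc by (simp add: a_minus_def l_distr l_minus r_distr r_minus m_ac)
  also have "\<ominus> (c \<otimes> H m \<otimes> x [^] m) \<oplus> \<dots> = \<ominus> (c \<otimes> H (Suc m) \<otimes> x [^] Suc m)"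
    unfolding assms(4) using assms(2,3,5) xc by (simp add: a_minus_def a_assoc[symmetric] l_neg)
  finally show ?case .
qed

text \<open>The quotient is sought in S, not in R: in the intended ring p is a unit, and congruence
  modulo p in R would say nothing.\<close>

definition cg :: "'a set \<Rightarrow> 'a \<Rightarrow> 'a \<Rightarrow> 'a \<Rightarrow> bool" where
  "cg S q x y \<longleftrightarrow> (\<exists>w\<in>S. x = y \<oplus> q \<otimes> w)"

context
  fixes S q assumes S: "subring S R" and q: "q \<in> S"
begin

lemma cgI: "w \<in> S \<Longrightarrow> x = y \<oplus> q \<otimes> w \<Longrightarrow> cg S q x y"
  unfolding cg_def by blast

lemma cg_carr: "x \<in> S \<Longrightarrow> x \<in> carrier R"
  using subringE(1)[OF S] by auto

lemma cg_refl: "x \<in> S \<Longrightarrow> cg S q x x"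
  by (rule cgI[of \<zero>]) (use subringE(2)[OF S] cg_carr q in auto)

lemma cg_trans: "cg S q x y \<Longrightarrow> cg S q y z \<Longrightarrow> z \<in> S \<Longrightarrow> cg S q x z"
proof -
  assume "cg S q x y" "cg S q y z" and z: "z \<in> S"
  then obtain w w' where w: "w \<in> S" "x = y \<oplus> q \<otimes> w" "w' \<in> S" "y = z \<oplus> q \<otimes> w'" unfolding cg_def by blast
  have "x = z \<oplus> q \<otimes> (w' \<oplus> w)" using w z cg_carr q by (simp add: r_distr a_assoc)
  then show ?thesis using cgI subringE(7)[OF S w(3,1)] by blast
qed

lemma cg_add: "cg S q x y \<Longrightarrow> cg S q x' y' \<Longrightarrow> y \<in> S \<Longrightarrow> y' \<in> S \<Longrightarrow> cg S q (x \<oplus> x') (y \<oplus> y')"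
proof -
  assume "cg S q x y" "cg S q x' y'" and c: "y \<in> S" "y' \<in> S"
  then obtain w w' where w: "w \<in> S" "x = y \<oplus> q \<otimes> w" "w' \<in> S" "x' = y' \<oplus> q \<otimes> w'" unfolding cg_def by blast
  have "x \<oplus> x' = y \<oplus> y' \<oplus> q \<otimes> (w \<oplus> w')" using w c cg_carr q by (simp add: r_distr a_ac)
  then show ?thesis using cgI subringE(7)[OF S w(1,3)] by blast
qed

lemma cg_smult: "cg S q x y \<Longrightarrow> z \<in> S \<Longrightarrow> y \<in> S \<Longrightarrow> cg S q (z \<otimes> x) (z \<otimes> y)"
proof -
  assume "cg S q x y" and c: "z \<in> S" "y \<in> S"
  then obtain w where w: "w \<in> S" "x = y \<oplus> q \<otimes> w" unfolding cg_def by blast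
  have "z \<otimes> x = z \<otimes> y \<oplus> q \<otimes> (z \<otimes> w)" using w c cg_carr q by (simp add: r_distr m_lcomm)
  then show ?thesis using cgI subringE(6)[OF S c(1) w(1)] by blast
qed

lemma cg_minus: "cg S q x y \<Longrightarrow> cg S q x' y' \<Longrightarrow> y \<in> S \<Longrightarrow> y' \<in> S \<Longrightarrow> x' \<in> S \<Longrightarrow> cg S q (x \<ominus> x') (y \<ominus> y')"
proof -
  assume a: "cg S q x y" "cg S q x' y'" "y \<in> S" "y' \<in> S" "x' \<in> S"
  have m: "\<ominus> \<one> \<in> S" using subringE(3,5)[OF S] by auto
  have "cg S q (x \<oplus> \<ominus> \<one> \<otimes> x') (y \<oplus> \<ominus> \<one> \<otimes> y')"
    by (rule cg_add[OF a(1) cg_smult[OF a(2) m a(4)] a(3)]) (use subringE(6)[OF S m] a in auto)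
  then show ?thesis using a cg_carr by (simp add: a_minus_def l_minus)
qed

lemma cg_zero: "cg S q x \<zero> \<longleftrightarrow> (\<exists>w\<in>S. x = q \<otimes> w)"
  unfolding cg_def using cg_carr q by (auto intro!: bexI)

end

text \<open>Applying \<open>freshman\<close> to (x - y) + y avoids the sign of (-1)^p, which depends
  on the parity of p.\<close>

lemma cg_minus_pow:
  assumes S: "subring S R" and p: "Factorial_Ring.prime (p::nat)" and xy: "x \<in> S" "y \<in> S"
  shows "cg S (nat_elem R p) ((x \<ominus> y) [^] p) (x [^] p \<ominus> y [^] p)"
proof -
  note SE = subringE[OF S]
  have c: "x \<in> carrier R" "y \<in> carrier R" using xy SE(1) by auto
  have m: "x \<ominus> y \<in> S" unfolding a_minus_def using SE xy by simp
  obtain w where w: "w \<in> S" "((x \<ominus> y) \<oplus> y) [^] p = (x \<ominus> y) [^] p \<oplus> y [^] p \<oplus> nat_elem R p \<otimes> w"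
    using freshman[OF S p m xy(2)] by blast
  have wc: "w \<in> carrier R" using w SE(1) by auto
  have "(x \<ominus> y) \<oplus> y = x" using c by (simp add: a_minus_def a_assoc l_neg)
  then have e: "x [^] p = (x \<ominus> y) [^] p \<oplus> y [^] p \<oplus> nat_elem R p \<otimes> w" using w by simp
  have aux: "u = (u \<oplus> v \<oplus> s) \<ominus> v \<oplus> \<ominus> s" if "u \<in> carrier R" "v \<in> carrier R" "s \<in> carrier R" for u v s
    using that by algebra
  have "(x \<ominus> y) [^] p = x [^] p \<ominus> y [^] p \<oplus> nat_elem R p \<otimes> (\<ominus> w)"
    unfolding e using aux[of "(x \<ominus> y) [^] p" "y [^] p" "nat_elem R p \<otimes> w"] c wc by (simp add: r_minus)
  then show ?thesis unfolding cg_def using SE(5)[OF w(1)] by blast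
qed

lemma freshman_lsum:
  assumes S: "subring S R" and p: "Factorial_Ring.prime (p::nat)" and am: "\<And>i. a i \<in> S" "\<And>i. m i \<in> S"
  shows "cg S (nat_elem R p) (lsum R a m n [^] p) (lsum R (\<lambda>i. a i [^] p) (\<lambda>i. m i [^] p) n)"
proof (induction n)
  note SE = subringE[OF S]
  have pS: "x [^] (k::nat) \<in> S" if "x \<in> S" for x k by (induction k) (use SE that in auto)
  note cgr = cg_trans[OF S subring_nat_elem[OF S]] cg_add[OF S subring_nat_elem[OF S]] cg_refl[OF S subring_nat_elem[OF S]]
  {
    case 0
    have "p \<noteq> 0" using p by auto
    then have "\<zero> [^] p = \<zero>" by (cases p) auto
    then show ?case using cgr(3) SE(2) by simp
  next
    case (Suc n)
    have L: "lsum R a m n \<in> S" by (rule lsum_mem[OF subring_submod[OF S]]) (use am in auto)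
    have L': "lsum R (\<lambda>i. a i [^] p) (\<lambda>i. m i [^] p) n \<in> S"
      by (rule lsum_mem[OF subring_submod[OF S]]) (use am pS in auto)
    have amS: "a n \<otimes> m n \<in> S" using SE(6) am by auto
    have eq: "(a n \<otimes> m n) [^] p = a n [^] p \<otimes> m n [^] p" using am SE(1) by (intro nat_pow_distrib) auto
    have "cg S (nat_elem R p) ((lsum R a m n \<oplus> a n \<otimes> m n) [^] p) (lsum R a m n [^] p \<oplus> (a n \<otimes> m n) [^] p)"
      using freshman[OF S p L amS] unfolding cg_def by blast
    moreover have "cg S (nat_elem R p) (lsum R a m n [^] p \<oplus> (a n \<otimes> m n) [^] p)
        (lsum R (\<lambda>i. a i [^] p) (\<lambda>i. m i [^] p) n \<oplus> (a n \<otimes> m n) [^] p)"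
      by (rule cgr(2)[OF Suc cgr(3)[OF pS[OF amS]] L' pS[OF amS]])
    ultimately show ?case unfolding eq lsum.simps
      by (rule cgr(1)) (use L' SE(6,7) pS am in auto)
  }
qed

end

section \<open>Root closure\<close>

text \<open>The intended ring is \<open>A\<^sub>\<infinity>[1/p][1/g]\<close>, with \<open>A\<close> the image of \<open>A\<^sub>\<infinity>\<close>, \<open>\<pi> k = p\<^sup>1\<^sup>/\<^sup>p\<^sup>^\<^sup>k\<close> and \<open>\<gamma> k = g\<^sup>1\<^sup>/\<^sup>p\<^sup>^\<^sup>k\<close>. The factor \<open>\<gamma> k\<close> in
  \<open>frob_inj\<close> is due to the \<open>g\<close>-torsion of \<open>A\<^sub>\<infinity>\<close>, which vanishes in \<open>A\<close>.\<close>

locale perf = cring +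
  fixes p :: nat and A :: "'a set" and \<pi> \<gamma> :: "nat \<Rightarrow> 'a"
  assumes p: "Factorial_Ring.prime p" and A: "subring A R"
    and \<pi>A: "\<pi> k \<in> A" and \<gamma>A: "\<gamma> k \<in> A"
    and \<pi>_Suc: "\<pi> (Suc k) [^] p = \<pi> k" and \<gamma>_Suc: "\<gamma> (Suc k) [^] p = \<gamma> k"
    and \<pi>_0: "\<pi> 0 = nat_elem R p" and \<pi>U: "\<pi> 0 \<in> Units R" and \<gamma>U: "\<gamma> 0 \<in> Units R"
    and frob_inj: "x \<in> A \<Longrightarrow> y \<in> A \<Longrightarrow> x [^] p = \<pi> 0 \<otimes> y \<Longrightarrow> \<exists>z\<in>A. \<gamma> k \<otimes> x = \<pi> 1 \<otimes> z"
    and frob_surj: "x \<in> A \<Longrightarrow> \<exists>y\<in>A. cg A (\<pi> 0) (y [^] p) x"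
begin

lemmas AE = subringE[OF A]

lemma Ac: "x \<in> A \<Longrightarrow> x \<in> carrier R" using AE(1) by auto

lemma \<pi>c [simp]: "\<pi> k \<in> carrier R" and \<gamma>c [simp]: "\<gamma> k \<in> carrier R"
  using \<pi>A \<gamma>A Ac by auto

lemma p2: "p \<ge> 2" using p prime_ge_2_nat by blast

lemma \<pi>_tower: "\<pi> (k + l) [^] (p ^ l) = \<pi> k" by (rule power_tower[of \<pi> p]) (simp_all add: \<pi>_Suc)

lemma \<gamma>_tower: "\<gamma> (k + l) [^] (p ^ l) = \<gamma> k" by (rule power_tower[of \<gamma> p]) (simp_all add: \<gamma>_Suc)

lemma Units_of_pow: "x \<in> carrier R \<Longrightarrow> x [^] (n::nat) \<in> Units R \<Longrightarrow> n > 0 \<Longrightarrow> x \<in> Units R"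
  by (rule unit_factor[of x "x [^] (n - 1)"]) (auto simp: gr0_conv_Suc m_comm)

lemma pow_swap: "x \<in> carrier R \<Longrightarrow> (x [^] (a::nat)) [^] (b::nat) = (x [^] b) [^] a"
  by (simp add: nat_pow_pow mult.commute)

lemma \<pi>_Units [simp]: "\<pi> k \<in> Units R"
  by (rule Units_of_pow[of _ "p ^ k"]) (use \<pi>_tower[of 0 k] \<pi>U p2 in auto)

lemma \<gamma>_Units [simp]: "\<gamma> k \<in> Units R"
  by (rule Units_of_pow[of _ "p ^ k"]) (use \<gamma>_tower[of 0 k] \<gamma>U p2 in auto)

lemma pow_A: "x \<in> A \<Longrightarrow> x [^] (n::nat) \<in> A" by (induction n) (use AE in auto)

definition "\<delta> k = \<pi> k \<otimes> \<gamma> k"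

lemma \<delta>A: "\<delta> k \<in> A" unfolding \<delta>_def using AE(6) \<pi>A \<gamma>A by simp

lemma \<delta>c [simp]: "\<delta> k \<in> carrier R" using \<delta>A Ac by auto

lemma \<delta>_Suc: "\<delta> (Suc k) [^] p = \<delta> k" unfolding \<delta>_def by (simp add: nat_pow_distrib \<pi>_Suc \<gamma>_Suc)

lemma \<delta>_tower: "\<delta> (k + l) [^] (p ^ l) = \<delta> k" by (rule power_tower[of \<delta> p]) (simp_all add: \<delta>_Suc)

text \<open>\<open>star N\<close> is the ring of almost elements of \<open>N\<close>, with respect to \<open>(pg)\<^sup>1\<^sup>/\<^sup>p\<^sup>^\<^sup>\<infinity>\<close>.\<close>

definition star :: "'a set \<Rightarrow> 'a set" where
  "star N = {x \<in> carrier R. \<forall>k. \<delta> k \<otimes> x \<in> N}"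

text \<open>Almost injectivity of Frobenius from N modulo p^(1/p) to N modulo p, the property that
  lets p-th roots be taken in \<open>star N\<close>.\<close>

definition frob :: "'a set \<Rightarrow> bool" where
  "frob N \<longleftrightarrow> subring N R \<and> A \<subseteq> N \<and>
     (\<forall>x\<in>N. \<forall>y\<in>N. x [^] p = \<pi> 0 \<otimes> y \<longrightarrow> (\<forall>k. \<exists>z\<in>N. \<delta> k \<otimes> x = \<pi> 1 \<otimes> z))"

lemma frob_A: "frob A"
  unfolding frob_def
proof (intro conjI ballI impI allI)
  fix x y k assume x: "x \<in> A" and "y \<in> A" "x [^] p = \<pi> 0 \<otimes> y"
  then obtain z where z: "z \<in> A" "\<gamma> k \<otimes> x = \<pi> 1 \<otimes> z" using frob_inj by blast
  have "\<delta> k \<otimes> x = \<pi> 1 \<otimes> (\<pi> k \<otimes> z)"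
    unfolding \<delta>_def using z x Ac by (metis \<gamma>c \<pi>c m_assoc m_lcomm)
  then show "\<exists>z\<in>A. \<delta> k \<otimes> x = \<pi> 1 \<otimes> z" using AE(6)[OF \<pi>A z(1)] by blast
qed (use A in auto)

context
  fixes N assumes N: "frob N"
begin

lemma N_sub: "subring N R" and AN: "A \<subseteq> N" using N unfolding frob_def by auto

lemmas NE = subringE[OF N_sub]

lemma Nc: "x \<in> N \<Longrightarrow> x \<in> carrier R" using NE(1) by auto

text \<open>A fixed power s of the small factors is harmless: \<delta> k is the p^s-th power of
  \<delta> (k+s), and s <= p^s.\<close>

lemma star_pow:
  assumes x: "x \<in> carrier R" and "\<And>k. \<delta> k [^] (s::nat) \<otimes> x \<in> N"
  shows "x \<in> star N"
  unfolding star_def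
proof (intro CollectI conjI allI x)
  fix k
  have "s \<le> p ^ s" using p2 by (meson less_exp less_imp_le power_mono le_trans zero_le)
  then have "\<delta> (k + s) [^] (p ^ s) = \<delta> (k + s) [^] (p ^ s - s) \<otimes> \<delta> (k + s) [^] s" by (simp add: nat_pow_mult)
  then have "\<delta> k \<otimes> x = \<delta> (k + s) [^] (p ^ s - s) \<otimes> (\<delta> (k + s) [^] s \<otimes> x)"
    unfolding \<delta>_tower using x by (simp add: m_assoc)
  then show "\<delta> k \<otimes> x \<in> N" using NE(6)[OF subsetD[OF AN pow_A[OF \<delta>A]] assms(2)] by simp
qed

text \<open>Each application of \<open>frob\<close> removes one factor \<pi> 1 at the price of one
  factor \<delta> k: for y = (\<pi> 1)^(s+1) x the power y^p is p times (\<pi> 0)^s x^p, an element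
  of N.\<close>

lemma root_step:
  assumes "x \<in> carrier R" "\<pi> 1 [^] (s::nat) \<otimes> x \<in> N" "x [^] p \<in> N"
  shows "\<delta> k [^] s \<otimes> x \<in> N"
  using assms
proof (induction s arbitrary: x)
  case (Suc s)
  define y where "y = \<pi> 1 [^] Suc s \<otimes> x"
  have yp: "y [^] p = \<pi> 0 \<otimes> (\<pi> 0 [^] s \<otimes> x [^] p)"
  proof -
    have "(\<pi> 1 [^] Suc s) [^] p = \<pi> 0 [^] Suc s"
      using \<pi>_Suc[of 0] by (metis One_nat_def \<pi>c mult.commute nat_pow_pow)
    then show ?thesis unfolding y_def using Suc.prems by (simp add: nat_pow_distrib m_assoc m_comm del: nat_pow_Suc)
       (simp add: m_ac)
  qed
  have "\<pi> 0 [^] s \<otimes> x [^] p \<in> N" using NE(6)[OF subsetD[OF AN pow_A[OF \<pi>A]] Suc.prems(3)] .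
  then obtain z where z: "z \<in> N" "\<delta> k \<otimes> y = \<pi> 1 \<otimes> z"
    using N Suc.prems(2) yp unfolding frob_def y_def by blast
  have "\<pi> 1 \<otimes> (\<pi> 1 [^] s \<otimes> (\<delta> k \<otimes> x)) = \<pi> 1 \<otimes> z"
    unfolding z(2)[symmetric] y_def using Suc.prems by (simp add: m_ac)
  then have "\<pi> 1 [^] s \<otimes> (\<delta> k \<otimes> x) = z"
    using Units_l_cancel[OF \<pi>_Units] Suc.prems z(1) Nc by simp
  then have 1: "\<pi> 1 [^] s \<otimes> (\<delta> k \<otimes> x) \<in> N" using z by simp
  have 2: "(\<delta> k \<otimes> x) [^] p \<in> N"
    using Suc.prems NE(6)[OF subsetD[OF AN pow_A[OF \<delta>A]] Suc.prems(3)] by (simp add: nat_pow_distrib)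
  from Suc.IH[OF _ 1 2] Suc.prems show ?case by (simp add: m_assoc)
qed simp

text \<open>Only \<delta> k x^p is in N, so \<open>root_step\<close> is applied to \<delta> (k+1) x,
  whose p-th power this is. The bounded power s of losses is then removed by
  \<open>star_pow\<close>.\<close>

lemma star_root:
  assumes x: "x \<in> carrier R" "\<pi> 1 [^] (s::nat) \<otimes> x \<in> N" and xp: "x [^] p \<in> star N"
  shows "x \<in> star N"
proof (rule star_pow[OF x(1), of 2])
  fix k
  have e: "(\<delta> (Suc k) \<otimes> x) [^] p \<in> N"
    using xp x unfolding star_def by (simp add: nat_pow_distrib \<delta>_Suc)
  have "\<pi> 1 [^] s \<otimes> (\<delta> (Suc k) \<otimes> x) = \<delta> (Suc k) \<otimes> (\<pi> 1 [^] s \<otimes> x)" using x by (simp add: m_ac)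
  also have "\<dots> \<in> N" using NE(6)[OF subsetD[OF AN \<delta>A] x(2)] .
  finally have "\<delta> j [^] s \<otimes> (\<delta> (Suc k) \<otimes> x) \<in> N" for j using root_step e x by simp
  then have "\<delta> (Suc k) \<otimes> x \<in> star N" using star_pow[of "\<delta> (Suc k) \<otimes> x" s] x by simp
  then have "\<delta> (Suc k) \<otimes> (\<delta> (Suc k) \<otimes> x) \<in> N" unfolding star_def by blast
  then have "\<delta> (Suc k) [^] (2::nat) \<otimes> x \<in> N" using x by (simp add: numeral_2_eq_2 m_assoc)
  \<comment> \<open>The exponent fills \<delta> (k+1)^2 up to \<delta> (k+1)^(2p), which is
    (\<delta> k)^2.\<close>
  then have "\<delta> (Suc k) [^] (2 * (p - 1)) \<otimes> (\<delta> (Suc k) [^] (2::nat) \<otimes> x) \<in> N"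
    by (rule NE(6)[OF subsetD[OF AN pow_A[OF \<delta>A]]])
  moreover have "\<delta> k [^] (2::nat) = \<delta> (Suc k) [^] (2 * (p - 1)) \<otimes> \<delta> (Suc k) [^] (2::nat)"
  proof -
    have "2 * (p - 1) + 2 = p * 2" using p2 by simp
    then show ?thesis unfolding \<delta>_Suc[symmetric, of k] by (simp only: nat_pow_pow[OF \<delta>c] nat_pow_mult[OF \<delta>c])
  qed
  then have "\<delta> k [^] (2::nat) \<otimes> x = \<delta> (Suc k) [^] (2 * (p - 1)) \<otimes> (\<delta> (Suc k) [^] (2::nat) \<otimes> x)"
    using m_assoc[OF nat_pow_closed[OF \<delta>c] nat_pow_closed[OF \<delta>c] x(1)] by simp
  ultimately show "\<delta> k [^] (2::nat) \<otimes> x \<in> N" by simp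
qed

text \<open>The p^j-th power of (\<pi> j)^K x is p^K x^(p^j), an element of N. Taking p-th roots j
  times puts (\<pi> j)^K x into \<open>star N\<close> for every j, and for large j the factor (\<pi>
  j)^K divides any given \<pi> k.\<close>

lemma star_bounded:
  assumes x: "x \<in> carrier R" and K: "\<And>i::nat. \<pi> 0 [^] (K::nat) \<otimes> x [^] i \<in> N"
  shows "x \<in> star N"
proof -
  have iter: "z \<in> star N" if "z \<in> carrier R" "\<And>i. i < j \<Longrightarrow> \<pi> 1 [^] (s::nat) \<otimes> z [^] (p ^ i) \<in> N" "z [^] (p ^ j) \<in> star N"
    for z s j
    using that
  proof (induction j)
    case (Suc j)
    have "(z [^] (p ^ j)) [^] p \<in> star N" using Suc.prems by (simp add: nat_pow_pow mult.commute)
    then have "z [^] (p ^ j) \<in> star N" using star_root[of "z [^] (p ^ j)" s] Suc.prems by simp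
    then show ?case using Suc by simp
  qed simp
  have in_star: "\<pi> j [^] K \<otimes> x \<in> star N" for j
  proof (rule iter[of _ j "p * K"])
    show "\<pi> j [^] K \<otimes> x \<in> carrier R" using x by simp
    have "(\<pi> j [^] K \<otimes> x) [^] (p ^ j) = \<pi> 0 [^] K \<otimes> x [^] (p ^ j)"
      using \<pi>_tower[of 0 j] x by (simp add: nat_pow_distrib pow_swap[of "\<pi> j" K])
    then have "(\<pi> j [^] K \<otimes> x) [^] (p ^ j) \<in> N" using K by simp
    then show "(\<pi> j [^] K \<otimes> x) [^] (p ^ j) \<in> star N"
      unfolding star_def using NE(6)[OF subsetD[OF AN \<delta>A]] Nc by blast
    fix i assume "i < j"
    \<comment> \<open>\<open>star_root\<close> measures denominators in \<pi> 1 = p^(1/p), so the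
      bound p^K has exponent pK there, the same for all intermediate roots.\<close>
    have e: "\<pi> 1 [^] (p * K) = \<pi> 0 [^] K" using \<pi>_Suc[of 0] by (metis One_nat_def \<pi>c nat_pow_pow)
    have "(\<pi> j [^] K \<otimes> x) [^] (p ^ i) = \<pi> j [^] (K * p ^ i) \<otimes> x [^] (p ^ i)"
      using x by (simp add: nat_pow_distrib nat_pow_pow)
    then have "\<pi> 1 [^] (p * K) \<otimes> (\<pi> j [^] K \<otimes> x) [^] (p ^ i) = \<pi> j [^] (K * p ^ i) \<otimes> (\<pi> 0 [^] K \<otimes> x [^] (p ^ i))"
      unfolding e using x by (simp add: m_ac)
    then show "\<pi> 1 [^] (p * K) \<otimes> (\<pi> j [^] K \<otimes> x) [^] (p ^ i) \<in> N"
      using NE(6)[OF subsetD[OF AN pow_A[OF \<pi>A]] K] by simp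
  qed
  show ?thesis
  proof (rule star_pow[OF x, of 2])
    fix k
    have "K \<le> p ^ K" using p2 by (meson less_exp less_imp_le power_mono le_trans zero_le)
    then have "\<pi> k = \<pi> (k + K) [^] (p ^ K - K) \<otimes> \<pi> (k + K) [^] K"
      using \<pi>_tower[of k K] by (simp add: nat_pow_mult)
    then have "\<delta> k [^] (2::nat) \<otimes> x = (\<gamma> k \<otimes> \<pi> (k + K) [^] (p ^ K - K)) \<otimes> (\<delta> k \<otimes> (\<pi> (k + K) [^] K \<otimes> x))"
      using x by (simp add: numeral_2_eq_2 \<delta>_def m_ac)
    moreover have "\<delta> k \<otimes> (\<pi> (k + K) [^] K \<otimes> x) \<in> N" using in_star unfolding star_def by blast
    moreover have "\<gamma> k \<otimes> \<pi> (k + K) [^] (p ^ K - K) \<in> N" using AE(6)[OF \<gamma>A pow_A[OF \<pi>A]] AN by blast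
    ultimately show "\<delta> k [^] (2::nat) \<otimes> x \<in> N" using NE(6) by simp
  qed
qed

end

text \<open>The condition on valuations says that x is integral over A. Since g is inverted in R as
  well, it has to be assumed separately that x has only a power of p as denominator; then all powers
  of x have bounded denominators.\<close>

lemma integral_star:
  assumes x: "x \<in> carrier R" and "\<pi> 0 [^] (K::nat) \<otimes> x \<in> A"
    and v: "\<And>v. is_valuation R v \<Longrightarrow> (\<And>f. f \<in> A \<Longrightarrow> (f, \<one>) \<in> v) \<Longrightarrow> (x, \<one>) \<in> v"
  shows "x \<in> star A"
proof -
  interpret E: subring_elt R A "\<pi> 0" by (intro subring_elt.intro subring_elt_axioms.intro cring_axioms A \<pi>A)
  have "x \<in> integral_closure R A" by (rule integral_closure_valuations[OF A x v])
  from E.integral_bounded[OF this assms(2)] obtain K' :: nat where "\<And>i::nat. \<pi> 0 [^] K' \<otimes> x [^] i \<in> A" by blast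
  then show ?thesis using star_bounded[OF frob_A x] by blast
qed

subsection \<open>Adjoining roots of \<open>p\<^sup>n/g\<close>\<close>

definition "vv n l = \<pi> l [^] (n::nat) \<otimes> inv (\<gamma> l)"

definition "MM n = (\<Union>l. pset R A (vv n l))"

lemma vv_closed [simp]: "vv n l \<in> carrier R" by (simp add: vv_def)

lemma \<gamma>_vv: "\<gamma> l \<otimes> vv n l = \<pi> l [^] n"
  unfolding vv_def by (subst m_lcomm) auto

lemma vv_unique: "x \<in> carrier R \<Longrightarrow> \<gamma> l \<otimes> x = \<pi> l [^] n \<Longrightarrow> x = vv n l"
  using Units_l_cancel[OF \<gamma>_Units, of x "vv n l" l] \<gamma>_vv by simp

lemma vv_pow: "vv n (l + k) [^] (p ^ k) = vv n l"
proof (rule vv_unique)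
  have "\<gamma> l \<otimes> vv n (l + k) [^] (p ^ k) = (\<gamma> (l + k) \<otimes> vv n (l + k)) [^] (p ^ k)"
    by (simp add: nat_pow_distrib \<gamma>_tower)
  also have "\<dots> = \<pi> l [^] n" unfolding \<gamma>_vv
    using \<pi>_tower[of l k] by (metis \<pi>c mult.commute nat_pow_pow)
  finally show "\<gamma> l \<otimes> vv n (l + k) [^] (p ^ k) = \<pi> l [^] n" .
qed simp

lemma pset_minimal:
  assumes "subring S R" "A \<subseteq> S" "y \<in> S"
  shows "pset R A y \<subseteq> S"
proof
  fix z assume "z \<in> pset R A y"
  then obtain a n where a: "\<And>i. a i \<in> A" "z = lsum R a (\<lambda>i. y [^] i) n" by (auto elim!: psetE)
  have "y [^] i \<in> S" for i :: nat by (induction i) (use subringE[OF assms(1)] assms(3) in auto)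
  then show "z \<in> S" unfolding a using a assms by (intro lsum_mem[OF subring_submod[OF assms(1)]]) auto
qed

lemma P_sub: "subring (pset R A (vv n l)) R" by (rule subring_pset[OF A]) simp

lemma A_pset: "A \<subseteq> pset R A (vv n l)" using pset_incl[OF AE(1), of "vv n l"] by auto

lemma vv_pset: "vv n l [^] (i::nat) \<in> pset R A (vv n l)"
proof (induction i)
  case (Suc i)
  then show ?case using subringE(6)[OF P_sub _ gen_in_pset[OF A vv_closed]] by simp
qed (use subringE(3)[OF P_sub] in simp)

lemma pset_mono:
  assumes "l \<le> l'"
  shows "pset R A (vv n l) \<subseteq> pset R A (vv n l')"
proof (rule pset_minimal[OF P_sub A_pset])
  have "vv n l = vv n l' [^] (p ^ (l' - l))" using vv_pow[of n l "l' - l"] assms by simp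
  then show "vv n l \<in> pset R A (vv n l')" using vv_pset by simp
qed

lemma MM_common:
  assumes "x \<in> MM n" "y \<in> MM n"
  obtains l where "l \<ge> L" "x \<in> pset R A (vv n l)" "y \<in> pset R A (vv n l)"
proof -
  obtain l1 l2 where "x \<in> pset R A (vv n l1)" "y \<in> pset R A (vv n l2)" using assms unfolding MM_def by auto
  moreover have "l1 \<le> max L (max l1 l2)" "l2 \<le> max L (max l1 l2)" "L \<le> max L (max l1 l2)" by auto
  ultimately show thesis using that[of "max L (max l1 l2)"] pset_mono by blast
qed

lemma MM_I: "x \<in> pset R A (vv n l) \<Longrightarrow> x \<in> MM n" unfolding MM_def by blast

lemma A_MM: "A \<subseteq> MM n" using A_pset MM_I by blast

lemma MM_subring: "subring (MM n) R"
proof (rule subringI)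
  note PE = subringE[OF P_sub]
  show "MM n \<subseteq> carrier R" unfolding MM_def using PE(1) by auto
  show "\<one> \<in> MM n" using A_MM AE(3) by auto
  show "\<ominus> h \<in> MM n" if "h \<in> MM n" for h using that PE(5) unfolding MM_def by blast
  fix h k assume "h \<in> MM n" "k \<in> MM n"
  then obtain l where l: "h \<in> pset R A (vv n l)" "k \<in> pset R A (vv n l)" using MM_common by blast
  show "h \<otimes> k \<in> MM n" by (rule MM_I[OF PE(6)[OF l]])
  show "h \<oplus> k \<in> MM n" by (rule MM_I[OF PE(7)[OF l]])
qed

text \<open>If \<open>F(v) = 0\<close> for a polynomial \<open>F\<close> and \<open>v = c/b\<close>, then formally \<open>F = (b V - c) H\<close>. The
  coefficients of \<open>c H\<close> are integral over \<open>A\<close>: for a valuation with \<open>|b| \<le> |c|\<close> go up from the constant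
  coefficient, otherwise go down from the leading one.\<close>

lemma division:
  fixes n l :: nat
  defines "b \<equiv> \<gamma> l" and "c \<equiv> \<pi> l [^] n" and "x \<equiv> vv n l"
  assumes F: "\<And>i. F i \<in> A" and F0: "\<And>i. i \<ge> d \<Longrightarrow> F i = \<zero>" and van: "lsum R F (\<lambda>i. x [^] i) d = \<zero>"
  obtains H where "\<And>i. H i \<in> carrier R" "F 0 = \<ominus> (c \<otimes> H 0)" "\<And>i. F (Suc i) = b \<otimes> H i \<ominus> c \<otimes> H (Suc i)"
    "\<And>i. i \<ge> d \<Longrightarrow> H i = \<zero>" "\<And>i. c \<otimes> H i \<in> star A"
proof -
  have bA: "b \<in> A" and cA: "c \<in> A" unfolding b_def c_def using \<gamma>A pow_A[OF \<pi>A] by auto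
  have bc: "b \<in> carrier R" and cc: "c \<in> carrier R" and xc: "x \<in> carrier R" using bA cA Ac unfolding x_def by auto
  have bU: "b \<in> Units R" and cU: "c \<in> Units R" unfolding b_def c_def
    by (auto intro: Units_pow_closed)
  have bx: "b \<otimes> x = c" unfolding b_def c_def x_def by (rule \<gamma>_vv)
  have xU: "x \<in> Units R" by (rule unit_factor[of _ b]) (use bx cU bc xc m_comm in auto)
  have Fc: "F i \<in> carrier R" for i using F Ac by auto
  \<comment> \<open>The formal power series quotient of F by bV - c. It exists because the constant
    term c is a unit of R.\<close>
  define H where "H = rec_nat (inv c \<otimes> \<ominus> F 0) (\<lambda>i h. inv c \<otimes> (b \<otimes> h \<ominus> F (Suc i)))"
  have H_0: "H 0 = inv c \<otimes> \<ominus> F 0" and H_S: "H (Suc i) = inv c \<otimes> (b \<otimes> H i \<ominus> F (Suc i))" for i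
    by (simp_all add: H_def)
  have Hc: "H i \<in> carrier R" for i by (induction i) (use Fc bc cU in \<open>auto simp: H_0 H_S\<close>)
  have cinv: "c \<otimes> (inv c \<otimes> y) = y" if "y \<in> carrier R" for y
    using that cU cc by (simp add: m_assoc[symmetric])
  have cH0: "c \<otimes> H 0 = \<ominus> F 0" unfolding H_0 by (rule cinv) (use Fc in simp)
  have cHS: "c \<otimes> H (Suc i) = b \<otimes> H i \<ominus> F (Suc i)" for i unfolding H_S by (rule cinv) (use Fc bc Hc in simp)
  have eq0: "F 0 = \<ominus> (c \<otimes> H 0)" unfolding cH0 using Fc by simp
  have eqS: "F (Suc i) = b \<otimes> H i \<ominus> c \<otimes> H (Suc i)" for i
    unfolding cHS using Fc[of "Suc i"] bc Hc[of i] by algebra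
  \<comment> \<open>The remainder of the truncated division at x is -c H_i x^i. It equals F(x) = 0
    once i >= d, and c and x are units, so H is a polynomial.\<close>
  have Hz: "H i = \<zero>" if "i \<ge> d" for i
  proof -
    have "lsum R F (\<lambda>i. x [^] i) (Suc i) = \<ominus> (c \<otimes> H i \<otimes> x [^] i)"
      by (rule telescope[OF bc cc xc bx Hc eq0 eqS])
    moreover have "lsum R F (\<lambda>i. x [^] i) (Suc i) = lsum R F (\<lambda>i. x [^] i) d"
      by (rule lsum_extend) (use F0 that Fc xc in auto)
    ultimately have "\<ominus> (c \<otimes> H i \<otimes> x [^] i) = \<zero>" using van by simp
    then have "c \<otimes> H i \<otimes> x [^] i = \<zero>" using cc Hc xc by (metis m_closed minus_minus minus_zero nat_pow_closed)
    then have "(c \<otimes> x [^] i) \<otimes> H i = (c \<otimes> x [^] i) \<otimes> \<zero>" using cc xc Hc by (simp add: m_ac)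
    moreover have "c \<otimes> x [^] i \<in> Units R" using cU xU by (simp add: Units_pow_closed)
    ultimately show ?thesis using Units_l_cancel Hc by blast
  qed
  have val: "(c \<otimes> H i, \<one>) \<in> v" if v: "is_valuation R v" "\<And>f. f \<in> A \<Longrightarrow> (f, \<one>) \<in> v" for v i
  proof (cases "(b, c) \<in> v")
    case True
    show ?thesis
    proof (induction i)
      case 0
      show ?case unfolding cH0 using valuation_uminus[OF v(1) v(2)[OF F]] .
    next
      case (Suc i)
      have "(b \<otimes> H i, c \<otimes> H i) \<in> v" using valuation_mult[OF v(1) True valuation_refl[OF v(1) Hc]] .
      then have "(b \<otimes> H i, \<one>) \<in> v" using Suc valuationD(4)[OF v(1)] by blast
      then show ?case unfolding cHS using valuation_minus[OF v(1) _ v(2)[OF F]] by blast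
    qed
  next
    case False
    then have cb: "(c, b) \<in> v" using valuationD(3)[OF v(1)] bc cc by blast
    have cH: "(c \<otimes> H i, b \<otimes> H i) \<in> v" for i using valuation_mult[OF v(1) cb valuation_refl[OF v(1) Hc]] .
    have "(b \<otimes> H (d - k), \<one>) \<in> v" for k
    proof (induction k)
      case 0
      show ?case using Hz[of d] bc valuation_zero[OF v(1)] by simp
    next
      case (Suc k)
      show ?case
      proof (cases "k < d")
        case True
        then have "Suc (d - Suc k) = d - k" by simp
        then have "b \<otimes> H (d - Suc k) = F (d - k) \<oplus> c \<otimes> H (d - k)"
          using cHS[of "d - Suc k"] Fc[of "d - k"] bc Hc[of "d - Suc k"]
          by (simp add: a_minus_def a_comm[of "F (d - k)"] a_assoc l_neg)
        moreover have "(c \<otimes> H (d - k), \<one>) \<in> v" using Suc cH valuationD(4)[OF v(1)] by blast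
        ultimately show ?thesis using valuationD(6)[OF v(1) v(2)[OF F]] by simp
      next
        case False
        then show ?thesis using Suc by simp
      qed
    qed
    note dn = this
    have "(b \<otimes> H i, \<one>) \<in> v"
    proof (cases "i \<le> d")
      case True
      then show ?thesis using dn[of "d - i"] by simp
    next
      case False
      then show ?thesis using Hz[of i] bc valuation_zero[OF v(1)] by simp
    qed
    then show ?thesis using cH valuationD(4)[OF v(1)] by blast
  qed
  \<comment> \<open>The recursion only divides by c, a power of p^(1/p^l); so the denominators of H
    are powers of p, as \<open>integral_star\<close> demands.\<close>
  have den: "c [^] Suc i \<otimes> H i \<in> A" for i
  proof (induction i)
    case 0
    show ?case using cH0 AE(5)[OF F] cc by simp
  next
    case (Suc i)
    have "c [^] Suc (Suc i) \<otimes> H (Suc i) = c [^] Suc i \<otimes> (c \<otimes> H (Suc i))" using cc Hc by (simp add: m_assoc)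
    also have "\<dots> = b \<otimes> (c [^] Suc i \<otimes> H i) \<ominus> c [^] Suc i \<otimes> F (Suc i)"
      unfolding cHS using bc Hc[of i] Fc[of "Suc i"] nat_pow_closed[OF cc, of "Suc i"]
      by (simp add: a_minus_def r_distr r_minus m_lcomm del: nat_pow_Suc)
    also have "\<dots> \<in> A" unfolding a_minus_def using AE(7)[OF AE(6)[OF bA Suc] AE(5)[OF AE(6)[OF pow_A[OF cA] F]]] .
    finally show ?case .
  qed
  have "c \<otimes> H i \<in> star A" for i
  proof (rule integral_star)
    show "c \<otimes> H i \<in> carrier R" using cc Hc by simp
    have "\<pi> 0 = \<pi> l [^] (p ^ l)" using \<pi>_tower[of 0 l] by simp
    then have "\<pi> 0 [^] (n * i) = \<pi> l [^] (n * i * p ^ l)" by (simp add: nat_pow_pow mult.commute)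
    also have "n * i * p ^ l = n * i * (p ^ l - 1) + n * i" using p2
      by (metis Suc_pred' mult.commute mult_Suc zero_less_power pos2 less_le_trans add.commute)
    finally have "\<pi> 0 [^] (n * i) = \<pi> l [^] (n * i * (p ^ l - 1)) \<otimes> c [^] i"
      unfolding c_def by (simp add: nat_pow_mult nat_pow_pow)
    then have "\<pi> 0 [^] (n * i) \<otimes> (c \<otimes> H i) = \<pi> l [^] (n * i * (p ^ l - 1)) \<otimes> (c [^] Suc i \<otimes> H i)"
      using cc Hc by (simp add: m_assoc)
    then show "\<pi> 0 [^] (n * i) \<otimes> (c \<otimes> H i) \<in> A" using AE(6)[OF pow_A[OF \<pi>A] den] by simp
  qed (rule val)
  then show thesis using that[OF Hc eq0 eqS Hz] by blast
qed

end

section \<open>Frobenius on M_n, and the estimates for kernel and cokernel\<close>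

context perf
begin

lemma le_pow: "n \<le> p ^ n"
  using p2 by (meson less_exp less_imp_le power_mono le_trans zero_le)

text \<open>Write x = Y(v) with v = v_l. Modulo p, x^p is the polynomial with coefficients Y_i^p in
  v^p, so the hypothesis becomes a polynomial F over A vanishing at v, and F = (bV - c) H. Taking
  p-th roots modulo p of b, c and a multiple of H gives a polynomial U with a factor b'V - c', which
  vanishes at v' = v_(l+1), while its coefficients have the same p-th powers modulo p as a multiple
  of those of Y(V^p). Injectivity of Frobenius on A compares the two coefficientwise modulo p^(1/p),
  and evaluation at v' leaves a multiple of x in p^(1/p) M_n.\<close>

lemma frob_MM: "frob (MM n)"
  unfolding frob_def
proof (intro conjI ballI impI allI)
  show "subring (MM n) R" by (rule MM_subring)
  show "A \<subseteq> MM n" by (rule A_MM)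
  fix x y k assume x: "x \<in> MM n" and y: "y \<in> MM n" and xy: "x [^] p = \<pi> 0 \<otimes> y"
  \<comment> \<open>The level is raised so that p^(l-k) >= n; then c' divides \<pi> (k+1), which
    pays for the final loss.\<close>
  obtain l where l: "l \<ge> k + n" "x \<in> pset R A (vv n l)" "y \<in> pset R A (vv n l)"
    using MM_common[OF x y] by blast
  define v where "v = vv n l"
  define v' where "v' = vv n (Suc l)"
  have vc: "v \<in> carrier R" "v' \<in> carrier R" unfolding v_def v'_def by simp_all
  have v'v: "v' [^] p = v" unfolding v_def v'_def using vv_pow[of n l 1] by simp
  note PE = subringE[OF P_sub[of n l, folded v_def]]
  obtain Y d where Y: "\<And>i. Y i \<in> A" "x = lsum R Y (\<lambda>i. v [^] i) d" using l(2) unfolding v_def by (auto elim!: psetE)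
  have Yc: "\<And>i. Y i \<in> carrier R" using Y Ac by auto
  have vP: "v [^] (i::nat) \<in> pset R A v" for i unfolding v_def by (rule vv_pset)
  have "cg (pset R A v) (nat_elem R p) (x [^] p) (lsum R (\<lambda>i. Y i [^] p) (\<lambda>i. (v [^] i) [^] p) d)"
    unfolding Y(2) by (rule freshman_lsum[OF P_sub[of n l, folded v_def] p])
      (use Y A_pset[of n l] vP in \<open>auto simp: v_def\<close>)
  then obtain w where w: "w \<in> pset R A v"
    "x [^] p = lsum R (\<lambda>i. Y i [^] p) (\<lambda>i. (v [^] i) [^] p) d \<oplus> \<pi> 0 \<otimes> w" unfolding cg_def \<pi>_0 by blast
  have "y \<oplus> \<ominus> w \<in> pset R A v" using PE(5,7) w(1) l(3) v_def by auto
  then obtain Z e where Z: "\<And>i. Z i \<in> A" "y \<oplus> \<ominus> w = lsum R Z (\<lambda>i. v [^] i) e" by (auto elim!: psetE)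
  have Zc: "\<And>i. Z i \<in> carrier R" using Z Ac by auto
  have wc: "w \<in> carrier R" and yc: "y \<in> carrier R" using w(1) l(3) PE(1) v_def by auto
  \<comment> \<open>x^p up to multiples of p, as a polynomial in v supported in degrees divisible by
    p.\<close>
  define sp where "sp = (\<lambda>m. if p dvd m then Y (m div p) [^] p else \<zero>)"
  have spc: "sp i \<in> carrier R" for i unfolding sp_def using Yc by simp
  have sp: "lsum R sp (\<lambda>m. v [^] m) (p * d) = lsum R (\<lambda>i. Y i [^] p) (\<lambda>i. (v [^] i) [^] p) d"
  proof -
    have "lsum R sp (\<lambda>m. v [^] m) (p * d) = lsum R (\<lambda>i. Y i [^] p) (\<lambda>i. (v [^] p) [^] i) d"
      unfolding sp_def by (rule lsum_sparse) (use Yc vc p2 in auto)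
    then show ?thesis using pow_swap[OF vc(1), of p] by simp
  qed
  define D where "D = max (p * d) e"
  define S where "S = (\<lambda>m. if m < p * d then sp m else \<zero>)"
  define T where "T = (\<lambda>m. if m < e then Z m else \<zero>)"
  \<comment> \<open>The hypothesis x^p = p y, written as a relation F(v) = 0; T collects the
    coefficients of y - w.\<close>
  define F where "F = (\<lambda>m. S m \<oplus> \<ominus> \<pi> 0 \<otimes> T m)"
  have vp: "\<And>i::nat. v [^] i \<in> carrier R" and vp': "\<And>i::nat. v' [^] i \<in> carrier R" using vc by auto
  have SA: "S m \<in> A" and TA: "T m \<in> A" for m unfolding S_def T_def sp_def using Y Z AE(2) pow_A by auto
  have Sc: "S m \<in> carrier R" and Tc: "T m \<in> carrier R" for m using SA TA Ac by auto
  have FA: "F m \<in> A" for m unfolding F_def using AE(5,6,7) SA TA \<pi>A by simp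
  have Fc: "F m \<in> carrier R" for m using FA Ac by auto
  have F0: "F i = \<zero>" if "i \<ge> D" for i using that unfolding F_def S_def T_def D_def by simp
  have Fv: "lsum R F (\<lambda>i. v [^] i) D = \<zero>"
  proof -
    have "lsum R F (\<lambda>i. v [^] i) D = lsum R S (\<lambda>i. v [^] i) D \<oplus> lsum R (\<lambda>m. \<ominus> \<pi> 0 \<otimes> T m) (\<lambda>i. v [^] i) D"
      unfolding F_def by (rule lsum_add[symmetric]) (use Sc Tc vp in auto)
    also have "lsum R (\<lambda>m. \<ominus> \<pi> 0 \<otimes> T m) (\<lambda>i. v [^] i) D = \<ominus> \<pi> 0 \<otimes> lsum R T (\<lambda>i. v [^] i) D"
      by (rule lsum_smult[symmetric]) (use Tc vp in auto)
    also have "lsum R T (\<lambda>i. v [^] i) D = y \<oplus> \<ominus> w" unfolding Z(2) T_def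
      by (rule lsum_pad) (use Zc vp in \<open>auto simp: D_def\<close>)
    also have "lsum R S (\<lambda>i. v [^] i) D = lsum R sp (\<lambda>m. v [^] m) (p * d)" unfolding S_def
      by (rule lsum_pad) (use spc vp in \<open>auto simp: D_def\<close>)
    also have "\<dots> \<oplus> \<ominus> \<pi> 0 \<otimes> (y \<oplus> \<ominus> w) = \<zero>"
    proof -
      have L: "lsum R (\<lambda>i. Y i [^] p) (\<lambda>i. (v [^] i) [^] p) d \<in> carrier R" (is "?L \<in> _") using Yc vc by auto
      have e: "?L \<oplus> \<pi> 0 \<otimes> w = \<pi> 0 \<otimes> y" using w(2) xy by simp
      have "?L \<oplus> \<ominus> \<pi> 0 \<otimes> (y \<oplus> \<ominus> w) = (?L \<oplus> \<pi> 0 \<otimes> w) \<oplus> \<ominus> (\<pi> 0 \<otimes> y)"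
        using L wc yc by (simp add: l_minus r_distr r_minus minus_add a_ac)
      then show ?thesis unfolding sp e using yc by (simp add: r_neg)
    qed
    finally show ?thesis .
  qed
  define b where "b = \<gamma> l"
  define c where "c = \<pi> l [^] n"
  obtain H where H: "\<And>i. H i \<in> carrier R" "F 0 = \<ominus> (c \<otimes> H 0)" "\<And>i. F (Suc i) = b \<otimes> H i \<ominus> c \<otimes> H (Suc i)"
    "\<And>i. i \<ge> D \<Longrightarrow> H i = \<zero>" "\<And>i. c \<otimes> H i \<in> star A"
    using division[OF FA F0 Fv[unfolded v_def]] unfolding b_def c_def by blast
  have bA: "b \<in> A" and cA: "c \<in> A" unfolding b_def c_def using \<gamma>A pow_A[OF \<pi>A] by auto
  have bc: "b \<in> carrier R" and cc: "c \<in> carrier R" using bA cA Ac by auto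
  \<comment> \<open>\<open>division\<close> puts c H only almost into A. The factor \<delta> k turns
    it into elements G of A, to which \<open>frob_surj\<close> applies.\<close>
  define \<theta> where "\<theta> = \<delta> k \<otimes> c"
  define G where "G m = \<theta> \<otimes> H m" for m
  have \<theta>A: "\<theta> \<in> A" unfolding \<theta>_def using AE(6) \<delta>A cA by simp
  have \<theta>c: "\<theta> \<in> carrier R" using \<theta>A Ac by auto
  have GA: "G m \<in> A" for m
  proof -
    have "G m = \<delta> k \<otimes> (c \<otimes> H m)" unfolding G_def \<theta>_def using cc H by (simp add: m_assoc)
    then show ?thesis using H(5) unfolding star_def by auto
  qed
  have Gc: "G m \<in> carrier R" for m using GA Ac by auto
  note cgs = cg_trans[OF A \<pi>A[of 0]] cg_refl[OF A \<pi>A[of 0]] cg_smult[OF A \<pi>A[of 0]] cg_minus[OF A \<pi>A[of 0]]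
  have "\<forall>m. \<exists>h. h \<in> A \<and> cg A (\<pi> 0) (h [^] p) (G m)" using frob_surj[OF GA] by blast
  then obtain h0 where h0: "\<And>m. h0 m \<in> A" "\<And>m. cg A (\<pi> 0) (h0 m [^] p) (G m)" by metis
  \<comment> \<open>From degree D on, H and G vanish, and the root 0 is forced so that h is a
    polynomial and the telescoping sum below has no boundary term.\<close>
  define h where "h m = (if D \<le> m then \<zero> else h0 m)" for m
  have zp: "\<zero> [^] p = \<zero>" using p2 by (cases p) auto
  have hA: "h m \<in> A" for m unfolding h_def using h0 AE(2) by simp
  have hc: "h m \<in> carrier R" for m using hA Ac by auto
  have hG: "cg A (\<pi> 0) (h m [^] p) (G m)" for m
    unfolding h_def using h0(2) H(4)[of m] \<theta>c cgs(2)[OF AE(2)] zp by (simp add: G_def)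
  \<comment> \<open>The coefficients of V h(V); likewise \<open>Gm\<close> for V G(V).\<close>
  define hm where "hm m = (if m = 0 then \<zero> else h (m - 1))" for m
  define Gm where "Gm m = (if m = 0 then \<zero> else G (m - 1))" for m
  have hmA: "hm m \<in> A" and GmA: "Gm m \<in> A" for m unfolding hm_def Gm_def using hA GA AE(2) by auto
  have hmc: "hm m \<in> carrier R" and Gmc: "Gm m \<in> carrier R" for m using hmA GmA Ac by auto
  have hmG: "cg A (\<pi> 0) (hm m [^] p) (Gm m)" for m
    unfolding hm_def Gm_def using hG cgs(2)[OF AE(2)] zp by simp
  have \<theta>F: "\<theta> \<otimes> F m = b \<otimes> Gm m \<ominus> c \<otimes> G m" for m
  proof (cases m)
    case 0
    then show ?thesis using H(1,2) \<theta>c bc cc by (simp add: Gm_def G_def a_minus_def r_minus m_lcomm)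
  next
    case (Suc i)
    then show ?thesis using H(1) \<theta>c bc cc
      by (simp add: Gm_def G_def H(3) a_minus_def r_minus r_distr m_lcomm)
  qed
  define b' where "b' = \<gamma> (Suc l)"
  define c' where "c' = \<pi> (Suc l) [^] n"
  define \<theta>' where "\<theta>' = \<delta> (Suc k) \<otimes> c'"
  have b'A: "b' \<in> A" and c'A: "c' \<in> A" unfolding b'_def c'_def using \<gamma>A pow_A[OF \<pi>A] by auto
  have \<theta>'A: "\<theta>' \<in> A" unfolding \<theta>'_def using AE(6) \<delta>A c'A by simp
  have b'c: "b' \<in> carrier R" and c'c: "c' \<in> carrier R" and \<theta>'c: "\<theta>' \<in> carrier R" using b'A c'A \<theta>'A Ac by auto
  have b'p: "b' [^] p = b" unfolding b'_def b_def by (rule \<gamma>_Suc)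
  have c'p: "c' [^] p = c" unfolding c'_def c_def using pow_swap[OF \<pi>c, of "Suc l" n p] \<pi>_Suc by simp
  have \<theta>'p: "\<theta>' [^] p = \<theta>" unfolding \<theta>'_def \<theta>_def using c'c by (simp add: nat_pow_distrib \<delta>_Suc c'p)
  \<comment> \<open>The coefficients of (b'V - c') h(V). Their p-th powers are congruent to those of
    (bV - c) G(V), and the polynomial vanishes at v' because b' v' = c'.\<close>
  define U where "U m = b' \<otimes> hm m \<ominus> c' \<otimes> h m" for m
  have UA: "U m \<in> A" for m unfolding U_def a_minus_def using AE(5,6,7) b'A c'A hA hmA by simp
  have Uc: "U m \<in> carrier R" for m using UA Ac by auto
  \<comment> \<open>The coefficients of Y(V^p): exact p-th roots of S, with value Y(v) = x at v'
    since v'^p = v.\<close>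
  define s where "s m = (if m < p * d then (if p dvd m then Y (m div p) else \<zero>) else \<zero>)" for m
  have sA: "s m \<in> A" for m unfolding s_def using Y AE(2) by simp
  have sc: "s m \<in> carrier R" for m using sA Ac by auto
  have sS: "s m [^] p = S m" for m unfolding s_def S_def sp_def using zp by simp
  have UF: "cg A (\<pi> 0) (U m [^] p) (\<theta> \<otimes> F m)" for m
  proof -
    have 1: "cg A (\<pi> 0) (U m [^] p) ((b' \<otimes> hm m) [^] p \<ominus> (c' \<otimes> h m) [^] p)"
      unfolding U_def \<pi>_0 by (rule cg_minus_pow[OF A p]) (use AE(6) b'A c'A hA hmA in auto)
    have e: "(b' \<otimes> hm m) [^] p = b \<otimes> hm m [^] p" "(c' \<otimes> h m) [^] p = c \<otimes> h m [^] p"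
      using b'c c'c hmc hc by (simp_all add: nat_pow_distrib b'p c'p)
    have 2: "cg A (\<pi> 0) (b \<otimes> hm m [^] p \<ominus> c \<otimes> h m [^] p) (b \<otimes> Gm m \<ominus> c \<otimes> G m)"
      by (rule cgs(4)[OF cgs(3)[OF hmG bA GmA] cgs(3)[OF hG cA GA]]) (use AE(6) bA cA GA GmA hA pow_A in auto)
    show ?thesis unfolding \<theta>F using 1 2 unfolding e
      by (rule cgs(1)) (use AE(5,6,7) bA cA GA GmA in \<open>simp add: a_minus_def\<close>)
  qed
  have FS: "cg A (\<pi> 0) (\<theta> \<otimes> F m) ((\<theta>' \<otimes> s m) [^] p)" for m
  proof -
    have "\<theta> \<otimes> F m = (\<theta>' \<otimes> s m) [^] p \<oplus> \<pi> 0 \<otimes> (\<ominus> (\<theta> \<otimes> T m))"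
      using \<theta>'c sc \<theta>c Sc Tc by (simp add: nat_pow_distrib \<theta>'p sS F_def r_distr l_minus r_minus m_lcomm)
    then show ?thesis unfolding cg_def using AE(5,6) \<theta>A TA by blast
  qed
  \<comment> \<open>Both U_m and \<theta>' s_m have p-th power congruent to \<theta> F_m modulo p,
    so their difference has a p-th power in pA and \<open>frob_inj\<close> applies, with the factor
    \<gamma> (k+1).\<close>
  have "\<exists>z. z \<in> A \<and> \<gamma> (Suc k) \<otimes> (U m \<ominus> \<theta>' \<otimes> s m) = \<pi> 1 \<otimes> z" for m
  proof -
    define q where "q = \<theta>' \<otimes> s m"
    have qA: "q \<in> A" unfolding q_def using AE(6) \<theta>'A sA by simp
    have qc: "q \<in> carrier R" using qA Ac by auto
    have "cg A (\<pi> 0) (U m [^] p) (q [^] p)"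
      unfolding q_def by (rule cgs(1)[OF UF FS]) (use pow_A qA q_def in auto)
    then have 1: "cg A (\<pi> 0) (U m [^] p \<ominus> q [^] p) (q [^] p \<ominus> q [^] p)"
      by (rule cgs(4)[OF _ cgs(2)]) (use pow_A qA in auto)
    have 2: "cg A (\<pi> 0) ((U m \<ominus> q) [^] p) (U m [^] p \<ominus> q [^] p)"
      unfolding \<pi>_0 by (rule cg_minus_pow[OF A p UA qA])
    have "cg A (\<pi> 0) ((U m \<ominus> q) [^] p) \<zero>"
      using cgs(1)[OF 2 1] AE(2) qc by (simp add: a_minus_def r_neg)
    then obtain w where w: "w \<in> A" "(U m \<ominus> q) [^] p = \<pi> 0 \<otimes> w" using cg_zero[OF A \<pi>A] by blast
    have "U m \<ominus> q \<in> A" unfolding a_minus_def using AE(5,7) UA qA by simp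
    from frob_inj[OF this w] show ?thesis unfolding q_def by blast
  qed
  then obtain z where z: "\<And>m. z m \<in> A" "\<And>m. \<gamma> (Suc k) \<otimes> (U m \<ominus> \<theta>' \<otimes> s m) = \<pi> 1 \<otimes> z m" by metis
  have zc: "z m \<in> carrier R" for m using z Ac by auto
  define W where "W = lsum R z (\<lambda>m. v' [^] m) (Suc D)"
  have WM: "W \<in> MM n"
  proof -
    have "W \<in> pset R A (vv n (Suc l))" unfolding W_def v'_def by (rule psetI) (rule z)
    then show ?thesis by (rule MM_I)
  qed
  have Wc: "W \<in> carrier R" unfolding W_def using zc vp' by auto
  have Us: "lsum R U (\<lambda>m. v' [^] m) (Suc D) = \<zero>"
  proof -
    have b'v: "b' \<otimes> v' = c'" unfolding b'_def v'_def c'_def by (rule \<gamma>_vv)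
    have "lsum R U (\<lambda>m. v' [^] m) (Suc D) = \<ominus> (c' \<otimes> h D \<otimes> v' [^] D)"
      by (rule telescope[OF b'c c'c vc(2) b'v hc]) (use b'c c'c hc in \<open>simp_all add: U_def hm_def a_minus_def\<close>)
    then show ?thesis using c'c vp' by (simp add: h_def)
  qed
  have ss: "lsum R s (\<lambda>m. v' [^] m) (Suc D) = x"
  proof -
    have "lsum R s (\<lambda>m. v' [^] m) (Suc D) = lsum R (\<lambda>m. if p dvd m then Y (m div p) else \<zero>) (\<lambda>m. v' [^] m) (p * d)"
      unfolding s_def by (rule lsum_pad) (use Yc vp' in \<open>auto simp: D_def\<close>)
    also have "\<dots> = lsum R Y (\<lambda>i. (v' [^] p) [^] i) d" by (rule lsum_sparse) (use Yc vc p2 in auto)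
    finally show ?thesis unfolding v'v Y(2) .
  qed
  have xc: "x \<in> carrier R" using subringE(1)[OF MM_subring] x by auto
  have key: "\<gamma> (Suc k) \<otimes> (\<ominus> (\<theta>' \<otimes> x)) = \<pi> 1 \<otimes> W"
  proof -
    have "\<pi> 1 \<otimes> W = lsum R (\<lambda>m. \<gamma> (Suc k) \<otimes> (U m \<oplus> \<ominus> \<theta>' \<otimes> s m)) (\<lambda>m. v' [^] m) (Suc D)"
      unfolding W_def using z(2) zc vp' sc \<theta>'c
      by (subst lsum_smult) (auto intro!: lsum_cong simp: a_minus_def l_minus simp del: lsum.simps)
    also have "\<dots> = \<gamma> (Suc k) \<otimes> lsum R (\<lambda>m. U m \<oplus> \<ominus> \<theta>' \<otimes> s m) (\<lambda>m. v' [^] m) (Suc D)"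
      by (rule lsum_smult[symmetric]) (use Uc sc \<theta>'c vp' in auto)
    also have "lsum R (\<lambda>m. U m \<oplus> \<ominus> \<theta>' \<otimes> s m) (\<lambda>m. v' [^] m) (Suc D)
        = lsum R U (\<lambda>m. v' [^] m) (Suc D) \<oplus> lsum R (\<lambda>m. \<ominus> \<theta>' \<otimes> s m) (\<lambda>m. v' [^] m) (Suc D)"
      by (rule lsum_add[symmetric]) (use Uc sc \<theta>'c vp' in auto)
    also have "lsum R (\<lambda>m. \<ominus> \<theta>' \<otimes> s m) (\<lambda>m. v' [^] m) (Suc D) = \<ominus> \<theta>' \<otimes> lsum R s (\<lambda>m. v' [^] m) (Suc D)"
      by (rule lsum_smult[symmetric]) (use sc \<theta>'c vp' in auto)
    finally show ?thesis unfolding Us ss using \<theta>'c xc by (simp add: l_minus)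
  qed
  \<comment> \<open>The total loss is \<gamma> (k+1) \<delta> (k+1) c'. As c' divides \<pi> (k+1),
    it divides \<delta> (k+1)^2 and hence \<delta> k; the element a is the cofactor.\<close>
  define r where "r = p ^ (l - k) - n"
  define a where "a = \<delta> (Suc k) [^] (p - 2) \<otimes> \<pi> (Suc l) [^] r"
  have aA: "a \<in> A" unfolding a_def using AE(6) \<pi>A \<delta>A pow_A by simp
  have ac: "a \<in> carrier R" using aA Ac by auto
  have "n \<le> l - k" using l(1) by simp
  then have "n \<le> p ^ (l - k)" using le_pow[of "l - k"] le_trans by blast
  then have pk: "\<pi> (Suc k) = \<pi> (Suc l) [^] r \<otimes> c'"
    unfolding c'_def r_def using \<pi>_tower[of "Suc k" "l - k"] l(1) by (simp add: nat_pow_mult)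
  have "\<delta> k = a \<otimes> (\<gamma> (Suc k) \<otimes> \<theta>')"
  proof -
    have "p = (p - 2) + 2" using p2 by simp
    then have "\<delta> k = \<delta> (Suc k) [^] (p - 2) \<otimes> \<delta> (Suc k) [^] (2::nat)"
      using \<delta>_Suc[of k] by (metis \<delta>c nat_pow_mult)
    also have "\<delta> (Suc k) [^] (2::nat) = \<pi> (Suc k) \<otimes> (\<gamma> (Suc k) \<otimes> \<delta> (Suc k))"
      by (simp add: numeral_2_eq_2 \<delta>_def m_ac)
    also have "\<dots> = \<pi> (Suc l) [^] r \<otimes> (\<gamma> (Suc k) \<otimes> \<theta>')"
      by (subst pk) (use c'c in \<open>simp add: \<theta>'_def m_ac\<close>)
    finally show ?thesis unfolding a_def using \<theta>'c by (simp add: m_assoc)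
  qed
  then have "\<delta> k \<otimes> x = \<pi> 1 \<otimes> (\<ominus> (a \<otimes> W))"
  proof -
    assume e: "\<delta> k = a \<otimes> (\<gamma> (Suc k) \<otimes> \<theta>')"
    have "\<delta> k \<otimes> x = \<ominus> (a \<otimes> (\<gamma> (Suc k) \<otimes> (\<ominus> (\<theta>' \<otimes> x))))"
      unfolding e using ac \<theta>'c xc by (simp add: r_minus m_assoc)
    then show ?thesis unfolding key using ac Wc by (simp add: r_minus m_lcomm)
  qed
  moreover have "\<ominus> (a \<otimes> W) \<in> MM n" using subringE(5,6)[OF MM_subring] subsetD[OF A_MM aA] WM by simp
  ultimately show "\<exists>z\<in>MM n. \<delta> k \<otimes> x = \<pi> 1 \<otimes> z" by blast
qed

lemma MM_star:
  assumes "x \<in> carrier R" "\<And>i::nat. \<pi> 0 [^] (K::nat) \<otimes> x [^] i \<in> pset R A (vv n 0)"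
  shows "x \<in> star (MM n)"
  using star_bounded[OF frob_MM assms(1)] MM_I assms(2) by blast

text \<open>The factor g^(1/p^(k+1)) is \<gamma> l to the power q = p^(l-k-1). It clears the
  denominators of the powers up to q of v' = v_l for n', which land in A. A higher power i contains
  (n' - n) i >= m p^(k+1) q = m p^l factors p^(1/p^l) more than the same power of v_l for n, and is
  divisible by p^m in M_n.\<close>

lemma cokernel_estimate:
  assumes x: "x \<in> star (MM n')" and n: "n + m * p ^ Suc k \<le> n'"
  shows "\<exists>a\<in>A. \<exists>w\<in>MM n. \<delta> k \<otimes> x = a \<oplus> \<pi> 0 [^] m \<otimes> w"
proof -
  have xc: "x \<in> carrier R" using x unfolding star_def by blast
  note ME = subringE[OF MM_subring]
  have Mc: "\<And>y n. y \<in> MM n \<Longrightarrow> y \<in> carrier R" using ME(1) by auto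
  have "\<delta> (Suc k) \<otimes> x \<in> MM n'" using x unfolding star_def by blast
  then obtain l where l: "l \<ge> Suc k" "\<delta> (Suc k) \<otimes> x \<in> pset R A (vv n' l)"
    using MM_common[of "\<delta> (Suc k) \<otimes> x" n' "\<delta> (Suc k) \<otimes> x"] by blast
  obtain a d where a: "\<And>i. a i \<in> A" "\<delta> (Suc k) \<otimes> x = lsum R a (\<lambda>i. vv n' l [^] i) d" using l(2) by (auto elim!: psetE)
  have ac: "\<And>i. a i \<in> carrier R" using a Ac by auto
  \<comment> \<open>The A-submodule A + p^m M_n, so that each monomial can be treated on its
    own.\<close>
  define Q where "Q = {y. \<exists>a\<in>A. \<exists>w\<in>MM n. y = a \<oplus> \<pi> 0 [^] m \<otimes> w}"
  have Q: "submod R A Q"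
    unfolding submod_def
  proof (intro conjI ballI)
    show "Q \<subseteq> carrier R" unfolding Q_def using Ac Mc by auto
    have "\<zero> = \<zero> \<oplus> \<pi> 0 [^] m \<otimes> \<zero>" by simp
    then show "\<zero> \<in> Q" unfolding Q_def using AE(2) ME(2) by blast
    show "y \<oplus> z \<in> Q" if yz: "y \<in> Q" "z \<in> Q" for y z
    proof -
      obtain a w b u where *: "a \<in> A" "w \<in> MM n" "y = a \<oplus> \<pi> 0 [^] m \<otimes> w" "b \<in> A" "u \<in> MM n" "z = b \<oplus> \<pi> 0 [^] m \<otimes> u"
        using yz unfolding Q_def by blast
      have "y \<oplus> z = (a \<oplus> b) \<oplus> \<pi> 0 [^] m \<otimes> (w \<oplus> u)" unfolding * using * Ac Mc by (simp add: r_distr a_ac)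
      then show ?thesis unfolding Q_def using AE(7)[OF *(1,4)] ME(7)[OF *(2,5)] by blast
    qed
    show "c \<otimes> y \<in> Q" if cy: "c \<in> A" "y \<in> Q" for c y
    proof -
      obtain a w where *: "a \<in> A" "w \<in> MM n" "y = a \<oplus> \<pi> 0 [^] m \<otimes> w" using cy unfolding Q_def by blast
      have "c \<otimes> y = (c \<otimes> a) \<oplus> \<pi> 0 [^] m \<otimes> (c \<otimes> w)" unfolding * using * cy Ac Mc by (simp add: r_distr m_lcomm)
      then show ?thesis unfolding Q_def using AE(6)[OF cy(1) *(1)] ME(6)[OF subsetD[OF A_MM cy(1)] *(2)] by blast
    qed
  qed
  define q where "q = p ^ (l - Suc k)"
  have g: "\<gamma> (Suc k) = \<gamma> l [^] q" using \<gamma>_tower[of "Suc k" "l - Suc k"] l(1) by (simp add: q_def)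
  have \<gamma>v: "\<gamma> l [^] i \<otimes> vv n' l [^] i = \<pi> l [^] (n' * i)" for i :: nat
    using \<gamma>_vv[of l n'] by (simp add: nat_pow_distrib[symmetric] nat_pow_pow)
  have terms: "\<gamma> (Suc k) \<otimes> vv n' l [^] i \<in> Q" for i :: nat
  proof (cases "i \<le> q")
    case True
    then have "\<gamma> (Suc k) = \<gamma> l [^] (q - i) \<otimes> \<gamma> l [^] i" unfolding g by (simp add: nat_pow_mult)
    then have "\<gamma> (Suc k) \<otimes> vv n' l [^] i = \<gamma> l [^] (q - i) \<otimes> \<pi> l [^] (n' * i)"
      using \<gamma>v[of i] by (simp add: m_assoc)
    then have "\<gamma> (Suc k) \<otimes> vv n' l [^] i \<in> A" using AE(6)[OF pow_A[OF \<gamma>A] pow_A[OF \<pi>A]] by simp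
    moreover from this have "\<gamma> (Suc k) \<otimes> vv n' l [^] i = \<gamma> (Suc k) \<otimes> vv n' l [^] i \<oplus> \<pi> 0 [^] m \<otimes> \<zero>" by simp
    ultimately show ?thesis unfolding Q_def using ME(2) by blast
  next
    case False
    \<comment> \<open>Passing from n' to n releases n' - n factors p^(1/p^l) for each factor
      v_l.\<close>
    have vs: "vv n' l = \<pi> l [^] (n' - n) \<otimes> vv n l"
    proof (rule vv_unique[symmetric])
      have "\<gamma> l \<otimes> (\<pi> l [^] (n' - n) \<otimes> vv n l) = \<pi> l [^] (n' - n) \<otimes> \<pi> l [^] n"
        by (subst m_lcomm) (simp_all add: \<gamma>_vv)
      then show "\<gamma> l \<otimes> (\<pi> l [^] (n' - n) \<otimes> vv n l) = \<pi> l [^] n'" using n by (simp add: nat_pow_mult)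
    qed simp
    define r where "r = (n' - n) * i - m * p ^ l"
    have "m * p ^ Suc k * q \<le> (n' - n) * i" by (rule mult_le_mono) (use n False in auto)
    moreover have "p ^ Suc k * q = p ^ l" unfolding q_def using l(1) by (simp add: power_add[symmetric] del: power_Suc)
    ultimately have r: "(n' - n) * i = r + m * p ^ l" unfolding r_def by (simp add: mult.assoc)
    have \<pi>l: "\<pi> l [^] (m * p ^ l) = \<pi> 0 [^] m"
      using \<pi>_tower[of 0 l] nat_pow_pow[OF \<pi>c, of l "p ^ l" m] by (simp add: mult.commute)
    have "vv n' l [^] i = \<pi> l [^] ((n' - n) * i) \<otimes> vv n l [^] i"
      unfolding vs by (simp add: nat_pow_distrib nat_pow_pow)
    also have "\<dots> = \<pi> 0 [^] m \<otimes> (\<pi> l [^] r \<otimes> vv n l [^] i)"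
      unfolding r by (simp add: nat_pow_mult[symmetric] \<pi>l m_ac)
    finally have "\<gamma> (Suc k) \<otimes> vv n' l [^] i = \<zero> \<oplus> \<pi> 0 [^] m \<otimes> (\<gamma> (Suc k) \<otimes> (\<pi> l [^] r \<otimes> vv n l [^] i))"
      by (simp add: m_lcomm)
    moreover have "\<gamma> (Suc k) \<otimes> (\<pi> l [^] r \<otimes> vv n l [^] i) \<in> MM n"
      using ME(6)[OF subsetD[OF A_MM \<gamma>A] ME(6)[OF subsetD[OF A_MM pow_A[OF \<pi>A]] MM_I[OF vv_pset]]] .
    ultimately show ?thesis unfolding Q_def using AE(2) by blast
  qed
  have "\<gamma> (Suc k) \<otimes> (\<delta> (Suc k) \<otimes> x) = lsum R a (\<lambda>i. \<gamma> (Suc k) \<otimes> vv n' l [^] i) d"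
    unfolding a(2) by (rule lsum_smult_right) (use ac in auto)
  also have "\<dots> \<in> Q" by (rule lsum_mem[OF Q]) (use a terms in auto)
  finally have 1: "\<gamma> (Suc k) \<otimes> (\<delta> (Suc k) \<otimes> x) \<in> Q" .
  \<comment> \<open>\<delta> k is the p-th power of \<delta> (k+1). Two of its p factors cover the
    losses \<gamma> (k+1) and \<delta> (k+1), with one \<pi> (k+1) left over.\<close>
  have "\<delta> k = (\<delta> (Suc k) [^] (p - 2) \<otimes> \<pi> (Suc k)) \<otimes> (\<gamma> (Suc k) \<otimes> \<delta> (Suc k))"
  proof -
    have "p = (p - 2) + 2" using p2 by simp
    then have "\<delta> k = \<delta> (Suc k) [^] (p - 2) \<otimes> \<delta> (Suc k) [^] (2::nat)"
      using \<delta>_Suc[of k] by (metis \<delta>c nat_pow_mult)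
    also have "\<delta> (Suc k) [^] (2::nat) = \<pi> (Suc k) \<otimes> (\<gamma> (Suc k) \<otimes> \<delta> (Suc k))"
      by (simp add: numeral_2_eq_2 \<delta>_def m_ac)
    finally show ?thesis by (simp add: m_assoc)
  qed
  then have "\<delta> k \<otimes> x = (\<delta> (Suc k) [^] (p - 2) \<otimes> \<pi> (Suc k)) \<otimes> (\<gamma> (Suc k) \<otimes> (\<delta> (Suc k) \<otimes> x))"
    using xc by (simp add: m_assoc)
  moreover have "\<delta> (Suc k) [^] (p - 2) \<otimes> \<pi> (Suc k) \<in> A" using AE(6)[OF pow_A[OF \<delta>A] \<pi>A] .
  ultimately have "\<delta> k \<otimes> x \<in> Q" using submodD(5)[OF Q _ 1] by simp
  then show ?thesis unfolding Q_def by blast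
qed

text \<open>Put j = k+2, so that y = \<delta> j z is a polynomial in v_l. At a valuation with |v_l|
  <= 1 one has |y| <= 1. Otherwise |\<gamma> l| <= |\<pi> l|^n, hence |\<gamma> j| <= |p^m| by the
  bound on n, and |\<gamma> j y| <= |p^m y| <= 1. So \<gamma> j y is integral over A and almost in
  A. The losses \<delta> j, \<gamma> j, \<delta> j divide (\<delta> j)^3, and p^2 >= 3.\<close>

lemma kernel_estimate:
  assumes z: "z \<in> star (MM n)" and zA: "\<pi> 0 [^] m \<otimes> z \<in> A" and n: "m * p ^ (k + 2) \<le> n"
  shows "\<delta> k \<otimes> z \<in> A"
proof -
  define j where "j = k + 2"
  have zc: "z \<in> carrier R" using z unfolding star_def by blast
  define y where "y = \<delta> j \<otimes> z"
  have yM: "y \<in> MM n" using z unfolding star_def y_def by blast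
  have yc: "y \<in> carrier R" unfolding y_def using zc by simp
  obtain l where l: "l \<ge> j" "y \<in> pset R A (vv n l)" using MM_common[OF yM yM] by blast
  obtain a d where a: "\<And>i. a i \<in> A" "y = lsum R a (\<lambda>i. vv n l [^] i) d" using l(2) by (auto elim!: psetE)
  define q where "q = p ^ (l - j)"
  have g: "\<gamma> j = \<gamma> l [^] q" using \<gamma>_tower[of j "l - j"] l(1) by (simp add: q_def)
  have pj: "p ^ j * q = p ^ l" unfolding q_def using l(1) by (simp add: power_add[symmetric])
  have yA: "\<pi> 0 [^] m \<otimes> y \<in> A"
  proof -
    have "\<pi> 0 [^] m \<otimes> y = \<delta> j \<otimes> (\<pi> 0 [^] m \<otimes> z)" unfolding y_def using zc by (simp add: m_lcomm)
    then show ?thesis using AE(6)[OF \<delta>A zA] by simp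
  qed
  have "\<gamma> j \<otimes> y \<in> star A"
  proof (rule integral_star)
    show "\<gamma> j \<otimes> y \<in> carrier R" using yc by simp
    have "\<pi> 0 [^] m \<otimes> (\<gamma> j \<otimes> y) = \<gamma> j \<otimes> (\<pi> 0 [^] m \<otimes> y)" using yc by (simp add: m_lcomm)
    then show "\<pi> 0 [^] m \<otimes> (\<gamma> j \<otimes> y) \<in> A" using AE(6)[OF \<gamma>A yA] by simp
    fix v assume v: "is_valuation R v" "\<And>f. f \<in> A \<Longrightarrow> (f, \<one>) \<in> v"
    note V = valuationD[OF v(1)]
    show "(\<gamma> j \<otimes> y, \<one>) \<in> v"
    proof (cases "(vv n l, \<one>) \<in> v")
      case True
      have vi: "(vv n l [^] i, \<one>) \<in> v" for i :: nat using valuation_pow[OF v(1) True, of i] by simp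
      have "(a i \<otimes> vv n l [^] i, \<one>) \<in> v" for i
        using valuation_mult[OF v(1) v(2)[OF a(1)] vi, of i i] by simp
      then have "(y, \<one>) \<in> v" unfolding a(2) using valuation_lsum[OF v(1)] by simp
      then show ?thesis using valuation_mult[OF v(1) v(2)[OF \<gamma>A]] by fastforce
    next
      case False
      then have "(\<one>, vv n l) \<in> v" using V(3) by simp
      from valuation_mult[OF v(1) valuation_refl[OF v(1) \<gamma>c[of l]] this]
      have "(\<gamma> l, \<pi> l [^] n) \<in> v" by (simp add: \<gamma>_vv)
      from valuation_pow[OF v(1) this, of q] have 1: "(\<gamma> j, \<pi> l [^] (n * q)) \<in> v"
        unfolding g by (simp add: nat_pow_pow)
      have "m * p ^ j * q \<le> n * q" using n unfolding j_def by (rule mult_le_mono1)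
      then have "n * q = (n * q - m * p ^ l) + p ^ l * m" using pj by (simp add: mult.assoc mult.commute[of "p ^ l" m])
      then have "\<pi> l [^] (n * q) = \<pi> l [^] (n * q - m * p ^ l) \<otimes> \<pi> 0 [^] m"
        using \<pi>_tower[of 0 l] by (metis \<pi>c add_0 nat_pow_mult nat_pow_pow)
      then have "\<pi> l [^] (n * q) \<otimes> y = \<pi> l [^] (n * q - m * p ^ l) \<otimes> (\<pi> 0 [^] m \<otimes> y)" using yc by (simp add: m_assoc)
      then have "\<pi> l [^] (n * q) \<otimes> y \<in> A" using AE(6)[OF pow_A[OF \<pi>A] yA] by simp
      then have "(\<pi> l [^] (n * q) \<otimes> y, \<one>) \<in> v" by (rule v(2))
      moreover have "(\<gamma> j \<otimes> y, \<pi> l [^] (n * q) \<otimes> y) \<in> v" using valuation_mult[OF v(1) 1 valuation_refl[OF v(1) yc]] .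
      ultimately show ?thesis using V(4) by blast
    qed
  qed
  then have 1: "\<delta> j \<otimes> (\<gamma> j \<otimes> y) \<in> A" unfolding star_def by blast
  have "\<delta> k \<otimes> z = (\<delta> j [^] (p ^ 2 - 3) \<otimes> \<pi> j) \<otimes> (\<delta> j \<otimes> (\<gamma> j \<otimes> y))"
  proof -
    have "(2::nat) ^ 2 \<le> p ^ 2" using p2 by (rule power_mono) simp
    then have "p ^ 2 = (p ^ 2 - 3) + 3" by simp
    then have "\<delta> k = \<delta> j [^] (p ^ 2 - 3) \<otimes> \<delta> j [^] (3::nat)"
      using \<delta>_tower[of k 2] unfolding j_def by (metis \<delta>c nat_pow_mult)
    also have "\<delta> j [^] (3::nat) = \<pi> j \<otimes> \<gamma> j \<otimes> \<delta> j \<otimes> \<delta> j" by (simp add: numeral_3_eq_3 \<delta>_def m_ac)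
    finally show ?thesis unfolding y_def using zc by (simp add: m_ac)
  qed
  then show ?thesis using AE(6)[OF AE(6)[OF pow_A[OF \<delta>A] \<pi>A] 1] by simp
qed

end

section \<open>Integral perfectoid algebras\<close>

lemma (in cring) hom_pow:
  assumes "cring S" "h \<in> ring_hom R S" "x \<in> carrier R"
  shows "h (x [^] (n::nat)) = h x [^]\<^bsub>S\<^esub> n"
  by (induction n) (use assms ring_hom_mult[OF assms(2)] ring_hom_one[OF assms(2)] in auto)

locale perfectoid_elt =
  fixes p :: nat and A :: "'a ring" (structure) and \<iota> :: "perfd \<Rightarrow> 'a" and groot :: "nat \<Rightarrow> 'a"
  assumes prime_p: "Factorial_Ring.prime p" and perfectoid: "integral_perfectoid p A \<iota>"
    and gr [simp]: "\<And>k. groot k \<in> carrier A" and gr_Suc: "\<And>k. groot (Suc k) [^] p = groot k"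
begin

sublocale cring A using perfectoid unfolding integral_perfectoid_def by blast

abbreviation "pA \<equiv> nat_elem A p"

definition "\<omega> k = \<iota> (K_root p k)"

lemma pgt0: "p > 0" using prime_p prime_gt_0_nat by blast

interpretation K: K_setup p by unfold_locales (rule pgt0)

lemma \<iota>_hom: "\<iota> \<in> ring_hom (K_ints p) A" using perfectoid unfolding integral_perfectoid_def by blast

lemma \<omega>c [simp]: "\<omega> k \<in> carrier A"
  unfolding \<omega>_def by (rule ring_hom_closed[OF \<iota>_hom K.K_root_closed])

lemma \<omega>_Suc: "\<omega> (Suc k) [^] p = \<omega> k"
  unfolding \<omega>_def using cring.hom_pow[OF K.K_ints_cring cring_axioms \<iota>_hom K.K_root_closed, of "Suc k" p] K.K_root_Suc
  by simp

lemma \<omega>_0: "\<omega> 0 = pA"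
  unfolding \<omega>_def K.K_root_0 by (rule cring.nat_elem_hom[OF K.K_ints_cring cring_axioms \<iota>_hom])

lemma \<omega>_1: "\<omega> 1 [^] p = pA" using \<omega>_Suc[of 0] \<omega>_0 by simp

lemma p_regular:
  assumes "a \<in> carrier A" "pA \<otimes> a = \<zero>"
  shows "a = \<zero>"
proof (rule flat_regular[OF K.K_ints_cring cring_axioms \<iota>_hom _ _ K.K_ints_regular assms(1)])
  show "flat (K_ints p) (alg_module \<iota> A)" using perfectoid unfolding integral_perfectoid_def by blast
  show "nat_elem (K_ints p) p \<in> carrier (K_ints p)" by (rule cring.nat_elem_closed[OF K.K_ints_cring])
  show "\<iota> (nat_elem (K_ints p) p) \<otimes> a = \<zero>"
    using assms(2) cring.nat_elem_hom[OF K.K_ints_cring cring_axioms \<iota>_hom, of p] by simp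
qed

lemma p_pow_regular:
  assumes "a \<in> carrier A" "pA [^] (n::nat) \<otimes> a = \<zero>"
  shows "a = \<zero>"
  using assms
proof (induction n arbitrary: a)
  case (Suc n)
  have "pA [^] n \<otimes> (pA \<otimes> a) = \<zero>" using Suc.prems by (simp add: m_assoc)
  then have "pA \<otimes> a = \<zero>" using Suc.IH[of "pA \<otimes> a"] Suc.prems by simp
  then show ?case by (rule p_regular[OF Suc.prems(1)])
qed simp

text \<open>A constant sequence of an infinitely p-divisible element is null, and the map to the
  p-adic completion is injective.\<close>

lemma separated:
  assumes a: "a \<in> carrier A" and "\<And>N::nat. \<exists>d\<in>carrier A. a = pA [^] N \<otimes> d"
  shows "a = \<zero>"
proof -
  interpret C: adic A "carrier A" pA by (rule adic_whole) simp
  have inj: "inj_on (to_p_completion p A) (carrier A)"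
    using perfectoid unfolding integral_perfectoid_def bij_betw_def by blast
  have "(\<lambda>n. a \<ominus> \<zero>) \<in> null_seqs A (carrier A) pA"
    unfolding null_seqs_def adic_nbhd_def using a assms(2) by (auto simp: a_minus_def)
  then have "to_p_completion p A a = to_p_completion p A \<zero>"
    unfolding to_completion_def using C.coset_eq'[of "\<lambda>_. a" "\<lambda>_. \<zero>"] a by simp
  then show ?thesis using inj_onD[OF inj] a by blast
qed

abbreviation "Ip \<equiv> PIdl pA"
abbreviation "I1 \<equiv> PIdl (\<omega> 1)"

lemma Ip_ideal: "ideal Ip A" and I1_ideal: "ideal I1 A"
  by (auto intro: cgenideal_ideal)

lemma Ip_mem: "x \<in> Ip \<longleftrightarrow> (\<exists>w\<in>carrier A. x = pA \<otimes> w)"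
  unfolding cgenideal_def using m_comm by auto

lemma I1_mem: "x \<in> I1 \<longleftrightarrow> (\<exists>w\<in>carrier A. x = \<omega> 1 \<otimes> w)"
  unfolding cgenideal_def using m_comm by auto

abbreviation "Fr \<equiv> induced A Ip (\<lambda>x. x [^] p)"

lemma Fr_iso: "Fr \<in> ring_iso (A Quot I1) (A Quot Ip)"
  using perfectoid unfolding integral_perfectoid_def \<omega>_def by blast

lemma Ip_coset_eq: "x \<in> carrier A \<Longrightarrow> y \<in> carrier A \<Longrightarrow> Ip +> x = Ip +> y \<longleftrightarrow> cg (carrier A) pA x y"
proof -
  assume c: "x \<in> carrier A" "y \<in> carrier A"
  have "x \<ominus> y = pA \<otimes> w \<longleftrightarrow> x = y \<oplus> pA \<otimes> w" if w: "w \<in> carrier A" for w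
  proof
    assume "x \<ominus> y = pA \<otimes> w"
    then have "y \<oplus> pA \<otimes> w = y \<oplus> (x \<ominus> y)" by simp
    then show "x = y \<oplus> pA \<otimes> w" using c by (simp add: a_minus_def a_lcomm r_neg)
  next
    assume "x = y \<oplus> pA \<otimes> w"
    then show "x \<ominus> y = pA \<otimes> w" using c w by (simp add: a_minus_def a_comm[of y] a_assoc r_neg)
  qed
  then show ?thesis using ideal.coset_eq[OF Ip_ideal c] unfolding Ip_mem cg_def by blast
qed

text \<open>\<open>induced_coset\<close> does not apply, since the p-th power is additive only
  modulo p. The representatives agree because (\<omega> 1 i)^p = p i^p.\<close>

lemma Fr_coset:
  assumes x: "x \<in> carrier A"
  shows "Fr (I1 +> x) = Ip +> x [^] p"
proof -
  have "Ip +> y [^] p = Ip +> x [^] p" if y: "y \<in> I1 +> x" for y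
  proof -
    obtain i0 where i0: "i0 \<in> I1" "y = i0 \<oplus> x" using y unfolding a_r_coset_def' by blast
    obtain i where i': "i \<in> carrier A" "i0 = \<omega> 1 \<otimes> i" using i0(1) unfolding I1_mem by (rule bexE)
    have i: "i \<in> carrier A" "y = \<omega> 1 \<otimes> i \<oplus> x" using i' i0(2) by simp_all
    obtain w where w: "w \<in> carrier A" "(\<omega> 1 \<otimes> i \<oplus> x) [^] p = (\<omega> 1 \<otimes> i) [^] p \<oplus> x [^] p \<oplus> pA \<otimes> w"
      using freshman[OF carrier_is_subring prime_p, of "\<omega> 1 \<otimes> i" x] i x by auto
    have "y [^] p = x [^] p \<oplus> pA \<otimes> (i [^] p \<oplus> w)"
      unfolding i w using i x w(1) nat_pow_distrib[OF \<omega>c i(1), of 1 p] \<omega>_1 by (simp add: r_distr a_ac)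
    then show ?thesis using i x w(1) by (subst Ip_coset_eq) (auto simp: cg_def)
  qed
  moreover have "x \<in> I1 +> x"
    using abelian_subgroup.a_rcos_self[OF abelian_subgroupI3 x] ideal.axioms(1)[OF I1_ideal] abelian_group_axioms by blast
  ultimately show ?thesis unfolding induced_def by blast
qed

lemma frobenius_injective:
  assumes x: "x \<in> carrier A" and y: "y \<in> carrier A" "x [^] p = pA \<otimes> y"
  shows "\<exists>z\<in>carrier A. x = \<omega> 1 \<otimes> z"
proof -
  have inj: "inj_on Fr (carrier (A Quot I1))" using Fr_iso unfolding ring_iso_def bij_betw_def by blast
  have zp: "\<zero> [^] p = \<zero>" using pgt0 by (cases p) auto
  have "Fr (I1 +> x) = Fr (I1 +> \<zero>)"
    unfolding Fr_coset[OF x] Fr_coset[OF zero_closed] zp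
    using x y by (subst Ip_coset_eq) (auto simp: cg_def)
  moreover have "I1 +> x \<in> carrier (A Quot I1)" "I1 +> \<zero> \<in> carrier (A Quot I1)"
    using coset_closed[OF additive_subgroup.a_subset] I1_ideal x unfolding ideal_def by blast+
  ultimately have "I1 +> x = I1 +> \<zero>" using inj_onD[OF inj] by blast
  then have "x \<ominus> \<zero> \<in> I1" using ideal.coset_eq[OF I1_ideal x zero_closed] by simp
  then show ?thesis using x I1_mem by (simp add: a_minus_def)
qed

lemma frobenius_surjective:
  assumes x: "x \<in> carrier A"
  shows "\<exists>y\<in>carrier A. cg (carrier A) pA (y [^] p) x"
proof -
  have surj: "Fr ` carrier (A Quot I1) = carrier (A Quot Ip)" using Fr_iso unfolding ring_iso_def bij_betw_def by blast
  have "Ip +> x \<in> carrier (A Quot Ip)"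
    using coset_closed[OF additive_subgroup.a_subset] Ip_ideal x unfolding ideal_def by blast
  then have "Ip +> x \<in> Fr ` carrier (A Quot I1)" by (simp only: surj)
  then obtain C where C: "C \<in> carrier (A Quot I1)" "Fr C = Ip +> x" by (auto simp only: image_iff)
  obtain y where y: "y \<in> carrier A" "C = I1 +> y" using C(1) by (rule quot_elemE)
  have "Ip +> y [^] p = Ip +> x" using C(2) Fr_coset[OF y(1)] y by simp
  then show ?thesis using Ip_coset_eq[of "y [^] p" x] x y by auto
qed

text \<open>Injectivity of Frobenius writes x as \<omega> 1 z, and regularity of p gives z^p = 0
  again. Iteration makes x infinitely divisible by p, hence 0.\<close>

lemma reduced_p:
  assumes "x \<in> carrier A" "x [^] p = \<zero>"
  shows "x = \<zero>"
proof -
  have step: "\<exists>z\<in>carrier A. x = \<omega> 1 \<otimes> z \<and> z [^] p = \<zero>" if x: "x \<in> carrier A" "x [^] p = \<zero>" for x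
  proof -
    obtain z where z: "z \<in> carrier A" "x = \<omega> 1 \<otimes> z" using frobenius_injective[OF x(1) zero_closed] x by auto
    have "pA \<otimes> z [^] p = \<zero>" using x(2) unfolding z(2) nat_pow_distrib[OF \<omega>c z(1)] \<omega>_1 .
    then have "z [^] p = \<zero>" by (rule p_regular[OF nat_pow_closed[OF z(1)]])
    then show ?thesis using z by blast
  qed
  have "\<exists>z\<in>carrier A. x = \<omega> 1 [^] s \<otimes> z \<and> z [^] p = \<zero>" for s :: nat
  proof (induction s)
    case 0
    then show ?case using assms by (intro bexI[of _ x]) auto
  next
    case (Suc s)
    then obtain z where z: "z \<in> carrier A" "x = \<omega> 1 [^] s \<otimes> z" "z [^] p = \<zero>" by blast
    then obtain z' where "z' \<in> carrier A" "z = \<omega> 1 \<otimes> z'" "z' [^] p = \<zero>" using step by blast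
    then show ?case using z by (intro bexI[of _ z']) (auto simp: m_assoc)
  qed
  note all = this
  show ?thesis
  proof (rule separated[OF assms(1)])
    fix N :: nat
    obtain z where "z \<in> carrier A" "x = \<omega> 1 [^] (p * N) \<otimes> z" using all by blast
    then show "\<exists>d\<in>carrier A. x = pA [^] N \<otimes> d" using \<omega>_1 nat_pow_pow[OF \<omega>c, of 1 p N] by auto
  qed
qed

lemma reduced:
  assumes "x \<in> carrier A" "x [^] (n::nat) = \<zero>"
  shows "x = \<zero>"
proof -
  have p2: "p \<ge> 2" using prime_p prime_ge_2_nat by blast
  have pw: "x [^] (p ^ j) = \<zero> \<Longrightarrow> x = \<zero>" for j
  proof (induction j)
    case (Suc j)
    have "(x [^] (p ^ j)) [^] p = \<zero>" using Suc.prems assms(1) by (simp add: nat_pow_pow mult.commute)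
    then show ?case using Suc.IH reduced_p[of "x [^] (p ^ j)"] assms(1) by simp
  qed (use assms in simp)
  have "n \<le> p ^ n" using p2 by (meson less_exp less_imp_le power_mono le_trans zero_le)
  then have "x [^] (p ^ n) = x [^] (p ^ n - n) \<otimes> x [^] n" using assms(1) by (simp add: nat_pow_mult)
  then show ?thesis using pw[of n] assms by simp
qed

text \<open>A is reduced, and a high power of g^(1/p^k) a contains the factor g^j a.\<close>

lemma g_torsion:
  assumes a: "a \<in> carrier A" and j: "groot 0 [^] (j::nat) \<otimes> a = \<zero>"
  shows "groot k \<otimes> a = \<zero>"
\<comment> \<open>With \<open>Suc j\<close> in place of j the exponent is positive also for j = 0,
  so at least one factor a can be split off.\<close>
proof (rule reduced[of _ "p ^ k * Suc j"])
  show "groot k \<otimes> a \<in> carrier A" using a by simp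
  have g: "groot k [^] (p ^ k) = groot 0" using power_tower[of groot p 0 k] gr_Suc by simp
  have n: "p ^ k * Suc j = Suc (p ^ k * Suc j - 1)" using pgt0 by simp
  have "(groot k \<otimes> a) [^] (p ^ k * Suc j) = groot 0 [^] Suc j \<otimes> a [^] (p ^ k * Suc j)"
    unfolding nat_pow_distrib[OF gr a] nat_pow_pow[OF gr, symmetric] g ..
  also have "a [^] (p ^ k * Suc j) = a [^] (p ^ k * Suc j - 1) \<otimes> a" by (subst n) simp
  also have "groot 0 [^] Suc j \<otimes> (a [^] (p ^ k * Suc j - 1) \<otimes> a)
      = groot 0 \<otimes> a [^] (p ^ k * Suc j - 1) \<otimes> (groot 0 [^] j \<otimes> a)" using a by (simp add: m_ac)
  also have "\<dots> = \<zero>" unfolding j using a by simp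
  finally show "(groot k \<otimes> a) [^] (p ^ k * Suc j) = \<zero>" .
qed

subsection \<open>Inverting \<open>p\<close> and \<open>g\<close>\<close>

sublocale AR: loc_elt A pA by unfold_locales simp

abbreviation "RR \<equiv> p_inverted p A"

lemma RR_eq: "RR = localization A pA" by (simp add: p_inverted_def)

sublocale RR: cring RR unfolding RR_eq by (rule AR.loc_cring)

abbreviation "toR \<equiv> to_p_inverted p A"

lemma toR_eq: "toR = to_loc A pA" by (simp add: to_p_inverted_def)

lemma toR_hom: "toR \<in> ring_hom A RR" unfolding RR_eq toR_eq by (rule AR.to_loc_hom)

abbreviation "pR \<equiv> nat_elem RR p"

lemma toR_p: "toR pA = pR" by (rule nat_elem_hom[OF RR.cring_axioms toR_hom])

definition "sR = toR (groot 0)"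

lemma sR [simp]: "sR \<in> carrier RR" unfolding sR_def by (rule ring_hom_closed[OF toR_hom]) simp

sublocale RB: loc_elt RR sR by unfold_locales simp

definition "BB = localization RR sR"

sublocale BB: cring BB unfolding BB_def by (rule RB.loc_cring)

definition "toB = to_loc RR sR"

lemma toB_hom: "toB \<in> ring_hom RR BB" unfolding BB_def toB_def by (rule RB.to_loc_hom)

definition "e a = toB (toR a)"

lemma e_hom: "e \<in> ring_hom A BB" using ring_hom_trans[OF toR_hom toB_hom] by (simp add: e_def[abs_def] comp_def)

lemma ec [simp]: "a \<in> carrier A \<Longrightarrow> e a \<in> carrier BB" using ring_hom_closed[OF e_hom] .

lemma e_p: "e pA = nat_elem BB p" by (rule nat_elem_hom[OF BB.cring_axioms e_hom])

lemma e_pow: "a \<in> carrier A \<Longrightarrow> e (a [^] (n::nat)) = e a [^]\<^bsub>BB\<^esub> n"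
  by (rule hom_pow[OF BB.cring_axioms e_hom])

text \<open>A kernel element is killed by some product p^i g^j; p is regular, and
  \<open>g_torsion\<close> replaces g^j by any g^(1/p^k).\<close>

lemma e_kernel:
  assumes a: "a \<in> carrier A" "e a = \<zero>\<^bsub>BB\<^esub>"
  shows "groot k \<otimes> a = \<zero>"
proof -
  have c: "toR a \<in> carrier RR" using ring_hom_closed[OF toR_hom] a by simp
  have "to_loc RR sR (toR a) = to_loc RR sR \<zero>\<^bsub>RR\<^esub>"
    using a(2) ring_hom_zero[OF toB_hom RR.ring_axioms BB.ring_axioms] by (simp add: e_def toB_def)
  then obtain j :: nat where "sR [^]\<^bsub>RR\<^esub> j \<otimes>\<^bsub>RR\<^esub> toR a = sR [^]\<^bsub>RR\<^esub> j \<otimes>\<^bsub>RR\<^esub> \<zero>\<^bsub>RR\<^esub>"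
    using RB.to_loc_eq[OF c RR.zero_closed] by blast
  moreover have "sR [^]\<^bsub>RR\<^esub> j \<otimes>\<^bsub>RR\<^esub> toR a = toR (groot 0 [^] j \<otimes> a)"
    unfolding sR_def using ring_hom_mult[OF toR_hom, of "groot 0 [^] j" a] a hom_pow[OF RR.cring_axioms toR_hom gr] by simp
  ultimately have "to_loc A pA (groot 0 [^] j \<otimes> a) = to_loc A pA \<zero>"
    using ring_hom_zero[OF toR_hom ring_axioms RR.ring_axioms] by (simp add: toR_eq)
  then obtain i :: nat where "pA [^] i \<otimes> (groot 0 [^] j \<otimes> a) = pA [^] i \<otimes> \<zero>"
    using AR.to_loc_eq[of "groot 0 [^] j \<otimes> a" \<zero>] a by auto
  then have "groot 0 [^] j \<otimes> a = \<zero>" using p_pow_regular[of "groot 0 [^] j \<otimes> a" i] a by simp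
  then show ?thesis by (rule g_torsion[OF a(1)])
qed

definition "AB = e ` carrier A"

lemma AB_subring: "subring AB BB"
proof -
  interpret h: ring_hom_ring A BB e by (rule ring_hom_ringI2[OF ring_axioms BB.ring_axioms e_hom])
  show ?thesis unfolding AB_def by (rule h.img_is_subring[OF carrier_is_subring])
qed

lemma unit_toR: "\<exists>s\<in>carrier RR. s \<otimes>\<^bsub>RR\<^esub> pR = \<one>\<^bsub>RR\<^esub>"
  using AR.inverse_t AR.fraction_closed[of \<one> 1] unfolding RR_eq[symmetric] toR_eq[symmetric] toR_p
  by (intro bexI[of _ "fraction A pA \<one> 1"]) auto

lemma unit_toB: "\<exists>s\<in>carrier BB. s \<otimes>\<^bsub>BB\<^esub> nat_elem BB p = \<one>\<^bsub>BB\<^esub>"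
proof -
  obtain s where s: "s \<in> carrier RR" "s \<otimes>\<^bsub>RR\<^esub> pR = \<one>\<^bsub>RR\<^esub>" using unit_toR by blast
  have "toB s \<otimes>\<^bsub>BB\<^esub> nat_elem BB p = \<one>\<^bsub>BB\<^esub>"
    using ring_hom_mult[OF toB_hom s(1), of pR] s(2) ring_hom_one[OF toB_hom] RR.nat_elem_hom[OF BB.cring_axioms toB_hom] by simp
  then show ?thesis using ring_hom_closed[OF toB_hom s(1)] by blast
qed

sublocale PF: perf BB p AB "\<lambda>k. e (\<omega> k)" "\<lambda>k. e (groot k)"
proof (intro perf.intro perf_axioms.intro BB.cring_axioms)
  show "Factorial_Ring.prime p" by (rule prime_p)
  show "subring AB BB" by (rule AB_subring)
  show "e (\<omega> k) \<in> AB" "e (groot k) \<in> AB" for k by (simp_all add: AB_def)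
  show "e (\<omega> (Suc k)) [^]\<^bsub>BB\<^esub> p = e (\<omega> k)" for k using \<omega>_Suc e_pow[of "\<omega> (Suc k)" p] by simp
  show "e (groot (Suc k)) [^]\<^bsub>BB\<^esub> p = e (groot k)" for k using gr_Suc e_pow[of "groot (Suc k)" p] by simp
  show "e (\<omega> 0) = nat_elem BB p" unfolding \<omega>_0 by (rule e_p)
  show "e (\<omega> 0) \<in> Units BB" unfolding \<omega>_0 e_p using unit_toB BB.m_comm by (auto simp: Units_def)
  show "e (groot 0) \<in> Units BB"
  proof -
    define f where "f = fraction RR sR \<one>\<^bsub>RR\<^esub> 1"
    have fe: "f \<otimes>\<^bsub>BB\<^esub> e (groot 0) = \<one>\<^bsub>BB\<^esub>" unfolding f_def
      using RB.inverse_t unfolding BB_def[symmetric] toB_def[symmetric] e_def sR_def[symmetric] .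
    have fc: "f \<in> carrier BB" unfolding BB_def f_def by (rule RB.fraction_closed) simp
    have "e (groot 0) \<otimes>\<^bsub>BB\<^esub> f = \<one>\<^bsub>BB\<^esub>" using fe BB.m_comm[OF fc, of "e (groot 0)"] by simp
    then show ?thesis using fe fc unfolding Units_def by auto
  qed
  show "\<exists>z\<in>AB. e (groot k) \<otimes>\<^bsub>BB\<^esub> x = e (\<omega> 1) \<otimes>\<^bsub>BB\<^esub> z"
    if xy: "x \<in> AB" "y \<in> AB" "x [^]\<^bsub>BB\<^esub> p = e (\<omega> 0) \<otimes>\<^bsub>BB\<^esub> y" for x y k
  proof -
    obtain a b where ab: "a \<in> carrier A" "x = e a" "b \<in> carrier A" "y = e b" using xy unfolding AB_def by auto
    have "e (a [^] p) = e (pA \<otimes> b)" using xy(3) ab ring_hom_mult[OF e_hom, of pA b] e_pow[of a p] by (simp add: \<omega>_0)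
    moreover have "e (a [^] p \<ominus> pA \<otimes> b) = e (a [^] p) \<ominus>\<^bsub>BB\<^esub> e (pA \<otimes> b)"
    proof -
      interpret h: ring_hom_ring A BB e by (rule ring_hom_ringI2[OF ring_axioms BB.ring_axioms e_hom])
      show ?thesis using ab by (simp add: a_minus_def)
    qed
    ultimately have "e (a [^] p \<ominus> pA \<otimes> b) = \<zero>\<^bsub>BB\<^esub>" using ab by (simp add: a_minus_def BB.r_neg)
    then have z: "groot k \<otimes> (a [^] p \<ominus> pA \<otimes> b) = \<zero>" using e_kernel ab by simp
    have "groot k \<otimes> a [^] p = groot k \<otimes> (a [^] p \<ominus> pA \<otimes> b) \<oplus> groot k \<otimes> (pA \<otimes> b)"
      using ab gr[of k] nat_pow_closed[OF ab(1), of p] by (simp add: a_minus_def r_distr r_minus a_assoc l_neg)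
    then have eq: "groot k \<otimes> a [^] p = groot k \<otimes> (pA \<otimes> b)" using z ab by simp
    obtain q where q: "p = Suc q" using pgt0 gr0_implies_Suc by blast
    \<comment> \<open>Of the p factors g^(1/p^k), one transports the equation from the image back to
      A; the others stay with the right-hand side.\<close>
    have "(groot k \<otimes> a) [^] p = groot k [^] q \<otimes> (groot k \<otimes> a [^] p)"
      unfolding nat_pow_distrib[OF gr ab(1)] by (subst (1) q) (use ab in \<open>simp add: m_assoc\<close>)
    also have "\<dots> = pA \<otimes> (groot k [^] q \<otimes> (groot k \<otimes> b))" unfolding eq using ab by (simp add: m_ac)
    finally obtain z where z: "z \<in> carrier A" "groot k \<otimes> a = \<omega> 1 \<otimes> z"
      using frobenius_injective[of "groot k \<otimes> a" "groot k [^] q \<otimes> (groot k \<otimes> b)"] ab by auto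
    have "e (groot k) \<otimes>\<^bsub>BB\<^esub> x = e (\<omega> 1) \<otimes>\<^bsub>BB\<^esub> e z"
      using ring_hom_mult[OF e_hom gr ab(1), of k] ring_hom_mult[OF e_hom \<omega>c z(1), of 1] z(2) ab by simp
    then show ?thesis using z by (auto simp: AB_def)
  qed
  show "\<exists>y\<in>AB. BB.cg AB (e (\<omega> 0)) (y [^]\<^bsub>BB\<^esub> p) x" if x: "x \<in> AB" for x
  proof -
    obtain a where a: "a \<in> carrier A" "x = e a" using x unfolding AB_def by auto
    obtain y w where y: "y \<in> carrier A" "w \<in> carrier A" "y [^] p = a \<oplus> pA \<otimes> w"
      using frobenius_surjective[OF a(1)] unfolding cg_def by blast
    have "e y [^]\<^bsub>BB\<^esub> p = x \<oplus>\<^bsub>BB\<^esub> e (\<omega> 0) \<otimes>\<^bsub>BB\<^esub> e w"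
      using y a e_pow[OF y(1), of p] ring_hom_add[OF e_hom a(1), of "pA \<otimes> w"] ring_hom_mult[OF e_hom _ y(2), of pA]
      by (simp add: \<omega>_0)
    then show ?thesis using y unfolding BB.cg_def AB_def by blast
  qed
qed

end

section \<open>Pro-systems\<close>

lemma transition_aux_comp: "transition_aux f n (i + k) = transition_aux f n i \<circ> transition_aux f (n + i) k"
  by (induction k) (simp_all add: add.assoc fun_eq_iff)

lemma transition_refl: "transition f n n = id"
  by (simp add: transition_def)

lemma transition_comp:
  assumes "n \<le> i" "i \<le> j"
  shows "transition f n j x = transition f n i (transition f i j x)"
  using transition_aux_comp[of f n "i - n" "j - i"] assms by (simp add: transition_def)

lemma transition_step: "transition f n (Suc n) x = f n x"
  by (simp add: transition_def)

lemma mod_homD: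
  assumes "u \<in> mod_hom R M N"
  shows "x \<in> carrier M \<Longrightarrow> u x \<in> carrier N"
    "x \<in> carrier M \<Longrightarrow> y \<in> carrier M \<Longrightarrow> u (x \<oplus>\<^bsub>M\<^esub> y) = u x \<oplus>\<^bsub>N\<^esub> u y"
    "a \<in> carrier R \<Longrightarrow> x \<in> carrier M \<Longrightarrow> u (a \<odot>\<^bsub>M\<^esub> x) = a \<odot>\<^bsub>N\<^esub> u x"
  using assms by (auto simp: mod_hom_def)

lemma mod_hom_comp:
  assumes "u \<in> mod_hom R M N" "w \<in> mod_hom R N P"
  shows "w \<circ> u \<in> mod_hom R M P"
  using assms by (auto simp: mod_hom_def)

lemma mod_hom_zero:
  assumes "module R M" "module R N" "u \<in> mod_hom R M N"
  shows "u \<zero>\<^bsub>M\<^esub> = \<zero>\<^bsub>N\<^esub>"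
proof -
  interpret M: module R M by fact
  interpret N: module R N by fact
  have c: "u \<zero>\<^bsub>M\<^esub> \<in> carrier N" using mod_homD(1)[OF assms(3)] by simp
  have "u \<zero>\<^bsub>M\<^esub> \<oplus>\<^bsub>N\<^esub> u \<zero>\<^bsub>M\<^esub> = u \<zero>\<^bsub>M\<^esub>" using mod_homD(2)[OF assms(3), of "\<zero>\<^bsub>M\<^esub>" "\<zero>\<^bsub>M\<^esub>"] by simp
  then show ?thesis using c by (metis N.add.l_cancel_one')
qed

definition submodl :: "('a, 'c) ring_scheme \<Rightarrow> ('a, 'm) module \<Rightarrow> 'm set \<Rightarrow> bool" where
  "submodl R M H \<longleftrightarrow> H \<subseteq> carrier M \<and> \<zero>\<^bsub>M\<^esub> \<in> H \<and> (\<forall>x\<in>H. \<forall>y\<in>H. x \<oplus>\<^bsub>M\<^esub> y \<in> H) \<and>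
     (\<forall>a\<in>carrier R. \<forall>x\<in>H. a \<odot>\<^bsub>M\<^esub> x \<in> H)"

lemma submodl_uminus:
  assumes "module R M" "submodl R M H" "x \<in> H"
  shows "\<ominus>\<^bsub>M\<^esub> x \<in> H"
proof -
  interpret module R M by fact
  have "(\<ominus>\<^bsub>R\<^esub> \<one>\<^bsub>R\<^esub>) \<odot>\<^bsub>M\<^esub> x \<in> H" using assms(2,3) unfolding submodl_def by simp
  moreover have "x \<in> carrier M" using assms unfolding submodl_def by auto
  ultimately show ?thesis using smult_l_minus[of "\<one>\<^bsub>R\<^esub>" x] by simp
qed

lemma submodl_module:
  assumes M: "module R M" and H: "submodl R M H"
  shows "module R (M\<lparr>carrier := H\<rparr>)"
proof -
  interpret module R M by fact
  have HD: "\<And>x. x \<in> H \<Longrightarrow> x \<in> carrier M" "\<zero>\<^bsub>M\<^esub> \<in> H" "\<And>x y. x \<in> H \<Longrightarrow> y \<in> H \<Longrightarrow> x \<oplus>\<^bsub>M\<^esub> y \<in> H"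
    "\<And>a x. a \<in> carrier R \<Longrightarrow> x \<in> H \<Longrightarrow> a \<odot>\<^bsub>M\<^esub> x \<in> H" using H unfolding submodl_def by auto
  show ?thesis
  proof (rule moduleI)
    show "cring R" by unfold_locales
    show "abelian_group (M\<lparr>carrier := H\<rparr>)"
    proof (rule abelian_groupI)
      show "\<exists>y\<in>carrier (M\<lparr>carrier := H\<rparr>). y \<oplus>\<^bsub>M\<lparr>carrier := H\<rparr>\<^esub> x = \<zero>\<^bsub>M\<lparr>carrier := H\<rparr>\<^esub>"
        if "x \<in> carrier (M\<lparr>carrier := H\<rparr>)" for x
        using that submodl_uminus[OF M H] HD(1) by (intro bexI[of _ "\<ominus>\<^bsub>M\<^esub> x"]) (auto simp: M.l_neg)
    qed (use HD in \<open>auto simp: M.a_ac\<close>)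
  qed (use HD in \<open>auto simp: smult_l_distr smult_r_distr smult_assoc1\<close>)
qed

text \<open>The system of images of \<open>M (\<alpha> n)\<close> in \<open>M n\<close>, for \<open>\<alpha>\<close> growing fast enough, is killed by \<open>c\<close>.\<close>

lemma pro_killedI:
  assumes M: "pro_system R M f" and c: "c \<in> carrier R"
    and ex: "\<And>n. \<exists>j\<ge>n. \<forall>x\<in>carrier (M j). c \<odot>\<^bsub>M n\<^esub> transition f n j x = \<zero>\<^bsub>M n\<^esub>"
  shows "pro_killed R c M f"
proof -
  have mod: "module R (M n)" and f: "f n \<in> mod_hom R (M (Suc n)) (M n)" for n
    using M unfolding pro_system_def by auto
  have th_aux: "transition_aux f n i \<in> mod_hom R (M (n + i)) (M n)" for n i
  proof (induction i)
    case 0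
    show ?case by (simp add: mod_hom_def)
  next
    case (Suc i)
    then show ?case using mod_hom_comp[OF f[of "n + i"] Suc] by (simp only: transition_aux.simps add_Suc_right)
  qed
  have th: "transition f n j \<in> mod_hom R (M j) (M n)" if "n \<le> j" for n j
    using th_aux[of n "j - n"] that by (simp add: transition_def)
  obtain j0 where j0: "\<And>n. j0 n \<ge> n" "\<And>n x. x \<in> carrier (M (j0 n)) \<Longrightarrow> c \<odot>\<^bsub>M n\<^esub> transition f n (j0 n) x = \<zero>\<^bsub>M n\<^esub>"
    using ex by metis
  \<comment> \<open>Besides \<alpha> n >= j0 n, monotonicity is arranged, so that the transition
    maps carry the images into one another.\<close>
  define \<alpha> where "\<alpha> = rec_nat (j0 0) (\<lambda>n a. max a (j0 (Suc n)))"
  have \<alpha>S: "\<alpha> (Suc n) = max (\<alpha> n) (j0 (Suc n))" and \<alpha>0: "\<alpha> 0 = j0 0" for n by (simp_all add: \<alpha>_def)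
  have \<alpha>j: "j0 n \<le> \<alpha> n" for n by (cases n) (simp_all add: \<alpha>S \<alpha>0)
  have \<alpha>n: "n \<le> \<alpha> n" for n using j0(1)[of n] \<alpha>j[of n] by simp
  have \<alpha>m: "\<alpha> n \<le> \<alpha> (Suc n)" for n by (simp add: \<alpha>S)
  define H where "H n = transition f n (\<alpha> n) ` carrier (M (\<alpha> n))" for n
  define T where "T n = (M n)\<lparr>carrier := H n\<rparr>" for n
  have H: "submodl R (M n) (H n)" for n
  proof -
    interpret Mn: module R "M (\<alpha> n)" by (rule mod)
    note t = mod_homD[OF th[OF \<alpha>n[of n]]]
    show ?thesis
      unfolding submodl_def H_def
    proof (intro conjI ballI)
      show "transition f n (\<alpha> n) ` carrier (M (\<alpha> n)) \<subseteq> carrier (M n)" using t(1) by auto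
      show "\<zero>\<^bsub>M n\<^esub> \<in> transition f n (\<alpha> n) ` carrier (M (\<alpha> n))"
        using mod_hom_zero[OF mod mod th[OF \<alpha>n[of n]]] by (metis Mn.M.zero_closed imageI)
      show "x \<oplus>\<^bsub>M n\<^esub> y \<in> transition f n (\<alpha> n) ` carrier (M (\<alpha> n))"
        if xy: "x \<in> transition f n (\<alpha> n) ` carrier (M (\<alpha> n))" "y \<in> transition f n (\<alpha> n) ` carrier (M (\<alpha> n))" for x y
      proof -
        obtain a b where ab: "a \<in> carrier (M (\<alpha> n))" "x = transition f n (\<alpha> n) a"
          "b \<in> carrier (M (\<alpha> n))" "y = transition f n (\<alpha> n) b" using xy by auto
        have "x \<oplus>\<^bsub>M n\<^esub> y = transition f n (\<alpha> n) (a \<oplus>\<^bsub>M (\<alpha> n)\<^esub> b)" using ab t(2) by simp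
        then show ?thesis using ab by blast
      qed
      show "r \<odot>\<^bsub>M n\<^esub> x \<in> transition f n (\<alpha> n) ` carrier (M (\<alpha> n))"
        if rx: "r \<in> carrier R" "x \<in> transition f n (\<alpha> n) ` carrier (M (\<alpha> n))" for r x
      proof -
        obtain a where a: "a \<in> carrier (M (\<alpha> n))" "x = transition f n (\<alpha> n) a" using rx by auto
        have "r \<odot>\<^bsub>M n\<^esub> x = transition f n (\<alpha> n) (r \<odot>\<^bsub>M (\<alpha> n)\<^esub> a)" using a rx t(3) by simp
        then show ?thesis using a rx by blast
      qed
    qed
  qed
  have Tmod: "module R (T n)" for n unfolding T_def by (rule submodl_module[OF mod H])
  have fT: "f n x \<in> H n" if x: "x \<in> H (Suc n)" for n x
  proof -
    obtain y where y: "y \<in> carrier (M (\<alpha> (Suc n)))" "x = transition f (Suc n) (\<alpha> (Suc n)) y"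
      using x unfolding H_def by auto
    have "f n x = transition f n (\<alpha> (Suc n)) y"
      unfolding y(2) transition_step[of f n, symmetric] by (rule transition_comp[symmetric]) (use \<alpha>n[of "Suc n"] in auto)
    also have "\<dots> = transition f n (\<alpha> n) (transition f (\<alpha> n) (\<alpha> (Suc n)) y)"
      by (rule transition_comp[OF \<alpha>n \<alpha>m])
    finally show ?thesis unfolding H_def using mod_homD(1)[OF th[OF \<alpha>m] y(1)] by blast
  qed
  have HM: "x \<in> H n \<Longrightarrow> x \<in> carrier (M n)" for x n using H[of n] unfolding submodl_def by auto
  have T: "pro_system R T f"
    unfolding pro_system_def
  proof (intro allI conjI Tmod)
    show "f n \<in> mod_hom R (T (Suc n)) (T n)" for n
      using fT f[of n] HM unfolding mod_hom_def T_def by auto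
  qed
  have kill: "c \<odot>\<^bsub>T n\<^esub> x = \<zero>\<^bsub>T n\<^esub>" if x: "x \<in> carrier (T n)" for n x
  proof -
    obtain y where y: "y \<in> carrier (M (\<alpha> n))" "x = transition f n (\<alpha> n) y" using x unfolding T_def H_def by auto
    have "x = transition f n (j0 n) (transition f (j0 n) (\<alpha> n) y)"
      unfolding y(2) by (rule transition_comp[OF j0(1) \<alpha>j])
    then have "c \<odot>\<^bsub>M n\<^esub> x = \<zero>\<^bsub>M n\<^esub>" using j0(2) mod_homD(1)[OF th[OF \<alpha>j] y(1)] by simp
    then show ?thesis by (simp add: T_def)
  qed
  have tT: "transition f n j x \<in> carrier (T n)" if "n \<le> j" "x \<in> carrier (T j)" for n j x
  proof -
    have "transition f n (n + i) x \<in> H n" if "x \<in> H (n + i)" for i x n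
      using that
    proof (induction i arbitrary: x)
      case (Suc i)
      have "transition f n (Suc (n + i)) x = transition f n (n + i) (f (n + i) x)"
        using transition_comp[of n "n + i" "Suc (n + i)" f x] by (simp add: transition_step)
      then show ?case using Suc.IH[OF fT] Suc.prems by simp
    qed (simp add: transition_refl)
    from this[of x n "j - n"] that show ?thesis by (simp add: T_def)
  qed
  have u: "transition f n (\<alpha> n) \<in> mod_hom R (M (\<alpha> n)) (T n)" for n
    using th[OF \<alpha>n[of n]] unfolding mod_hom_def T_def H_def by auto
  \<comment> \<open>The isomorphism maps M (\<alpha> n) onto its image T n, and its inverse is the
    inclusion of T n in M n; both composites are transition maps.\<close>
  have "pro_hom R M f T f \<alpha> (\<lambda>n. transition f n (\<alpha> n))"
    unfolding pro_hom_def
  proof (intro conjI allI u)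
    fix n
    have "f n (transition f (Suc n) (\<alpha> (Suc n)) x) = transition f n (\<alpha> n) (transition f (\<alpha> n) (\<alpha> (Suc n)) x)" for x
      using transition_comp[of n "Suc n" "\<alpha> (Suc n)" f x] \<alpha>n[of "Suc n"] transition_comp[OF \<alpha>n \<alpha>m, of f n x]
      by (simp add: transition_step)
    then show "\<exists>j. \<alpha> n \<le> j \<and> \<alpha> (Suc n) \<le> j \<and> (\<forall>x\<in>carrier (M j).
        f n (transition f (Suc n) (\<alpha> (Suc n)) (transition f (\<alpha> (Suc n)) j x)) =
        transition f n (\<alpha> n) (transition f (\<alpha> n) j x))"
      using \<alpha>m[of n] by (intro exI[of _ "\<alpha> (Suc n)"]) (simp add: transition_refl)
  qed
  moreover have "pro_hom R T f M f (\<lambda>n. n) (\<lambda>n. id)"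
    unfolding pro_hom_def
  proof (intro conjI allI)
    show "id \<in> mod_hom R (T n) (M n)" for n using HM by (auto simp: mod_hom_def T_def)
    show "\<exists>j\<ge>n. Suc n \<le> j \<and> (\<forall>x\<in>carrier (T j). f n (id (transition f (Suc n) j x)) = id (transition f n j x))" for n
      by (intro exI[of _ "Suc n"]) (simp add: transition_refl transition_step)
  qed
  moreover have "pro_eq M f (\<lambda>n. \<alpha> ((\<lambda>n. n) n)) (\<lambda>n. id \<circ> transition f ((\<lambda>n. n) n) (\<alpha> ((\<lambda>n. n) n))) (\<lambda>n. n) (\<lambda>n. id)"
    unfolding pro_eq_def
  proof
    show "\<exists>j\<ge>\<alpha> n. n \<le> j \<and> (\<forall>x\<in>carrier (M j). (id \<circ> transition f n (\<alpha> n)) (transition f (\<alpha> n) j x) = id (transition f n j x))" for n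
      using \<alpha>n[of n] by (intro exI[of _ "\<alpha> n"]) (simp add: transition_refl)
  qed
  moreover have "pro_eq T f (\<lambda>n. (\<lambda>n. n) (\<alpha> n)) (\<lambda>n. transition f n (\<alpha> n) \<circ> id) (\<lambda>n. n) (\<lambda>n. id)"
    unfolding pro_eq_def
  proof
    show "\<exists>j\<ge>\<alpha> n. n \<le> j \<and> (\<forall>x\<in>carrier (T j). (transition f n (\<alpha> n) \<circ> id) (transition f (\<alpha> n) j x) = id (transition f n j x))" for n
      using \<alpha>n[of n] by (intro exI[of _ "\<alpha> n"]) (simp add: transition_refl)
  qed
  ultimately have "pro_isomorphic R M f T f"
    unfolding pro_isomorphic_def
    by (intro exI[of _ \<alpha>] exI[of _ "\<lambda>n. transition f n (\<alpha> n)"] exI[of _ "\<lambda>n. n"] exI[of _ "\<lambda>n. id"] conjI)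
  then show ?thesis unfolding pro_killed_def using T kill by blast
qed

lemma ker_pro_system:
  assumes M: "pro_system R M f" and N: "pro_system R N g" and h: "\<And>n. h n \<in> mod_hom R (M n) (N n)"
    and comm: "\<And>n x. x \<in> carrier (M (Suc n)) \<Longrightarrow> h n (f n x) = g n (h (Suc n) x)"
  shows "pro_system R (\<lambda>n. ker_module (M n) (N n) (h n)) f"
proof -
  have mod: "module R (M n)" "module R (N n)" and f: "f n \<in> mod_hom R (M (Suc n)) (M n)" "g n \<in> mod_hom R (N (Suc n)) (N n)" for n
    using M N unfolding pro_system_def by auto
  have ker: "a_kernel (M n) (N n) (h n) = {x \<in> carrier (M n). h n x = \<zero>\<^bsub>N n\<^esub>}" for n
    by (simp add: a_kernel_def kernel_def)
  have "submodl R (M n) (a_kernel (M n) (N n) (h n))" for n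
  proof -
    interpret M: module R "M n" by (rule mod)
    interpret N: module R "N n" by (rule mod)
    have "r \<odot>\<^bsub>N n\<^esub> \<zero>\<^bsub>N n\<^esub> = \<zero>\<^bsub>N n\<^esub>" if "r \<in> carrier R" for r using that by simp
    then show ?thesis unfolding submodl_def ker using mod_homD[OF h[of n]] mod_hom_zero[OF mod h[of n]] by auto
  qed
  moreover have "f n \<in> mod_hom R (ker_module (M (Suc n)) (N (Suc n)) (h (Suc n))) (ker_module (M n) (N n) (h n))" for n
    unfolding mod_hom_def ker_module_def ker using mod_homD[OF f(1)[of n]] comm mod_hom_zero[OF mod(2) mod(2) f(2)[of n]] by auto
  ultimately show ?thesis unfolding pro_system_def ker_module_def using submodl_module mod by blast
qed

subsection \<open>Cokernels\<close>

lemma submodl_subgroup: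
  assumes M: "module R M" and H: "submodl R M H"
  shows "abelian_subgroup H M"
proof -
  interpret module R M by fact
  have "subgroup H (add_monoid M)"
  proof (rule group.subgroupI[OF M.a_group])
    show "H \<subseteq> carrier (add_monoid M)" "H \<noteq> {}" using H unfolding submodl_def by auto
    show "inv\<^bsub>add_monoid M\<^esub> a \<in> H" if "a \<in> H" for a
      using submodl_uminus[OF M H that] by (simp add: a_inv_def)
    show "a \<otimes>\<^bsub>add_monoid M\<^esub> b \<in> H" if "a \<in> H" "b \<in> H" for a b using H that unfolding submodl_def by auto
  qed
  then show ?thesis by (rule abelian_subgroupI3[OF additive_subgroup.intro M.abelian_group_axioms])
qed

lemma coset_eq_mod:
  assumes M: "module R M" and H: "submodl R M H" and x: "x \<in> carrier M" and y: "y \<in> carrier M"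
  shows "H +>\<^bsub>M\<^esub> x = H +>\<^bsub>M\<^esub> y \<longleftrightarrow> x \<ominus>\<^bsub>M\<^esub> y \<in> H"
proof -
  interpret module R M by fact
  interpret S: abelian_subgroup H M by (rule submodl_subgroup[OF M H])
  have "x \<in> H +>\<^bsub>M\<^esub> y \<longleftrightarrow> x \<ominus>\<^bsub>M\<^esub> y \<in> H" using S.a_rcos_module[OF y x] by (simp add: a_minus_def)
  then show ?thesis using S.a_repr_independence'[of x y] S.a_rcos_self[OF x] y by auto
qed

lemma induced_mod_coset:
  assumes M: "module R M" and N: "module R N" and H: "submodl R M H" and K: "submodl R N K"
    and u: "\<And>x. x \<in> carrier M \<Longrightarrow> u x \<in> carrier N" "\<And>x y. x \<in> carrier M \<Longrightarrow> y \<in> carrier M \<Longrightarrow> u (x \<oplus>\<^bsub>M\<^esub> y) = u x \<oplus>\<^bsub>N\<^esub> u y"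
    and HK: "\<And>x. x \<in> H \<Longrightarrow> u x \<in> K" and x: "x \<in> carrier M"
  shows "induced N K u (H +>\<^bsub>M\<^esub> x) = K +>\<^bsub>N\<^esub> u x"
proof -
  interpret M: module R M by fact
  interpret N: module R N by fact
  interpret S: abelian_subgroup H M by (rule submodl_subgroup[OF M H])
  have "K +>\<^bsub>N\<^esub> u y = K +>\<^bsub>N\<^esub> u x" if y: "y \<in> H +>\<^bsub>M\<^esub> x" for y
  proof -
    obtain i where i: "i \<in> H" "y = i \<oplus>\<^bsub>M\<^esub> x" using y unfolding a_r_coset_def' by blast
    have c: "i \<in> carrier M" using i H unfolding submodl_def by auto
    have "u y \<ominus>\<^bsub>N\<^esub> u x = u i" using i c x u by (simp add: a_minus_def N.M.a_assoc N.M.r_neg)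
    then show ?thesis using coset_eq_mod[OF N K, of "u y" "u x"] u(1) i c x HK by simp
  qed
  then show ?thesis unfolding induced_def using S.a_rcos_self[OF x] by blast
qed

lemma quot_module_simps:
  "carrier (quot_module M H) = a_rcosets\<^bsub>M\<^esub> H" "\<zero>\<^bsub>quot_module M H\<^esub> = H"
  "C \<oplus>\<^bsub>quot_module M H\<^esub> E = C <+>\<^bsub>M\<^esub> E" "a \<odot>\<^bsub>quot_module M H\<^esub> C = induced M H (\<lambda>x. a \<odot>\<^bsub>M\<^esub> x) C"
  by (simp_all add: quot_module_def)

lemma quot_smult:
  assumes M: "module R M" and H: "submodl R M H" and a: "a \<in> carrier R" and x: "x \<in> carrier M"
  shows "a \<odot>\<^bsub>quot_module M H\<^esub> (H +>\<^bsub>M\<^esub> x) = H +>\<^bsub>M\<^esub> (a \<odot>\<^bsub>M\<^esub> x)"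
proof -
  interpret module R M by fact
  show ?thesis unfolding quot_module_simps
    by (rule induced_mod_coset[OF M M H H _ _ _ x]) (use a H in \<open>auto simp: smult_r_distr submodl_def\<close>)
qed

lemma quot_module_module:
  assumes M: "module R M" and H: "submodl R M H"
  shows "module R (quot_module M H)"
proof -
  interpret module R M by fact
  interpret S: abelian_subgroup H M by (rule submodl_subgroup[OF M H])
  have el: "\<exists>x\<in>carrier M. C = H +>\<^bsub>M\<^esub> x" if "C \<in> carrier (quot_module M H)" for C
    using that unfolding quot_module_simps A_RCOSETS_def' by blast
  have cl: "H +>\<^bsub>M\<^esub> x \<in> carrier (quot_module M H)" if "x \<in> carrier M" for x
    using that unfolding quot_module_simps A_RCOSETS_def' by blast
  have add: "(H +>\<^bsub>M\<^esub> x) \<oplus>\<^bsub>quot_module M H\<^esub> (H +>\<^bsub>M\<^esub> y) = H +>\<^bsub>M\<^esub> (x \<oplus>\<^bsub>M\<^esub> y)"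
    if "x \<in> carrier M" "y \<in> carrier M" for x y
    unfolding quot_module_simps using S.a_rcos_sum[OF that] .
  have zero: "\<zero>\<^bsub>quot_module M H\<^esub> = H +>\<^bsub>M\<^esub> \<zero>\<^bsub>M\<^esub>"
    using H unfolding quot_module_simps submodl_def by simp
  note sm = quot_smult[OF M H]
  show ?thesis
  proof (rule moduleI)
    show "cring R" by unfold_locales
    show "abelian_group (quot_module M H)"
    proof (rule abelian_groupI)
      fix C assume "C \<in> carrier (quot_module M H)"
      then obtain x where x: "x \<in> carrier M" "C = H +>\<^bsub>M\<^esub> x" using el by blast
      show "\<zero>\<^bsub>quot_module M H\<^esub> \<oplus>\<^bsub>quot_module M H\<^esub> C = C" unfolding zero x using x add by simp
      show "\<exists>E\<in>carrier (quot_module M H). E \<oplus>\<^bsub>quot_module M H\<^esub> C = \<zero>\<^bsub>quot_module M H\<^esub>"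
        unfolding zero x using x add cl by (intro bexI[of _ "H +>\<^bsub>M\<^esub> (\<ominus>\<^bsub>M\<^esub> x)"]) (auto simp: M.l_neg)
      fix E assume "E \<in> carrier (quot_module M H)"
      then obtain y where y: "y \<in> carrier M" "E = H +>\<^bsub>M\<^esub> y" using el by blast
      show "C \<oplus>\<^bsub>quot_module M H\<^esub> E \<in> carrier (quot_module M H)" unfolding x y using x y add cl by simp
      show "C \<oplus>\<^bsub>quot_module M H\<^esub> E = E \<oplus>\<^bsub>quot_module M H\<^esub> C" unfolding x y using x y add by (simp add: M.a_comm)
      fix G assume "G \<in> carrier (quot_module M H)"
      then obtain z where z: "z \<in> carrier M" "G = H +>\<^bsub>M\<^esub> z" using el by blast
      show "C \<oplus>\<^bsub>quot_module M H\<^esub> E \<oplus>\<^bsub>quot_module M H\<^esub> G = C \<oplus>\<^bsub>quot_module M H\<^esub> (E \<oplus>\<^bsub>quot_module M H\<^esub> G)"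
        unfolding x y z using x y z add by (simp add: M.a_assoc)
    next
      show "\<zero>\<^bsub>quot_module M H\<^esub> \<in> carrier (quot_module M H)" unfolding zero by (rule cl) simp
    qed
  next
    fix a C assume a: "a \<in> carrier R" and "C \<in> carrier (quot_module M H)"
    then obtain x where x: "x \<in> carrier M" "C = H +>\<^bsub>M\<^esub> x" using el by blast
    show "a \<odot>\<^bsub>quot_module M H\<^esub> C \<in> carrier (quot_module M H)" unfolding x using a x sm cl by simp
    show "\<And>b. b \<in> carrier R \<Longrightarrow> (a \<oplus>\<^bsub>R\<^esub> b) \<odot>\<^bsub>quot_module M H\<^esub> C = a \<odot>\<^bsub>quot_module M H\<^esub> C \<oplus>\<^bsub>quot_module M H\<^esub> b \<odot>\<^bsub>quot_module M H\<^esub> C"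
      unfolding x using a x sm add by (simp add: smult_l_distr)
    show "\<And>b. b \<in> carrier R \<Longrightarrow> (a \<otimes>\<^bsub>R\<^esub> b) \<odot>\<^bsub>quot_module M H\<^esub> C = a \<odot>\<^bsub>quot_module M H\<^esub> (b \<odot>\<^bsub>quot_module M H\<^esub> C)"
      unfolding x using a x sm by (simp add: smult_assoc1)
    fix E assume "E \<in> carrier (quot_module M H)"
    then obtain y where y: "y \<in> carrier M" "E = H +>\<^bsub>M\<^esub> y" using el by blast
    show "a \<odot>\<^bsub>quot_module M H\<^esub> (C \<oplus>\<^bsub>quot_module M H\<^esub> E) = a \<odot>\<^bsub>quot_module M H\<^esub> C \<oplus>\<^bsub>quot_module M H\<^esub> a \<odot>\<^bsub>quot_module M H\<^esub> E"
      unfolding x y using a x y sm add by (simp add: smult_r_distr)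
  next
    fix C assume "C \<in> carrier (quot_module M H)"
    then obtain x where x: "x \<in> carrier M" "C = H +>\<^bsub>M\<^esub> x" using el by blast
    show "\<one>\<^bsub>R\<^esub> \<odot>\<^bsub>quot_module M H\<^esub> C = C" unfolding x using x sm by simp
  qed
qed

lemma image_submodl:
  assumes M: "module R M" and N: "module R N" and h: "h \<in> mod_hom R M N"
  shows "submodl R N (h ` carrier M)"
  unfolding submodl_def
proof (intro conjI ballI)
  interpret M: module R M by fact
  note t = mod_homD[OF h]
  show "h ` carrier M \<subseteq> carrier N" using t(1) by auto
  show "\<zero>\<^bsub>N\<^esub> \<in> h ` carrier M" using mod_hom_zero[OF M N h] by (metis M.M.zero_closed imageI)
  show "x \<oplus>\<^bsub>N\<^esub> y \<in> h ` carrier M" if xy: "x \<in> h ` carrier M" "y \<in> h ` carrier M" for x y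
  proof -
    obtain a b where ab: "a \<in> carrier M" "x = h a" "b \<in> carrier M" "y = h b" using xy by auto
    have "x \<oplus>\<^bsub>N\<^esub> y = h (a \<oplus>\<^bsub>M\<^esub> b)" using ab t(2) by simp
    then show ?thesis using ab by blast
  qed
  show "r \<odot>\<^bsub>N\<^esub> x \<in> h ` carrier M" if rx: "r \<in> carrier R" "x \<in> h ` carrier M" for r x
  proof -
    obtain a where a: "a \<in> carrier M" "x = h a" using rx by auto
    have "r \<odot>\<^bsub>N\<^esub> x = h (r \<odot>\<^bsub>M\<^esub> a)" using a rx t(3) by simp
    then show ?thesis using a rx by blast
  qed
qed

text \<open>The second part computes composite transitions on representatives, so that estimates for
  elements of the N j can be applied to the cokernels, whose maps are given as unions over
  cosets.\<close>

lemma coker_pro_system: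
  assumes M: "pro_system R M f" and N: "pro_system R N g" and h: "\<And>n. h n \<in> mod_hom R (M n) (N n)"
    and comm: "\<And>n x. x \<in> carrier (M (Suc n)) \<Longrightarrow> h n (f n x) = g n (h (Suc n) x)"
  shows "pro_system R (\<lambda>n. coker_module (M n) (N n) (h n)) (\<lambda>n. induced (N n) (h n ` carrier (M n)) (g n))"
    and "n \<le> j \<Longrightarrow> x \<in> carrier (N j) \<Longrightarrow>
      transition (\<lambda>n. induced (N n) (h n ` carrier (M n)) (g n)) n j (h j ` carrier (M j) +>\<^bsub>N j\<^esub> x)
      = h n ` carrier (M n) +>\<^bsub>N n\<^esub> transition g n j x \<and> transition g n j x \<in> carrier (N n)"
proof -
  have mod: "module R (M n)" "module R (N n)" and f: "f n \<in> mod_hom R (M (Suc n)) (M n)" "g n \<in> mod_hom R (N (Suc n)) (N n)" for n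
    using M N unfolding pro_system_def by auto
  define H where "H n = h n ` carrier (M n)" for n
  have H: "submodl R (N n) (H n)" for n unfolding H_def by (rule image_submodl[OF mod h])
  have gH: "g n x \<in> H n" if x: "x \<in> H (Suc n)" for n x
  proof -
    obtain y where y: "y \<in> carrier (M (Suc n))" "x = h (Suc n) y" using x unfolding H_def by auto
    then have "g n x = h n (f n y)" using comm by simp
    then show ?thesis unfolding H_def using mod_homD(1)[OF f(1) y(1)] by simp
  qed
  define G where "G n = induced (N n) (H n) (g n)" for n
  have G: "G n (H (Suc n) +>\<^bsub>N (Suc n)\<^esub> x) = H n +>\<^bsub>N n\<^esub> g n x" if "x \<in> carrier (N (Suc n))" for n x
    unfolding G_def using induced_mod_coset[OF mod(2) mod(2) H H _ _ _ that, of "g n"] mod_homD[OF f(2)[of n]] gH by blast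
  have el: "\<exists>x\<in>carrier (N n). C = H n +>\<^bsub>N n\<^esub> x" if "C \<in> carrier (quot_module (N n) (H n))" for C n
    using that unfolding quot_module_simps A_RCOSETS_def' by blast
  have cl: "H n +>\<^bsub>N n\<^esub> x \<in> carrier (quot_module (N n) (H n))" if "x \<in> carrier (N n)" for x n
    using that unfolding quot_module_simps A_RCOSETS_def' by blast
  have Gm: "G n \<in> mod_hom R (quot_module (N (Suc n)) (H (Suc n))) (quot_module (N n) (H n))" for n
    unfolding mod_hom_def
  proof (intro CollectI conjI ballI)
    interpret N0: module R "N n" by (rule mod)
    interpret N1: module R "N (Suc n)" by (rule mod)
    interpret S0: abelian_subgroup "H n" "N n" by (rule submodl_subgroup[OF mod(2) H])
    interpret S1: abelian_subgroup "H (Suc n)" "N (Suc n)" by (rule submodl_subgroup[OF mod(2) H])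
    note gd = mod_homD[OF f(2)[of n]]
    fix C assume "C \<in> carrier (quot_module (N (Suc n)) (H (Suc n)))"
    then obtain x where x: "x \<in> carrier (N (Suc n))" "C = H (Suc n) +>\<^bsub>N (Suc n)\<^esub> x" using el by blast
    show "G n C \<in> carrier (quot_module (N n) (H n))" unfolding x using G x cl gd by simp
    show "G n (a \<odot>\<^bsub>quot_module (N (Suc n)) (H (Suc n))\<^esub> C) = a \<odot>\<^bsub>quot_module (N n) (H n)\<^esub> G n C" if a: "a \<in> carrier R" for a
      unfolding x using x a gd G quot_smult[OF mod(2) H] by simp
    fix E assume "E \<in> carrier (quot_module (N (Suc n)) (H (Suc n)))"
    then obtain y where y: "y \<in> carrier (N (Suc n))" "E = H (Suc n) +>\<^bsub>N (Suc n)\<^esub> y" using el by blast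
    show "G n (C \<oplus>\<^bsub>quot_module (N (Suc n)) (H (Suc n))\<^esub> E) = G n C \<oplus>\<^bsub>quot_module (N n) (H n)\<^esub> G n E"
      unfolding x y quot_module_simps using x y gd G S0.a_rcos_sum S1.a_rcos_sum by simp
  qed
  show "pro_system R (\<lambda>n. coker_module (M n) (N n) (h n)) (\<lambda>n. induced (N n) (h n ` carrier (M n)) (g n))"
    unfolding pro_system_def coker_module_def H_def[symmetric] G_def[symmetric]
    using Gm quot_module_module[OF mod(2) H] by blast
  have tr: "transition_aux G n i (H (n + i) +>\<^bsub>N (n + i)\<^esub> x) = H n +>\<^bsub>N n\<^esub> transition_aux g n i x \<and> transition_aux g n i x \<in> carrier (N n)"
    if "x \<in> carrier (N (n + i))" for n i x
    using that
  proof (induction i arbitrary: x)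
    case (Suc i)
    have "g (n + i) x \<in> carrier (N (n + i))" using mod_homD(1)[OF f(2)] Suc.prems by simp
    then show ?case using Suc.IH[of "g (n + i) x"] G[of x "n + i"] Suc.prems by simp
  qed simp
  show "n \<le> j \<Longrightarrow> x \<in> carrier (N j) \<Longrightarrow>
      transition (\<lambda>n. induced (N n) (h n ` carrier (M n)) (g n)) n j (h j ` carrier (M j) +>\<^bsub>N j\<^esub> x)
      = h n ` carrier (M n) +>\<^bsub>N n\<^esub> transition g n j x \<and> transition g n j x \<in> carrier (N n)"
    using tr[of x n "j - n"] unfolding transition_def H_def[symmetric] G_def[symmetric] by simp
qed

section \<open>Bounded functions on \<open>U\<^sub>n\<close>\<close>

lemma (in cring) valuation_root:
  assumes v: "is_valuation R v" and x: "x \<in> carrier R" "(x [^] (n::nat), \<one>) \<in> v" "n > 0"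
  shows "(x, \<one>) \<in> v"
proof (rule ccontr)
  assume "(x, \<one>) \<notin> v"
  then have "(\<one>, x) \<in> v" using valuationD(3)[OF v] x by blast
  from valuation_mult[OF v valuation_refl[OF v x(1)] valuation_pow[OF v this, of "n - 1"]]
  have "(x, x \<otimes> x [^] (n - 1)) \<in> v" using x by simp
  also have "x \<otimes> x [^] (n - 1) = x [^] n" using x by (cases n) (simp_all add: m_comm)
  finally have "(x, x [^] n) \<in> v" .
  then have "(x, \<one>) \<in> v" using valuationD(4)[OF v] x by blast
  with \<open>(x, \<one>) \<notin> v\<close> show False ..
qed

lemma (in cring) valuation_subring:
  assumes "\<And>w. w \<in> V \<Longrightarrow> is_valuation R w"
  shows "subring {h \<in> carrier R. \<forall>w\<in>V. (h, \<one>) \<in> w} R"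
proof (rule subringI)
  show "\<one> \<in> {h \<in> carrier R. \<forall>w\<in>V. (h, \<one>) \<in> w}" using valuation_refl[OF assms] by simp
  show "\<ominus> h \<in> {h \<in> carrier R. \<forall>w\<in>V. (h, \<one>) \<in> w}" if "h \<in> {h \<in> carrier R. \<forall>w\<in>V. (h, \<one>) \<in> w}" for h
    using that valuation_uminus[OF assms] by simp
  show "h \<otimes> k \<in> {h \<in> carrier R. \<forall>w\<in>V. (h, \<one>) \<in> w}"
    if "h \<in> {h \<in> carrier R. \<forall>w\<in>V. (h, \<one>) \<in> w}" "k \<in> {h \<in> carrier R. \<forall>w\<in>V. (h, \<one>) \<in> w}" for h k
    using that valuation_mult_one[OF assms] by simp
  show "h \<oplus> k \<in> {h \<in> carrier R. \<forall>w\<in>V. (h, \<one>) \<in> w}"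
    if "h \<in> {h \<in> carrier R. \<forall>w\<in>V. (h, \<one>) \<in> w}" "k \<in> {h \<in> carrier R. \<forall>w\<in>V. (h, \<one>) \<in> w}" for h k
    using that valuationD(6)[OF assms] by simp
qed auto

text \<open>Continuity is inherited because h carries t^N D into t'^N D'.\<close>

lemma pullback_Cont:
  assumes R: "cring R" and S: "cring S" and h: "h \<in> ring_hom R S" and w: "w \<in> Cont S D' t'"
    and D: "D \<subseteq> carrier R" "\<And>d. d \<in> D \<Longrightarrow> h d \<in> D'" and t: "t \<in> carrier R" "h t = t'"
  shows "pullback_valuation R h w \<in> Cont R D t"
proof -
  interpret R: cring R by fact
  interpret S: cring S by fact
  note H = ring_hom_closed[OF h] ring_hom_mult[OF h] ring_hom_add[OF h]
  have z: "h \<zero>\<^bsub>R\<^esub> = \<zero>\<^bsub>S\<^esub>" using ring_hom_zero[OF h R.ring_axioms S.ring_axioms] .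
  have wv: "is_valuation S w" and wo: "\<And>b c. b \<in> carrier S \<Longrightarrow> c \<in> carrier S \<Longrightarrow> (b, \<zero>\<^bsub>S\<^esub>) \<notin> w \<Longrightarrow> (c, \<zero>\<^bsub>S\<^esub>) \<notin> w
      \<Longrightarrow> adic_open S D' t' {a \<in> carrier S. (b, a \<otimes>\<^bsub>S\<^esub> c) \<notin> w}"
    using w unfolding Cont_def by auto
  have nb: "h y \<in> adic_nbhd S D' t' N" "y \<in> carrier R" if y: "y \<in> adic_nbhd R D t N" for y N
  proof -
    obtain d where d: "d \<in> D" "y = t [^]\<^bsub>R\<^esub> N \<otimes>\<^bsub>R\<^esub> d" using y unfolding adic_nbhd_def by auto
    have dc: "d \<in> carrier R" using d D by auto
    have "h y = t' [^]\<^bsub>S\<^esub> N \<otimes>\<^bsub>S\<^esub> h d"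
      unfolding d using H(2)[of "t [^]\<^bsub>R\<^esub> N" d] R.hom_pow[OF S h t(1)] t dc by simp
    then show "h y \<in> adic_nbhd S D' t' N" unfolding adic_nbhd_def using D(2)[OF d(1)] by simp
    show "y \<in> carrier R" unfolding d using t dc by simp
  qed
  have "adic_open R D t {a \<in> carrier R. (b, a \<otimes>\<^bsub>R\<^esub> c) \<notin> pullback_valuation R h w}"
    if b: "b \<in> carrier R" "(b, \<zero>\<^bsub>R\<^esub>) \<notin> pullback_valuation R h w"
      and c: "c \<in> carrier R" "(c, \<zero>\<^bsub>R\<^esub>) \<notin> pullback_valuation R h w" for b c
  proof -
    have "(h b, \<zero>\<^bsub>S\<^esub>) \<notin> w" "(h c, \<zero>\<^bsub>S\<^esub>) \<notin> w" using b c z by (auto simp: pullback_valuation_def)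
    then have o: "adic_open S D' t' {a \<in> carrier S. (h b, a \<otimes>\<^bsub>S\<^esub> h c) \<notin> w}" using wo H(1) b c by blast
    have mem: "(b, a \<otimes>\<^bsub>R\<^esub> c) \<in> pullback_valuation R h w \<longleftrightarrow> (h b, h a \<otimes>\<^bsub>S\<^esub> h c) \<in> w" if "a \<in> carrier R" for a
      using that b c H(2) by (simp add: pullback_valuation_def)
    show ?thesis
      unfolding adic_open_def
    proof (intro conjI ballI)
      show "{a \<in> carrier R. (b, a \<otimes>\<^bsub>R\<^esub> c) \<notin> pullback_valuation R h w} \<subseteq> carrier R" by auto
      fix x assume x: "x \<in> {a \<in> carrier R. (b, a \<otimes>\<^bsub>R\<^esub> c) \<notin> pullback_valuation R h w}"
      then have xc: "x \<in> carrier R" and "h x \<in> {a \<in> carrier S. (h b, a \<otimes>\<^bsub>S\<^esub> h c) \<notin> w}" using mem H(1) by auto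
      then obtain N where N: "\<And>y. y \<in> adic_nbhd S D' t' N \<Longrightarrow> h x \<oplus>\<^bsub>S\<^esub> y \<in> {a \<in> carrier S. (h b, a \<otimes>\<^bsub>S\<^esub> h c) \<notin> w}"
        using o unfolding adic_open_def by blast
      have "x \<oplus>\<^bsub>R\<^esub> y \<in> {a \<in> carrier R. (b, a \<otimes>\<^bsub>R\<^esub> c) \<notin> pullback_valuation R h w}" if "y \<in> adic_nbhd R D t N" for y
        using N[OF nb(1)[OF that]] nb(2)[OF that] mem[of "x \<oplus>\<^bsub>R\<^esub> y"] xc H(3) by simp
      then show "\<exists>N. \<forall>y\<in>adic_nbhd R D t N. x \<oplus>\<^bsub>R\<^esub> y \<in> {a \<in> carrier R. (b, a \<otimes>\<^bsub>R\<^esub> c) \<notin> pullback_valuation R h w}"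
        by blast
    qed
  qed
  then show ?thesis unfolding Cont_def using R.valuation_pullback[OF S h wv] by blast
qed

context perfectoid_elt
begin

abbreviation "DR \<equiv> toR ` carrier A"
abbreviation "pB \<equiv> nat_elem BB p"

lemma toB_p: "to_loc RR sR pR = pB"
  using RR.nat_elem_hom[OF BB.cring_axioms toB_hom] unfolding toB_def .

lemma DR_subring: "subring DR RR"
proof -
  interpret h: ring_hom_ring A RR toR by (rule ring_hom_ringI2[OF ring_axioms RR.ring_axioms toR_hom])
  show ?thesis by (rule h.img_is_subring[OF carrier_is_subring])
qed

lemma R_denominator:
  assumes "x \<in> carrier RR"
  obtains k :: nat and a where "a \<in> carrier A" "pR [^]\<^bsub>RR\<^esub> k \<otimes>\<^bsub>RR\<^esub> x = toR a"
proof -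
  obtain a k where a: "a \<in> carrier A" "x = fraction A pA a k"
    using assms unfolding RR_eq by (rule AR.loc_carrierE)
  have "x \<otimes>\<^bsub>RR\<^esub> pR [^]\<^bsub>RR\<^esub> k = toR a"
    using AR.fraction_cancel[OF a(1), of k] unfolding a(2) RR_eq[symmetric] toR_eq[symmetric] toR_p .
  then show thesis using that[OF a(1), of k] assms RR.m_comm by simp
qed

sublocale RA: adic RR DR pR
proof (intro adic.intro subring_elt.intro subring_elt_axioms.intro adic_axioms.intro RR.cring_axioms DR_subring)
  show "pR \<in> DR" using toR_p by force
  show "\<exists>N::nat. pR [^]\<^bsub>RR\<^esub> N \<otimes>\<^bsub>RR\<^esub> x \<in> DR" if "x \<in> carrier RR" for x
    using R_denominator[OF that] by (metis imageI)
qed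

definition "DB (n::nat) = rat_subring RR DR (pR [^]\<^bsub>RR\<^esub> n) sR"

abbreviation "v0 n \<equiv> PF.vv n 0"

lemma e_\<omega>0: "e (\<omega> 0) = pB" by (simp add: \<omega>_0 e_p)

text \<open>The fraction p^n/g is v_0, since g times either of them is p^n and g is a unit. So
  Huber's ring of definition is the first of the rings A[v_l] whose union is M_n.\<close>

lemma DB_eq: "DB n = pset BB AB (v0 n)"
proof -
  define F where "F = fraction RR sR (pR [^]\<^bsub>RR\<^esub> n) 1"
  have Fc: "F \<in> carrier BB" unfolding F_def BB_def by (rule RB.fraction_closed) simp
  have sB: "to_loc RR sR sR = e (groot 0)" by (simp add: e_def sR_def toB_def)
  have "F \<otimes>\<^bsub>BB\<^esub> e (groot 0) [^]\<^bsub>BB\<^esub> (1::nat) = toB (pR [^]\<^bsub>RR\<^esub> n)"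
    using RB.fraction_cancel[of "pR [^]\<^bsub>RR\<^esub> n" 1] unfolding sB F_def BB_def toB_def by simp
  moreover have "toB (pR [^]\<^bsub>RR\<^esub> n) = pB [^]\<^bsub>BB\<^esub> n"
    using RR.hom_pow[OF BB.cring_axioms toB_hom, of pR n] RR.nat_elem_hom[OF BB.cring_axioms toB_hom] by simp
  ultimately have "e (groot 0) \<otimes>\<^bsub>BB\<^esub> F = e (\<omega> 0) [^]\<^bsub>BB\<^esub> n"
    using Fc BB.m_comm[of F "e (groot 0)"] BB.nat_pow_eone[of "e (groot 0)"] by (simp add: e_\<omega>0 del: One_nat_def)
  then have F: "F = v0 n" by (rule PF.vv_unique[OF Fc])
  have img: "to_loc RR sR ` DR = AB" unfolding AB_def e_def[abs_def] toB_def by auto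
  have "DB n = generate_ring BB (insert (v0 n) AB)"
    unfolding DB_def rat_subring_def BB_def[symmetric] F_def[symmetric] F img ..
  also have "\<dots> = pset BB AB (v0 n)"
  proof (rule BB.generate_ringI[symmetric])
    show "insert (v0 n) AB \<subseteq> carrier BB" using PF.AE(1) by simp
    show "subring (pset BB AB (v0 n)) BB" by (rule PF.P_sub)
    show "insert (v0 n) AB \<subseteq> pset BB AB (v0 n)" using PF.A_pset BB.gen_in_pset[OF AB_subring] by simp
    show "pset BB AB (v0 n) \<subseteq> K" if "subring K BB" "insert (v0 n) AB \<subseteq> K" for K
      by (rule PF.pset_minimal) (use that in auto)
  qed
  finally show ?thesis .
qed

lemma AB_DB: "AB \<subseteq> DB n" unfolding DB_eq by (rule PF.A_pset)

lemma DB_subring: "subring (DB n) BB" unfolding DB_eq by (rule PF.P_sub)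

lemma pB_AB: "pB \<in> AB" using PF.\<pi>A[of 0] by (simp add: e_\<omega>0)

text \<open>Denominators g^l are absorbed by powers of p because p^(nl) = g^l v_0^l with v_0 in the
  ring of definition.\<close>

lemma BA: "adic BB (DB n) pB"
proof (intro adic.intro subring_elt.intro subring_elt_axioms.intro adic_axioms.intro BB.cring_axioms DB_subring)
  show "pB \<in> DB n" using pB_AB AB_DB by auto
  fix x assume x: "x \<in> carrier BB"
  obtain y l where y: "y \<in> carrier RR" "x = fraction RR sR y l" using x unfolding BB_def by (rule RB.loc_carrierE)
  have sB: "to_loc RR sR sR = e (groot 0)" by (simp add: e_def sR_def toB_def)
  have g: "x \<otimes>\<^bsub>BB\<^esub> e (groot 0) [^]\<^bsub>BB\<^esub> l = toB y"
    using RB.fraction_cancel[OF y(1), of l] unfolding y(2) BB_def[symmetric] sB unfolding toB_def .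
  obtain k :: nat and a where a: "a \<in> carrier A" "pR [^]\<^bsub>RR\<^esub> k \<otimes>\<^bsub>RR\<^esub> y = toR a" by (rule R_denominator[OF y(1)])
  have "toB (pR [^]\<^bsub>RR\<^esub> k) = pB [^]\<^bsub>BB\<^esub> k"
    using RR.hom_pow[OF BB.cring_axioms toB_hom, of pR k] RR.nat_elem_hom[OF BB.cring_axioms toB_hom] by simp
  then have 1: "pB [^]\<^bsub>BB\<^esub> k \<otimes>\<^bsub>BB\<^esub> toB y = e a"
    using ring_hom_mult[OF toB_hom _ y(1), of "pR [^]\<^bsub>RR\<^esub> k"] a(2) by (simp add: e_def)
  have gv: "e (groot 0) [^]\<^bsub>BB\<^esub> l \<otimes>\<^bsub>BB\<^esub> v0 n [^]\<^bsub>BB\<^esub> l = pB [^]\<^bsub>BB\<^esub> (n * l)"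
    using PF.\<gamma>_vv[of 0 n] by (simp add: BB.nat_pow_distrib[symmetric] BB.nat_pow_pow e_\<omega>0)
  have "pB [^]\<^bsub>BB\<^esub> (k + n * l) \<otimes>\<^bsub>BB\<^esub> x
      = pB [^]\<^bsub>BB\<^esub> k \<otimes>\<^bsub>BB\<^esub> (e (groot 0) [^]\<^bsub>BB\<^esub> l \<otimes>\<^bsub>BB\<^esub> v0 n [^]\<^bsub>BB\<^esub> l) \<otimes>\<^bsub>BB\<^esub> x"
    unfolding gv by (simp add: BB.nat_pow_mult)
  also have "\<dots> = (pB [^]\<^bsub>BB\<^esub> k \<otimes>\<^bsub>BB\<^esub> (x \<otimes>\<^bsub>BB\<^esub> e (groot 0) [^]\<^bsub>BB\<^esub> l)) \<otimes>\<^bsub>BB\<^esub> v0 n [^]\<^bsub>BB\<^esub> l"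
    using x by (simp add: BB.m_ac)
  also have "\<dots> = e a \<otimes>\<^bsub>BB\<^esub> v0 n [^]\<^bsub>BB\<^esub> l" unfolding g 1 ..
  also have "\<dots> \<in> DB n" unfolding DB_eq
  proof (rule subringE(6)[OF PF.P_sub _ PF.vv_pset])
    show "e a \<in> pset BB AB (v0 n)" using PF.A_pset a(1) unfolding AB_def by blast
  qed
  finally show "\<exists>N::nat. pB [^]\<^bsub>BB\<^esub> N \<otimes>\<^bsub>BB\<^esub> x \<in> DB n" by blast
qed

section \<open>The completed ring O(U_n) and its bounded functions\<close>

definition "RH (n::nat) = completion BB (DB n) pB"
definition "DH (n::nat) = completion_subring BB (DB n) pB"
definition "tc (n::nat) = to_completion BB (DB n) pB"

lemma RH_cring: "cring (RH n)" unfolding RH_def by (rule adic.Rh_cring[OF BA])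

lemma tc_hom: "tc n \<in> ring_hom BB (RH n)" unfolding tc_def RH_def by (rule adic.to_completion_hom[OF BA])

lemma tc_closed: "x \<in> carrier BB \<Longrightarrow> tc n x \<in> carrier (RH n)" by (rule ring_hom_closed[OF tc_hom])

lemma tc_p: "tc n pB = nat_elem (RH n) p" by (rule BB.nat_elem_hom[OF RH_cring tc_hom])

lemma RH_adic: "adic (RH n) (DH n) (nat_elem (RH n) p)"
  using adic.Rh_adic[OF BA] unfolding RH_def[symmetric] DH_def[symmetric] tc_def[symmetric] tc_p .

lemma rat_loc_eq: "rat_localization RR DR pR (pR [^]\<^bsub>RR\<^esub> n) sR = RH n"
  by (simp add: rat_localization_def RH_def BB_def[symmetric] DB_def[symmetric] toB_p)

lemma to_rat_eq: "to_rat_localization RR DR pR (pR [^]\<^bsub>RR\<^esub> n) sR x = tc n (toB x)"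
  by (simp only: to_rat_localization_def tc_def BB_def[symmetric] DB_def[symmetric] toB_p toB_def)

definition "UU (n::nat) = U_subset p A (groot 0) n"

definition "PT (n::nat) = {w \<in> Cont (RH n) (DH n) (nat_elem (RH n) p). pullback_valuation RR (\<lambda>x. tc n (toB x)) w \<in> UU n}"

lemma toB_pR: "toB pR = pB" using toB_p unfolding toB_def .

lemma PT_eq: "rat_points RR DR pR (pR [^]\<^bsub>RR\<^esub> n) sR (UU n) = PT n"
  unfolding rat_points_def PT_def rat_loc_eq to_rat_eq toB_pR tc_p BB_def[symmetric] DB_def[symmetric] toB_p DH_def[symmetric]
    to_rat_eq[abs_def] ..

abbreviation "OU n \<equiv> bdd_ring p A (groot 0) n"

lemma OU_eq: "OU n = (RH n)\<lparr>carrier := {h \<in> carrier (RH n). \<forall>w\<in>PT n. (h, \<one>\<^bsub>RH n\<^esub>) \<in> w}\<rparr>"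
  unfolding bdd_ring_def O_plus_def sR_def[symmetric] UU_def[symmetric] PT_eq rat_loc_eq ..

lemma OU_mem: "h \<in> carrier (OU n) \<longleftrightarrow> h \<in> carrier (RH n) \<and> (\<forall>w\<in>PT n. (h, \<one>\<^bsub>RH n\<^esub>) \<in> w)"
  by (simp add: OU_eq)

lemma OU_ops: "\<one>\<^bsub>OU n\<^esub> = \<one>\<^bsub>RH n\<^esub>" "\<zero>\<^bsub>OU n\<^esub> = \<zero>\<^bsub>RH n\<^esub>" "x \<otimes>\<^bsub>OU n\<^esub> y = x \<otimes>\<^bsub>RH n\<^esub> y" "x \<oplus>\<^bsub>OU n\<^esub> y = x \<oplus>\<^bsub>RH n\<^esub> y"
  by (simp_all add: OU_eq)

lemma PT_val: "w \<in> PT n \<Longrightarrow> is_valuation (RH n) w" unfolding PT_def Cont_def by blast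

lemma OU_subring: "subring (carrier (OU n)) (RH n)"
proof -
  interpret H: cring "RH n" by (rule RH_cring)
  show ?thesis unfolding OU_eq using H.valuation_subring[of "PT n"] PT_val by simp
qed

lemma OU_cring: "cring (OU n)"
proof -
  interpret H: cring "RH n" by (rule RH_cring)
  have "OU n = (RH n)\<lparr>carrier := carrier (OU n)\<rparr>" by (simp add: OU_eq)
  then show ?thesis using H.subring_cring[OF OU_subring] by metis
qed

lemma OU_nat_elem: "nat_elem (OU n) k = nat_elem (RH n) k"
  unfolding nat_elem_def OU_eq add_pow_def by simp (simp add: nat_pow_def)

lemma OU_pow: "x [^]\<^bsub>OU n\<^esub> (k::nat) = x [^]\<^bsub>RH n\<^esub> k"
  unfolding OU_eq nat_pow_def by simp

lemma RB_hom: "(\<lambda>x. tc n (toB x)) \<in> ring_hom RR (RH n)"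
  using ring_hom_trans[OF toB_hom tc_hom] by (simp add: comp_def)

lemma to_bdd_eq: "to_bdd p A (groot 0) n a = tc n (e a)"
  unfolding to_bdd_def sR_def[symmetric] to_rat_eq e_def ..

lemma UU_mem: "x \<in> UU n \<longleftrightarrow> x \<in> Cont RR DR pR \<and> (\<forall>f\<in>DR. (f, \<one>\<^bsub>RR\<^esub>) \<in> x) \<and> (pR [^]\<^bsub>RR\<^esub> n, sR) \<in> x"
  by (auto simp: UU_def U_subset_def perfd_space_def Spa_def sR_def)

lemma UU_mono: "UU n \<subseteq> UU (Suc n)"
proof
  fix x assume x: "x \<in> UU n"
  then have v: "is_valuation RR x" unfolding UU_mem Cont_def by blast
  have "(pR, \<one>\<^bsub>RR\<^esub>) \<in> x" using x RA.tD unfolding UU_mem by blast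
  from RR.valuation_mult[OF v _ this, of "pR [^]\<^bsub>RR\<^esub> n" sR] x
  have "(pR [^]\<^bsub>RR\<^esub> Suc n, sR) \<in> x" unfolding UU_mem by simp
  then show "x \<in> UU (Suc n)" using x unfolding UU_mem by blast
qed

lemma PT_A:
  assumes "w \<in> PT n" "a \<in> carrier A"
  shows "(tc n (e a), \<one>\<^bsub>RH n\<^esub>) \<in> w"
proof -
  have "(toR a, \<one>\<^bsub>RR\<^esub>) \<in> pullback_valuation RR (\<lambda>x. tc n (toB x)) w"
    using assms unfolding PT_def UU_mem by blast
  then show ?thesis using ring_hom_one[OF RB_hom] by (simp add: pullback_valuation_def e_def)
qed

lemma tc_OU: assumes "a \<in> carrier A" shows "tc n (e a) \<in> carrier (OU n)"
  unfolding OU_mem using PT_A[OF _ assms] tc_closed assms by simp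

lemma to_bdd_hom: "to_bdd p A (groot 0) n \<in> ring_hom A (OU n)"
proof -
  have h: "(\<lambda>a. tc n (e a)) \<in> ring_hom A (RH n)" using ring_hom_trans[OF e_hom tc_hom] by (simp add: comp_def)
  show ?thesis
    by (rule ring_hom_memI)
      (use tc_OU ring_hom_mult[OF h] ring_hom_add[OF h] ring_hom_one[OF h] in \<open>auto simp: to_bdd_eq OU_ops\<close>)
qed

lemma tc_vv:
  "tc n (e (groot 0)) \<otimes>\<^bsub>RH n\<^esub> tc n (v0 n) = tc n (toB (pR [^]\<^bsub>RR\<^esub> n))"
proof -
  have "toB (pR [^]\<^bsub>RR\<^esub> n) = e (\<omega> 0) [^]\<^bsub>BB\<^esub> n"
    using RR.hom_pow[OF BB.cring_axioms toB_hom, of pR n] toB_pR by (simp add: e_\<omega>0)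
  then show ?thesis using ring_hom_mult[OF tc_hom, of "e (groot 0)" "v0 n"] PF.\<gamma>_vv[of 0 n] by simp
qed

text \<open>g is invertible on U_n, so |g| can be cancelled; this turns |p^n| <= |g| into |v_0| <=
  1.\<close>

lemma tc_g_unit:
  assumes w: "is_valuation (RH n) w"
  shows "(tc n (e (groot 0)), \<zero>\<^bsub>RH n\<^esub>) \<notin> w"
proof -
  interpret H: cring "RH n" by (rule RH_cring)
  have i: "inv\<^bsub>BB\<^esub> (e (groot 0)) \<in> carrier BB" "e (groot 0) \<otimes>\<^bsub>BB\<^esub> inv\<^bsub>BB\<^esub> (e (groot 0)) = \<one>\<^bsub>BB\<^esub>"
    using PF.\<gamma>_Units[of 0] by auto
  have "tc n (e (groot 0)) \<otimes>\<^bsub>RH n\<^esub> tc n (inv\<^bsub>BB\<^esub> (e (groot 0))) = \<one>\<^bsub>RH n\<^esub>"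
    using ring_hom_mult[OF tc_hom _ i(1), of "e (groot 0)" n] i ring_hom_one[OF tc_hom] by simp
  then show ?thesis by (rule H.valuation_unit[OF w tc_closed tc_closed, rotated 2]) (use i in auto)
qed

lemma PT_v0:
  assumes w: "w \<in> PT n"
  shows "(tc n (v0 n), \<one>\<^bsub>RH n\<^esub>) \<in> w"
proof -
  interpret H: cring "RH n" by (rule RH_cring)
  note wv = PT_val[OF w]
  have c: "tc n (v0 n) \<in> carrier (RH n)" "tc n (e (groot 0)) \<in> carrier (RH n)" by (auto intro: tc_closed)
  have "(pR [^]\<^bsub>RR\<^esub> n, sR) \<in> pullback_valuation RR (\<lambda>x. tc n (toB x)) w"
    using w unfolding PT_def UU_mem by blast
  then have "(tc n (toB (pR [^]\<^bsub>RR\<^esub> n)), tc n (e (groot 0))) \<in> w"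
    by (simp add: pullback_valuation_def e_def sR_def)
  then have "(tc n (v0 n) \<otimes>\<^bsub>RH n\<^esub> tc n (e (groot 0)), \<one>\<^bsub>RH n\<^esub> \<otimes>\<^bsub>RH n\<^esub> tc n (e (groot 0))) \<in> w"
    unfolding tc_vv[symmetric] using c by (simp add: H.m_comm)
  then show ?thesis using valuationD(8)[OF wv _ tc_g_unit[OF wv]] c by blast
qed

text \<open>A root v_l of v_0 is bounded by 1 wherever v_0 is, and the functions bounded by 1 form a
  ring containing A.\<close>

lemma MM_OU:
  assumes x: "x \<in> PF.MM n"
  shows "tc n x \<in> carrier (OU n)"
proof -
  interpret H: cring "RH n" by (rule RH_cring)
  interpret h: ring_hom_ring BB "RH n" "tc n" by (rule ring_hom_ringI2[OF BB.ring_axioms H.ring_axioms tc_hom])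
  note OE = subringE[OF OU_subring]
  define S where "S = {x \<in> carrier BB. tc n x \<in> carrier (OU n)}"
  have S: "subring S BB"
    by (rule BB.subringI) (use OE in \<open>auto simp: S_def\<close>)
  have AS: "AB \<subseteq> S" using tc_OU unfolding S_def AB_def by auto
  have v: "PF.vv n l \<in> S" for l
  proof -
    have "(tc n (PF.vv n l), \<one>\<^bsub>RH n\<^esub>) \<in> w" if w: "w \<in> PT n" for w
    proof (rule H.valuation_root[OF PT_val[OF w] tc_closed])
      have "PF.vv n l [^]\<^bsub>BB\<^esub> (p ^ l) = v0 n" using PF.vv_pow[of n 0 l] by simp
      then show "(tc n (PF.vv n l) [^]\<^bsub>RH n\<^esub> (p ^ l), \<one>\<^bsub>RH n\<^esub>) \<in> w"
        using PT_v0[OF w] BB.hom_pow[OF RH_cring tc_hom, of "PF.vv n l" n "p ^ l"] by simp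
    qed (use pgt0 in auto)
    then show ?thesis unfolding S_def OU_mem using tc_closed by simp
  qed
  obtain l where "x \<in> pset BB AB (PF.vv n l)" using x unfolding PF.MM_def by blast
  then have "x \<in> S" using PF.pset_minimal[OF S AS v] by blast
  then show ?thesis unfolding S_def by blast
qed

text \<open>By continuity \<open>|p\<^sup>N \<delta>| < 1\<close> for all \<open>\<delta>\<close> in the ring of definition, and modulo \<open>p\<^sup>N\<close> every \<open>\<delta>\<close> comes from
  \<open>A[p\<^sup>n/g]\<close>.\<close>

lemma DH_OU: "DH n \<subseteq> carrier (OU n)"
proof
  interpret H: cring "RH n" by (rule RH_cring)
  interpret B: adic BB "DB n" pB by (rule BA)
  interpret A: adic "RH n" "DH n" "nat_elem (RH n) p" by (rule RH_adic)
  fix \<delta> assume d: "\<delta> \<in> DH n"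
  have dc: "\<delta> \<in> carrier (RH n)" using A.Dc[OF d] .
  obtain s where s: "s \<in> carrier BB" "s \<otimes>\<^bsub>BB\<^esub> pB = \<one>\<^bsub>BB\<^esub>" using unit_toB by blast
  have "(\<delta>, \<one>\<^bsub>RH n\<^esub>) \<in> w" if w: "w \<in> PT n" for w
  proof -
    note wv = PT_val[OF w]
    have o1: "(\<one>\<^bsub>RH n\<^esub>, \<zero>\<^bsub>RH n\<^esub>) \<notin> w" by (rule valuationD(5)[OF wv])
    have "adic_open (RH n) (DH n) (nat_elem (RH n) p) {a \<in> carrier (RH n). (\<one>\<^bsub>RH n\<^esub>, a \<otimes>\<^bsub>RH n\<^esub> \<one>\<^bsub>RH n\<^esub>) \<notin> w}"
      using w o1 unfolding PT_def Cont_def by blast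
    moreover have "\<zero>\<^bsub>RH n\<^esub> \<in> {a \<in> carrier (RH n). (\<one>\<^bsub>RH n\<^esub>, a \<otimes>\<^bsub>RH n\<^esub> \<one>\<^bsub>RH n\<^esub>) \<notin> w}" using o1 by simp
    ultimately obtain N where N: "\<And>y. y \<in> A.nb N \<Longrightarrow> \<zero>\<^bsub>RH n\<^esub> \<oplus>\<^bsub>RH n\<^esub> y \<in> {a \<in> carrier (RH n). (\<one>\<^bsub>RH n\<^esub>, a \<otimes>\<^bsub>RH n\<^esub> \<one>\<^bsub>RH n\<^esub>) \<notin> w}"
      unfolding adic_open_def by blast
    obtain x \<delta>' where x: "x \<in> carrier BB" "\<delta>' \<in> DH n" "\<delta> = tc n x \<oplus>\<^bsub>RH n\<^esub> tc n pB [^]\<^bsub>RH n\<^esub> N \<otimes>\<^bsub>RH n\<^esub> \<delta>'"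
      using B.completion_approx[OF s, of \<delta> N] dc unfolding RH_def DH_def tc_def by blast
    define z where "z = nat_elem (RH n) p [^]\<^bsub>RH n\<^esub> N \<otimes>\<^bsub>RH n\<^esub> \<delta>'"
    have znb: "z \<in> A.nb N" unfolding z_def by (rule A.nbI[OF x(2)])
    have zc: "z \<in> carrier (RH n)" using A.nb_carrier[OF znb] .
    have zD: "z \<in> DH n" using A.nb_D[OF znb] .
    have "(\<one>\<^bsub>RH n\<^esub>, z) \<notin> w" using N[OF znb] zc by simp
    then have z1: "(z, \<one>\<^bsub>RH n\<^esub>) \<in> w" using valuationD(3)[OF wv] zc by blast
    have eq: "\<delta> = tc n x \<oplus>\<^bsub>RH n\<^esub> z" using x(3) unfolding z_def tc_p .
    have "tc n x = \<delta> \<oplus>\<^bsub>RH n\<^esub> (\<ominus>\<^bsub>RH n\<^esub> z)" unfolding eq using tc_closed[OF x(1), of n] zc by (simp add: H.a_assoc H.r_neg)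
    then have "tc n x \<in> DH n" using A.DE(5,7) d zD by simp
    then have "x \<in> DB n" using B.to_completion_D[OF x(1)] unfolding tc_def DH_def by simp
    then have "tc n x \<in> carrier (OU n)" unfolding DB_eq using MM_OU PF.MM_I by blast
    then have "(tc n x, \<one>\<^bsub>RH n\<^esub>) \<in> w" using w unfolding OU_mem by blast
    then show ?thesis unfolding eq using valuationD(6)[OF wv] z1 by blast
  qed
  then show "\<delta> \<in> carrier (OU n)" unfolding OU_mem using dc by blast
qed

lemma tc_DH: "x \<in> carrier BB \<Longrightarrow> tc n x \<in> DH n \<longleftrightarrow> x \<in> DB n"
  unfolding tc_def DH_def by (rule adic.to_completion_D[OF BA])

text \<open>Otherwise \<open>unbounded_valuation\<close> gives a continuous valuation that is at
  most 1 on the ring of definition but larger than 1 at y. As A and v_0 lie in that ring, its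
  restriction is a point of U_n, where y would have to be bounded by 1.\<close>

lemma OU_power_bounded:
  assumes y: "y \<in> carrier (OU n)"
  shows "y \<in> power_bounded (RH n) (DH n) (nat_elem (RH n) p)"
proof (rule ccontr)
  assume nb: "y \<notin> power_bounded (RH n) (DH n) (nat_elem (RH n) p)"
  interpret H: cring "RH n" by (rule RH_cring)
  interpret A: adic "RH n" "DH n" "nat_elem (RH n) p" by (rule RH_adic)
  obtain s where s: "s \<in> carrier BB" "s \<otimes>\<^bsub>BB\<^esub> pB = \<one>\<^bsub>BB\<^esub>" using unit_toB by blast
  have s': "tc n s \<in> carrier (RH n)" "tc n s \<otimes>\<^bsub>RH n\<^esub> nat_elem (RH n) p = \<one>\<^bsub>RH n\<^esub>"
    using tc_closed[OF s(1)] ring_hom_mult[OF tc_hom s(1), of pB n] s(2) ring_hom_one[OF tc_hom] tc_p by auto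
  have yc: "y \<in> carrier (RH n)" using y unfolding OU_mem by blast
  obtain w where w: "w \<in> Cont (RH n) (DH n) (nat_elem (RH n) p)" "\<And>f. f \<in> DH n \<Longrightarrow> (f, \<one>\<^bsub>RH n\<^esub>) \<in> w"
    "(y, \<one>\<^bsub>RH n\<^esub>) \<notin> w" using A.unbounded_valuation[OF s' yc nb] by blast
  have wv: "is_valuation (RH n) w" using w(1) unfolding Cont_def by blast
  have tB: "tc n (toB x) \<in> DH n" if "x \<in> DR" for x
  proof -
    have "toB x \<in> AB" using that unfolding AB_def e_def[abs_def] by auto
    then have "toB x \<in> DB n" using AB_DB by auto
    moreover have "toB x \<in> carrier BB" using that ring_hom_closed[OF toB_hom] RA.Dc by blast
    ultimately show ?thesis using tc_DH by simp
  qed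
  have C: "pullback_valuation RR (\<lambda>x. tc n (toB x)) w \<in> Cont RR DR pR"
  proof (rule pullback_Cont[OF RR.cring_axioms RH_cring RB_hom w(1)])
    show "DR \<subseteq> carrier RR" using RA.Dc by auto
    show "tc n (toB d) \<in> DH n" if "d \<in> DR" for d using tB[OF that] .
    show "pR \<in> carrier RR" "tc n (toB pR) = nat_elem (RH n) p" using toB_pR tc_p by simp_all
  qed
  have "(f, \<one>\<^bsub>RR\<^esub>) \<in> pullback_valuation RR (\<lambda>x. tc n (toB x)) w" if "f \<in> DR" for f
    using w(2)[OF tB[OF that]] RA.Dc[OF that] ring_hom_one[OF RB_hom] by (simp add: pullback_valuation_def)
  \<comment> \<open>|p^n| = |g v_0| <= |g|.\<close>
  moreover have "(pR [^]\<^bsub>RR\<^esub> n, sR) \<in> pullback_valuation RR (\<lambda>x. tc n (toB x)) w"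
  proof -
    have "v0 n \<in> DB n" unfolding DB_eq by (rule BB.gen_in_pset[OF AB_subring]) simp
    then have "(tc n (v0 n), \<one>\<^bsub>RH n\<^esub>) \<in> w" using w(2) tc_DH by simp
    from H.valuation_mult[OF wv valuation_refl[OF wv tc_closed[of "e (groot 0)"]] this]
    have "(tc n (e (groot 0)) \<otimes>\<^bsub>RH n\<^esub> tc n (v0 n), tc n (e (groot 0))) \<in> w" using tc_closed by simp
    then show ?thesis unfolding tc_vv using ring_hom_closed[OF toR_hom] by (simp add: pullback_valuation_def e_def sR_def)
  qed
  ultimately have "w \<in> PT n" unfolding PT_def UU_mem using w(1) C by blast
  then show False using y w(3) unfolding OU_mem by blast
qed

text \<open>By \<open>tc_DH\<close>, lying in the completed ring of definition can be tested in
  A[1/p][1/g], so the powers of x have bounded denominators over A[v_0] already there, and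
  \<open>MM_star\<close> applies.\<close>

lemma power_bounded_star:
  assumes x: "x \<in> carrier BB" and pb: "tc n x \<in> power_bounded (RH n) (DH n) (nat_elem (RH n) p)"
  shows "x \<in> PF.star (PF.MM n)"
proof -
  interpret H: cring "RH n" by (rule RH_cring)
  interpret A: adic "RH n" "DH n" "nat_elem (RH n) p" by (rule RH_adic)
  obtain K :: nat where K: "\<And>i::nat. nat_elem (RH n) p [^]\<^bsub>RH n\<^esub> K \<otimes>\<^bsub>RH n\<^esub> tc n x [^]\<^bsub>RH n\<^esub> i \<in> DH n"
    using A.power_boundedE[OF pb] by blast
  have "pB [^]\<^bsub>BB\<^esub> K \<otimes>\<^bsub>BB\<^esub> x [^]\<^bsub>BB\<^esub> i \<in> DB n" for i :: nat
  proof -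
    have "tc n (pB [^]\<^bsub>BB\<^esub> K \<otimes>\<^bsub>BB\<^esub> x [^]\<^bsub>BB\<^esub> i) = nat_elem (RH n) p [^]\<^bsub>RH n\<^esub> K \<otimes>\<^bsub>RH n\<^esub> tc n x [^]\<^bsub>RH n\<^esub> i"
      using ring_hom_mult[OF tc_hom, of "pB [^]\<^bsub>BB\<^esub> K" "x [^]\<^bsub>BB\<^esub> i" n] x BB.hom_pow[OF RH_cring tc_hom] tc_p by simp
    then show ?thesis using K[of i] tc_DH[of "pB [^]\<^bsub>BB\<^esub> K \<otimes>\<^bsub>BB\<^esub> x [^]\<^bsub>BB\<^esub> i" n] x by simp
  qed
  then show ?thesis using PF.MM_star[OF x, of K n] unfolding DB_eq e_\<omega>0 by blast
qed

text \<open>In the completion a/p^m equals y, so it is power bounded and almost lies in M_n;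
  \<open>kernel_estimate\<close> then places it almost in the image of A.\<close>

lemma kernel_bdd:
  assumes a: "a \<in> carrier A" and y: "y \<in> carrier (OU n)"
    and ay: "tc n (e a) = nat_elem (RH n) p [^]\<^bsub>RH n\<^esub> m \<otimes>\<^bsub>RH n\<^esub> y" and n: "m * p ^ (k + 3) \<le> n"
  shows "\<exists>b\<in>carrier A. \<omega> k \<otimes> groot k \<otimes> a = pA [^] m \<otimes> b"
proof -
  interpret H: cring "RH n" by (rule RH_cring)
  obtain s where s: "s \<in> carrier BB" "s \<otimes>\<^bsub>BB\<^esub> pB = \<one>\<^bsub>BB\<^esub>" using unit_toB by blast
  define x where "x = s [^]\<^bsub>BB\<^esub> m \<otimes>\<^bsub>BB\<^esub> e a"
  have xc: "x \<in> carrier BB" unfolding x_def using s a by simp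
  have sp: "s [^]\<^bsub>BB\<^esub> m \<otimes>\<^bsub>BB\<^esub> pB [^]\<^bsub>BB\<^esub> m = \<one>\<^bsub>BB\<^esub>" using s by (simp add: BB.nat_pow_distrib[symmetric])
  have yc: "y \<in> carrier (RH n)" using y unfolding OU_mem by blast
  have px: "pB [^]\<^bsub>BB\<^esub> m \<otimes>\<^bsub>BB\<^esub> x = e a"
  proof -
    have "pB [^]\<^bsub>BB\<^esub> m \<otimes>\<^bsub>BB\<^esub> x = s [^]\<^bsub>BB\<^esub> m \<otimes>\<^bsub>BB\<^esub> pB [^]\<^bsub>BB\<^esub> m \<otimes>\<^bsub>BB\<^esub> e a"
      unfolding x_def using s a by (simp add: BB.m_ac)
    then show ?thesis unfolding sp using a by simp
  qed
  have "tc n x = tc n (s [^]\<^bsub>BB\<^esub> m) \<otimes>\<^bsub>RH n\<^esub> (tc n (pB [^]\<^bsub>BB\<^esub> m) \<otimes>\<^bsub>RH n\<^esub> y)"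
    unfolding x_def using ring_hom_mult[OF tc_hom, of "s [^]\<^bsub>BB\<^esub> m" "e a" n] s a ay
      BB.hom_pow[OF RH_cring tc_hom, of pB n m] tc_p by simp
  also have "\<dots> = tc n (s [^]\<^bsub>BB\<^esub> m \<otimes>\<^bsub>BB\<^esub> pB [^]\<^bsub>BB\<^esub> m) \<otimes>\<^bsub>RH n\<^esub> y"
    using ring_hom_mult[OF tc_hom, of "s [^]\<^bsub>BB\<^esub> m" "pB [^]\<^bsub>BB\<^esub> m" n] s yc tc_closed by (simp add: H.m_assoc)
  also have "\<dots> = y" unfolding sp using ring_hom_one[OF tc_hom] yc by simp
  finally have "x \<in> PF.star (PF.MM n)" using power_bounded_star[OF xc] OU_power_bounded[OF y] by simp
  moreover have "e (\<omega> 0) [^]\<^bsub>BB\<^esub> m \<otimes>\<^bsub>BB\<^esub> x \<in> AB" unfolding e_\<omega>0 px using a by (simp add: AB_def)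
  \<comment> \<open>\<open>kernel_estimate\<close> is used at level k+1, since a second loss follows
    when the identity is lifted from the image of A to A.\<close>
  moreover have "m * p ^ (Suc k + 2) \<le> n" using n by (simp add: numeral_3_eq_3)
  ultimately have "PF.\<delta> (Suc k) \<otimes>\<^bsub>BB\<^esub> x \<in> AB" by (rule PF.kernel_estimate)
  then obtain a' where a': "a' \<in> carrier A" "PF.\<delta> (Suc k) \<otimes>\<^bsub>BB\<^esub> x = e a'" unfolding AB_def by blast
  have d: "PF.\<delta> (Suc k) = e (\<omega> (Suc k) \<otimes> groot (Suc k))"
    unfolding PF.\<delta>_def using ring_hom_mult[OF e_hom] by simp
  define c where "c = \<omega> (Suc k) \<otimes> groot (Suc k) \<otimes> a"
  have cc: "c \<in> carrier A" unfolding c_def using a by simp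
  have "e c = PF.\<delta> (Suc k) \<otimes>\<^bsub>BB\<^esub> (pB [^]\<^bsub>BB\<^esub> m \<otimes>\<^bsub>BB\<^esub> x)"
    unfolding c_def px d using ring_hom_mult[OF e_hom, of "\<omega> (Suc k) \<otimes> groot (Suc k)" a] a by simp
  also have "\<dots> = pB [^]\<^bsub>BB\<^esub> m \<otimes>\<^bsub>BB\<^esub> e a'" unfolding a'(2)[symmetric] using xc by (simp add: BB.m_lcomm)
  also have "\<dots> = e (pA [^] m \<otimes> a')" using ring_hom_mult[OF e_hom, of "pA [^] m" a'] a' e_pow[of pA m] e_p by simp
  finally have ec': "e c = e (pA [^] m \<otimes> a')" .
  have "e (c \<ominus> pA [^] m \<otimes> a') = \<zero>\<^bsub>BB\<^esub>"
  proof -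
    interpret h: ring_hom_ring A BB e by (rule ring_hom_ringI2[OF ring_axioms BB.ring_axioms e_hom])
    show ?thesis using cc a' ec' by (simp add: a_minus_def BB.r_neg)
  qed
  then have z: "groot (Suc k) \<otimes> (c \<ominus> pA [^] m \<otimes> a') = \<zero>" using e_kernel cc a' by simp
  have "groot (Suc k) \<otimes> c = groot (Suc k) \<otimes> (c \<ominus> pA [^] m \<otimes> a') \<oplus> groot (Suc k) \<otimes> (pA [^] m \<otimes> a')"
    using cc a' by (simp add: a_minus_def r_distr r_minus a_assoc l_neg)
  then have gc: "groot (Suc k) \<otimes> c = groot (Suc k) \<otimes> (pA [^] m \<otimes> a')" using z a' by simp
  have p2: "p \<ge> 2" using prime_p prime_ge_2_nat by blast
  \<comment> \<open>The losses are \<omega> (k+1) once and g^(1/p^(k+1)) twice: once from \<delta>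
    (k+1) and once from the g-torsion. They divide \<omega> k g^(1/p^k) with cofactor r, as p >=
    2.\<close>
  define r where "r = \<omega> (Suc k) [^] (p - 1) \<otimes> groot (Suc k) [^] (p - 2)"
  have rc: "r \<in> carrier A" unfolding r_def by simp
  have "\<omega> k = \<omega> (Suc k) [^] (p - 1) \<otimes> \<omega> (Suc k)"
    using \<omega>_Suc[of k] p2 nat_pow_Suc[of "\<omega> (Suc k)" "p - 1"] by simp
  moreover have "groot k = groot (Suc k) [^] (p - 2) \<otimes> (groot (Suc k) \<otimes> groot (Suc k))"
  proof -
    have "p = Suc (Suc (p - 2))" using p2 by simp
    then have "groot k = groot (Suc k) [^] Suc (Suc (p - 2))" using gr_Suc[of k] by metis
    then show ?thesis by (simp add: m_assoc)
  qed
  ultimately have "\<omega> k \<otimes> groot k \<otimes> a = r \<otimes> (groot (Suc k) \<otimes> c)"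
    unfolding r_def c_def using a by (simp add: m_ac)
  also have "\<dots> = pA [^] m \<otimes> (r \<otimes> (groot (Suc k) \<otimes> a'))" unfolding gc using rc a' by (simp add: m_ac)
  finally show ?thesis using rc a' by (intro bexI[of _ "r \<otimes> (groot (Suc k) \<otimes> a')"]) auto
qed

subsection \<open>Restriction maps\<close>

abbreviation "res n \<equiv> bdd_restrict p A (groot 0) n"

lemma DB_mono: "DB (Suc n) \<subseteq> DB n"
proof -
  have "v0 (Suc n) = pB \<otimes>\<^bsub>BB\<^esub> v0 n"
  proof (rule PF.vv_unique[symmetric])
    have "e (groot 0) \<otimes>\<^bsub>BB\<^esub> (pB \<otimes>\<^bsub>BB\<^esub> v0 n) = pB \<otimes>\<^bsub>BB\<^esub> (e (groot 0) \<otimes>\<^bsub>BB\<^esub> v0 n)" by (simp add: BB.m_lcomm)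
    then show "e (groot 0) \<otimes>\<^bsub>BB\<^esub> (pB \<otimes>\<^bsub>BB\<^esub> v0 n) = e (\<omega> 0) [^]\<^bsub>BB\<^esub> Suc n"
      unfolding PF.\<gamma>_vv e_\<omega>0 by (simp add: BB.m_comm)
  qed simp
  moreover have "v0 n \<in> DB n" unfolding DB_eq by (rule BB.gen_in_pset[OF AB_subring]) simp
  moreover have "pB \<in> DB n" using pB_AB AB_DB by blast
  ultimately have "v0 (Suc n) \<in> DB n" using subringE(6)[OF DB_subring, of pB n "v0 n"] by simp
  then show ?thesis unfolding DB_eq[of "Suc n"] by (intro PF.pset_minimal[OF DB_subring AB_DB])
qed

lemma res_eq: "res n = induced (cauchy_ring BB (DB n) pB) (null_seqs BB (DB n) pB) id"
  unfolding bdd_restrict_def Let_def sR_def[symmetric] BB_def[symmetric] DB_def[symmetric] toB_p ..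

lemmas res_facts = completion_map[OF BA BA DB_mono, folded res_eq]

lemma res_hom: "res n \<in> ring_hom (RH (Suc n)) (RH n)"
  using res_facts(1) unfolding RH_def .

lemma res_tc: "x \<in> carrier BB \<Longrightarrow> res n (tc (Suc n) x) = tc n x"
  using res_facts(2) unfolding tc_def .

text \<open>A point of U_n pulled back along the restriction map is a point of U_(n+1), because U_n
  is contained in U_(n+1); there y is bounded by 1.\<close>

lemma res_OU:
  assumes y: "y \<in> carrier (OU (Suc n))"
  shows "res n y \<in> carrier (OU n)"
proof -
  interpret H: cring "RH n" by (rule RH_cring)
  interpret A1: adic "RH (Suc n)" "DH (Suc n)" "nat_elem (RH (Suc n)) p" by (rule RH_adic)
  have yc: "y \<in> carrier (RH (Suc n))" using y unfolding OU_mem by blast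
  have "(res n y, \<one>\<^bsub>RH n\<^esub>) \<in> w" if w: "w \<in> PT n" for w
  proof -
    have "pullback_valuation (RH (Suc n)) (res n) w \<in> Cont (RH (Suc n)) (DH (Suc n)) (nat_elem (RH (Suc n)) p)"
    proof (rule pullback_Cont[OF RH_cring RH_cring res_hom])
      show "w \<in> Cont (RH n) (DH n) (nat_elem (RH n) p)" using w unfolding PT_def by blast
      show "DH (Suc n) \<subseteq> carrier (RH (Suc n))" using A1.Dc by auto
      show "res n d \<in> DH n" if "d \<in> DH (Suc n)" for d using res_facts(3) that unfolding DH_def .
      show "nat_elem (RH (Suc n)) p \<in> carrier (RH (Suc n))" by (rule A1.t)
      show "res n (nat_elem (RH (Suc n)) p) = nat_elem (RH n) p"
        by (rule cring.nat_elem_hom[OF RH_cring RH_cring res_hom])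
    qed
    moreover have "pullback_valuation RR (\<lambda>x. tc (Suc n) (toB x)) (pullback_valuation (RH (Suc n)) (res n) w)
        = pullback_valuation RR (\<lambda>x. tc n (toB x)) w"
      unfolding pullback_valuation_def using res_tc ring_hom_closed[OF toB_hom] tc_closed by auto
    moreover have "pullback_valuation RR (\<lambda>x. tc n (toB x)) w \<in> UU (Suc n)" using w UU_mono unfolding PT_def by blast
    ultimately have "pullback_valuation (RH (Suc n)) (res n) w \<in> PT (Suc n)" unfolding PT_def by simp
    then have "(y, \<one>\<^bsub>RH (Suc n)\<^esub>) \<in> pullback_valuation (RH (Suc n)) (res n) w" using y unfolding OU_mem by blast
    then show ?thesis using ring_hom_one[OF res_hom] by (simp add: pullback_valuation_def)
  qed
  then show ?thesis unfolding OU_mem using ring_hom_closed[OF res_hom yc] by blast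
qed

lemma res_OU_hom: "res n \<in> ring_hom (OU (Suc n)) (OU n)"
proof (rule ring_hom_memI)
  have c: "x \<in> carrier (OU (Suc n)) \<Longrightarrow> x \<in> carrier (RH (Suc n))" for x unfolding OU_mem by blast
  show "res n x \<in> carrier (OU n)" if "x \<in> carrier (OU (Suc n))" for x by (rule res_OU[OF that])
  show "res n \<one>\<^bsub>OU (Suc n)\<^esub> = \<one>\<^bsub>OU n\<^esub>" unfolding OU_ops by (rule ring_hom_one[OF res_hom])
  fix x y assume "x \<in> carrier (OU (Suc n))" "y \<in> carrier (OU (Suc n))"
  then show "res n (x \<otimes>\<^bsub>OU (Suc n)\<^esub> y) = res n x \<otimes>\<^bsub>OU n\<^esub> res n y"
    "res n (x \<oplus>\<^bsub>OU (Suc n)\<^esub> y) = res n x \<oplus>\<^bsub>OU n\<^esub> res n y"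
    unfolding OU_ops using ring_hom_mult[OF res_hom] ring_hom_add[OF res_hom] c by auto
qed

text \<open>Restriction from U_(n+i) to U_n, the counterpart of \<open>transition_aux\<close> before
  reduction modulo p^m.\<close>

primrec ress :: "nat \<Rightarrow> nat \<Rightarrow> 'a bdd \<Rightarrow> 'a bdd" where
  "ress n 0 = id"
| "ress n (Suc i) = ress n i \<circ> res (n + i)"

lemma ress_hom: "ress n i \<in> ring_hom (RH (n + i)) (RH n)"
proof (induction i)
  case (Suc i)
  show ?case using ring_hom_trans[OF res_hom[of "n + i"] Suc] by (simp only: ress.simps add_Suc_right)
qed (auto intro: ring_hom_memI)

lemma ress_tc: "x \<in> carrier BB \<Longrightarrow> ress n i (tc (n + i) x) = tc n x"
  by (induction i) (simp_all add: res_tc)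

lemma ress_OU: "y \<in> carrier (OU (n + i)) \<Longrightarrow> ress n i y \<in> carrier (OU n)"
  by (induction i arbitrary: y) (simp_all add: res_OU)

text \<open>Up to p^m times an element of the ring of definition, y comes from some x in
  A[1/p][1/g]. That x is almost in M_(n+i), where \<open>cokernel_estimate\<close> applies, and the
  error remains p^m times a bounded function after restriction.\<close>

lemma cokernel_bdd:
  assumes y: "y \<in> carrier (OU (n + i))" and i: "m * p ^ Suc k \<le> i"
  shows "\<exists>a\<in>carrier A. \<exists>w\<in>carrier (OU n). tc n (e (\<omega> k \<otimes> groot k)) \<otimes>\<^bsub>RH n\<^esub> ress n i y
     = tc n (e a) \<oplus>\<^bsub>RH n\<^esub> nat_elem (RH n) p [^]\<^bsub>RH n\<^esub> m \<otimes>\<^bsub>RH n\<^esub> w"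
proof -
  define j where "j = n + i"
  interpret H: cring "RH n" by (rule RH_cring)
  interpret Hj: cring "RH j" by (rule RH_cring)
  interpret B: adic BB "DB j" pB by (rule BA)
  interpret Aj: adic "RH j" "DH j" "nat_elem (RH j) p" by (rule RH_adic)
  note OE = subringE[OF OU_subring[of n]] and OEj = subringE[OF OU_subring[of j]]
  have OUc: "x \<in> carrier (OU l) \<Longrightarrow> x \<in> carrier (RH l)" for x l unfolding OU_mem by blast
  have yj: "y \<in> carrier (OU j)" using y unfolding j_def .
  have yc: "y \<in> carrier (RH j)" by (rule OUc[OF yj])
  obtain s where s: "s \<in> carrier BB" "s \<otimes>\<^bsub>BB\<^esub> pB = \<one>\<^bsub>BB\<^esub>" using unit_toB by blast
  obtain x \<delta>' where x: "x \<in> carrier BB" "\<delta>' \<in> DH j" "y = tc j x \<oplus>\<^bsub>RH j\<^esub> tc j pB [^]\<^bsub>RH j\<^esub> m \<otimes>\<^bsub>RH j\<^esub> \<delta>'"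
    using B.completion_approx[OF s, of y m] yc unfolding RH_def DH_def tc_def by blast
  define z where "z = nat_elem (RH j) p [^]\<^bsub>RH j\<^esub> m \<otimes>\<^bsub>RH j\<^esub> \<delta>'"
  have zD: "z \<in> DH j" unfolding z_def by (rule Aj.nb_D[OF Aj.nbI[OF x(2)]])
  have zO: "z \<in> carrier (OU j)" using zD DH_OU by blast
  have zc: "z \<in> carrier (RH j)" by (rule OUc[OF zO])
  have yz: "y = tc j x \<oplus>\<^bsub>RH j\<^esub> z" using x(3) unfolding z_def tc_p .
  have xj: "tc j x \<in> carrier (RH j)" by (rule tc_closed[OF x(1)])
  \<comment> \<open>The approximation x is itself bounded by 1, since the correction z lies in the
    ring of definition and hence in \<open>OU j\<close>.\<close>
  have "tc j x = y \<oplus>\<^bsub>RH j\<^esub> (\<ominus>\<^bsub>RH j\<^esub> z)" unfolding yz using xj zc by (simp add: Hj.a_assoc Hj.r_neg)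
  then have "tc j x \<in> carrier (OU j)" using OEj(5,7) yj zO by simp
  then have st: "x \<in> PF.star (PF.MM j)" by (rule power_bounded_star[OF x(1) OU_power_bounded])
  have "n + m * p ^ Suc k \<le> j" using i by (simp add: j_def)
  from PF.cokernel_estimate[OF st this] obtain b w where b: "b \<in> AB" and w: "w \<in> PF.MM n"
    and eq: "PF.\<delta> k \<otimes>\<^bsub>BB\<^esub> x = b \<oplus>\<^bsub>BB\<^esub> e (\<omega> 0) [^]\<^bsub>BB\<^esub> m \<otimes>\<^bsub>BB\<^esub> w" by blast
  obtain a where a: "a \<in> carrier A" "b = e a" using b unfolding AB_def by blast
  have wc: "w \<in> carrier BB" using subringE(1)[OF PF.MM_subring] w by auto
  define C where "C = tc n (e (\<omega> k \<otimes> groot k))"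
  have CO: "C \<in> carrier (OU n)" unfolding C_def by (rule tc_OU) simp
  have d: "PF.\<delta> k = e (\<omega> k \<otimes> groot k)" unfolding PF.\<delta>_def using ring_hom_mult[OF e_hom] by simp
  define P where "P = nat_elem (RH n) p [^]\<^bsub>RH n\<^esub> m"
  have Pc: "P \<in> carrier (RH n)" unfolding P_def by simp
  have tP: "tc n (pB [^]\<^bsub>BB\<^esub> m) = P" unfolding P_def using BB.hom_pow[OF RH_cring tc_hom, of pB n m] tc_p by simp
  have \<delta>'O: "\<delta>' \<in> carrier (OU (n + i))" using x(2) DH_OU unfolding j_def by blast
  define D where "D = ress n i \<delta>'"
  have DO: "D \<in> carrier (OU n)" unfolding D_def by (rule ress_OU[OF \<delta>'O])
  have ry: "ress n i y = tc n x \<oplus>\<^bsub>RH n\<^esub> P \<otimes>\<^bsub>RH n\<^esub> D"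
  proof -
    note rh = ress_hom[of n i, folded j_def]
    have \<delta>'c: "\<delta>' \<in> carrier (RH j)" using Aj.Dc[OF x(2)] .
    have pc: "nat_elem (RH j) p \<in> carrier (RH j)" by simp
    have "ress n i z = P \<otimes>\<^bsub>RH n\<^esub> D"
      unfolding z_def D_def P_def using ring_hom_mult[OF rh _ \<delta>'c, of "nat_elem (RH j) p [^]\<^bsub>RH j\<^esub> m"]
        Hj.hom_pow[OF RH_cring rh pc, of m] Hj.nat_elem_hom[OF RH_cring rh, of p] by simp
    then show ?thesis unfolding yz using ring_hom_add[OF rh xj zc] ress_tc[OF x(1), of n i] by (simp add: j_def)
  qed
  have "C \<otimes>\<^bsub>RH n\<^esub> tc n x = tc n (e a) \<oplus>\<^bsub>RH n\<^esub> P \<otimes>\<^bsub>RH n\<^esub> tc n w"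
  proof -
    have "C \<otimes>\<^bsub>RH n\<^esub> tc n x = tc n (PF.\<delta> k \<otimes>\<^bsub>BB\<^esub> x)"
      unfolding C_def d using ring_hom_mult[OF tc_hom _ x(1), of "e (\<omega> k \<otimes> groot k)" n] by simp
    also have "\<dots> = tc n (e a) \<oplus>\<^bsub>RH n\<^esub> P \<otimes>\<^bsub>RH n\<^esub> tc n w"
      unfolding eq a(2) e_\<omega>0 tP[symmetric] using a wc
        ring_hom_add[OF tc_hom, of "e a" "pB [^]\<^bsub>BB\<^esub> m \<otimes>\<^bsub>BB\<^esub> w" n] ring_hom_mult[OF tc_hom, of "pB [^]\<^bsub>BB\<^esub> m" w n] by simp
    finally show ?thesis .
  qed
  then have "C \<otimes>\<^bsub>RH n\<^esub> ress n i y = tc n (e a) \<oplus>\<^bsub>RH n\<^esub> P \<otimes>\<^bsub>RH n\<^esub> (tc n w \<oplus>\<^bsub>RH n\<^esub> C \<otimes>\<^bsub>RH n\<^esub> D)"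
    unfolding ry using OUc[OF CO] OUc[OF DO] Pc tc_closed[OF x(1), of n] tc_closed[OF wc, of n] tc_closed[of "e a" n] a
    by (simp add: H.r_distr H.a_assoc H.m_lcomm)
  moreover have "tc n w \<oplus>\<^bsub>RH n\<^esub> C \<otimes>\<^bsub>RH n\<^esub> D \<in> carrier (OU n)" using OE(6,7) MM_OU[OF w] CO DO by simp
  ultimately show ?thesis unfolding C_def P_def using a(1) by blast
qed

end

section \<open>Reduction modulo \<open>p\<^sup>m\<close>\<close>

context cring
begin

lemma p_pow_ideal: "ideal (p_pow_ideal p m R) R"
  unfolding p_pow_ideal_def by (rule cgenideal_ideal) simp

lemma p_pow_ideal_mem: "x \<in> p_pow_ideal p m R \<longleftrightarrow> (\<exists>y\<in>carrier R. x = nat_elem R p [^] m \<otimes> y)"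
proof -
  have "y \<otimes> nat_elem R p [^] m = nat_elem R p [^] m \<otimes> y" if "y \<in> carrier R" for y using that by (simp add: m_comm)
  then show ?thesis unfolding p_pow_ideal_def cgenideal_def by force
qed

text \<open>The module structure modulo p^m on representatives; later arguments use these rules
  instead of the record fields.\<close>

lemma mod_p_pow_coset:
  shows "C \<in> carrier (mod_p_pow p m h R) \<Longrightarrow> \<exists>x\<in>carrier R. C = p_pow_ideal p m R +> x"
    and "x \<in> carrier R \<Longrightarrow> p_pow_ideal p m R +> x \<in> carrier (mod_p_pow p m h R)"
    and "x \<in> carrier R \<Longrightarrow> y \<in> carrier R \<Longrightarrow>
      (p_pow_ideal p m R +> x) \<oplus>\<^bsub>mod_p_pow p m h R\<^esub> (p_pow_ideal p m R +> y) = p_pow_ideal p m R +> (x \<oplus> y)"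
    and "h a \<in> carrier R \<Longrightarrow> x \<in> carrier R \<Longrightarrow>
      a \<odot>\<^bsub>mod_p_pow p m h R\<^esub> (p_pow_ideal p m R +> x) = p_pow_ideal p m R +> (h a \<otimes> x)"
    and "x \<in> carrier R \<Longrightarrow> p_pow_ideal p m R +> x = \<zero>\<^bsub>mod_p_pow p m h R\<^esub> \<longleftrightarrow> x \<in> p_pow_ideal p m R"
proof -
  interpret I: ideal "p_pow_ideal p m R" R by (rule p_pow_ideal)
  note H = I.rcos_ring_hom
  show "C \<in> carrier (mod_p_pow p m h R) \<Longrightarrow> \<exists>x\<in>carrier R. C = p_pow_ideal p m R +> x"
    by (auto simp: mod_p_pow_def alg_module_def FactRing_def A_RCOSETS_def')
  show "x \<in> carrier R \<Longrightarrow> p_pow_ideal p m R +> x \<in> carrier (mod_p_pow p m h R)"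
    using ring_hom_closed[OF H] by (simp add: mod_p_pow_def alg_module_def)
  show "x \<in> carrier R \<Longrightarrow> y \<in> carrier R \<Longrightarrow>
      (p_pow_ideal p m R +> x) \<oplus>\<^bsub>mod_p_pow p m h R\<^esub> (p_pow_ideal p m R +> y) = p_pow_ideal p m R +> (x \<oplus> y)"
    using ring_hom_add[OF H] by (simp add: mod_p_pow_def alg_module_def)
  show "h a \<in> carrier R \<Longrightarrow> x \<in> carrier R \<Longrightarrow>
      a \<odot>\<^bsub>mod_p_pow p m h R\<^esub> (p_pow_ideal p m R +> x) = p_pow_ideal p m R +> (h a \<otimes> x)"
    using ring_hom_mult[OF H] by (simp add: mod_p_pow_def alg_module_def)
  assume x: "x \<in> carrier R"
  have "\<zero>\<^bsub>mod_p_pow p m h R\<^esub> = p_pow_ideal p m R" by (simp add: mod_p_pow_def alg_module_def FactRing_def)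
  then show "p_pow_ideal p m R +> x = \<zero>\<^bsub>mod_p_pow p m h R\<^esub> \<longleftrightarrow> x \<in> p_pow_ideal p m R"
    using I.a_rcos_const I.a_rcos_self[OF x] by auto
qed

lemma mod_p_pow_module:
  assumes A: "cring A" and h: "h \<in> ring_hom A R"
  shows "module A (mod_p_pow p m h R)" (is "module A ?M")
proof -
  interpret A: cring A by fact
  note [simp] = ring_hom_closed[OF h] mod_p_pow_coset(2-4) ring_hom_add[OF h] ring_hom_mult[OF h] ring_hom_one[OF h]
  note el = mod_p_pow_coset(1)
  have z: "\<zero>\<^bsub>?M\<^esub> = p_pow_ideal p m R +> \<zero>"
    using mod_p_pow_coset(5)[OF zero_closed, of p m h]
      additive_subgroup.zero_closed[OF ideal.axioms(1)[OF p_pow_ideal[of p m]]] by simp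
  show ?thesis
  proof (rule moduleI[OF A])
    show "abelian_group ?M"
    proof (rule abelian_groupI)
      fix C assume "C \<in> carrier ?M"
      then obtain x where x: "x \<in> carrier R" "C = p_pow_ideal p m R +> x" using el by blast
      show "\<zero>\<^bsub>?M\<^esub> \<oplus>\<^bsub>?M\<^esub> C = C" unfolding z x using x by simp
      show "\<exists>E\<in>carrier ?M. E \<oplus>\<^bsub>?M\<^esub> C = \<zero>\<^bsub>?M\<^esub>"
        unfolding z x using x by (intro bexI[of _ "p_pow_ideal p m R +> (\<ominus> x)"]) (auto simp: l_neg)
      fix E assume "E \<in> carrier ?M"
      then obtain y where y: "y \<in> carrier R" "E = p_pow_ideal p m R +> y" using el by blast
      show "C \<oplus>\<^bsub>?M\<^esub> E \<in> carrier ?M" unfolding x y using x y by simp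
      show "C \<oplus>\<^bsub>?M\<^esub> E = E \<oplus>\<^bsub>?M\<^esub> C" unfolding x y using x y by (simp add: a_comm)
      fix G assume "G \<in> carrier ?M"
      then obtain w where w: "w \<in> carrier R" "G = p_pow_ideal p m R +> w" using el by blast
      show "C \<oplus>\<^bsub>?M\<^esub> E \<oplus>\<^bsub>?M\<^esub> G = C \<oplus>\<^bsub>?M\<^esub> (E \<oplus>\<^bsub>?M\<^esub> G)"
        unfolding x y w using x y w by (simp add: a_assoc)
    next
      show "\<zero>\<^bsub>?M\<^esub> \<in> carrier ?M" unfolding z by simp
    qed
  next
    fix a C assume a: "a \<in> carrier A" and "C \<in> carrier ?M"
    then obtain x where x: "x \<in> carrier R" "C = p_pow_ideal p m R +> x" using el by blast
    show "a \<odot>\<^bsub>?M\<^esub> C \<in> carrier ?M" unfolding x using a x by simp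
    show "(a \<oplus>\<^bsub>A\<^esub> b) \<odot>\<^bsub>?M\<^esub> C = a \<odot>\<^bsub>?M\<^esub> C \<oplus>\<^bsub>?M\<^esub> b \<odot>\<^bsub>?M\<^esub> C" if "b \<in> carrier A" for b
      unfolding x using a x that by (simp add: l_distr)
    show "(a \<otimes>\<^bsub>A\<^esub> b) \<odot>\<^bsub>?M\<^esub> C = a \<odot>\<^bsub>?M\<^esub> (b \<odot>\<^bsub>?M\<^esub> C)" if "b \<in> carrier A" for b
      unfolding x using a x that by (simp add: m_assoc)
    fix E assume "E \<in> carrier ?M"
    then obtain y where y: "y \<in> carrier R" "E = p_pow_ideal p m R +> y" using el by blast
    show "a \<odot>\<^bsub>?M\<^esub> (C \<oplus>\<^bsub>?M\<^esub> E) = a \<odot>\<^bsub>?M\<^esub> C \<oplus>\<^bsub>?M\<^esub> a \<odot>\<^bsub>?M\<^esub> E"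
      unfolding x y using a x y by (simp add: r_distr)
  next
    fix C assume "C \<in> carrier ?M"
    then obtain x where x: "x \<in> carrier R" "C = p_pow_ideal p m R +> x" using el by blast
    show "\<one>\<^bsub>A\<^esub> \<odot>\<^bsub>?M\<^esub> C = C" unfolding x using x by simp
  qed
qed

lemma map_mod_p_pow_coset:
  assumes S: "cring S" and u: "u \<in> ring_hom R S" and x: "x \<in> carrier R"
  shows "map_mod_p_pow p m S u (p_pow_ideal p m R +> x) = p_pow_ideal p m S +>\<^bsub>S\<^esub> u x"
  unfolding map_mod_p_pow_def
proof (rule induced_coset[OF cring_axioms S u p_pow_ideal cring.p_pow_ideal[OF S] _ x])
  fix y assume "y \<in> p_pow_ideal p m R"
  then obtain z where z: "z \<in> carrier R" "y = nat_elem R p [^] m \<otimes> z" unfolding p_pow_ideal_mem by blast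
  have "u y = nat_elem S p [^]\<^bsub>S\<^esub> m \<otimes>\<^bsub>S\<^esub> u z"
    unfolding z using ring_hom_mult[OF u _ z(1), of "nat_elem R p [^] m"] hom_pow[OF S u, of "nat_elem R p" m]
      nat_elem_hom[OF S u, of p] by simp
  then show "u y \<in> p_pow_ideal p m S"
    unfolding cring.p_pow_ideal_mem[OF S] using ring_hom_closed[OF u z(1)] by blast
qed

lemma map_mod_p_pow_hom:
  assumes S: "cring S" and u: "u \<in> ring_hom R S"
    and h: "\<And>a. a \<in> carrier A \<Longrightarrow> h a \<in> carrier R" "\<And>a. a \<in> carrier A \<Longrightarrow> h' a = u (h a)"
  shows "map_mod_p_pow p m S u \<in> mod_hom A (mod_p_pow p m h R) (mod_p_pow p m h' S)"
proof -
  interpret S: cring S by fact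
  note [simp] = ring_hom_closed[OF u] ring_hom_add[OF u] ring_hom_mult[OF u] map_mod_p_pow_coset[OF S u]
    mod_p_pow_coset(2-4) S.mod_p_pow_coset(2-4) h
  show ?thesis
    unfolding mod_hom_def
  proof (intro CollectI conjI ballI)
    fix C assume "C \<in> carrier (mod_p_pow p m h R)"
    then obtain x where x: "x \<in> carrier R" "C = p_pow_ideal p m R +> x" using mod_p_pow_coset(1) by blast
    show "map_mod_p_pow p m S u C \<in> carrier (mod_p_pow p m h' S)" unfolding x using x by simp
    show "map_mod_p_pow p m S u (a \<odot>\<^bsub>mod_p_pow p m h R\<^esub> C) = a \<odot>\<^bsub>mod_p_pow p m h' S\<^esub> map_mod_p_pow p m S u C"
      if "a \<in> carrier A" for a unfolding x using x that by simp
    fix E assume "E \<in> carrier (mod_p_pow p m h R)"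
    then obtain y where y: "y \<in> carrier R" "E = p_pow_ideal p m R +> y" using mod_p_pow_coset(1) by blast
    show "map_mod_p_pow p m S u (C \<oplus>\<^bsub>mod_p_pow p m h R\<^esub> E)
        = map_mod_p_pow p m S u C \<oplus>\<^bsub>mod_p_pow p m h' S\<^esub> map_mod_p_pow p m S u E"
      unfolding x y using x y by simp
  qed
qed

end

section \<open>The almost-pro-isomorphism\<close>

context perfectoid_elt
begin

abbreviation "tb n \<equiv> to_bdd p A (groot 0) n"
text \<open>Pro-systems are indexed from 0 while the sets U_n start at n = 1, hence the shift to
  \<open>Suc i\<close>.\<close>

abbreviation "NN m i \<equiv> mod_p_pow p m (tb (Suc i)) (OU (Suc i))"
abbreviation "rr m i \<equiv> map_mod_p_pow p m (OU (Suc i)) (res (Suc i))"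
abbreviation "hh m i \<equiv> map_mod_p_pow p m (OU (Suc i)) (tb (Suc i))"
abbreviation "Jn m n \<equiv> p_pow_ideal p m (OU n)"

lemma res_tb: "a \<in> carrier A \<Longrightarrow> res n (tb (Suc n) a) = tb n a"
  by (simp add: to_bdd_eq res_tc)

lemma transition_id: "transition (\<lambda>i. id) n j = id"
proof -
  have "transition_aux (\<lambda>i. id) n i = id" for i by (induction i) auto
  then show ?thesis by (simp add: transition_def)
qed

lemma transition_rr:
  assumes "n \<le> j" and "y \<in> carrier (OU (Suc j))"
  shows "transition (rr m) n j (Jn m (Suc j) +>\<^bsub>OU (Suc j)\<^esub> y)
    = Jn m (Suc n) +>\<^bsub>OU (Suc n)\<^esub> ress (Suc n) (j - n) y"
proof -
  have "transition_aux (rr m) n i (Jn m (Suc n + i) +>\<^bsub>OU (Suc n + i)\<^esub> y)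
      = Jn m (Suc n) +>\<^bsub>OU (Suc n)\<^esub> ress (Suc n) i y" if "y \<in> carrier (OU (Suc n + i))" for y i
    using that
  proof (induction i arbitrary: y)
    case (Suc i)
    have y: "y \<in> carrier (OU (Suc (Suc n + i)))" using Suc.prems by simp
    have "rr m (n + i) (Jn m (Suc n + Suc i) +>\<^bsub>OU (Suc n + Suc i)\<^esub> y)
        = Jn m (Suc n + i) +>\<^bsub>OU (Suc n + i)\<^esub> res (Suc n + i) y"
      using cring.map_mod_p_pow_coset[OF OU_cring OU_cring res_OU_hom y, of p m] by simp
    then show ?case using Suc.IH[OF res_OU[OF y]] by simp
  qed simp
  from this[of y "j - n"] assms show ?thesis by (simp add: transition_def)
qed

lemma pro_A: "pro_system A (\<lambda>i. mod_p_pow p m id A) (\<lambda>i. id)"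
proof -
  have "id \<in> ring_hom A A" by (auto intro: ring_hom_memI)
  then show ?thesis unfolding pro_system_def mod_hom_def using mod_p_pow_module[OF cring_axioms] by auto
qed

lemma pro_NN: "pro_system A (NN m) (rr m)"
  unfolding pro_system_def
proof (intro allI conjI)
  show "module A (NN m n)" for n by (rule cring.mod_p_pow_module[OF OU_cring cring_axioms to_bdd_hom])
  show "rr m n \<in> mod_hom A (NN m (Suc n)) (NN m n)" for n
    by (rule cring.map_mod_p_pow_hom[OF OU_cring OU_cring res_OU_hom])
      (use ring_hom_closed[OF to_bdd_hom] res_tb in auto)
qed

lemma hh_hom: "hh m n \<in> mod_hom A (mod_p_pow p m id A) (NN m n)"
  by (rule map_mod_p_pow_hom[OF OU_cring to_bdd_hom]) auto

lemma hh_coset: "a \<in> carrier A \<Longrightarrow> hh m n (p_pow_ideal p m A +> a) = Jn m (Suc n) +>\<^bsub>OU (Suc n)\<^esub> tb (Suc n) a"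
  by (rule map_mod_p_pow_coset[OF OU_cring to_bdd_hom])

lemma hh_comm:
  assumes "x \<in> carrier (mod_p_pow p m id A)"
  shows "hh m n (id x) = rr m n (hh m (Suc n) x)"
proof -
  obtain a where a: "a \<in> carrier A" "x = p_pow_ideal p m A +> a" using mod_p_pow_coset(1)[OF assms] by blast
  show ?thesis
    unfolding a using a hh_coset res_tb[of a "Suc n"]
      cring.map_mod_p_pow_coset[OF OU_cring OU_cring res_OU_hom ring_hom_closed[OF to_bdd_hom a(1)], of p m "Suc n"] by simp
qed

lemma Jn_mem:
  "x \<in> Jn m n \<longleftrightarrow> (\<exists>y\<in>carrier (OU n). x = nat_elem (RH n) p [^]\<^bsub>RH n\<^esub> m \<otimes>\<^bsub>RH n\<^esub> y)"
  unfolding cring.p_pow_ideal_mem[OF OU_cring] OU_pow OU_nat_elem OU_ops ..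

text \<open>The source is constant with identity transitions, so it suffices that for large j the
  kernel at j is itself killed by (pg)^(1/p^k); this is \<open>kernel_bdd\<close>.\<close>

lemma kernel_killed:
  "pro_killed A (\<omega> k \<otimes> groot k) (\<lambda>n. ker_module (mod_p_pow p m id A) (NN m n) (hh m n)) (\<lambda>i. id)"
proof (rule pro_killedI)
  show "pro_system A (\<lambda>n. ker_module (mod_p_pow p m id A) (NN m n) (hh m n)) (\<lambda>i. id)"
    by (rule ker_pro_system[OF pro_A pro_NN hh_hom hh_comm])
  show "\<omega> k \<otimes> groot k \<in> carrier A" by simp
  fix n
  define j where "j = max n (m * p ^ (k + 3))"
  have "(\<omega> k \<otimes> groot k) \<odot>\<^bsub>mod_p_pow p m id A\<^esub> x = \<zero>\<^bsub>mod_p_pow p m id A\<^esub>"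
    if x: "x \<in> carrier (mod_p_pow p m id A)" "hh m j x = \<zero>\<^bsub>NN m j\<^esub>" for x
  proof -
    obtain a where a: "a \<in> carrier A" "x = p_pow_ideal p m A +> a" using mod_p_pow_coset(1)[OF x(1)] by blast
    have "tb (Suc j) a \<in> Jn m (Suc j)"
      using x(2) cring.mod_p_pow_coset(5)[OF OU_cring ring_hom_closed[OF to_bdd_hom a(1)]]
      unfolding a(2) hh_coset[OF a(1)] by blast
    then obtain y where y: "y \<in> carrier (OU (Suc j))"
      "tc (Suc j) (e a) = nat_elem (RH (Suc j)) p [^]\<^bsub>RH (Suc j)\<^esub> m \<otimes>\<^bsub>RH (Suc j)\<^esub> y"
      unfolding Jn_mem to_bdd_eq by blast
    have "m * p ^ (k + 3) \<le> Suc j" by (simp add: j_def)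
    from kernel_bdd[OF a(1) y this] have "\<omega> k \<otimes> groot k \<otimes> a \<in> p_pow_ideal p m A"
      unfolding p_pow_ideal_mem .
    then show ?thesis
      unfolding a(2) using mod_p_pow_coset(4)[of id "\<omega> k \<otimes> groot k" a p m] mod_p_pow_coset(5)[of "\<omega> k \<otimes> groot k \<otimes> a" p m id] a(1)
      by simp
  qed
  then have "\<forall>x\<in>carrier (ker_module (mod_p_pow p m id A) (NN m j) (hh m j)).
      (\<omega> k \<otimes> groot k) \<odot>\<^bsub>ker_module (mod_p_pow p m id A) (NN m n) (hh m n)\<^esub> transition (\<lambda>i. id) n j x
      = \<zero>\<^bsub>ker_module (mod_p_pow p m id A) (NN m n) (hh m n)\<^esub>"
    by (simp add: ker_module_def a_kernel_def kernel_def transition_id)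
  moreover have "n \<le> j" by (simp add: j_def)
  ultimately show "\<exists>j\<ge>n. \<forall>x\<in>carrier (ker_module (mod_p_pow p m id A) (NN m j) (hh m j)).
      (\<omega> k \<otimes> groot k) \<odot>\<^bsub>ker_module (mod_p_pow p m id A) (NN m n) (hh m n)\<^esub> transition (\<lambda>i. id) n j x
      = \<zero>\<^bsub>ker_module (mod_p_pow p m id A) (NN m n) (hh m n)\<^esub>" by blast
qed

text \<open>A fixed gap j - n suffices for every n: after multiplication by (pg)^(1/p^k), the
  restriction of any bounded function from level j is an element of A plus p^m times a bounded
  function, and so is 0 in the cokernel at n.\<close>

lemma cokernel_killed:
  "pro_killed A (\<omega> k \<otimes> groot k) (\<lambda>n. coker_module (mod_p_pow p m id A) (NN m n) (hh m n))
     (\<lambda>n. induced (NN m n) (hh m n ` carrier (mod_p_pow p m id A)) (rr m n))"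
proof (rule pro_killedI)
  note cps = coker_pro_system[OF pro_A pro_NN hh_hom hh_comm]
  show "pro_system A (\<lambda>n. coker_module (mod_p_pow p m id A) (NN m n) (hh m n))
     (\<lambda>n. induced (NN m n) (hh m n ` carrier (mod_p_pow p m id A)) (rr m n))" by (rule cps(1))
  show ck: "\<omega> k \<otimes> groot k \<in> carrier A" by simp
  fix n
  define c where "c = \<omega> k \<otimes> groot k"
  have cc: "c \<in> carrier A" by (simp add: c_def)
  define j where "j = n + m * p ^ Suc k"
  define I where "I n = hh m n ` carrier (mod_p_pow p m id A)" for n
  have nj: "n \<le> j" by (simp add: j_def)
  have NM: "module A (NN m n)" for n using pro_NN unfolding pro_system_def by blast
  have IM: "submodl A (NN m n) (I n)" for n
    unfolding I_def by (rule image_submodl[OF _ NM hh_hom]) (use pro_A in \<open>auto simp: pro_system_def\<close>)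
  interpret O: cring "OU (Suc n)" by (rule OU_cring)
  interpret H: cring "RH (Suc n)" by (rule RH_cring)
  have key: "c \<odot>\<^bsub>coker_module (mod_p_pow p m id A) (NN m n) (hh m n)\<^esub>
      transition (\<lambda>n. induced (NN m n) (hh m n ` carrier (mod_p_pow p m id A)) (rr m n)) n j x
      = \<zero>\<^bsub>coker_module (mod_p_pow p m id A) (NN m n) (hh m n)\<^esub>"
    if x: "x \<in> carrier (coker_module (mod_p_pow p m id A) (NN m j) (hh m j))" for x
  proof -
    obtain z where z: "z \<in> carrier (NN m j)" "x = I j +>\<^bsub>NN m j\<^esub> z"
      using x unfolding coker_module_def quot_module_simps A_RCOSETS_def' I_def by blast
    obtain y where y: "y \<in> carrier (OU (Suc j))" "z = Jn m (Suc j) +>\<^bsub>OU (Suc j)\<^esub> y"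
      using cring.mod_p_pow_coset(1)[OF OU_cring z(1)] by blast
    define y' where "y' = ress (Suc n) (j - n) y"
    have yj: "y \<in> carrier (OU (Suc n + (j - n)))" using y(1) nj by simp
    have y'c: "y' \<in> carrier (OU (Suc n))" unfolding y'_def by (rule ress_OU[OF yj])
    have tr: "transition (rr m) n j z = Jn m (Suc n) +>\<^bsub>OU (Suc n)\<^esub> y'"
      unfolding y(2) y'_def by (rule transition_rr[OF nj y(1)])
    have tx: "transition (\<lambda>n. induced (NN m n) (hh m n ` carrier (mod_p_pow p m id A)) (rr m n)) n j x
        = I n +>\<^bsub>NN m n\<^esub> (Jn m (Suc n) +>\<^bsub>OU (Suc n)\<^esub> y')"
      unfolding z(2) tr[symmetric] I_def by (rule conjunct1[OF cps(2)[OF _ nj z(1)]])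
    have Jc: "Jn m (Suc n) +>\<^bsub>OU (Suc n)\<^esub> y' \<in> carrier (NN m n)" by (rule O.mod_p_pow_coset(2)[OF y'c])
    have "m * p ^ Suc k \<le> j - n" by (simp add: j_def)
    from cokernel_bdd[OF yj this] obtain a w where a: "a \<in> carrier A" and w: "w \<in> carrier (OU (Suc n))"
      and eq: "tc (Suc n) (e c) \<otimes>\<^bsub>RH (Suc n)\<^esub> y'
        = tc (Suc n) (e a) \<oplus>\<^bsub>RH (Suc n)\<^esub> nat_elem (RH (Suc n)) p [^]\<^bsub>RH (Suc n)\<^esub> m \<otimes>\<^bsub>RH (Suc n)\<^esub> w"
      unfolding y'_def c_def by blast
    define q where "q = nat_elem (RH (Suc n)) p [^]\<^bsub>RH (Suc n)\<^esub> m \<otimes>\<^bsub>RH (Suc n)\<^esub> w"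
    have qJ: "q \<in> Jn m (Suc n)" unfolding q_def Jn_mem using w by blast
    have qc: "q \<in> carrier (OU (Suc n))" using ideal.Icarr[OF O.p_pow_ideal qJ] .
    note tbc = ring_hom_closed[OF to_bdd_hom]
    have eq': "tb (Suc n) c \<otimes>\<^bsub>OU (Suc n)\<^esub> y' = tb (Suc n) a \<oplus>\<^bsub>OU (Suc n)\<^esub> q"
      unfolding OU_ops to_bdd_eq q_def by (rule eq)
    \<comment> \<open>The error term is divisible by p^m within the bounded functions, so it
      vanishes in the reduction.\<close>
    have q0: "Jn m (Suc n) +>\<^bsub>OU (Suc n)\<^esub> q = Jn m (Suc n) +>\<^bsub>OU (Suc n)\<^esub> \<zero>\<^bsub>OU (Suc n)\<^esub>"
      using O.mod_p_pow_coset(5)[OF qc, of p m "tb (Suc n)"] qJ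
        O.mod_p_pow_coset(5)[OF O.zero_closed, of p m "tb (Suc n)"]
        additive_subgroup.zero_closed[OF ideal.axioms(1)[OF O.p_pow_ideal[of p m]]] by simp
    have "c \<odot>\<^bsub>NN m n\<^esub> (Jn m (Suc n) +>\<^bsub>OU (Suc n)\<^esub> y') = Jn m (Suc n) +>\<^bsub>OU (Suc n)\<^esub> (tb (Suc n) c \<otimes>\<^bsub>OU (Suc n)\<^esub> y')"
      by (rule O.mod_p_pow_coset(4)[of "tb (Suc n)" c, OF tbc[OF cc] y'c])
    also have "\<dots> = (Jn m (Suc n) +>\<^bsub>OU (Suc n)\<^esub> tb (Suc n) a) \<oplus>\<^bsub>NN m n\<^esub> (Jn m (Suc n) +>\<^bsub>OU (Suc n)\<^esub> q)"
      unfolding eq' by (rule O.mod_p_pow_coset(3)[OF tbc[OF a] qc, symmetric])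
    also have "\<dots> = Jn m (Suc n) +>\<^bsub>OU (Suc n)\<^esub> tb (Suc n) a"
      unfolding q0 using O.mod_p_pow_coset(3)[OF tbc[OF a] O.zero_closed] tbc[OF a] by simp
    also have "\<dots> \<in> I n" unfolding hh_coset[OF a, symmetric] I_def using mod_p_pow_coset(2)[OF a] by blast
    finally have cI: "c \<odot>\<^bsub>NN m n\<^esub> (Jn m (Suc n) +>\<^bsub>OU (Suc n)\<^esub> y') \<in> I n" .
    interpret S: abelian_subgroup "I n" "NN m n" by (rule submodl_subgroup[OF NM IM])
    show ?thesis
      unfolding tx unfolding coker_module_def I_def[symmetric] quot_smult[OF NM IM cc Jc] quot_module_simps(2)
      by (rule S.a_rcos_const[OF cI])
  qed
  show "\<exists>j\<ge>n. \<forall>x\<in>carrier (coker_module (mod_p_pow p m id A) (NN m j) (hh m j)).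
      (\<omega> k \<otimes> groot k) \<odot>\<^bsub>coker_module (mod_p_pow p m id A) (NN m n) (hh m n)\<^esub>
      transition (\<lambda>n. induced (NN m n) (hh m n ` carrier (mod_p_pow p m id A)) (rr m n)) n j x
      = \<zero>\<^bsub>coker_module (mod_p_pow p m id A) (NN m n) (hh m n)\<^esub>"
    using key nj unfolding c_def by blast
qed

lemma almost_iso:
  "almost_pro_iso A (\<lambda>k. \<iota> (K_root p k) \<otimes> groot k) (\<lambda>i. mod_p_pow p m id A) (\<lambda>i. id) (NN m) (rr m) (hh m)"
  unfolding almost_pro_iso_def
  using pro_A pro_NN hh_hom hh_comm kernel_killed cokernel_killed unfolding \<omega>_def by blast

end

theorem theorem1p6:
  fixes p d m :: nat
    and W :: "'w ring"
    and g :: "'w A0"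
    and A :: "'a ring"
    and \<kappa> :: "perfd \<Rightarrow> 'w Ainf0"
    and \<iota> :: "perfd \<Rightarrow> 'a"
    and \<phi> :: "'w Ainf0 \<Rightarrow> 'a"
    and groot :: "nat \<Rightarrow> 'a"
  assumes "Factorial_Ring.prime p"
    and "unramified_dvr p W"
    and "g \<in> carrier (A0_ring p d W)"
    and "integral_perfectoid p (Ainf0_ring p d W) \<kappa>"
    and "\<forall>k. \<kappa> (K_root p k) = Ainf0_p_root p d W k"
    and "integral_perfectoid p A \<iota>"
    and "\<phi> \<in> ring_hom (Ainf0_ring p d W) A"
    and "\<forall>x\<in>carrier (K_ints p). \<phi> (\<kappa> x) = \<iota> x"
    and "almost_ff_mod_p p d W A \<phi>"
    and "\<forall>k. groot k \<in> carrier A"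
    and "groot 0 = \<phi> (A0_to_Ainf0 p d W g)"
    and "\<forall>k. groot (Suc k) [^]\<^bsub>A\<^esub> p = groot k"
  shows "almost_pro_iso A (\<lambda>k. \<iota> (K_root p k) \<otimes>\<^bsub>A\<^esub> groot k)
           (\<lambda>i. mod_p_pow p m id A)
           (\<lambda>i. id)
           (\<lambda>i. mod_p_pow p m (to_bdd p A (groot 0) (Suc i)) (bdd_ring p A (groot 0) (Suc i)))
           (\<lambda>i. map_mod_p_pow p m (bdd_ring p A (groot 0) (Suc i)) (bdd_restrict p A (groot 0) (Suc i)))
           (\<lambda>i. map_mod_p_pow p m (bdd_ring p A (groot 0) (Suc i)) (to_bdd p A (groot 0) (Suc i)))"
proof -
  interpret perfectoid_elt p A \<iota> groot
    using assms(1,6,10,12) by unfold_locales auto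
  show ?thesis by (rule almost_iso)
qed

end
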